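(* There exists a natural isomorphism of functors $\mathrm{red}\circ\mathbf{C}C^\infty\cong C^\infty\circ\mathrm{red}$ from the category of constraint manifolds to the opposite of the category of algebras; i.e. for every constraint manifold $\mathcal M$ there is an algebra isomorphism $\mathbf{C}C^\infty(\mathcal M)_{\mathrm{red}}\simeq C^\infty(\mathcal M_{\mathrm{red}})$, natural with respect to constraint maps, so that the diagram formed by the functors $\mathbf{C}C^\infty$ (constraint manifolds to strong constraint algebras), $C^\infty$ (manifolds to algebras) and the two reduction functors commutes up to natural isomorphism.
   Context: All manifolds are real, smooth and connected. A constraint manifold $\mathcal{M}=(M,C,D)$ consists of a manifold $M$, a closed embedded submanifold $\iota\colon C\hookrightarrow M$ and a simple distribution $D\subseteq TC$, i.e. a regular involutive distribution whose leaf space $\mathcal M_{\mathrm{red}}=C/D$ is a smooth manifold with $C\to C/D$ a surjective submersion. A constraint map $\phi\colon(M,C,D)\to(M',C',D')$ is a smooth map $M\to M'$ with $\phi(C)\subseteq C'$ and $T\phi(D)\subseteq D'$. The reduction functor sends $\mathcal M$ to $\mathcal M_{\mathrm{red}}$ and $\phi$ to $\phi_{\mathrm{red}}([p])=[\phi(p)]$. A strong constraint algebra is a triple $(\mathcal A_{\mathrm T},\mathcal A_{\mathrm N},\mathcal A_0)$ of a unital associative algebra, a unital subalgebra $\mathcal A_{\mathrm N}\subseteq\mathcal A_{\mathrm T}$, and $\mathcal A_0\subseteq\mathcal A_{\mathrm N}$ a two-sided ideal of $\mathcal A_{\mathrm T}$; morphisms are unital algebra morphisms of $\mathrm T$-components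 preserving $\mathrm N$- and $0$-components. Its reduction is $\mathcal A_{\mathrm{red}}=\mathcal A_{\mathrm N}/\mathcal A_0$, with induced maps on morphisms. $\mathbf{C}C^\infty(\mathcal M)$ has $\mathrm T$: $C^\infty(M)$; $\mathrm N$: $\{f:\mathcal L_X(f|_C)=0\ \forall X\in\Gamma^\infty(D)\}$; $0$: $\{f:f|_C=0\}$; on constraint maps $\mathbf{C}C^\infty(\phi)=\phi^*$, $\phi^*f=f\circ\phi$. *)

theory Defs
  imports "HOL-Analysis.Analysis" "HOL-Algebra.Module" "HOL-Algebra.Subrings" "HOL-Algebra.QuotRing"
begin

section \<open>Categories and functors\<close>

text \<open>Arrows need not determine their source and target, so composition and the arrow part of
  a functor take the objects involved as arguments: \<open>Comp C X Y Z g f\<close> is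
  \<open>g \<circ> f\<close> for \<open>f : X \<rightarrow> Y\<close> and \<open>g : Y \<rightarrow> Z\<close>.\<close>

record ('o, 'm) cat =
  Obj :: "'o set"
  Hom :: "'o \<Rightarrow> 'o \<Rightarrow> 'm set"
  Ident :: "'o \<Rightarrow> 'm"
  Comp :: "'o \<Rightarrow> 'o \<Rightarrow> 'o \<Rightarrow> 'm \<Rightarrow> 'm \<Rightarrow> 'm"

definition category :: "('o, 'm) cat \<Rightarrow> bool" where
  "category C \<longleftrightarrow>
     (\<forall>X\<in>Obj C. Ident C X \<in> Hom C X X) \<and>
     (\<forall>X\<in>Obj C. \<forall>Y\<in>Obj C. \<forall>Z\<in>Obj C. \<forall>f\<in>Hom C X Y. \<forall>g\<in>Hom C Y Z.
        Comp C X Y Z g f \<in> Hom C X Z) \<and>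
     (\<forall>X\<in>Obj C. \<forall>Y\<in>Obj C. \<forall>f\<in>Hom C X Y.
        Comp C X X Y f (Ident C X) = f \<and> Comp C X Y Y (Ident C Y) f = f) \<and>
     (\<forall>W\<in>Obj C. \<forall>X\<in>Obj C. \<forall>Y\<in>Obj C. \<forall>Z\<in>Obj C.
        \<forall>f\<in>Hom C W X. \<forall>g\<in>Hom C X Y. \<forall>h\<in>Hom C Y Z.
          Comp C W X Z (Comp C X Y Z h g) f = Comp C W Y Z h (Comp C W X Y g f))"

definition op_cat :: "('o, 'm) cat \<Rightarrow> ('o, 'm) cat" where
  "op_cat C = \<lparr>Obj = Obj C, Hom = (\<lambda>X Y. Hom C Y X), Ident = Ident C,
                Comp = (\<lambda>X Y Z g f. Comp C Z Y X f g)\<rparr>"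

record ('o, 'm, 'p, 'n) func =
  on_obj :: "'o \<Rightarrow> 'p"
  on_arr :: "'o \<Rightarrow> 'o \<Rightarrow> 'm \<Rightarrow> 'n"

definition is_functor :: "('o, 'm) cat \<Rightarrow> ('p, 'n) cat \<Rightarrow> ('o, 'm, 'p, 'n) func \<Rightarrow> bool" where
  "is_functor C D F \<longleftrightarrow> category C \<and> category D \<and>
     (\<forall>X\<in>Obj C. on_obj F X \<in> Obj D) \<and>
     (\<forall>X\<in>Obj C. \<forall>Y\<in>Obj C. \<forall>f\<in>Hom C X Y.
        on_arr F X Y f \<in> Hom D (on_obj F X) (on_obj F Y)) \<and>
     (\<forall>X\<in>Obj C. on_arr F X X (Ident C X) = Ident D (on_obj F X)) \<and>
     (\<forall>X\<in>Obj C. \<forall>Y\<in>Obj C. \<forall>Z\<in>Obj C. \<forall>f\<in>Hom C X Y. \<forall>g\<in>Hom C Y Z.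
        on_arr F X Z (Comp C X Y Z g f) =
        Comp D (on_obj F X) (on_obj F Y) (on_obj F Z) (on_arr F Y Z g) (on_arr F X Y f))"

definition comp_func ::
  "('p, 'n, 'q, 'k) func \<Rightarrow> ('o, 'm, 'p, 'n) func \<Rightarrow> ('o, 'm, 'q, 'k) func" (infixr "\<circ>\<^sub>F" 55) where
  "G \<circ>\<^sub>F F = \<lparr>on_obj = (\<lambda>X. on_obj G (on_obj F X)),
               on_arr = (\<lambda>X Y f. on_arr G (on_obj F X) (on_obj F Y) (on_arr F X Y f))\<rparr>"

definition op_func :: "('o, 'm, 'p, 'n) func \<Rightarrow> ('o, 'm, 'p, 'n) func" where
  "op_func F = \<lparr>on_obj = on_obj F, on_arr = (\<lambda>X Y f. on_arr F Y X f)\<rparr>"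


section \<open>Real algebras\<close>

text \<open>The library's \<open>algebra\<close> locale requires commutativity, so
  associative unital algebras are introduced here on top of \<open>ring\<close> and \<open>module\<close>.\<close>

definition real_ring :: "real ring" where
  "real_ring = \<lparr>carrier = UNIV, mult = (*), one = 1, zero = 0, add = (+)\<rparr>"

type_synonym 'x alg = "(real, 'x) module"

definition unital_algebra :: "'x alg \<Rightarrow> bool" where
  "unital_algebra A \<longleftrightarrow> ring A \<and> Module.module real_ring A \<and>
     (\<forall>r. \<forall>x\<in>carrier A. \<forall>y\<in>carrier A.
        (r \<odot>\<^bsub>A\<^esub> x) \<otimes>\<^bsub>A\<^esub> y = r \<odot>\<^bsub>A\<^esub> (x \<otimes>\<^bsub>A\<^esub> y) \<and>
        x \<otimes>\<^bsub>A\<^esub> (r \<odot>\<^bsub>A\<^esub> y) = r \<odot>\<^bsub>A\<^esub> (x \<otimes>\<^bsub>A\<^esub> y))"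

definition unital_subalgebra :: "'x set \<Rightarrow> 'x alg \<Rightarrow> bool" where
  "unital_subalgebra N A \<longleftrightarrow> subring N A \<and> (\<forall>r. \<forall>x\<in>N. r \<odot>\<^bsub>A\<^esub> x \<in> N)"

definition alg_hom :: "'x alg \<Rightarrow> 'y alg \<Rightarrow> ('x \<Rightarrow> 'y) set" where
  "alg_hom A B = {h \<in> ring_hom A B \<inter> extensional (carrier A).
     \<forall>r. \<forall>x\<in>carrier A. h (r \<odot>\<^bsub>A\<^esub> x) = r \<odot>\<^bsub>B\<^esub> h x}"

definition alg_iso :: "'x alg \<Rightarrow> 'y alg \<Rightarrow> ('x \<Rightarrow> 'y) set" where
  "alg_iso A B = {h \<in> alg_hom A B. bij_betw h (carrier A) (carrier B)}"

definition alg_cat :: "('x alg, 'x \<Rightarrow> 'x) cat" where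
  "alg_cat = \<lparr>Obj = {A. unital_algebra A}, Hom = alg_hom,
     Ident = (\<lambda>A. \<lambda>x\<in>carrier A. x),
     Comp = (\<lambda>A B E g f. compose (carrier A) g f)\<rparr>"

text \<open>A natural isomorphism between two functors into the opposite of the category of real
  algebras. The algebras in the image of \<open>F\<close> and of \<open>G\<close> may have elements of
  different types. As all components are isomorphisms, they may be given as algebra maps
  \<open>F X \<rightarrow> G X\<close>.\<close>

definition natural_alg_iso ::
  "('o, 'm) cat \<Rightarrow> ('o, 'm, 'x alg, 'x \<Rightarrow> 'x) func \<Rightarrow> ('o, 'm, 'y alg, 'y \<Rightarrow> 'y) func
     \<Rightarrow> ('o \<Rightarrow> 'x \<Rightarrow> 'y) \<Rightarrow> bool" where
  "natural_alg_iso C F G \<eta> \<longleftrightarrow>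
     is_functor C (op_cat alg_cat) F \<and> is_functor C (op_cat alg_cat) G \<and>
     (\<forall>X\<in>Obj C. \<eta> X \<in> alg_iso (on_obj F X) (on_obj G X)) \<and>
     (\<forall>X\<in>Obj C. \<forall>Y\<in>Obj C. \<forall>f\<in>Hom C X Y.
        compose (carrier (on_obj F Y)) (\<eta> X) (on_arr F X Y f) =
        compose (carrier (on_obj F Y)) (on_arr G X Y f) (\<eta> Y))"


section \<open>Strong constraint algebras and their reduction\<close>

record 'x scalg =
  compT :: "'x alg"
  compN :: "'x set"
  comp0 :: "'x set"

definition strong_constraint_algebra :: "'x scalg \<Rightarrow> bool" where
  "strong_constraint_algebra A \<longleftrightarrow> unital_algebra (compT A) \<and>
     unital_subalgebra (compN A) (compT A) \<and> ideal (comp0 A) (compT A) \<and> comp0 A \<subseteq> compN A"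

definition scalg_hom :: "'x scalg \<Rightarrow> 'y scalg \<Rightarrow> ('x \<Rightarrow> 'y) set" where
  "scalg_hom A B =
     {h \<in> alg_hom (compT A) (compT B). h ` compN A \<subseteq> compN B \<and> h ` comp0 A \<subseteq> comp0 B}"

definition scalg_cat :: "('x scalg, 'x \<Rightarrow> 'x) cat" where
  "scalg_cat = \<lparr>Obj = {A. strong_constraint_algebra A}, Hom = scalg_hom,
     Ident = (\<lambda>A. \<lambda>x\<in>carrier (compT A). x),
     Comp = (\<lambda>A B E g f. compose (carrier (compT A)) g f)\<rparr>"

definition red_alg :: "'x scalg \<Rightarrow> 'x set alg" where
  "red_alg A = (let Q = (compT A)\<lparr>carrier := compN A\<rparr> Quot comp0 A in
     \<lparr>carrier = carrier Q, mult = mult Q, one = one Q, zero = zero Q, add = add Q,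
      smult = (\<lambda>r K. \<Union>x\<in>K. comp0 A +>\<^bsub>compT A\<^esub> (r \<odot>\<^bsub>compT A\<^esub> x))\<rparr>)"

definition red_alg_func :: "('x scalg, 'x \<Rightarrow> 'x, 'x set alg, 'x set \<Rightarrow> 'x set) func" where
  "red_alg_func = \<lparr>on_obj = red_alg,
     on_arr = (\<lambda>A B h. \<lambda>K\<in>carrier (red_alg A). \<Union>x\<in>K. comp0 B +>\<^bsub>compT B\<^esub> h x)\<rparr>"


section \<open>Smooth manifolds\<close>

text \<open>Real \<open>n\<close>-space is \<open>Euclidean_space n\<close>: sequences vanishing
  from index \<open>n\<close> on. \<open>C_k_on n k V f\<close>: the partial derivatives of \<open>f\<close>
  up to order \<open>k\<close> exist and are continuous on the open set \<open>V\<close>.\<close>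

definition partial_deriv :: "nat \<Rightarrow> ((nat \<Rightarrow> real) \<Rightarrow> real) \<Rightarrow> (nat \<Rightarrow> real) \<Rightarrow> real" where
  "partial_deriv i f x = deriv (\<lambda>t. f (x(i := t))) (x i)"

primrec C_k_on :: "nat \<Rightarrow> nat \<Rightarrow> (nat \<Rightarrow> real) set \<Rightarrow> ((nat \<Rightarrow> real) \<Rightarrow> real) \<Rightarrow> bool" where
  "C_k_on n 0 V f \<longleftrightarrow> continuous_map (subtopology (Euclidean_space n) V) euclideanreal f"
| "C_k_on n (Suc k) V f \<longleftrightarrow>
     continuous_map (subtopology (Euclidean_space n) V) euclideanreal f \<and>
     (\<forall>i<n. (\<forall>x\<in>V. (\<lambda>t. f (x(i := t))) differentiable (at (x i))) \<and>
            C_k_on n k V (partial_deriv i f))"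

definition smooth_on :: "nat \<Rightarrow> (nat \<Rightarrow> real) set \<Rightarrow> ((nat \<Rightarrow> real) \<Rightarrow> real) \<Rightarrow> bool" where
  "smooth_on n V f \<longleftrightarrow> (\<forall>k. C_k_on n k V f)"

text \<open>A chart \<open>(U, \<phi>)\<close> has domain \<open>U\<close>; the values of \<open>\<phi>\<close> outside \<open>U\<close>
  are irrelevant, and its inverse is \<open>inv_into U \<phi>\<close>. The atlas need not be maximal: it
  represents the smooth structure it generates.\<close>

record 'a manifold =
  mtop :: "'a topology"
  mdim :: nat
  atlas :: "('a set \<times> ('a \<Rightarrow> nat \<Rightarrow> real)) set"

abbreviation points :: "'a manifold \<Rightarrow> 'a set" where
  "points M \<equiv> topspace (mtop M)"

definition is_manifold :: "'a manifold \<Rightarrow> bool" where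
  "is_manifold M \<longleftrightarrow>
     Hausdorff_space (mtop M) \<and> second_countable (mtop M) \<and> connected_space (mtop M) \<and>
     (\<Union>(U, \<phi>)\<in>atlas M. U) = points M \<and>
     (\<forall>(U, \<phi>)\<in>atlas M. openin (mtop M) U \<and> openin (Euclidean_space (mdim M)) (\<phi> ` U) \<and>
        homeomorphic_map (subtopology (mtop M) U)
                         (subtopology (Euclidean_space (mdim M)) (\<phi> ` U)) \<phi>) \<and>
     (\<forall>(U, \<phi>)\<in>atlas M. \<forall>(V, \<psi>)\<in>atlas M. \<forall>j<mdim M.
        smooth_on (mdim M) (\<phi> ` (U \<inter> V)) (\<lambda>x. \<psi> (inv_into U \<phi> x) j))"

definition smooth_fun_on :: "'a manifold \<Rightarrow> 'a set \<Rightarrow> ('a \<Rightarrow> real) \<Rightarrow> bool" where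
  "smooth_fun_on M W f \<longleftrightarrow>
     (\<forall>(U, \<phi>)\<in>atlas M. smooth_on (mdim M) (\<phi> ` (U \<inter> W)) (\<lambda>x. f (inv_into U \<phi> x)))"

definition C_inf :: "'a manifold \<Rightarrow> ('a \<Rightarrow> real) set" where
  "C_inf M = {f \<in> extensional (points M). smooth_fun_on M (points M) f}"

definition smooth_maps :: "'a manifold \<Rightarrow> 'b manifold \<Rightarrow> ('a \<Rightarrow> 'b) set" where
  "smooth_maps M N = {F \<in> extensional (points M).
     continuous_map (mtop M) (mtop N) F \<and>
     (\<forall>(U, \<phi>)\<in>atlas M. \<forall>(V, \<psi>)\<in>atlas N. \<forall>j<mdim N.
        smooth_on (mdim M) (\<phi> ` (U \<inter> F -` V)) (\<lambda>x. \<psi> (F (inv_into U \<phi> x)) j))}"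

definition mfd_cat :: "('a manifold, 'a \<Rightarrow> 'a) cat" where
  "mfd_cat = \<lparr>Obj = {M. is_manifold M}, Hom = smooth_maps,
     Ident = (\<lambda>M. \<lambda>p\<in>points M. p),
     Comp = (\<lambda>M N P g f. compose (points M) g f)\<rparr>"

definition C_inf_alg :: "'a manifold \<Rightarrow> ('a \<Rightarrow> real) alg" where
  "C_inf_alg M =
     \<lparr>carrier = C_inf M,
      mult = (\<lambda>f g. \<lambda>p\<in>points M. f p * g p),
      one = (\<lambda>p\<in>points M. 1),
      zero = (\<lambda>p\<in>points M. 0),
      add = (\<lambda>f g. \<lambda>p\<in>points M. f p + g p),
      smult = (\<lambda>r f. \<lambda>p\<in>points M. r * f p)\<rparr>"

definition pullback :: "'a manifold \<Rightarrow> 'b manifold \<Rightarrow> ('a \<Rightarrow> 'b) \<Rightarrow> ('b \<Rightarrow> real) \<Rightarrow> 'a \<Rightarrow> real" where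
  "pullback M N F = (\<lambda>f\<in>C_inf N. compose (points M) f F)"

definition C_inf_func ::
  "('a manifold, 'a \<Rightarrow> 'a, ('a \<Rightarrow> real) alg, ('a \<Rightarrow> real) \<Rightarrow> 'a \<Rightarrow> real) func" where
  "C_inf_func = \<lparr>on_obj = C_inf_alg, on_arr = pullback\<rparr>"


section \<open>Tangent vectors, vector fields and distributions\<close>

text \<open>Tangent vectors at \<open>p\<close> are the derivations at \<open>p\<close> of the algebra of smooth functions.\<close>

type_synonym 'a tvec = "('a \<Rightarrow> real) \<Rightarrow> real"

definition tangent_space :: "'a manifold \<Rightarrow> 'a \<Rightarrow> 'a tvec set" where
  "tangent_space M p = {v \<in> extensional (C_inf M).
     (\<forall>f\<in>C_inf M. \<forall>g\<in>C_inf M.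
        v (\<lambda>q\<in>points M. f q + g q) = v f + v g \<and>
        v (\<lambda>q\<in>points M. f q * g q) = v f * g p + f p * v g) \<and>
     (\<forall>c. \<forall>f\<in>C_inf M. v (\<lambda>q\<in>points M. c * f q) = c * v f)}"

definition tangent_map :: "'a manifold \<Rightarrow> 'b manifold \<Rightarrow> ('a \<Rightarrow> 'b) \<Rightarrow> 'a tvec \<Rightarrow> 'b tvec" where
  "tangent_map M N F v = (\<lambda>g\<in>C_inf N. v (compose (points M) g F))"

definition immersion :: "'a manifold \<Rightarrow> 'b manifold \<Rightarrow> ('a \<Rightarrow> 'b) \<Rightarrow> bool" where
  "immersion M N F \<longleftrightarrow> F \<in> smooth_maps M N \<and>
     (\<forall>p\<in>points M. inj_on (tangent_map M N F) (tangent_space M p))"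

definition surjective_submersion :: "'a manifold \<Rightarrow> 'b manifold \<Rightarrow> ('a \<Rightarrow> 'b) \<Rightarrow> bool" where
  "surjective_submersion M N F \<longleftrightarrow> F \<in> smooth_maps M N \<and> F ` points M = points N \<and>
     (\<forall>p\<in>points M. tangent_map M N F ` tangent_space M p = tangent_space N (F p))"

definition incl :: "'a manifold \<Rightarrow> 'a \<Rightarrow> 'a" where
  "incl S = (\<lambda>p\<in>points S. p)"

definition closed_embedded_submanifold :: "'a manifold \<Rightarrow> 'a manifold \<Rightarrow> bool" where
  "closed_embedded_submanifold S M \<longleftrightarrow> is_manifold S \<and>
     closedin (mtop M) (points S) \<and> mtop S = subtopology (mtop M) (points S) \<and>
     immersion S M (incl S)"

definition vector_field_on :: "'a manifold \<Rightarrow> 'a set \<Rightarrow> ('a \<Rightarrow> 'a tvec) \<Rightarrow> bool" where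
  "vector_field_on M W X \<longleftrightarrow> (\<forall>p\<in>W. X p \<in> tangent_space M p) \<and>
     (\<forall>f\<in>C_inf M. smooth_fun_on M W (\<lambda>p. X p f))"

definition lie_deriv :: "'a manifold \<Rightarrow> ('a \<Rightarrow> 'a tvec) \<Rightarrow> ('a \<Rightarrow> real) \<Rightarrow> 'a \<Rightarrow> real" where
  "lie_deriv M X f = (\<lambda>p\<in>points M. X p f)"

definition lie_bracket ::
  "'a manifold \<Rightarrow> ('a \<Rightarrow> 'a tvec) \<Rightarrow> ('a \<Rightarrow> 'a tvec) \<Rightarrow> 'a \<Rightarrow> 'a tvec" where
  "lie_bracket M X Y =
     (\<lambda>p. \<lambda>f\<in>C_inf M. X p (lie_deriv M Y f) - Y p (lie_deriv M X f))"

text \<open>A distribution assigns to each point a set of tangent vectors. It is regular if, for some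
  constant rank \<open>r\<close>, it is locally framed by \<open>r\<close> smooth vector fields.\<close>

definition regular_distribution :: "'a manifold \<Rightarrow> ('a \<Rightarrow> 'a tvec set) \<Rightarrow> bool" where
  "regular_distribution M D \<longleftrightarrow>
     (\<exists>r::nat. \<forall>p\<in>points M. \<exists>W X. openin (mtop M) W \<and> p \<in> W \<and>
        (\<forall>i<r. vector_field_on M W (X i)) \<and>
        (\<forall>q\<in>W.
           D q = {v. \<exists>c. v = (\<lambda>f\<in>C_inf M. \<Sum>i<r. c i * X i q f)} \<and>
           (\<forall>c. (\<forall>f\<in>C_inf M. (\<Sum>i<r. c i * X i q f) = 0) \<longrightarrow> (\<forall>i<r. c i = 0))))"

definition sections :: "'a manifold \<Rightarrow> ('a \<Rightarrow> 'a tvec set) \<Rightarrow> ('a \<Rightarrow> 'a tvec) set" where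
  "sections M D = {X. vector_field_on M (points M) X \<and> (\<forall>p\<in>points M. X p \<in> D p)}"

definition involutive :: "'a manifold \<Rightarrow> ('a \<Rightarrow> 'a tvec set) \<Rightarrow> bool" where
  "involutive M D \<longleftrightarrow>
     (\<forall>X\<in>sections M D. \<forall>Y\<in>sections M D. lie_bracket M X Y \<in> sections M D)"

text \<open>Connectedness of an integral manifold is part of \<open>is_manifold\<close>.\<close>

definition integral_manifold :: "'a manifold \<Rightarrow> ('a \<Rightarrow> 'a tvec set) \<Rightarrow> 'a manifold \<Rightarrow> bool" where
  "integral_manifold M D L \<longleftrightarrow> is_manifold L \<and> immersion L M (incl L) \<and>
     (\<forall>p\<in>points L. tangent_map L M (incl L) ` tangent_space L p = D p)"

text \<open>The leaves are the classes of the equivalence relation generated by lying on a common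
  connected integral manifold. By the Frobenius theorem, for regular involutive \<open>D\<close> the
  generating relation is already an equivalence relation on \<open>points M\<close>, and its classes are
  the maximal connected integral manifolds.\<close>

definition leaf_rel :: "'a manifold \<Rightarrow> ('a \<Rightarrow> 'a tvec set) \<Rightarrow> ('a \<times> 'a) set" where
  "leaf_rel M D = {(p, q). \<exists>L. integral_manifold M D L \<and> p \<in> points L \<and> q \<in> points L}\<^sup>*"

definition leaf_space :: "'a manifold \<Rightarrow> ('a \<Rightarrow> 'a tvec set) \<Rightarrow> 'a set set" where
  "leaf_space M D = points M // leaf_rel M D"

definition leaf_proj :: "'a manifold \<Rightarrow> ('a \<Rightarrow> 'a tvec set) \<Rightarrow> 'a \<Rightarrow> 'a set" where
  "leaf_proj M D = (\<lambda>p\<in>points M. leaf_rel M D `` {p})"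

definition leaf_manifold ::
  "'a manifold \<Rightarrow> ('a \<Rightarrow> 'a tvec set) \<Rightarrow> 'a set manifold \<Rightarrow> bool" where
  "leaf_manifold M D N \<longleftrightarrow> is_manifold N \<and> points N = leaf_space M D \<and>
     surjective_submersion M N (leaf_proj M D)"

definition simple_distribution :: "'a manifold \<Rightarrow> ('a \<Rightarrow> 'a tvec set) \<Rightarrow> bool" where
  "simple_distribution M D \<longleftrightarrow> regular_distribution M D \<and> involutive M D \<and>
     (\<exists>N. leaf_manifold M D N)"


section \<open>Constraint manifolds and their reduction\<close>

text \<open>\<open>distr \<M> p\<close> consists of derivations of the smooth functions on the submanifold
  \<open>sub \<M>\<close>; its values at points outside the submanifold are irrelevant.\<close>

record 'a cmfd =
  amb :: "'a manifold"
  sub :: "'a manifold"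
  distr :: "'a \<Rightarrow> 'a tvec set"

definition constraint_manifold :: "'a cmfd \<Rightarrow> bool" where
  "constraint_manifold \<M> \<longleftrightarrow> is_manifold (amb \<M>) \<and>
     closed_embedded_submanifold (sub \<M>) (amb \<M>) \<and>
     simple_distribution (sub \<M>) (distr \<M>)"

definition constraint_maps :: "'a cmfd \<Rightarrow> 'b cmfd \<Rightarrow> ('a \<Rightarrow> 'b) set" where
  "constraint_maps \<M> \<N> = {\<phi> \<in> smooth_maps (amb \<M>) (amb \<N>).
     \<phi> ` points (sub \<M>) \<subseteq> points (sub \<N>) \<and>
     (\<forall>p\<in>points (sub \<M>).
        tangent_map (sub \<M>) (sub \<N>) (restrict \<phi> (points (sub \<M>))) ` distr \<M> p
          \<subseteq> distr \<N> (\<phi> p))}"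

definition cmfd_cat :: "('a cmfd, 'a \<Rightarrow> 'a) cat" where
  "cmfd_cat = \<lparr>Obj = {\<M>. constraint_manifold \<M>}, Hom = constraint_maps,
     Ident = (\<lambda>\<M>. \<lambda>p\<in>points (amb \<M>). p),
     Comp = (\<lambda>\<M> \<N> \<P> g f. compose (points (amb \<M>)) g f)\<rparr>"

text \<open>The smooth structure on the leaf space for which the projection is a submersion is unique,
  so the choice below only selects an atlas for it.\<close>

definition red_mfd :: "'a cmfd \<Rightarrow> 'a set manifold" where
  "red_mfd \<M> = (SOME N. leaf_manifold (sub \<M>) (distr \<M>) N)"

definition red_mfd_func :: "('a cmfd, 'a \<Rightarrow> 'a, 'a set manifold, 'a set \<Rightarrow> 'a set) func" where
  "red_mfd_func = \<lparr>on_obj = red_mfd,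
     on_arr = (\<lambda>\<M> \<N> \<phi>. \<lambda>K\<in>leaf_space (sub \<M>) (distr \<M>).
       \<Union>p\<in>K. leaf_proj (sub \<N>) (distr \<N>) (\<phi> p))\<rparr>"

definition CC_inf :: "'a cmfd \<Rightarrow> ('a \<Rightarrow> real) scalg" where
  "CC_inf \<M> =
     \<lparr>compT = C_inf_alg (amb \<M>),
      compN = {f \<in> C_inf (amb \<M>). \<forall>X\<in>sections (sub \<M>) (distr \<M>). \<forall>p\<in>points (sub \<M>).
                 lie_deriv (sub \<M>) X (restrict f (points (sub \<M>))) p = 0},
      comp0 = {f \<in> C_inf (amb \<M>). \<forall>p\<in>points (sub \<M>). f p = 0}\<rparr>"

definition CC_inf_func ::
  "('a cmfd, 'a \<Rightarrow> 'a, ('a \<Rightarrow> real) scalg, ('a \<Rightarrow> real) \<Rightarrow> 'a \<Rightarrow> real) func" where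
  "CC_inf_func = \<lparr>on_obj = CC_inf, on_arr = (\<lambda>\<M> \<N>. pullback (amb \<M>) (amb \<N>))\<rparr>"

end

theory Submission
  imports Defs
begin

text \<open>A smooth function on \<open>M\<close> that is constant along the distribution on \<open>C\<close> restricts to a function on
  \<open>C\<close> that is constant on leaves, and so descends to a function on the leaf space; the descended
  function is smooth because a surjective submersion has smooth local sections. Conversely, a smooth
  function on the leaf space pulls back to \<open>C\<close> and extends from the closed submanifold \<open>C\<close> to \<open>M\<close> by a
  partition of unity. The extension is annihilated by \<open>D\<close> because, by the Frobenius theorem, every
  vector of \<open>D\<close> is tangent to an integral manifold, which the projection collapses to a point. Two
  extensions differ by a function vanishing on \<open>C\<close>, and both constructions commute with pullback.\<close>

section \<open>Calculus on open subsets of Euclidean space\<close>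

text \<open>Tangent vectors are derivations of global smooth functions, so the whole argument is
  carried by functions: smoothness of a map is tested on pullbacks, equality of leaves on smooth
  functions over the Hausdorff leaf space, and local data are cut off to global functions before a
  derivation can be applied to them. In particular the definition of a constraint map speaks of
  \<open>D\<close> alone. That such a map sends leaves into leaves is derived: functions pulled back
  from the target leaf space are annihilated by \<open>D\<close>, hence constant on leaves, and
  there are enough of them to separate the points of the target.

  The analytic obstacle is the local theory. Submersions need right inverses, immersions need left
  inverses, distributions need integral manifolds. The first two are reduced to exchanging one
  coordinate at a time, which is a one-variable problem. The third is reduced to commuting fields: a
  frame normalised on suitable coordinates commutes by involutivity, and the time-one map of its
  linear combinations, differentiated in the coefficients, parametrises the integral
  manifold.\<close>

definition ES :: "nat \<Rightarrow> (nat \<Rightarrow> real) set" where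
  "ES n = {x. \<forall>i\<ge>n. x i = 0}"

text \<open>Cubes serve as neighbourhoods because they are products: changing one coordinate to an
  admissible value stays inside, which is what arguments along coordinate directions use.\<close>

definition ebox :: "nat \<Rightarrow> (nat \<Rightarrow> real) \<Rightarrow> real \<Rightarrow> (nat \<Rightarrow> real) set" where
  "ebox n x e = {y \<in> ES n. \<forall>i<n. \<bar>y i - x i\<bar> < e}"

abbreviation eopen :: "nat \<Rightarrow> (nat \<Rightarrow> real) set \<Rightarrow> bool" where
  "eopen n \<equiv> openin (Euclidean_space n)"

lemma Euclidean_space_ES: "Euclidean_space n = top_of_set (ES n)"
  by (simp add: Euclidean_space_def ES_def euclidean_product_topology)

lemma topspace_ES [simp]: "topspace (Euclidean_space n) = ES n"
  by (simp add: Euclidean_space_ES)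

lemma ES_upd [simp]: "x \<in> ES n \<Longrightarrow> i < n \<Longrightarrow> x(i := t) \<in> ES n"
  by (auto simp: ES_def)

lemma eopen_open: "eopen n V \<longleftrightarrow> (\<exists>U. open U \<and> V = ES n \<inter> U)"
  by (simp add: Euclidean_space_ES openin_open)

lemma eopen_subset: "eopen n V \<Longrightarrow> V \<subseteq> ES n"
  using openin_subset by fastforce

lemma continuous_on_coord [continuous_intros]: "continuous_on S (\<lambda>x::nat \<Rightarrow> real. x i)"
  by (rule continuous_on_subset[OF continuous_on_product_coordinates subset_UNIV])

lemma eopen_ebox: "eopen n (ebox n x e)"
proof -
  have "open (\<Inter>i\<in>{..<n}. {y::nat \<Rightarrow> real. \<bar>y i - x i\<bar> < e})"
    by (intro open_INT ballI open_Collect_less continuous_intros) auto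
  moreover have "ebox n x e = ES n \<inter> (\<Inter>i\<in>{..<n}. {y::nat \<Rightarrow> real. \<bar>y i - x i\<bar> < e})"
    by (auto simp: ebox_def)
  ultimately show ?thesis
    unfolding eopen_open by blast
qed

lemma ebox_mono: "d \<le> e \<Longrightarrow> ebox n x d \<subseteq> ebox n x e"
  by (force simp: ebox_def)

lemma centre_in_ebox: "x \<in> ES n \<Longrightarrow> 0 < e \<Longrightarrow> x \<in> ebox n x e"
  by (auto simp: ebox_def)

text \<open>A basic open set of the product topology restricts only finitely many coordinates, and
  those from \<open>n\<close> on vanish on \<open>ES n\<close>, so one common radius is
  enough.\<close>

lemma eopen_iff: "eopen n V \<longleftrightarrow> V \<subseteq> ES n \<and> (\<forall>x\<in>V. \<exists>e>0. ebox n x e \<subseteq> V)"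
proof
  assume V: "eopen n V"
  have "\<exists>e>0. ebox n x e \<subseteq> V" if x: "x \<in> V" for x
  proof -
    obtain U where U: "open U" "V = ES n \<inter> U"
      using V unfolding eopen_open by blast
    then have "openin (powertop_real UNIV) U"
      by (simp add: euclidean_product_topology)
    then obtain X where X: "x \<in> Pi\<^sub>E UNIV X" "\<And>i. open (X i)" "finite {i. X i \<noteq> UNIV}" "Pi\<^sub>E UNIV X \<subseteq> U"
      using product_topology_open_contains_basis[of "\<lambda>_. euclideanreal" UNIV U x] U x by auto
    have "\<exists>e>0. ball (x i) e \<subseteq> X i" for i
      using X(1,2) by (metis PiE_E UNIV_I open_contains_ball)
    then obtain e where e: "\<And>i. e i > 0" "\<And>i. ball (x i) (e i) \<subseteq> X i" by metis
    \<comment> \<open>The inserted 1 makes the minimum range over a non-empty set even if no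
      coordinate is restricted.\<close>
    define d where "d = Min (insert 1 (e ` {i. X i \<noteq> UNIV}))"
    have d0: "d > 0" using X(3) e(1) by (auto simp: d_def)
    have "ebox n x d \<subseteq> V"
    proof
      fix y assume y: "y \<in> ebox n x d"
      have "y i \<in> X i" for i
      proof (cases "X i = UNIV")
        case False
        then have "d \<le> e i" unfolding d_def using X(3) by (intro Min_le) auto
        moreover have "\<bar>y i - x i\<bar> < d"
        proof (cases "i < n")
          case False
          then have "y i = 0" "x i = 0" using y x eopen_subset[OF V] by (auto simp: ebox_def ES_def)
          then show ?thesis using d0 by simp
        qed (use y in \<open>auto simp: ebox_def\<close>)
        ultimately show ?thesis using e(2)[of i] by (auto simp: dist_real_def subset_eq abs_minus_commute)
      qed auto
      then have "y \<in> U" using X(4) by (auto simp: PiE_def)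
      then show "y \<in> V" using y U by (auto simp: ebox_def)
    qed
    then show ?thesis using d0 by blast
  qed
  then show "V \<subseteq> ES n \<and> (\<forall>x\<in>V. \<exists>e>0. ebox n x e \<subseteq> V)"
    using eopen_subset[OF V] by blast
next
  assume "V \<subseteq> ES n \<and> (\<forall>x\<in>V. \<exists>e>0. ebox n x e \<subseteq> V)"
  then show "eopen n V"
    by (subst openin_subopen) (meson eopen_ebox centre_in_ebox subset_iff)
qed

lemma eopen_ES: "eopen n (ES n)"
  by (metis openin_topspace topspace_ES)

lemma eopen_boxE:
  assumes "eopen n V" "x \<in> V"
  obtains e where "e > 0" "ebox n x e \<subseteq> V"
  using assms eopen_iff by blast

lemma continuous_map_ES:
  "V \<subseteq> ES n \<Longrightarrow> continuous_map (subtopology (Euclidean_space n) V) euclideanreal f \<longleftrightarrow> continuous_on V f"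
  by (simp add: Euclidean_space_ES subtopology_subtopology inf.absorb2)

lemma eopen_upd:
  assumes "eopen n V" "x \<in> V" "i < n"
  obtains e where "e > 0" "\<And>t. \<bar>t - x i\<bar> < e \<Longrightarrow> x(i := t) \<in> V"
proof -
  obtain e where e: "e > 0" "ebox n x e \<subseteq> V" using eopen_boxE[OF assms(1,2)] .
  moreover have "x \<in> ES n" using assms eopen_subset by blast
  ultimately have "x(i := t) \<in> V" if "\<bar>t - x i\<bar> < e" for t
    using that assms(3) by (auto simp: ebox_def subset_eq)
  then show ?thesis using that e by blast
qed

lemma eventually_upd:
  assumes "eopen n V" "x \<in> V" "i < n"
  shows "eventually (\<lambda>t. x(i := t) \<in> V) (nhds (x i))"
proof -
  obtain e where "e > 0" "\<And>t. \<bar>t - x i\<bar> < e \<Longrightarrow> x(i := t) \<in> V" using eopen_upd[OF assms] by metis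
  then show ?thesis unfolding eventually_nhds_metric by (auto simp: dist_real_def)
qed

section \<open>Continuity of real functions in terms of boxes\<close>

lemma continuous_on_eboxI:
  assumes V: "V \<subseteq> ES n"
    and c: "\<And>x e. x \<in> V \<Longrightarrow> e > 0 \<Longrightarrow> \<exists>d>0. \<forall>y\<in>V \<inter> ebox n x d. \<bar>f y - f x\<bar> < (e::real)"
  shows "continuous_on V f"
  unfolding continuous_on_topological
proof (intro ballI allI impI)
  fix x B assume x: "x \<in> V" and B: "open B" "f x \<in> B"
  then obtain e where e: "e > 0" "ball (f x) e \<subseteq> B" using open_contains_ball by blast
  obtain d where d: "d > 0" "\<forall>y\<in>V \<inter> ebox n x d. \<bar>f y - f x\<bar> < e" using c[OF x e(1)] by blast
  obtain A where A: "open A" "ebox n x d = ES n \<inter> A"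
    using eopen_ebox[of n x d] unfolding eopen_open by blast
  have "x \<in> A" using A centre_in_ebox[of x n d] d x V by blast
  moreover have "f y \<in> B" if "y \<in> V" "y \<in> A" for y
  proof -
    have "y \<in> V \<inter> ebox n x d" using that A(2) V by blast
    then have "\<bar>f y - f x\<bar> < e" using d(2) by blast
    then have "f y \<in> ball (f x) e" by (simp add: dist_real_def abs_minus_commute)
    then show ?thesis using e(2) by blast
  qed
  ultimately show "\<exists>A. open A \<and> x \<in> A \<and> (\<forall>y\<in>V. y \<in> A \<longrightarrow> f y \<in> B)" using A by blast
qed

lemma continuous_on_eboxD:
  assumes V: "eopen n V" and f: "continuous_on V f" and x: "x \<in> V" and e: "e > (0::real)"
  obtains d where "d > 0" "ebox n x d \<subseteq> V" "\<And>y. y \<in> ebox n x d \<Longrightarrow> \<bar>f y - f x\<bar> < e"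
proof -
  obtain A where A: "open A" "x \<in> A" "\<forall>y\<in>V. y \<in> A \<longrightarrow> f y \<in> ball (f x) e"
    using f x e unfolding continuous_on_topological by (metis centre_in_ball open_ball)
  have "eopen n (V \<inter> A)"
    using V A(1) unfolding eopen_open by (metis inf_assoc open_Int)
  then obtain d where "d > 0" "ebox n x d \<subseteq> V \<inter> A"
    using eopen_boxE A(2) x by (metis IntI)
  then show ?thesis using that A(3) by (force simp: dist_real_def abs_minus_commute)
qed

text \<open>The common box later bounds the coefficients of all commuting fields together with their
  derivatives.\<close>

lemma continuous_on_eboxD_finite:
  assumes V: "eopen n V" and f: "\<And>j. j \<in> J \<Longrightarrow> continuous_on V (f j)" and J: "finite J"
    and x: "x \<in> V" and e: "e > (0::real)"
  shows "\<exists>d>0. ebox n x d \<subseteq> V \<and> (\<forall>y\<in>ebox n x d. \<forall>j\<in>J. \<bar>f j y - f j x\<bar> < e)"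
  using J f
proof (induction J)
  case empty
  then show ?case using eopen_boxE[OF V x] by (metis empty_iff)
next
  case (insert a J)
  then obtain d where d: "d > 0" "ebox n x d \<subseteq> V" "\<forall>y\<in>ebox n x d. \<forall>j\<in>J. \<bar>f j y - f j x\<bar> < e"
    by blast
  obtain d' where d': "d' > 0" "ebox n x d' \<subseteq> V" "\<And>y. y \<in> ebox n x d' \<Longrightarrow> \<bar>f a y - f a x\<bar> < e"
    using continuous_on_eboxD[OF V _ x e, of "f a"] insert by blast
  have "ebox n x (min d d') \<subseteq> ebox n x d \<inter> ebox n x d'" using ebox_mono by simp
  then show ?case using d d' by (intro exI[of _ "min d d'"]) auto
qed

subsection \<open>Partial derivatives and the mean value theorem\<close>

text \<open>Existence and value of the \<open>i\<close>-th partial derivative in one relation;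
  \<open>partial_deriv\<close> alone has a value even where the derivative does not exist.\<close>

definition hpd :: "nat \<Rightarrow> ((nat \<Rightarrow> real) \<Rightarrow> real) \<Rightarrow> real \<Rightarrow> (nat \<Rightarrow> real) \<Rightarrow> bool" where
  "hpd i f f' x \<longleftrightarrow> ((\<lambda>t. f (x(i := t))) has_real_derivative f') (at (x i))"

lemma hpd_partial_deriv: "hpd i f f' x \<Longrightarrow> partial_deriv i f x = f'"
  unfolding hpd_def partial_deriv_def by (rule DERIV_imp_deriv)

lemma hpd_upd: "hpd i f f' (x(i := s)) \<longleftrightarrow> ((\<lambda>t. f (x(i := t))) has_real_derivative f') (at s)"
  by (simp add: hpd_def)

lemma hpd_cong:
  assumes "eopen n V" "x \<in> V" "i < n" "\<And>y. y \<in> V \<Longrightarrow> f y = g y"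
  shows "hpd i f f' x \<longleftrightarrow> hpd i g f' x"
  unfolding hpd_def
  by (rule DERIV_cong_ev)
     (auto intro: eventually_mono[OF eventually_upd[OF assms(1-3)]] assms(4))

lemma C_k_on_Suc_iff:
  assumes V: "eopen n V"
  shows "C_k_on n (Suc k) V f \<longleftrightarrow> continuous_on V f \<and>
     (\<forall>i<n. (\<forall>x\<in>V. hpd i f (partial_deriv i f x) x) \<and> C_k_on n k V (partial_deriv i f))"
proof -
  have "(\<lambda>t. f (x(i := t))) differentiable (at (x i)) \<longleftrightarrow> hpd i f (partial_deriv i f x) x" for x i
    unfolding hpd_def partial_deriv_def
    by (metis DERIV_deriv_iff_real_differentiable)
  then show ?thesis using continuous_map_ES[OF eopen_subset[OF V]] by simp
qed

lemma C_k_on_0_iff: "eopen n V \<Longrightarrow> C_k_on n 0 V f \<longleftrightarrow> continuous_on V f"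
  by (simp add: continuous_map_ES eopen_subset)

lemma C_k_on_continuous: "eopen n V \<Longrightarrow> C_k_on n k V f \<Longrightarrow> continuous_on V f"
  by (cases k) (auto simp: C_k_on_0_iff C_k_on_Suc_iff simp del: C_k_on.simps)

lemma C_k_on_cong:
  assumes V: "eopen n V"
  shows "(\<And>x. x \<in> V \<Longrightarrow> f x = g x) \<Longrightarrow> C_k_on n k V f \<longleftrightarrow> C_k_on n k V g"
proof (induction k arbitrary: f g)
  case 0
  then show ?case using V by (simp add: C_k_on_0_iff cong: continuous_on_cong del: C_k_on.simps)
next
  case (Suc k)
  have c: "continuous_on V f \<longleftrightarrow> continuous_on V g"
    using Suc.prems by (simp cong: continuous_on_cong)
  have h: "hpd i f f' x \<longleftrightarrow> hpd i g f' x" if "i < n" "x \<in> V" for i x f'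
    using hpd_cong[OF V] that Suc.prems by blast
  have "partial_deriv i f x = partial_deriv i g x" if "i < n" "x \<in> V" for i x
    unfolding partial_deriv_def
    by (rule deriv_cong_ev) (auto intro: eventually_mono[OF eventually_upd[OF V \<open>x \<in> V\<close> \<open>i < n\<close>]] Suc.prems)
  then show ?case using c h Suc.IH[of "partial_deriv i f" "partial_deriv i g" for i] V
    by (simp add: C_k_on_Suc_iff del: C_k_on.simps)
qed

text \<open>Explicit formulas \<open>g\<close> replace \<open>partial_deriv i f\<close>; the closure
  properties below are inductions on \<open>k\<close> that supply such formulas.\<close>

lemma C_k_on_SucI:
  assumes V: "eopen n V" and "continuous_on V f"
    and g: "\<And>i x. i < n \<Longrightarrow> x \<in> V \<Longrightarrow> hpd i f (g i x) x" "\<And>i. i < n \<Longrightarrow> C_k_on n k V (g i)"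
  shows "C_k_on n (Suc k) V f"
proof -
  have "C_k_on n k V (partial_deriv i f)" if "i < n" for i
    using g that C_k_on_cong[OF V, of "partial_deriv i f" "g i"] hpd_partial_deriv by metis
  then show ?thesis using assms hpd_partial_deriv by (metis C_k_on_Suc_iff)
qed

lemma C_k_on_subset:
  assumes "eopen n V" "eopen n W" "W \<subseteq> V"
  shows "C_k_on n k V f \<Longrightarrow> C_k_on n k W f"
proof (induction k arbitrary: f)
  case 0
  then show ?case using assms continuous_on_subset by (auto simp: C_k_on_0_iff simp del: C_k_on.simps)
next
  case (Suc k)
  then show ?case using assms continuous_on_subset by (auto simp: C_k_on_Suc_iff simp del: C_k_on.simps)
qed

lemma C_k_on_SucD:
  assumes V: "eopen n V"
  shows "C_k_on n (Suc k) V f \<Longrightarrow> C_k_on n k V f"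
proof (induction k arbitrary: f)
  case 0
  then show ?case using V by (auto simp: C_k_on_0_iff C_k_on_Suc_iff simp del: C_k_on.simps)
next
  case (Suc k)
  then show ?case using C_k_on_Suc_iff[OF V] by meson
qed

lemma C_k_on_local:
  assumes V: "eopen n V"
  shows "(\<And>x. x \<in> V \<Longrightarrow> \<exists>W. eopen n W \<and> x \<in> W \<and> C_k_on n k W f) \<Longrightarrow> C_k_on n k V f"
proof (induction k arbitrary: f)
  case 0
  have "continuous_on V f"
  proof (rule continuous_on_eboxI[OF eopen_subset[OF V]])
    fix x and e :: real assume x: "x \<in> V" and e: "e > 0"
    obtain W where W: "eopen n W" "x \<in> W" "C_k_on n 0 W f" using 0[OF x] by blast
    then show "\<exists>d>0. \<forall>y\<in>V \<inter> ebox n x d. \<bar>f y - f x\<bar> < e"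
      using continuous_on_eboxD[OF W(1) _ W(2) e, of f] by (metis C_k_on_0_iff IntE)
  qed
  then show ?case using V by (simp add: C_k_on_0_iff del: C_k_on.simps)
next
  case (Suc k)
  note W = this
  have 1: "C_k_on n k V f" using Suc.IH W(2) C_k_on_SucD by meson
  have 2: "hpd i f (partial_deriv i f x) x" if "i < n" "x \<in> V" for i x
    using W(2)[OF that(2)] C_k_on_Suc_iff that(1) by meson
  have 3: "C_k_on n k V (partial_deriv i f)" if "i < n" for i
    using Suc.IH[of "partial_deriv i f"] W(2) C_k_on_Suc_iff that by meson
  show ?case using 1 2 3 C_k_on_continuous[OF V] by (auto simp: C_k_on_Suc_iff[OF V] simp del: C_k_on.simps)
qed

text \<open>Walk from \<open>x\<close> to \<open>y\<close> one coordinate at a time and apply the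
  mean value theorem on each leg. The box keeps the legs inside the domain; the bound on
  \<open>\<xi>\<close> forces the intermediate points to approach \<open>x\<close> as
  \<open>y\<close> does.\<close>

lemma ebox_mvt:
  assumes g: "\<And>j z. j < n \<Longrightarrow> z \<in> ebox n c e \<Longrightarrow> hpd j f (g j z) z"
    and x: "x \<in> ebox n c e" and y: "y \<in> ebox n c e"
  shows "\<exists>\<xi>. (\<forall>j<n. \<xi> j \<in> ebox n c e \<and> (\<forall>i. \<bar>\<xi> j i - x i\<bar> \<le> \<bar>y i - x i\<bar>)) \<and>
     f y - f x = (\<Sum>j<n. g j (\<xi> j) * (y j - x j))"
proof -
  \<comment> \<open>Corner points of the path: the first \<open>k\<close> coordinates are already
    those of \<open>y\<close>.\<close>
  define z where "z k = (\<lambda>i. if i < k then y i else x i)" for k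
  have z: "z k \<in> ebox n c e" for k
    using x y by (auto simp: ebox_def z_def ES_def)
  have zS: "z (Suc k) = (z k)(k := y k)" "z k = (z k)(k := x k)" for k
    by (auto simp: z_def fun_eq_iff less_Suc_eq)
  have "\<exists>\<xi>. \<xi> \<in> ebox n c e \<and> (\<forall>i. \<bar>\<xi> i - x i\<bar> \<le> \<bar>y i - x i\<bar>) \<and>
     f (z (Suc j)) - f (z j) = g j \<xi> * (y j - x j)" if j: "j < n" for j
  proof -
    define \<phi> where "\<phi> = (\<lambda>t. f ((z j)(j := t)))"
    have mem: "(z j)(j := t) \<in> ebox n c e" if "min (x j) (y j) \<le> t" "t \<le> max (x j) (y j)" for t
    proof -
      have "\<bar>x j - c j\<bar> < e" "\<bar>y j - c j\<bar> < e" using x y j by (auto simp: ebox_def)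
      then have "\<bar>t - c j\<bar> < e" using that by (auto simp: abs_less_iff min_def max_def split: if_splits)
      then show ?thesis using z[of j] j by (auto simp: ebox_def)
    qed
    have der: "(\<phi> has_real_derivative g j ((z j)(j := t))) (at t)"
      if "min (x j) (y j) \<le> t" "t \<le> max (x j) (y j)" for t
      using g[OF j mem[OF that]] unfolding \<phi>_def hpd_upd by simp
    have "\<exists>t. min (x j) (y j) \<le> t \<and> t \<le> max (x j) (y j) \<and> \<phi> (y j) - \<phi> (x j) = g j ((z j)(j := t)) * (y j - x j)"
    proof (cases "x j" "y j" rule: linorder_cases)
      case less
      obtain t where "x j < t" "t < y j" "\<phi> (y j) - \<phi> (x j) = (y j - x j) * g j ((z j)(j := t))"
        using MVT2[OF less, of \<phi> "\<lambda>t. g j ((z j)(j := t))"] der less by (auto simp: min_def max_def)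
      then show ?thesis by (intro exI[of _ t]) (auto simp: mult.commute)
    next
      case equal
      then show ?thesis by (intro exI[of _ "x j"]) auto
    next
      case greater
      obtain t where "y j < t" "t < x j" "\<phi> (x j) - \<phi> (y j) = (x j - y j) * g j ((z j)(j := t))"
        using MVT2[OF greater, of \<phi> "\<lambda>t. g j ((z j)(j := t))"] der greater by (auto simp: min_def max_def)
      then show ?thesis by (intro exI[of _ t]) (auto simp: algebra_simps)
    qed
    then obtain t where t: "min (x j) (y j) \<le> t" "t \<le> max (x j) (y j)"
       "\<phi> (y j) - \<phi> (x j) = g j ((z j)(j := t)) * (y j - x j)" by blast
    have "\<bar>((z j)(j := t)) i - x i\<bar> \<le> \<bar>y i - x i\<bar>" for i
      using t(1,2) by (auto simp: z_def)
    moreover have "f (z (Suc j)) - f (z j) = \<phi> (y j) - \<phi> (x j)"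
      unfolding \<phi>_def using zS by metis
    ultimately show ?thesis using mem[OF t(1,2)] t(3) by (intro exI[of _ "(z j)(j := t)"]) auto
  qed
  then obtain \<xi> where \<xi>: "\<And>j. j < n \<Longrightarrow> \<xi> j \<in> ebox n c e \<and> (\<forall>i. \<bar>\<xi> j i - x i\<bar> \<le> \<bar>y i - x i\<bar>) \<and>
     f (z (Suc j)) - f (z j) = g j (\<xi> j) * (y j - x j)" by metis
  have "z 0 = x" "z n = y"
    using x y by (auto simp: z_def ebox_def ES_def fun_eq_iff)
  then have "f y - f x = (\<Sum>j<n. f (z (Suc j)) - f (z j))"
    using sum_lessThan_telescope[of "\<lambda>k. f (z k)" n] by simp
  also have "\<dots> = (\<Sum>j<n. g j (\<xi> j) * (y j - x j))" using \<xi> by simp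
  finally show ?thesis using \<xi> by (intro exI[of _ \<xi>]) auto
qed

text \<open>Differentiability in Caratheodory's form: the increment is linear in the coordinate
  increments, with slopes that converge to the partial derivatives. The limit is stated along
  arbitrary curves and filters so that both the chain rule and the implicit function can pass to
  it.\<close>

lemma difference_slopes:
  assumes V: "eopen n V"
    and g: "\<And>j z. j < n \<Longrightarrow> z \<in> V \<Longrightarrow> hpd j f (g j z) z" "\<And>j. j < n \<Longrightarrow> continuous_on V (g j)"
    and xV: "x \<in> V"
  obtains e q where "e > 0" "\<forall>y\<in>ebox n x e. f y - f x = (\<Sum>j<n. q j y * (y j - x j))"
    "\<forall>j<n. \<forall>\<gamma> F. (\<forall>d>0. eventually (\<lambda>t. \<gamma> t \<in> ebox n x d) F) \<longrightarrow> ((\<lambda>t::real. q j (\<gamma> t)) \<longlongrightarrow> g j x) F"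
proof -
  obtain e where e: "e > 0" "ebox n x e \<subseteq> V" using eopen_boxE[OF V xV] .
  have xe: "x \<in> ebox n x e" using e xV eopen_subset[OF V] centre_in_ebox by blast
  have "\<forall>y\<in>ebox n x e. \<exists>\<xi>. (\<forall>j<n. \<xi> j \<in> ebox n x e \<and> (\<forall>i. \<bar>\<xi> j i - x i\<bar> \<le> \<bar>y i - x i\<bar>)) \<and>
     f y - f x = (\<Sum>j<n. g j (\<xi> j) * (y j - x j))"
    by (intro ballI ebox_mvt[OF _ xe]) (use g(1) e in auto)
  from bchoice[OF this] obtain \<xi> where \<xi>: "\<And>y j. y \<in> ebox n x e \<Longrightarrow> j < n \<Longrightarrow> \<xi> y j \<in> ebox n x e"
     "\<And>y j i. y \<in> ebox n x e \<Longrightarrow> j < n \<Longrightarrow> \<bar>\<xi> y j i - x i\<bar> \<le> \<bar>y i - x i\<bar>"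
     "\<And>y. y \<in> ebox n x e \<Longrightarrow> f y - f x = (\<Sum>j<n. g j (\<xi> y j) * (y j - x j))" by blast
  have "((\<lambda>t. g j (\<xi> (\<gamma> t) j)) \<longlongrightarrow> g j x) F"
    if j: "j < n" and \<gamma>: "\<And>d. d > 0 \<Longrightarrow> eventually (\<lambda>t. \<gamma> t \<in> ebox n x d) F" for j and \<gamma> :: "real \<Rightarrow> _" and F
  proof (rule tendstoI)
    fix \<epsilon> :: real assume "\<epsilon> > 0"
    then obtain d where d: "d > 0" "ebox n x d \<subseteq> V" "\<And>y. y \<in> ebox n x d \<Longrightarrow> \<bar>g j y - g j x\<bar> < \<epsilon>"
      using continuous_on_eboxD[OF V g(2)[OF j] xV] by metis
    have "eventually (\<lambda>t. \<gamma> t \<in> ebox n x (min d e)) F" using \<gamma> d(1) e(1) by simp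
    then show "eventually (\<lambda>t. dist (g j (\<xi> (\<gamma> t) j)) (g j x) < \<epsilon>) F"
    proof eventually_elim
      case (elim t)
      then have te: "\<gamma> t \<in> ebox n x e" and td: "\<gamma> t \<in> ebox n x d" by (auto simp: ebox_def)
      have "\<xi> (\<gamma> t) j \<in> ebox n x d"
        unfolding ebox_def
      proof (intro CollectI conjI allI impI)
        show "\<xi> (\<gamma> t) j \<in> ES n" using \<xi>(1)[OF te j] by (auto simp: ebox_def)
        fix i assume "i < n"
        then show "\<bar>\<xi> (\<gamma> t) j i - x i\<bar> < d"
          using \<xi>(2)[OF te j, of i] td by (fastforce simp: ebox_def)
      qed
      then show ?case using d(3) by (simp add: dist_real_def)
    qed
  qed
  then show ?thesis using that[of e "\<lambda>j y. g j (\<xi> y j)"] e(1) \<xi>(3) by blast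
qed

lemma eventually_in_ebox:
  assumes "\<And>j. j < n \<Longrightarrow> ((\<lambda>t. \<gamma> t j) \<longlongrightarrow> x j) F" "eventually (\<lambda>t. \<gamma> t \<in> ES n) F" "d > 0"
  shows "eventually (\<lambda>t. \<gamma> t \<in> ebox n x d) F"
proof -
  have "eventually (\<lambda>t. \<forall>j\<in>{..<n}. \<bar>\<gamma> t j - x j\<bar> < d) F"
    using tendstoD[OF assms(1,3)] by (intro eventually_ball_finite) (auto simp: dist_real_def)
  then show ?thesis using assms(2) by eventually_elim (auto simp: ebox_def)
qed

text \<open>Divide the slope formula by \<open>t - t0\<close>. The derivative is taken within
  \<open>T\<close> because curves on the unit interval are differentiated at its end points
  too.\<close>

lemma chain_rule_curve:
  assumes V: "eopen n V"
    and g: "\<And>j z. j < n \<Longrightarrow> z \<in> V \<Longrightarrow> hpd j f (g j z) z" "\<And>j. j < n \<Longrightarrow> continuous_on V (g j)"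
    and \<gamma>: "\<And>j. j < n \<Longrightarrow> ((\<lambda>t. \<gamma> t j) has_real_derivative \<gamma>' j) (at t0 within T)"
    and mem: "\<And>t. t \<in> T \<Longrightarrow> \<gamma> t \<in> V" "t0 \<in> T"
  shows "((\<lambda>t. f (\<gamma> t)) has_real_derivative (\<Sum>j<n. g j (\<gamma> t0) * \<gamma>' j)) (at t0 within T)"
proof -
  obtain e q where e: "e > 0" and q: "\<forall>y\<in>ebox n (\<gamma> t0) e. f y - f (\<gamma> t0) = (\<Sum>j<n. q j y * (y j - \<gamma> t0 j))"
    "\<forall>j<n. \<forall>\<beta> F. (\<forall>d>0. eventually (\<lambda>t. \<beta> t \<in> ebox n (\<gamma> t0) d) F) \<longrightarrow> ((\<lambda>t::real. q j (\<beta> t)) \<longlongrightarrow> g j (\<gamma> t0)) F"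
    by (rule difference_slopes[where f = f and g = g, OF V g mem(1)[OF mem(2)]])
  have evbox: "eventually (\<lambda>t. \<gamma> t \<in> ebox n (\<gamma> t0) d) (at t0 within T)" if "d > 0" for d
  proof (rule eventually_in_ebox[OF _ _ that])
    show "((\<lambda>t. \<gamma> t j) \<longlongrightarrow> \<gamma> t0 j) (at t0 within T)" if "j < n" for j
      using DERIV_continuous[OF \<gamma>[OF that]] by (simp add: continuous_within)
    show "eventually (\<lambda>t. \<gamma> t \<in> ES n) (at t0 within T)"
      using mem eopen_subset[OF V] by (auto simp: eventually_at_filter intro!: always_eventually)
  qed
  have "((\<lambda>t. \<Sum>j<n. q j (\<gamma> t) * ((\<gamma> t j - \<gamma> t0 j) / (t - t0))) \<longlongrightarrow> (\<Sum>j<n. g j (\<gamma> t0) * \<gamma>' j)) (at t0 within T)"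
    by (intro tendsto_sum tendsto_mult q(2)[rule_format] evbox) (use \<gamma> in \<open>auto simp: has_field_derivative_iff\<close>)
  moreover have "eventually (\<lambda>t. (\<Sum>j<n. q j (\<gamma> t) * ((\<gamma> t j - \<gamma> t0 j) / (t - t0))) = (f (\<gamma> t) - f (\<gamma> t0)) / (t - t0)) (at t0 within T)"
    using evbox[OF e]
  proof eventually_elim
    case (elim t)
    then show ?case using q(1)[rule_format, OF elim] by (simp add: sum_divide_distrib)
  qed
  ultimately show ?thesis
    unfolding has_field_derivative_iff by (rule Lim_transform_eventually)
qed

subsection \<open>Closure properties of \<open>C\<^sup>k\<close> functions\<close>

lemma hpd_const: "hpd i (\<lambda>_. c) 0 x"
  by (simp add: hpd_def)

lemma hpd_coord: "hpd i (\<lambda>x. x j) (if i = j then 1 else 0) x"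
  by (auto simp: hpd_def)

lemma hpd_add: "hpd i f f' x \<Longrightarrow> hpd i g g' x \<Longrightarrow> hpd i (\<lambda>x. f x + g x) (f' + g') x"
  unfolding hpd_def by (rule DERIV_add)

lemma hpd_mult: "hpd i f f' x \<Longrightarrow> hpd i g g' x \<Longrightarrow> hpd i (\<lambda>x. f x * g x) (f' * g x + g' * f x) x"
  unfolding hpd_def using DERIV_mult by fastforce

lemma C_k_on_const:
  assumes V: "eopen n V"
  shows "C_k_on n k V (\<lambda>_. c)"
proof (induction k arbitrary: c)
  case (Suc k)
  show ?case by (rule C_k_on_SucI[OF V _ hpd_const Suc.IH]) auto
qed (use V in \<open>auto simp: C_k_on_0_iff simp del: C_k_on.simps\<close>)

lemma C_k_on_coord:
  assumes V: "eopen n V"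
  shows "C_k_on n k V (\<lambda>x. x j)"
proof (cases k)
  case (Suc l)
  show ?thesis unfolding Suc
    by (rule C_k_on_SucI[OF V _ hpd_coord C_k_on_const[OF V]]) (rule continuous_on_coord)
qed (use V in \<open>auto simp: C_k_on_0_iff intro: continuous_on_coord simp del: C_k_on.simps\<close>)

lemma C_k_on_add:
  assumes V: "eopen n V"
  shows "C_k_on n k V f \<Longrightarrow> C_k_on n k V g \<Longrightarrow> C_k_on n k V (\<lambda>x. f x + g x)"
proof (induction k arbitrary: f g)
  case (Suc k)
  note S = Suc.prems[unfolded C_k_on_Suc_iff[OF V]]
  show ?case
    by (rule C_k_on_SucI[OF V, where g = "\<lambda>i x. partial_deriv i f x + partial_deriv i g x"])
       (use S Suc.IH in \<open>auto intro!: continuous_intros hpd_add simp del: C_k_on.simps\<close>)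
qed (use V in \<open>auto simp: C_k_on_0_iff intro: continuous_intros simp del: C_k_on.simps\<close>)

lemma C_k_on_mult:
  assumes V: "eopen n V"
  shows "C_k_on n k V f \<Longrightarrow> C_k_on n k V g \<Longrightarrow> C_k_on n k V (\<lambda>x. f x * g x)"
proof (induction k arbitrary: f g)
  case (Suc k)
  note S = Suc.prems[unfolded C_k_on_Suc_iff[OF V]]
  note D = C_k_on_SucD[OF V Suc.prems(1)] C_k_on_SucD[OF V Suc.prems(2)]
  show ?case
    by (rule C_k_on_SucI[OF V, where g = "\<lambda>i x. partial_deriv i f x * g x + partial_deriv i g x * f x"])
       (use S D Suc.IH in \<open>auto intro!: continuous_intros hpd_mult C_k_on_add[OF V] simp del: C_k_on.simps\<close>)
qed (use V in \<open>auto simp: C_k_on_0_iff intro: continuous_intros simp del: C_k_on.simps\<close>)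

lemma C_k_on_sum:
  assumes V: "eopen n V" and "finite J" "\<And>j. j \<in> J \<Longrightarrow> C_k_on n k V (f j)"
  shows "C_k_on n k V (\<lambda>x. \<Sum>j\<in>J. f j x)"
  using assms(2,3) by (induction J) (auto intro: C_k_on_const[OF V] C_k_on_add[OF V])

lemma hpd_compose:
  assumes V: "eopen n V" and W: "eopen m W"
    and g: "\<And>j z. j < n \<Longrightarrow> z \<in> V \<Longrightarrow> hpd j f (g j z) z" "\<And>j. j < n \<Longrightarrow> continuous_on V (g j)"
    and G: "\<And>x. x \<in> W \<Longrightarrow> G x \<in> V" "\<And>j. j < n \<Longrightarrow> hpd i (\<lambda>x. G x j) (G' j) x"
    and x: "x \<in> W" "i < m"
  shows "hpd i (\<lambda>x. f (G x)) (\<Sum>j<n. g j (G x) * G' j) x"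
proof -
  obtain e where e: "e > 0" "\<And>t. \<bar>t - x i\<bar> < e \<Longrightarrow> x(i := t) \<in> W"
    using eopen_upd[OF W x] by metis
  have mem: "x i \<in> ball (x i) e" using e by simp
  have "((\<lambda>t. f (G (x(i := t)))) has_real_derivative (\<Sum>j<n. g j (G (x(i := x i))) * G' j)) (at (x i) within ball (x i) e)"
  proof (rule chain_rule_curve[OF V g])
    show "((\<lambda>t. G (x(i := t)) j) has_real_derivative G' j) (at (x i) within ball (x i) e)" if "j < n" for j
      using G(2)[OF that] unfolding hpd_def by (rule has_field_derivative_at_within)
  qed (use e G(1) mem in \<open>auto simp: dist_real_def abs_minus_commute\<close>)
  then show ?thesis
    unfolding hpd_def using at_within_open[OF mem open_ball] by simp
qed

lemma continuous_on_into_ES: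
  assumes "\<And>j. j < n \<Longrightarrow> continuous_on W (\<lambda>x. G x j)" "\<And>x. x \<in> W \<Longrightarrow> G x \<in> ES n"
  shows "continuous_on W (G :: _ \<Rightarrow> nat \<Rightarrow> real)"
proof (rule continuous_on_coordinatewise_then_product)
  fix j
  show "continuous_on W (\<lambda>x. G x j)"
  proof (cases "j < n")
    case False
    then have "\<And>x. x \<in> W \<Longrightarrow> G x j = 0" using assms(2) by (auto simp: ES_def)
    then show ?thesis by (metis continuous_on_cong continuous_on_const)
  qed (use assms(1) in auto)
qed

text \<open>Induction on \<open>k\<close> for all \<open>f\<close> at once: the chain rule expresses
  the partial derivatives of the composite through \<open>partial_deriv j f\<close> along
  \<open>G\<close>, to which the induction hypothesis applies.\<close>

lemma C_k_on_compose:
  assumes V: "eopen n V" and W: "eopen m W" and G: "\<And>x. x \<in> W \<Longrightarrow> G x \<in> V"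
  shows "C_k_on n k V f \<Longrightarrow> (\<And>j. j < n \<Longrightarrow> C_k_on m k W (\<lambda>x. G x j)) \<Longrightarrow> C_k_on m k W (\<lambda>x. f (G x))"
proof (induction k arbitrary: f)
  case 0
  have "continuous_on W G"
    by (rule continuous_on_into_ES[of n]) (use 0 C_k_on_0_iff[OF W] G eopen_subset[OF V] in \<open>auto simp del: C_k_on.simps\<close>)
  then have "continuous_on W (\<lambda>x. f (G x))"
    by (rule continuous_on_compose2[of V f, rotated]) (use 0 C_k_on_0_iff[OF V] G in \<open>auto simp del: C_k_on.simps\<close>)
  then show ?case using C_k_on_0_iff[OF W] by blast
next
  case (Suc k)
  note f = Suc.prems(1)[unfolded C_k_on_Suc_iff[OF V]]
  have "continuous_on W G"
    by (rule continuous_on_into_ES[of n]) (use Suc.prems(2) C_k_on_continuous[OF W] G eopen_subset[OF V] in \<open>auto simp del: C_k_on.simps\<close>)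
  then have c: "continuous_on W (\<lambda>x. f (G x))"
    by (rule continuous_on_compose2[of V f, rotated]) (use f G in blast)+
  have Gj: "C_k_on m k W (\<lambda>x. G x j)" if "j < n" for j
    using C_k_on_SucD[OF W] Suc.prems(2) that by blast
  show ?case
  proof (rule C_k_on_SucI[OF W c])
    fix i x assume i: "i < m" and x: "x \<in> W"
    show "hpd i (\<lambda>x. f (G x)) (\<Sum>j<n. partial_deriv j f (G x) * partial_deriv i (\<lambda>x. G x j) x) x"
    proof (rule hpd_compose[OF V W _ _ G _ x i])
      show "hpd i (\<lambda>x. G x j) (partial_deriv i (\<lambda>x. G x j) x) x" if "j < n" for j
        using Suc.prems(2)[OF that] C_k_on_Suc_iff[OF W] i x by blast
      show "continuous_on V (partial_deriv j f)" if "j < n" for j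
        using f that C_k_on_continuous[OF V] by blast
      show "hpd j f (partial_deriv j f z) z" if "j < n" "z \<in> V" for j z
        using f that by blast
    qed
  next
    fix i assume i: "i < m"
    have "C_k_on m k W (partial_deriv i (\<lambda>x. G x j))" if "j < n" for j
      using Suc.prems(2)[OF that] C_k_on_Suc_iff[OF W] i by blast
    moreover have "C_k_on m k W (\<lambda>x. partial_deriv j f (G x))" if "j < n" for j
      by (rule Suc.IH) (use f Gj that in blast)+
    ultimately show "C_k_on m k W (\<lambda>x. \<Sum>j<n. partial_deriv j f (G x) * partial_deriv i (\<lambda>x. G x j) x)"
      by (intro C_k_on_sum[OF W] C_k_on_mult[OF W] finite_lessThan) (simp_all only: lessThan_iff)
  qed
qed

lemma C_k_on_inverse:
  assumes V: "eopen n V" and nz: "\<And>x. x \<in> V \<Longrightarrow> f x \<noteq> 0"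
  shows "C_k_on n k V f \<Longrightarrow> C_k_on n k V (\<lambda>x. inverse (f x))"
proof (induction k)
  case 0
  then show ?case using V nz by (auto simp: C_k_on_0_iff intro!: continuous_intros simp del: C_k_on.simps)
next
  case (Suc k)
  note f = Suc.prems[unfolded C_k_on_Suc_iff[OF V]]
  have I: "C_k_on n k V (\<lambda>x. inverse (f x))" using Suc C_k_on_SucD[OF V] by blast
  show ?case
  proof (rule C_k_on_SucI[OF V, where g = "\<lambda>i x. (- 1) * (partial_deriv i f x * (inverse (f x) * inverse (f x)))"])
    show "continuous_on V (\<lambda>x. inverse (f x))" using C_k_on_continuous[OF V I] .
    show "hpd i (\<lambda>x. inverse (f x)) ((- 1) * (partial_deriv i f x * (inverse (f x) * inverse (f x)))) x"
      if "i < n" "x \<in> V" for i x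
    proof -
      have "((\<lambda>t. f (x(i := t))) has_real_derivative partial_deriv i f x) (at (x i))"
        using f that unfolding hpd_def by blast
      from DERIV_inverse_fun[OF this] nz[OF that(2)] show ?thesis
        unfolding hpd_def by (simp add: mult_ac)
    qed
    show "C_k_on n k V (\<lambda>x. (- 1) * (partial_deriv i f x * (inverse (f x) * inverse (f x))))" if "i < n" for i
      by (intro C_k_on_mult[OF V] C_k_on_const[OF V] I) (use f that in blast)
  qed
qed

section \<open>Smooth functions on open subsets of Euclidean space\<close>

lemma smooth_onD: "smooth_on n V f \<Longrightarrow> C_k_on n k V f"
  by (simp add: smooth_on_def)

lemma smooth_on_continuous: "eopen n V \<Longrightarrow> smooth_on n V f \<Longrightarrow> continuous_on V f"
  using C_k_on_continuous smooth_onD by blast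

lemma smooth_on_hpd: "eopen n V \<Longrightarrow> smooth_on n V f \<Longrightarrow> i < n \<Longrightarrow> x \<in> V \<Longrightarrow> hpd i f (partial_deriv i f x) x"
  using smooth_onD[of n V f "Suc 0"] C_k_on_Suc_iff by blast

lemma smooth_on_partial_deriv: "eopen n V \<Longrightarrow> smooth_on n V f \<Longrightarrow> i < n \<Longrightarrow> smooth_on n V (partial_deriv i f)"
  unfolding smooth_on_def using C_k_on_Suc_iff by blast

lemma smooth_on_subset: "eopen n V \<Longrightarrow> eopen n W \<Longrightarrow> W \<subseteq> V \<Longrightarrow> smooth_on n V f \<Longrightarrow> smooth_on n W f"
  unfolding smooth_on_def using C_k_on_subset by blast

lemma smooth_on_cong: "eopen n V \<Longrightarrow> (\<And>x. x \<in> V \<Longrightarrow> f x = g x) \<Longrightarrow> smooth_on n V f \<longleftrightarrow> smooth_on n V g"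
  unfolding smooth_on_def using C_k_on_cong by blast

lemma smooth_on_local:
  "eopen n V \<Longrightarrow> (\<And>x. x \<in> V \<Longrightarrow> \<exists>W. eopen n W \<and> x \<in> W \<and> smooth_on n W f) \<Longrightarrow> smooth_on n V f"
  unfolding smooth_on_def using C_k_on_local by (smt (verit))

lemma smooth_on_const: "eopen n V \<Longrightarrow> smooth_on n V (\<lambda>_. c)"
  unfolding smooth_on_def using C_k_on_const by blast

lemma smooth_on_coord: "eopen n V \<Longrightarrow> smooth_on n V (\<lambda>x. x j)"
  unfolding smooth_on_def using C_k_on_coord by blast

lemma smooth_on_add: "eopen n V \<Longrightarrow> smooth_on n V f \<Longrightarrow> smooth_on n V g \<Longrightarrow> smooth_on n V (\<lambda>x. f x + g x)"
  unfolding smooth_on_def using C_k_on_add by blast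

lemma smooth_on_mult: "eopen n V \<Longrightarrow> smooth_on n V f \<Longrightarrow> smooth_on n V g \<Longrightarrow> smooth_on n V (\<lambda>x. f x * g x)"
  unfolding smooth_on_def using C_k_on_mult by blast

lemma smooth_on_diff: "eopen n V \<Longrightarrow> smooth_on n V f \<Longrightarrow> smooth_on n V g \<Longrightarrow> smooth_on n V (\<lambda>x. f x - g x)"
  using smooth_on_add[of n V f "\<lambda>x. (- 1) * g x"] smooth_on_mult[of n V "\<lambda>_. - 1" g] smooth_on_const[of n V "- 1"] by simp

lemma smooth_on_sum: "eopen n V \<Longrightarrow> finite J \<Longrightarrow> (\<And>j. j \<in> J \<Longrightarrow> smooth_on n V (f j)) \<Longrightarrow> smooth_on n V (\<lambda>x. \<Sum>j\<in>J. f j x)"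
  unfolding smooth_on_def by (intro allI C_k_on_sum) auto

lemma smooth_on_inverse:
  "eopen n V \<Longrightarrow> (\<And>x. x \<in> V \<Longrightarrow> f x \<noteq> 0) \<Longrightarrow> smooth_on n V f \<Longrightarrow> smooth_on n V (\<lambda>x. inverse (f x))"
  unfolding smooth_on_def by (intro allI C_k_on_inverse) auto

lemma smooth_on_compose:
  assumes "eopen n V" "eopen m W" "\<And>x. x \<in> W \<Longrightarrow> G x \<in> V"
    "smooth_on n V f" "\<And>j. j < n \<Longrightarrow> smooth_on m W (\<lambda>x. G x j)"
  shows "smooth_on m W (\<lambda>x. f (G x))"
  unfolding smooth_on_def
proof
  fix k
  show "C_k_on m k W (\<lambda>x. f (G x))"
    by (rule C_k_on_compose[OF assms(1-3) smooth_onD[OF assms(4)] smooth_onD[OF assms(5)]])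
qed

lemma partial_deriv_compose:
  assumes V: "eopen n V" and W: "eopen m W" and G: "\<And>x. x \<in> W \<Longrightarrow> G x \<in> V"
    and f: "smooth_on n V f" "\<And>j. j < n \<Longrightarrow> smooth_on m W (\<lambda>x. G x j)" and "x \<in> W" "i < m"
  shows "partial_deriv i (\<lambda>x. f (G x)) x = (\<Sum>j<n. partial_deriv j f (G x) * partial_deriv i (\<lambda>x. G x j) x)"
  by (rule hpd_partial_deriv[OF hpd_compose[OF V W smooth_on_hpd[OF V f(1)]
        smooth_on_continuous[OF V smooth_on_partial_deriv[OF V f(1)]] G smooth_on_hpd[OF W f(2)]]])
     (use assms(6,7) in auto)

lemma partial_deriv_cong:
  assumes "eopen n V" "x \<in> V" "i < n" "\<And>y. y \<in> V \<Longrightarrow> f y = g y"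
  shows "partial_deriv i f x = partial_deriv i g x"
  unfolding partial_deriv_def
  by (rule deriv_cong_ev) (auto intro: eventually_mono[OF eventually_upd[OF assms(1-3)]] assms(4))

subsection \<open>Bump functions\<close>

text \<open>The factor \<open>inverse s ^ k\<close> makes this family of flat functions closed under
  differentiation, so that smoothness follows by induction without computing higher derivatives of
  the exponential.\<close>

definition flat :: "nat \<Rightarrow> real \<Rightarrow> real" where
  "flat k s = (if s > 0 then exp (- inverse s) * inverse s ^ k else 0)"

text \<open>With \<open>u = inverse s\<close> this is the decay of \<open>u ^ k / exp u\<close> at
  infinity.\<close>

lemma flat_tendsto_0: "(flat k \<longlongrightarrow> 0) (at 0)"
proof -
  have "((\<lambda>s. inverse s ^ k / exp (inverse s)) \<longlongrightarrow> 0) (at_right (0::real))"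
    by (rule filterlim_compose[OF tendsto_power_div_exp_0 filterlim_inverse_at_top_right])
  then have "((\<lambda>s. exp (- inverse s) * inverse s ^ k) \<longlongrightarrow> 0) (at_right (0::real))"
    by (simp add: exp_minus divide_inverse mult.commute)
  then have "(flat k \<longlongrightarrow> 0) (at_right 0)"
    by (rule Lim_transform_eventually) (auto simp: flat_def eventually_at_right_less intro: eventually_at_rightI[of 0 1])
  moreover have "(flat k \<longlongrightarrow> 0) (at_left 0)"
    by (rule Lim_transform_eventually[OF tendsto_const]) (auto simp: flat_def intro: eventually_at_leftI[of "-1"])
  ultimately show ?thesis by (simp add: filterlim_split_at)
qed

lemma flat_deriv: "(flat k has_real_derivative flat (k + 2) s - real k * flat (k + 1) s) (at s)"
proof (cases s "0::real" rule: linorder_cases)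
  case less
  have "((\<lambda>_. 0) has_real_derivative 0) (at s)" by simp
  moreover have "eventually (\<lambda>x. 0 = flat k x) (nhds s)"
    using eventually_nhds_in_open[of "{..<0}" s] less by (auto elim!: eventually_mono simp: flat_def)
  ultimately have "(flat k has_real_derivative 0) (at s)" using DERIV_cong_ev by fastforce
  then show ?thesis using less by (simp add: flat_def)
next
  case equal
  \<comment> \<open>Away from 0 the difference quotient of \<open>flat k\<close> at 0 is
    \<open>flat (Suc k)\<close>, whose limit is already known.\<close>
  have "((\<lambda>h. flat k h / h) \<longlongrightarrow> 0) (at 0)"
    by (rule Lim_transform_eventually[OF flat_tendsto_0[of "Suc k"]])
       (auto simp: flat_def divide_inverse eventually_at_filter mult_ac)
  then show ?thesis using equal by (simp add: has_field_derivative_iff flat_def)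
next
  case greater
  have "((\<lambda>s. exp (- inverse s) * inverse s ^ k) has_real_derivative flat (k + 2) s - real k * flat (k + 1) s) (at s)"
  proof -
    have 0: "(inverse has_real_derivative - (inverse s * inverse s)) (at s)"
      using DERIV_inverse[of s UNIV] greater by (simp add: power2_eq_square)
    have 1: "((\<lambda>s. exp (- inverse s)) has_real_derivative exp (- inverse s) * (inverse s * inverse s)) (at s)"
      using DERIV_fun_exp[OF DERIV_minus[OF 0]] by simp
    have 2: "((\<lambda>s. inverse s ^ k) has_real_derivative - (real k * inverse s ^ (k + 1))) (at s)"
      using DERIV_power[OF 0, of k] by (cases k) (simp_all add: mult_ac)
    have "exp (- inverse s) * (inverse s * inverse s) * inverse s ^ k + - (real k * inverse s ^ (k + 1)) * exp (- inverse s)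
        = flat (k + 2) s - real k * flat (k + 1) s"
      using greater by (simp add: flat_def algebra_simps)
    then show ?thesis using DERIV_mult[OF 1 2] by simp
  qed
  moreover have "eventually (\<lambda>x. exp (- inverse x) * inverse x ^ k = flat k x) (nhds s)"
    using eventually_nhds_in_open[of "{0<..}" s] greater by (auto elim!: eventually_mono simp: flat_def)
  ultimately show ?thesis using DERIV_cong_ev by fastforce
qed

lemma C_k_on_flat:
  assumes V: "eopen n V"
  shows "C_k_on n j V g \<Longrightarrow> C_k_on n j V (\<lambda>x. flat k (g x))"
proof (induction j arbitrary: k)
  case 0
  have "continuous_on UNIV (flat k)"
    by (rule DERIV_continuous_on) (use flat_deriv in blast)
  then show ?case using 0 V
    by (auto simp: C_k_on_0_iff intro: continuous_on_compose2[of UNIV "flat k"] simp del: C_k_on.simps)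
next
  case (Suc j)
  note g = Suc.prems[unfolded C_k_on_Suc_iff[OF V]]
  have I: "C_k_on n j V (\<lambda>x. flat k (g x))" for k using Suc C_k_on_SucD[OF V] by blast
  show ?case
  proof (rule C_k_on_SucI[OF V, where g = "\<lambda>i x. (flat (k + 2) (g x) + (- real k) * flat (k + 1) (g x)) * partial_deriv i g x"])
    show "continuous_on V (\<lambda>x. flat k (g x))" using C_k_on_continuous[OF V I] .
    show "hpd i (\<lambda>x. flat k (g x)) ((flat (k + 2) (g x) + (- real k) * flat (k + 1) (g x)) * partial_deriv i g x) x"
      if "i < n" "x \<in> V" for i x
    proof -
      have "((\<lambda>t. g (x(i := t))) has_real_derivative partial_deriv i g x) (at (x i))"
        using g that unfolding hpd_def by blast
      from DERIV_chain2[OF flat_deriv this] show ?thesis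
        unfolding hpd_def by simp
    qed
    show "C_k_on n j V (\<lambda>x. (flat (k + 2) (g x) + (- real k) * flat (k + 1) (g x)) * partial_deriv i g x)" if "i < n" for i
      by (intro C_k_on_mult[OF V] C_k_on_add[OF V] C_k_on_const[OF V] I) (use g that in blast)
  qed
qed

lemma smooth_bump_ES:
  assumes p: "p \<in> ES n" and e: "e > 0"
  obtains \<beta> d where "d > 0" "smooth_on n (ES n) \<beta>" "\<And>x. 0 \<le> \<beta> x" "\<And>x. \<beta> x \<le> 1"
    "\<And>x. x \<in> ebox n p d \<Longrightarrow> \<beta> x = 1" "\<And>x i. \<beta> x \<noteq> 0 \<Longrightarrow> i < n \<Longrightarrow> \<bar>x i - p i\<bar> \<le> e"
proof -
  \<comment> \<open>\<open>\<beta>\<close> equals 1 where \<open>s x\<close> is at least 1, that is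
    \<open>Q x \<le> e * e / 2\<close>, and 0 where \<open>s x\<close> is at most 0, that is
    \<open>Q x \<ge> e * e\<close>. The choice of \<open>d\<close> makes
    \<open>real n * (d * d)\<close> at most \<open>e * e / 2\<close>.\<close>
  define Q where "Q x = (\<Sum>i<n. (x i - p i) * (x i - p i))" for x
  define s where "s x = 2 - 2 / (e * e) * Q x" for x
  define \<beta> where "\<beta> x = flat 0 (s x) * inverse (flat 0 (s x) + flat 0 (1 - s x))" for x
  define d where "d = e / (2 * (real n + 1))"
  have d: "d > 0" using e by (simp add: d_def)
  \<comment> \<open>\<open>t\<close> and \<open>1 - t\<close> cannot both be non-positive, so the
    denominator of \<open>\<beta>\<close> never vanishes.\<close>
  have pos: "flat 0 t + flat 0 (1 - t) > 0" for t
    by (cases "t > 0") (auto simp: flat_def intro: add_pos_nonneg)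
  have nn: "flat 0 t \<ge> 0" for t by (simp add: flat_def)
  have s: "smooth_on n (ES n) s"
    unfolding s_def Q_def
    by (intro smooth_on_diff smooth_on_mult smooth_on_const smooth_on_coord smooth_on_sum eopen_ES) auto
  have fbs: "smooth_on n (ES n) (\<lambda>x. flat 0 (u x))" if "smooth_on n (ES n) u" for u
    using that C_k_on_flat[OF eopen_ES] unfolding smooth_on_def by blast
  have "smooth_on n (ES n) \<beta>"
    unfolding \<beta>_def
    by (intro smooth_on_mult smooth_on_inverse smooth_on_add fbs smooth_on_diff smooth_on_const s eopen_ES)
       (use pos in \<open>auto simp: less_imp_neq[symmetric]\<close>)
  moreover have "0 \<le> \<beta> x" "\<beta> x \<le> 1" for x
    using pos[of "s x"] nn by (auto simp: \<beta>_def divide_inverse[symmetric])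
  moreover have "\<beta> x = 1" if "x \<in> ebox n p d" for x
  proof -
    have "(x i - p i) * (x i - p i) \<le> d * d" if "i < n" for i
    proof -
      have "\<bar>x i - p i\<bar> \<le> d" using \<open>x \<in> ebox n p d\<close> that by (auto simp: ebox_def intro: less_imp_le)
      from mult_mono[OF this this] d show ?thesis by (simp add: abs_mult_self_eq)
    qed
    then have "Q x \<le> real n * (d * d)"
      unfolding Q_def using sum_bounded_above[of "{..<n}" "\<lambda>i. (x i - p i) * (x i - p i)" "d * d"] by simp
    also have "\<dots> \<le> e * e / 2"
    proof -
      have "real n * 2 \<le> (2 * (real n + 1)) * (2 * (real n + 1))" by (simp add: algebra_simps)
      moreover have "real n * (d * d) = e * e * (real n / ((2 * (real n + 1)) * (2 * (real n + 1))))"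
        by (simp add: d_def field_simps)
      moreover have "real n / ((2 * (real n + 1)) * (2 * (real n + 1))) \<le> 1 / 2"
        using calculation(1) by (subst divide_le_eq) (auto simp: field_simps)
      ultimately show ?thesis using mult_left_mono[of "real n / ((2 * (real n + 1)) * (2 * (real n + 1)))" "1/2" "e * e"] e by simp
    qed
    finally have "s x \<ge> 1" using e by (simp add: s_def field_simps)
    then show ?thesis using pos[of "s x"] by (simp add: \<beta>_def flat_def)
  qed
  moreover have "\<bar>x i - p i\<bar> \<le> e" if "\<beta> x \<noteq> 0" "i < n" for x i
  proof -
    have "s x > 0" using that(1) by (auto simp: \<beta>_def flat_def split: if_splits)
    then have "Q x \<le> e * e" using e by (simp add: s_def field_simps)
    moreover have "(x i - p i) * (x i - p i) \<le> Q x"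
      unfolding Q_def using that(2) by (intro member_le_sum) auto
    ultimately have "(x i - p i)\<^sup>2 \<le> e\<^sup>2" by (simp add: power2_eq_square)
    then show ?thesis using e by (metis abs_le_square_iff abs_of_pos)
  qed
  ultimately show ?thesis using that d by blast
qed

subsection \<open>Hadamard's lemma\<close>

text \<open>The weight \<open>t ^ m\<close> makes the family closed under differentiation:
  the \<open>i\<close>-th partial derivative of \<open>radial m p f\<close> is \<open>radial (Suc m) p (partial_deriv i f)\<close>.\<close>

definition radial :: "nat \<Rightarrow> (nat \<Rightarrow> real) \<Rightarrow> ((nat \<Rightarrow> real) \<Rightarrow> real) \<Rightarrow> (nat \<Rightarrow> real) \<Rightarrow> real" where
  "radial m p f x = integral {0..1} (\<lambda>t. t ^ m * f (\<lambda>i. p i + t * (x i - p i)))"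

lemma ray_in_ebox:
  assumes "p \<in> ES n" "x \<in> ebox n p e" "0 \<le> t" "t \<le> 1"
  shows "(\<lambda>i. p i + t * (x i - p i)) \<in> ebox n p e"
proof -
  have "\<bar>t * (x i - p i)\<bar> < e" if "i < n" for i
  proof -
    have "\<bar>t * (x i - p i)\<bar> \<le> \<bar>x i - p i\<bar>" using assms(3,4) mult_right_mono[of t 1 "\<bar>x i - p i\<bar>"] by (simp add: abs_mult)
    then show ?thesis using assms(2) that by (force simp: ebox_def)
  qed
  then show ?thesis using assms by (auto simp: ebox_def ES_def)
qed

lemma continuous_on_ray:
  assumes p: "p \<in> ES n" and f: "continuous_on (ebox n p e) f"
  shows "continuous_on (ebox n p e \<times> cbox 0 1) (\<lambda>(x, t). t ^ m * f (\<lambda>i. p i + t * (x i - p i)))"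
proof -
  have "continuous_on (ebox n p e \<times> cbox 0 1) (\<lambda>z. (\<lambda>i. p i + snd z * (fst z i - p i)))"
    by (rule continuous_on_coordinatewise_then_product)
       (intro continuous_intros continuous_on_compose2[OF continuous_on_coord[of UNIV]], auto)
  then have "continuous_on (ebox n p e \<times> cbox 0 1) (\<lambda>z. f (\<lambda>i. p i + snd z * (fst z i - p i)))"
    by (rule continuous_on_compose2[OF f]) (use ray_in_ebox[OF p] in auto)
  then show ?thesis unfolding split_beta by (intro continuous_intros)
qed

lemma C_k_on_radial:
  assumes p: "p \<in> ES n"
  shows "C_k_on n k (ebox n p e) f \<Longrightarrow> C_k_on n k (ebox n p e) (radial m p f)"
proof (induction k arbitrary: f m)
  case 0
  then show ?case
    using integral_continuous_on_param[OF continuous_on_ray[OF p, of e f m]]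
    by (simp add: C_k_on_0_iff[OF eopen_ebox] radial_def[abs_def] del: C_k_on.simps)
next
  case (Suc k)
  note f = Suc.prems[unfolded C_k_on_Suc_iff[OF eopen_ebox]]
  show ?case
  proof (rule C_k_on_SucI[OF eopen_ebox])
    show "continuous_on (ebox n p e) (radial m p f)"
      using integral_continuous_on_param[OF continuous_on_ray[OF p, of e f m]] f
      by (simp add: radial_def[abs_def])
    show "C_k_on n k (ebox n p e) (radial (Suc m) p (partial_deriv i f))" if "i < n" for i
      using Suc.IH f that by blast
    fix i x assume i: "i < n" and x: "x \<in> ebox n p e"
    obtain d where d: "d > 0" "\<And>t. \<bar>t - x i\<bar> < d \<Longrightarrow> x(i := t) \<in> ebox n p e"
      using eopen_upd[OF eopen_ebox x i] by metis
    have xd: "x(i := s) \<in> ebox n p e" if "s \<in> ball (x i) d" for s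
      using d(2)[of s] that by (auto simp: dist_real_def abs_minus_commute)
    \<comment> \<open>\<open>R s t\<close> runs along the ray from \<open>p\<close> to
      \<open>x\<close> with the \<open>i\<close>-th coordinate of \<open>x\<close> moved to
      \<open>s\<close>. Differentiation under the integral needs joint continuity in
      \<open>s\<close> and \<open>t\<close>, which \<open>cR\<close> provides.\<close>
    define R where "R s t = (\<lambda>l. p l + t * ((x(i := s)) l - p l))" for s t
    have Rb: "R s t \<in> ebox n p e" if "s \<in> ball (x i) d" "t \<in> cbox 0 1" for s t
      unfolding R_def using ray_in_ebox[OF p xd[OF that(1)]] that(2) by auto
    have cR: "continuous_on (ball (x i) d \<times> cbox 0 1) (\<lambda>z. g (R (fst z) (snd z)))"
      if "continuous_on (ebox n p e) g" for g
    proof -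
      have "continuous_on (ball (x i) d \<times> cbox 0 1) (\<lambda>z. R (fst z) (snd z))"
        unfolding R_def
      proof (rule continuous_on_coordinatewise_then_product)
        fix l show "continuous_on (ball (x i) d \<times> cbox 0 1) (\<lambda>z. p l + snd z * ((x(i := fst z)) l - p l))"
          by (cases "l = i") (auto intro!: continuous_intros)
      qed
      then show ?thesis by (rule continuous_on_compose2[OF that]) (use Rb in auto)
    qed
    have "((\<lambda>s. integral (cbox 0 1) (\<lambda>t. t ^ m * f (R s t))) has_real_derivative
        integral (cbox 0 1) (\<lambda>t. t ^ Suc m * partial_deriv i f (R (x i) t))) (at (x i) within ball (x i) d)"
    proof (rule leibniz_rule_field_derivative)
      show "((\<lambda>s. t ^ m * f (R s t)) has_real_derivative t ^ Suc m * partial_deriv i f (R s t)) (at s within ball (x i) d)"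
        if s: "s \<in> ball (x i) d" and t: "t \<in> cbox 0 1" for s t
      proof -
        have "((\<lambda>s. f (R s t)) has_real_derivative (\<Sum>j<n. partial_deriv j f (R s t) * (if j = i then t else 0))) (at s within ball (x i) d)"
        proof (rule chain_rule_curve[OF eopen_ebox])
          show "((\<lambda>s. R s t j) has_real_derivative (if j = i then t else 0)) (at s within ball (x i) d)" for j
            by (auto simp: R_def intro!: derivative_eq_intros)
        qed (use f Rb s t C_k_on_continuous[OF eopen_ebox] in blast)+
        also have "(\<Sum>j<n. partial_deriv j f (R s t) * (if j = i then t else 0)) = t * partial_deriv i f (R s t)"
          using i by (simp add: if_distrib sum.delta cong: if_cong)
        finally show ?thesis by (auto intro!: derivative_eq_intros)
      qed
      show "(\<lambda>t. t ^ m * f (R s t)) integrable_on cbox 0 1" if "s \<in> ball (x i) d" for s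
      proof -
        have "continuous_on (cbox 0 1) (\<lambda>t. f (R s t))"
          using f by (intro continuous_on_compose2[OF cR[of f], of _ "\<lambda>t. (s, t)", simplified]) (use that in \<open>auto intro!: continuous_intros\<close>)
        then show ?thesis by (intro integrable_continuous continuous_intros)
      qed
      have "continuous_on (ebox n p e) (partial_deriv i f)" using f i C_k_on_continuous[OF eopen_ebox] by blast
      from cR[OF this] show "continuous_on (ball (x i) d \<times> cbox 0 1) (\<lambda>(s, t). t ^ Suc m * partial_deriv i f (R s t))"
        unfolding split_beta by (intro continuous_intros)
    qed (use d in auto)
    then have "((\<lambda>s. radial m p f (x(i := s))) has_real_derivative radial (Suc m) p (partial_deriv i f) x) (at (x i) within ball (x i) d)"
      by (simp add: radial_def R_def)
    then show "hpd i (radial m p f) (radial (Suc m) p (partial_deriv i f) x) x"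
      unfolding hpd_def using at_within_open[of "x i" "ball (x i) d"] d by simp
  qed
qed

text \<open>Integrate the derivative of \<open>f\<close> along the ray from \<open>p\<close> to
  \<open>x\<close>: then \<open>g j\<close> is the average of \<open>partial_deriv j f\<close> over
  the ray. This expansion later turns a derivation into a combination of its values on
  coordinates.\<close>

lemma hadamard:
  assumes p: "p \<in> ES n" and e: "e > 0" and f: "smooth_on n (ebox n p e) f"
  obtains g where "\<And>j. j < n \<Longrightarrow> smooth_on n (ebox n p e) (g j)"
    "\<And>x. x \<in> ebox n p e \<Longrightarrow> f x = f p + (\<Sum>j<n. (x j - p j) * g j x)"
    "\<And>j. j < n \<Longrightarrow> g j p = partial_deriv j f p"
proof -
  let ?g = "\<lambda>j. radial 0 p (partial_deriv j f)"
  have sm: "smooth_on n (ebox n p e) (partial_deriv j f)" if "j < n" for j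
    by (rule smooth_on_partial_deriv[OF eopen_ebox f that])
  have 1: "smooth_on n (ebox n p e) (?g j)" if "j < n" for j
    using C_k_on_radial[OF p] sm[OF that] unfolding smooth_on_def by blast
  have 2: "f x = f p + (\<Sum>j<n. (x j - p j) * ?g j x)" if x: "x \<in> ebox n p e" for x
  proof -
    define R where "R t = (\<lambda>i. p i + t * (x i - p i))" for t
    have R: "R t \<in> ebox n p e" if "t \<in> {0..1}" for t
      unfolding R_def using ray_in_ebox[OF p x] that by simp
    have "((\<lambda>t. f (R t)) has_real_derivative (\<Sum>j<n. partial_deriv j f (R t) * (x j - p j))) (at t within {0..1})"
      if "t \<in> {0..1}" for t
      by (rule chain_rule_curve[OF eopen_ebox])
         (use R that sm f smooth_on_hpd[OF eopen_ebox] smooth_on_continuous[OF eopen_ebox] in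
           \<open>auto simp: R_def[abs_def] intro!: derivative_eq_intros\<close>)
    then have I: "((\<lambda>t. \<Sum>j<n. partial_deriv j f (R t) * (x j - p j)) has_integral (f (R 1) - f (R 0))) {0..1}"
      by (intro fundamental_theorem_of_calculus) (auto simp: has_real_derivative_iff_has_vector_derivative[symmetric])
    have "((\<lambda>t. partial_deriv j f (R t) * (x j - p j)) has_integral ?g j x * (x j - p j)) {0..1}" if j: "j < n" for j
    proof (rule has_integral_mult_left)
      have "continuous_on {0..1} R" unfolding R_def
        by (rule continuous_on_coordinatewise_then_product) (intro continuous_intros)
      then have "continuous_on {0..1} (\<lambda>t. partial_deriv j f (R t))"
        by (rule continuous_on_compose2[OF smooth_on_continuous[OF eopen_ebox sm[OF j]]]) (use R in auto)
      then have "(\<lambda>t. partial_deriv j f (R t)) integrable_on {0..1}" by (rule integrable_continuous_real)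
      then show "((\<lambda>t. partial_deriv j f (R t)) has_integral ?g j x) {0..1}"
        by (simp add: radial_def R_def[symmetric] integrable_integral)
    qed
    then have "((\<lambda>t. \<Sum>j<n. partial_deriv j f (R t) * (x j - p j)) has_integral (\<Sum>j<n. ?g j x * (x j - p j))) {0..1}"
      by (intro has_integral_sum) auto
    then have "f (R 1) - f (R 0) = (\<Sum>j<n. ?g j x * (x j - p j))" using I has_integral_unique by blast
    then show ?thesis by (simp add: R_def mult.commute)
  qed
  have 3: "?g j p = partial_deriv j f p" if "j < n" for j
    by (simp add: radial_def)
  show ?thesis by (rule that[OF 1 2 3])
qed

section \<open>Implicit functions and local inverses\<close>

text \<open>\<open>G\<close> solves a total differential equation with smooth right-hand side: once
  \<open>G\<close> is of class \<open>k\<close>, so are its derivatives \<open>A l j (G x)\<close>,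
  hence \<open>G\<close> is of class \<open>k + 1\<close>. Used for implicit functions and for
  flows.\<close>

lemma smooth_on_bootstrap:
  assumes T: "eopen r T" and V: "eopen m V" and G: "\<And>x. x \<in> T \<Longrightarrow> G x \<in> V"
    and c: "\<And>j. j < m \<Longrightarrow> continuous_on T (\<lambda>x. G x j)"
    and d: "\<And>x l j. x \<in> T \<Longrightarrow> l < r \<Longrightarrow> j < m \<Longrightarrow> hpd l (\<lambda>x. G x j) (A l j (G x)) x"
    and A: "\<And>l j. l < r \<Longrightarrow> j < m \<Longrightarrow> smooth_on m V (A l j)"
    and "j < m"
  shows "smooth_on r T (\<lambda>x. G x j)"
proof -
  have "\<forall>j<m. C_k_on r k T (\<lambda>x. G x j)" for k
  proof (induction k)
    case 0
    then show ?case using c C_k_on_0_iff[OF T] by blast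
  next
    case (Suc k)
    have "C_k_on r k T (\<lambda>x. A l j (G x))" if "l < r" "j < m" for l j
      by (rule C_k_on_compose[OF V T G smooth_onD[OF A]]) (use that Suc in auto)
    then show ?case using C_k_on_SucI[OF T c d] by blast
  qed
  then show ?thesis using assms(7) unfolding smooth_on_def by blast
qed

text \<open>The map \<open>y \<mapsto> y(i := h y)\<close> inverts
  \<open>x \<mapsto> x(i := u x)\<close> near \<open>p\<close>. Exchanging a single coordinate makes
  this a one-variable problem, solved by strict monotonicity in coordinate \<open>i\<close> and the
  intermediate value theorem.\<close>

lemma implicit_function:
  assumes V: "eopen n V" and u: "smooth_on n V u" and p: "p \<in> V" and i: "i < n"
    and nz: "partial_deriv i u p \<noteq> 0"
  obtains W h where "eopen n W" "p(i := u p) \<in> W" "smooth_on n W h" "h (p(i := u p)) = p i"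
    "\<forall>y\<in>W. y(i := h y) \<in> V" "\<forall>y\<in>W. u (y(i := h y)) = y i"
proof -
  define D where "D j = partial_deriv j u" for j
  have uD: "hpd j u (D j x) x" if "j < n" "x \<in> V" for j x
    unfolding D_def using smooth_on_hpd[OF V u that] .
  have sD: "smooth_on n V (D j)" if "j < n" for j
    unfolding D_def using smooth_on_partial_deriv[OF V u that] .
  \<comment> \<open>The sign that makes \<open>\<sigma> * u\<close> increasing in coordinate
    \<open>i\<close>, so that both signs of the derivative are treated together.\<close>
  define \<sigma> where "\<sigma> = sgn (D i p)"
  have \<sigma>: "\<bar>\<sigma>\<bar> = 1" "\<sigma> * D i p = \<bar>D i p\<bar>" "\<sigma> \<noteq> 0"
    using nz by (auto simp: \<sigma>_def D_def sgn_if)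
  have pE: "p \<in> ES n" using p eopen_subset[OF V] by blast
  obtain e where e: "e > 0" "ebox n p e \<subseteq> V" "\<And>y. y \<in> ebox n p e \<Longrightarrow> \<bar>D i y - D i p\<bar> < \<bar>D i p\<bar>"
    using continuous_on_eboxD[OF V smooth_on_continuous[OF V sD[OF i]] p, of "\<bar>D i p\<bar>"] nz D_def by auto
  have pos: "\<sigma> * D i y > 0" if "y \<in> ebox n p e" for y
    using e(3)[OF that] \<sigma> unfolding \<sigma>_def by (auto simp: sgn_if split: if_splits)
  have seg: "y(i := t) \<in> ebox n p e" if "y(i := s) \<in> ebox n p e" "\<bar>t - p i\<bar> < e" for y s t
    using that i by (auto simp: ebox_def ES_def)
  have mono: "\<sigma> * u (y(i := s)) < \<sigma> * u (y(i := t))" if "y(i := s) \<in> ebox n p e" "y(i := t) \<in> ebox n p e" "s < t" for y s t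
  proof (rule DERIV_pos_imp_increasing[OF \<open>s < t\<close>])
    fix x assume x: "s \<le> x" "x \<le> t"
    have "\<bar>s - p i\<bar> < e" "\<bar>t - p i\<bar> < e" using that i by (auto simp: ebox_def)
    then have yx: "y(i := x) \<in> ebox n p e" using seg[OF that(1), of x] x by linarith
    then have "((\<lambda>t. u (y(i := t))) has_real_derivative D i (y(i := x))) (at x)"
      using uD[OF i, of "y(i := x)"] e(2) hpd_upd by blast
    then have "((\<lambda>t. \<sigma> * u (y(i := t))) has_real_derivative \<sigma> * D i (y(i := x))) (at x)"
      by (rule DERIV_cmult)
    then show "\<exists>y'. ((\<lambda>x. \<sigma> * u (y(i := x))) has_real_derivative y') (at x) \<and> 0 < y'"
      using pos[OF yx] by blast
  qed
  have contu: "continuous_on V u" by (rule smooth_on_continuous[OF V u])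
  \<comment> \<open>The points \<open>q1\<close> and \<open>q2\<close> lie on the coordinate line
    through \<open>p\<close>, on either side of it, and \<open>\<sigma> * u\<close> takes a smaller
    and a larger value there. \<open>\<eta>\<close> is half the smaller gap, so two errors below
    \<open>\<eta>\<close> cannot close it.\<close>
  define a where "a = e / 2"
  define q1 where "q1 = p(i := p i - a)"
  define q2 where "q2 = p(i := p i + a)"
  have pe: "p(i := p i) \<in> ebox n p e" using centre_in_ebox[OF pE e(1)] by simp
  have q: "q1 \<in> ebox n p e" "q2 \<in> ebox n p e"
    unfolding q1_def q2_def using e(1) by (auto intro!: seg[OF pe] simp: a_def)
  have m1: "\<sigma> * u q1 < \<sigma> * u p" using mono[of p "p i - a" "p i"] q pe e(1) by (simp add: q1_def a_def)
  have m2: "\<sigma> * u p < \<sigma> * u q2" using mono[of p "p i" "p i + a"] q pe e(1) by (simp add: q2_def a_def)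
  define \<eta> where "\<eta> = min (\<sigma> * u p - \<sigma> * u q1) (\<sigma> * u q2 - \<sigma> * u p) / 2"
  have \<eta>: "\<eta> > 0" using m1 m2 by (auto simp: \<eta>_def)
  have \<eta>2: "2 * \<eta> \<le> \<sigma> * u p - \<sigma> * u q1" "2 * \<eta> \<le> \<sigma> * u q2 - \<sigma> * u p"
    by (auto simp: \<eta>_def min_def)
  have qV: "q1 \<in> V" "q2 \<in> V" using q e(2) by auto
  obtain d1 where d1: "d1 > 0" "\<And>y. y \<in> ebox n q1 d1 \<Longrightarrow> \<bar>u y - u q1\<bar> < \<eta>"
    using continuous_on_eboxD[OF V contu qV(1) \<eta>] by metis
  obtain d2 where d2: "d2 > 0" "\<And>y. y \<in> ebox n q2 d2 \<Longrightarrow> \<bar>u y - u q2\<bar> < \<eta>"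
    using continuous_on_eboxD[OF V contu qV(2) \<eta>] by metis
  define \<omega> where "\<omega> = min (min d1 d2) (min \<eta> e)"
  define y0 where "y0 = p(i := u p)"
  define W where "W = ebox n y0 \<omega>"
  have \<omega>: "\<omega> > 0" using d1 d2 \<eta> e by (simp add: \<omega>_def)
  have y0W: "y0 \<in> W" unfolding W_def y0_def using pE i \<omega> by (intro centre_in_ebox) auto
  have WE: "W \<subseteq> ES n" by (auto simp: W_def ebox_def)
  have box: "y(i := t) \<in> ebox n p e" if "y \<in> W" "\<bar>t - p i\<bar> < e" for y t
    using that i by (auto simp: W_def y0_def \<omega>_def ebox_def)
  have sol: "\<exists>t. \<bar>t - p i\<bar> < e \<and> u (y(i := t)) = y i" if y: "y \<in> W" for y
  proof -
    have ae: "\<bar>(p i - a) - p i\<bar> < e" "\<bar>(p i + a) - p i\<bar> < e" using e(1) by (auto simp: a_def)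
    have yi: "\<bar>y i - u p\<bar> < \<eta>" using y i by (auto simp: W_def ebox_def y0_def \<omega>_def)
    then have yi': "\<bar>\<sigma> * y i - \<sigma> * u p\<bar> < \<eta>" using \<sigma>(1) by (metis abs_mult mult_1 right_diff_distrib)
    have "y(i := p i - a) \<in> ebox n q1 d1" using y i by (auto simp: W_def y0_def q1_def \<omega>_def ebox_def d1)
    then have "\<bar>\<sigma> * u (y(i := p i - a)) - \<sigma> * u q1\<bar> < \<eta>" using d1(2) \<sigma>(1) by (metis abs_mult mult_1 right_diff_distrib)
    then have l: "\<sigma> * u (y(i := p i - a)) \<le> \<sigma> * y i" using yi' \<eta>2 by linarith
    have "y(i := p i + a) \<in> ebox n q2 d2" using y i by (auto simp: W_def y0_def q2_def \<omega>_def ebox_def d2)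
    then have "\<bar>\<sigma> * u (y(i := p i + a)) - \<sigma> * u q2\<bar> < \<eta>" using d2(2) \<sigma>(1) by (metis abs_mult mult_1 right_diff_distrib)
    then have r: "\<sigma> * y i \<le> \<sigma> * u (y(i := p i + a))" using yi' \<eta>2 by linarith
    have "isCont (\<lambda>t. \<sigma> * u (y(i := t))) x" if "p i - a \<le> x \<and> x \<le> p i + a" for x
    proof -
      have "y(i := x) \<in> V" using box[OF y, of x] that e by (auto simp: a_def)
      then have "((\<lambda>t. u (y(i := t))) has_real_derivative D i (y(i := x))) (at x)"
        using uD[OF i] hpd_upd by blast
      from DERIV_isCont[OF this] show ?thesis by (intro continuous_intros)
    qed
    then obtain t where "p i - a \<le> t" "t \<le> p i + a" "\<sigma> * u (y(i := t)) = \<sigma> * y i"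
      using IVT[of "\<lambda>t. \<sigma> * u (y(i := t))", OF l r] e(1) by (auto simp: a_def)
    then show ?thesis using \<sigma>(3) e(1) by (intro exI[of _ t]) (auto simp: a_def)
  qed
  define h where "h y = (SOME t. \<bar>t - p i\<bar> < e \<and> u (y(i := t)) = y i)" for y
  have h: "\<bar>h y - p i\<bar> < e" "u (y(i := h y)) = y i" if "y \<in> W" for y
    using someI_ex[OF sol[OF that]] by (auto simp: h_def)
  define K where "K y = y(i := h y)" for y
  have KB: "K y \<in> ebox n p e" if "y \<in> W" for y using box[OF that h(1)[OF that]] by (simp add: K_def)
  \<comment> \<open>Comparing \<open>t\<close> with the solution \<open>h y\<close> amounts to
    comparing values of \<open>u\<close>. The value of \<open>h\<close> at the base point and the
    continuity of \<open>h\<close> both follow from this equivalence.\<close>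
  have less: "h y < t \<longleftrightarrow> \<sigma> * y i < \<sigma> * u (y(i := t))" "t < h y \<longleftrightarrow> \<sigma> * u (y(i := t)) < \<sigma> * y i"
    if y: "y \<in> W" and t: "\<bar>t - p i\<bar> < e" for y t
    using mono[of y "h y" t] mono[of y t "h y"] box[OF y] h[OF y] t
    by (cases "h y" t rule: linorder_cases; force)+
  have hp: "h y0 = p i"
  proof -
    have "y0(i := p i) = p" by (simp add: y0_def)
    then show ?thesis using less[OF y0W, of "p i"] e(1) by (simp add: y0_def)
  qed
  have hcont: "continuous_on W h"
  proof (rule continuous_on_eboxI[OF WE])
    fix y and \<epsilon> :: real assume y: "y \<in> W" and \<epsilon>: "\<epsilon> > 0"
    \<comment> \<open>\<open>c\<close> is smaller than \<open>\<epsilon>\<close> and keeps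
      \<open>h y - c\<close> and \<open>h y + c\<close> in the admissible range. The sign conditions
      at these two values are open in \<open>z\<close>, so \<open>h z\<close> is trapped between
      them for \<open>z\<close> near \<open>y\<close>.\<close>
    define c where "c = min (\<epsilon> / 2) ((e - \<bar>h y - p i\<bar>) / 2)"
    have c: "c > 0" "c < \<epsilon>" using h(1)[OF y] \<epsilon> by (auto simp: c_def)
    have "c \<le> (e - \<bar>h y - p i\<bar>) / 2" unfolding c_def by (rule min.cobounded2)
    then have "c < e - \<bar>h y - p i\<bar>" using h(1)[OF y] by (simp add: field_simps)
    then have cm: "\<bar>h y - c - p i\<bar> < e" "\<bar>h y + c - p i\<bar> < e" using c(1) by (smt (verit))+
    have cont: "continuous_on W (\<lambda>z. \<sigma> * u (z(i := t)) - \<sigma> * z i)" if "\<bar>t - p i\<bar> < e" for t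
    proof -
      have "continuous_on W (\<lambda>z. z(i := t))"
      proof (rule continuous_on_coordinatewise_then_product)
        fix l show "continuous_on W (\<lambda>z. (z(i := t)) l)"
          by (cases "l = i") (auto intro!: continuous_intros)
      qed
      then have "continuous_on W (\<lambda>z. u (z(i := t)))"
        by (rule continuous_on_compose2[OF contu]) (use box[OF _ that] e(2) in auto)
      then show ?thesis by (intro continuous_intros)
    qed
    have n: "\<sigma> * u (y(i := h y - c)) - \<sigma> * y i < 0" "0 < \<sigma> * u (y(i := h y + c)) - \<sigma> * y i"
      using less(2)[OF y cm(1)] less(1)[OF y cm(2)] c(1) by auto
    have oW: "eopen n W" unfolding W_def by (rule eopen_ebox)
    obtain b1 where b1: "b1 > 0" "ebox n y b1 \<subseteq> W" "\<And>z. z \<in> ebox n y b1 \<Longrightarrow> \<sigma> * u (z(i := h y - c)) - \<sigma> * z i < 0"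
      using continuous_on_eboxD[OF oW cont[OF cm(1)] y, of "- (\<sigma> * u (y(i := h y - c)) - \<sigma> * y i)"] n(1) by (smt (verit))
    obtain b2 where b2: "b2 > 0" "ebox n y b2 \<subseteq> W" "\<And>z. z \<in> ebox n y b2 \<Longrightarrow> \<sigma> * u (z(i := h y + c)) - \<sigma> * z i > 0"
      using continuous_on_eboxD[OF oW cont[OF cm(2)] y, of "(\<sigma> * u (y(i := h y + c)) - \<sigma> * y i)"] n(2) by (smt (verit))
    have "\<bar>h z - h y\<bar> < \<epsilon>" if z: "z \<in> W" "z \<in> ebox n y (min b1 b2)" for z
    proof -
      have "z \<in> ebox n y b1" "z \<in> ebox n y b2" using z(2) by (auto simp: ebox_def)
      then show ?thesis using b1(3) b2(3) less(2)[OF z(1) cm(1)] less(1)[OF z(1) cm(2)] c by fastforce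
    qed
    then show "\<exists>d>0. \<forall>z\<in>W \<inter> ebox n y d. \<bar>h z - h y\<bar> < \<epsilon>"
      using b1(1) b2(1) by (intro exI[of _ "min b1 b2"]) auto
  qed
  have Wo: "eopen n W" unfolding W_def by (rule eopen_ebox)
  \<comment> \<open>The Jacobian matrix of \<open>y \<mapsto> y(i := h y)\<close> as a function of
    the image point, read off by differentiating \<open>u (y(i := h y)) = y i\<close>.\<close>
  define A where "A j l z = (if l = i then (if j = i then 1 else - D j z) * inverse (D i z) else if l = j then 1 else 0)" for j l z
  have hder: "hpd j h (A j i (K y)) y" if y: "y \<in> W" and j: "j < n" for y j
  proof -
    define x where "x = K y"
    have xV: "x \<in> V" using KB[OF y] e(2) by (auto simp: x_def)
    obtain e' qq where e': "e' > 0" and qq: "\<forall>z\<in>ebox n x e'. u z - u x = (\<Sum>l<n. qq l z * (z l - x l))"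
      "\<forall>l<n. \<forall>\<beta> F. (\<forall>d>0. eventually (\<lambda>t. \<beta> t \<in> ebox n x d) F) \<longrightarrow> ((\<lambda>t::real. qq l (\<beta> t)) \<longlongrightarrow> D l x) F"
      by (rule difference_slopes[where f = u and g = D, OF V uD smooth_on_continuous[OF V sD] xV])
    define \<beta> where "\<beta> s = K (y(j := s))" for s
    obtain c where c: "c > 0" "\<And>t. \<bar>t - y j\<bar> < c \<Longrightarrow> y(j := t) \<in> W" using eopen_upd[OF Wo y j] by metis
    have evW: "eventually (\<lambda>s. y(j := s) \<in> W) (at (y j))"
      using c unfolding eventually_at by (auto simp: dist_real_def intro!: exI[of _ c])
    have hcon: "((\<lambda>s. h (y(j := s))) \<longlongrightarrow> h y) (at (y j))"
    proof (rule tendstoI)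
      fix \<epsilon> :: real assume "\<epsilon> > 0"
      then obtain b where b: "b > 0" "\<And>z. z \<in> ebox n y b \<Longrightarrow> \<bar>h z - h y\<bar> < \<epsilon>"
        using continuous_on_eboxD[OF Wo hcont y] by metis
      have "y(j := s) \<in> ebox n y b" if "\<bar>s - y j\<bar> < b" for s
        using that y WE j b(1) by (auto simp: ebox_def)
      then show "eventually (\<lambda>s. dist (h (y(j := s))) (h y) < \<epsilon>) (at (y j))"
        using b unfolding eventually_at by (auto simp: dist_real_def intro!: exI[of _ b])
    qed
    have evbox: "eventually (\<lambda>s. \<beta> s \<in> ebox n x d) (at (y j))" if "d > 0" for d
    proof (rule eventually_in_ebox[OF _ _ that])
      show "((\<lambda>s. \<beta> s l) \<longlongrightarrow> x l) (at (y j))" if "l < n" for l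
        using hcon by (cases "l = i"; cases "l = j") (auto simp: \<beta>_def x_def K_def)
      show "eventually (\<lambda>s. \<beta> s \<in> ES n) (at (y j))"
        using evW by eventually_elim (use KB in \<open>auto simp: \<beta>_def ebox_def\<close>)
    qed
    have lim: "((\<lambda>s. qq l (\<beta> s)) \<longlongrightarrow> D l x) (at (y j))" if "l < n" for l
      using qq(2) that evbox by blast
    have Dx: "D i x \<noteq> 0" using pos[OF KB[OF y]] by (auto simp: x_def)
    have evnz: "eventually (\<lambda>s. qq i (\<beta> s) \<noteq> 0) (at (y j))"
      using tendsto_imp_eventually_ne[OF lim[OF i] Dx] .
    have "((\<lambda>s. (if j = i then 1 else - qq j (\<beta> s)) * inverse (qq i (\<beta> s))) \<longlongrightarrow> A j i x) (at (y j))"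
    proof -
      have "((\<lambda>s. (if j = i then 1 else - qq j (\<beta> s))) \<longlongrightarrow> (if j = i then 1 else - D j x)) (at (y j))"
        using lim[OF j] by (auto intro: tendsto_minus)
      from tendsto_mult[OF this tendsto_inverse[OF lim[OF i] Dx]] show ?thesis
        by (simp only: A_def refl if_True)
    qed
    moreover have "eventually (\<lambda>s. (if j = i then 1 else - qq j (\<beta> s)) * inverse (qq i (\<beta> s)) = (h (y(j := s)) - h y) / (s - y j)) (at (y j))"
    proof -
      have "eventually (\<lambda>s. s \<noteq> y j) (at (y j))" by (simp add: eventually_at_filter)
      then show ?thesis using evW evnz evbox[OF e']
      proof eventually_elim
        case (elim s)
        have 1: "u (\<beta> s) - u x = (y(j := s)) i - y i"
          unfolding \<beta>_def x_def K_def using h(2)[OF elim(2)] h(2)[OF y] by simp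
        have 2: "u (\<beta> s) - u x = (\<Sum>l<n. qq l (\<beta> s) * (\<beta> s l - x l))" by (rule qq(1)[rule_format, OF elim(4)])
        \<comment> \<open>The points \<open>\<beta> s\<close> and \<open>x\<close> differ only in
          the coordinates \<open>i\<close> and \<open>j\<close>, so at most two slopes survive and
          the difference quotient of \<open>h\<close> can be solved for.\<close>
        have 3: "(\<Sum>l<n. qq l (\<beta> s) * (\<beta> s l - x l)) = (\<Sum>l\<in>{i, j}. qq l (\<beta> s) * (\<beta> s l - x l))"
          by (rule sum.mono_neutral_right) (use i j in \<open>auto simp: \<beta>_def x_def K_def\<close>)
        have 4: "\<beta> s i - x i = h (y(j := s)) - h y" "j \<noteq> i \<Longrightarrow> \<beta> s j - x j = s - y j"
          by (auto simp: \<beta>_def x_def K_def)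
        show ?case
        proof (cases "j = i")
          case True
          then have "qq i (\<beta> s) * (h (y(j := s)) - h y) = s - y j" using 1 2 3 4(1) by simp
          then have "h (y(j := s)) - h y = (s - y j) * inverse (qq i (\<beta> s))" using elim(3) by (simp add: field_simps)
          then show ?thesis using True elim(1) by simp
        next
          case False
          then have "qq i (\<beta> s) * (h (y(j := s)) - h y) + qq j (\<beta> s) * (s - y j) = 0" using 1 2 3 4 by simp
          then have "qq i (\<beta> s) * (h (y(j := s)) - h y) = - qq j (\<beta> s) * (s - y j)" by simp
          then have "h (y(j := s)) - h y = (- qq j (\<beta> s) * inverse (qq i (\<beta> s))) * (s - y j)" using elim(3) by (simp add: field_simps)
          then show ?thesis using False elim(1) by simp
        qed
      qed
    qed
    ultimately have "((\<lambda>s. (h (y(j := s)) - h y) / (s - y j)) \<longlongrightarrow> A j i x) (at (y j))"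
      by (rule Lim_transform_eventually)
    then show ?thesis by (simp add: hpd_def has_field_derivative_iff x_def)
  qed
  have "smooth_on n W (\<lambda>y. K y i)"
  proof (rule smooth_on_bootstrap[OF Wo eopen_ebox KB, where A = A])
    show "continuous_on W (\<lambda>y. K y j)" for j
      using hcont by (cases "j = i") (auto simp: K_def intro!: continuous_intros)
    show "hpd l (\<lambda>y. K y j) (A l j (K y)) y" if "y \<in> W" "l < n" "j < n" for y l j
      using hder[OF that(1,2)] hpd_coord[of l j y] by (cases "j = i") (auto simp: K_def A_def)
    show "smooth_on n (ebox n p e) (A l j)" if "l < n" "j < n" for l j
    proof -
      have s: "smooth_on n (ebox n p e) (D l)" if "l < n" for l
        by (rule smooth_on_subset[OF V eopen_ebox e(2) sD[OF that]])
      have "smooth_on n (ebox n p e) (\<lambda>z. inverse (D i z))"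
        by (rule smooth_on_inverse[OF eopen_ebox _ s[OF i]]) (use pos in fastforce)
      moreover have "smooth_on n (ebox n p e) (\<lambda>z. (if l = i then 1 else - D l z))"
        using smooth_on_mult[OF eopen_ebox smooth_on_const[OF eopen_ebox, of n p e "-1"] s[OF that(1)]]
          smooth_on_const[OF eopen_ebox] by (cases "l = i") auto
      ultimately have "smooth_on n (ebox n p e) (\<lambda>z. (if l = i then 1 else - D l z) * inverse (D i z))"
        using smooth_on_mult[OF eopen_ebox] by blast
      then show ?thesis
        unfolding A_def[abs_def] using smooth_on_const[OF eopen_ebox]
        by (cases "j = i"; cases "j = l") (simp_all only: if_True if_False simp_thms)
    qed
  qed (use i in auto)
  then have "smooth_on n W h" by (simp add: K_def)
  then show ?thesis
    using that[OF Wo, of h] y0W hp box[OF _ h(1)] e(2) h(2) unfolding y0_def by blast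
qed

text \<open>Values lie in \<open>V\<close> and hence in \<open>ES n\<close>, so their coordinates
  from \<open>n\<close> on vanish and only those with \<open>j < n\<close> carry a smoothness
  condition.\<close>

definition smooth_mapping :: "nat \<Rightarrow> (nat \<Rightarrow> real) set \<Rightarrow> nat \<Rightarrow> (nat \<Rightarrow> real) set \<Rightarrow> ((nat \<Rightarrow> real) \<Rightarrow> nat \<Rightarrow> real) \<Rightarrow> bool" where
  "smooth_mapping m W n V G \<longleftrightarrow> eopen m W \<and> eopen n V \<and> G ` W \<subseteq> V \<and> (\<forall>j<n. smooth_on m W (\<lambda>x. G x j))"

lemma smooth_mapping_continuous:
  assumes "smooth_mapping m W n V G"
  shows "continuous_on W G"
proof (rule continuous_on_into_ES[of n])
  show "continuous_on W (\<lambda>x. G x j)" if "j < n" for j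
    using assms that smooth_on_continuous unfolding smooth_mapping_def by blast
  show "G x \<in> ES n" if "x \<in> W" for x
    using assms that eopen_subset unfolding smooth_mapping_def by blast
qed

lemma eopen_preimage:
  assumes W: "eopen m W" and G: "continuous_on W G" and V: "eopen n V" and GE: "G ` W \<subseteq> ES n"
  shows "eopen m {x \<in> W. G x \<in> V}"
proof -
  obtain U where U: "open U" "V = ES n \<inter> U" using V unfolding eopen_open by blast
  obtain B where B: "open B" "B \<inter> W = G -` U \<inter> W"
    using G U(1) unfolding continuous_on_open_invariant by blast
  obtain A where A: "open A" "W = ES m \<inter> A" using W unfolding eopen_open by blast
  have "{x \<in> W. G x \<in> V} = ES m \<inter> (A \<inter> B)" using U(2) B(2) A(2) GE by blast
  then show ?thesis unfolding eopen_open using A(1) B(1) by blast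
qed

lemma smooth_on_compose_mapping:
  "smooth_mapping m W n V G \<Longrightarrow> smooth_on n V f \<Longrightarrow> smooth_on m W (\<lambda>x. f (G x))"
  unfolding smooth_mapping_def by (rule smooth_on_compose[of n V]) auto

lemma smooth_mapping_compose:
  assumes "smooth_mapping m W n V G" "smooth_mapping n V l U F"
  shows "smooth_mapping m W l U (\<lambda>x. F (G x))"
  using assms smooth_on_compose_mapping[OF assms(1), of "\<lambda>x. F x j" for j]
  unfolding smooth_mapping_def image_subset_iff by blast

lemma partial_deriv_compose_mapping:
  "smooth_mapping m W n V G \<Longrightarrow> smooth_on n V f \<Longrightarrow> x \<in> W \<Longrightarrow> i < m \<Longrightarrow>
   partial_deriv i (\<lambda>x. f (G x)) x = (\<Sum>j<n. partial_deriv j f (G x) * partial_deriv i (\<lambda>x. G x j) x)"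
  unfolding smooth_mapping_def by (rule partial_deriv_compose[of n V m W]) auto

text \<open>The equations \<open>u l x = y (\<iota> l)\<close> are solved one at a time, each time for a coordinate that
  has not been used before; the vectors \<open>v l\<close> dual to the differentials guarantee that there is one.\<close>

lemma local_right_inverse:
  assumes V: "eopen c V" and p: "p \<in> V" and u: "\<And>k. k < n \<Longrightarrow> smooth_on c V (u k)"
    and v: "\<And>k l. k < n \<Longrightarrow> l < n \<Longrightarrow> (\<Sum>i<c. v l i * partial_deriv i (u k) p) = (if k = l then 1 else 0)"
  obtains W s where "smooth_mapping n W c V s" "(\<lambda>k. if k < n then u k p else 0) \<in> W"
    "s (\<lambda>k. if k < n then u k p else 0) = p" "\<forall>y\<in>W. \<forall>k<n. u k (s y) = y k"
proof -
  \<comment> \<open>Invariant: \<open>\<kappa>\<close> is a parametrisation in which the first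
    \<open>k\<close> functions \<open>u l\<close> have become the coordinates
    \<open>\<iota> l\<close>. The last conjunct says that its derivative at \<open>t0\<close> is
    onto, so that \<open>v k\<close> can be rewritten in the new coordinates.\<close>
  have "\<exists>T t0 \<kappa> \<iota>. smooth_mapping c T c V \<kappa> \<and> t0 \<in> T \<and> \<kappa> t0 = p \<and> inj_on \<iota> {..<k} \<and> \<iota> ` {..<k} \<subseteq> {..<c} \<and>
      (\<forall>l<k. \<forall>y\<in>T. u l (\<kappa> y) = y (\<iota> l)) \<and>
      (\<forall>z. \<exists>w. \<forall>j<c. z j = (\<Sum>i<c. w i * partial_deriv i (\<lambda>y. \<kappa> y j) t0))" if "k \<le> n" for k
    using that
  proof (induction k)
    case 0
    have "\<exists>w. \<forall>j<c. z j = (\<Sum>i<c. w i * partial_deriv i (\<lambda>y. y j) p)" for z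
      by (rule exI[of _ z]) (simp add: hpd_partial_deriv[OF hpd_coord] if_distrib sum.delta cong: if_cong)
    moreover have "smooth_mapping c V c V (\<lambda>x. x)"
      using V smooth_on_coord by (auto simp: smooth_mapping_def)
    ultimately show ?case using p by (intro exI[of _ V] exI[of _ p] exI[of _ "\<lambda>x. x"]) auto
  next
    case (Suc k)
    then obtain T t0 \<kappa> \<iota> where I: "smooth_mapping c T c V \<kappa>" "t0 \<in> T" "\<kappa> t0 = p" "inj_on \<iota> {..<k}" "\<iota> ` {..<k} \<subseteq> {..<c}"
      and eq: "\<forall>l<k. \<forall>y\<in>T. u l (\<kappa> y) = y (\<iota> l)"
      and sur: "\<forall>z. \<exists>w. \<forall>j<c. z j = (\<Sum>i<c. w i * partial_deriv i (\<lambda>y. \<kappa> y j) t0)"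
      by fastforce
    have T: "eopen c T" using I(1) by (simp add: smooth_mapping_def)
    have k: "k < n" using Suc.prems by simp
    obtain w where w: "\<And>j. j < c \<Longrightarrow> v k j = (\<Sum>i<c. w i * partial_deriv i (\<lambda>y. \<kappa> y j) t0)" using sur by metis
    have wu: "(\<Sum>i<c. w i * partial_deriv i (\<lambda>y. u l (\<kappa> y)) t0) = (if l = k then 1 else 0)" if l: "l < n" for l
    proof -
      have "(\<Sum>i<c. w i * partial_deriv i (\<lambda>y. u l (\<kappa> y)) t0)
        = (\<Sum>i<c. \<Sum>j<c. w i * (partial_deriv j (u l) p * partial_deriv i (\<lambda>y. \<kappa> y j) t0))"
        using partial_deriv_compose_mapping[OF I(1) u[OF l] I(2)] I(3) by (simp add: sum_distrib_left)
      also have "\<dots> = (\<Sum>j<c. \<Sum>i<c. w i * (partial_deriv j (u l) p * partial_deriv i (\<lambda>y. \<kappa> y j) t0))"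
        by (rule sum.swap)
      also have "\<dots> = (\<Sum>j<c. v k j * partial_deriv j (u l) p)"
        by (intro sum.cong) (auto simp: w sum_distrib_right sum_distrib_left mult_ac)
      finally show ?thesis using v[OF l k] by simp
    qed
    have "w (\<iota> l) = 0" if l: "l < k" for l
    proof -
      have il: "\<iota> l < c" using I(5) l by auto
      have "partial_deriv i (\<lambda>y. u l (\<kappa> y)) t0 = (if i = \<iota> l then 1 else 0)" if "i < c" for i
        using partial_deriv_cong[OF T I(2) that, of "\<lambda>y. u l (\<kappa> y)" "\<lambda>y. y (\<iota> l)"] eq l
        by (simp add: hpd_partial_deriv[OF hpd_coord])
      then have "(\<Sum>i<c. w i * partial_deriv i (\<lambda>y. u l (\<kappa> y)) t0) = (\<Sum>i<c. if i = \<iota> l then w i else 0)"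
        by (intro sum.cong) auto
      also have "\<dots> = w (\<iota> l)" using il by simp
      finally show ?thesis using wu[of l] l k by simp
    qed
    moreover have "\<exists>i<c. w i * partial_deriv i (\<lambda>y. u k (\<kappa> y)) t0 \<noteq> 0"
      using wu[OF k] sum.neutral[of "{..<c}" "\<lambda>i. w i * partial_deriv i (\<lambda>y. u k (\<kappa> y)) t0"] by auto
    ultimately obtain i where i: "i < c" "partial_deriv i (\<lambda>y. u k (\<kappa> y)) t0 \<noteq> 0" "i \<notin> \<iota> ` {..<k}"
      by fastforce
    let ?U = "\<lambda>y. u k (\<kappa> y)"
    have sU: "smooth_on c T ?U" by (rule smooth_on_compose_mapping[OF I(1) u[OF k]])
    define y0 where "y0 = t0(i := ?U t0)"
    obtain W h where W: "eopen c W" "y0 \<in> W" and h: "smooth_on c W h" "h y0 = t0 i"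
      and hT: "\<forall>y\<in>W. y(i := h y) \<in> T" and hU: "\<forall>y\<in>W. ?U (y(i := h y)) = y i"
      unfolding y0_def by (rule implicit_function[OF T sU I(2) i(1,2)])
    define K where "K y = y(i := h y)" for y
    have K: "smooth_mapping c W c T K"
      unfolding smooth_mapping_def
    proof (intro conjI allI impI)
      show "smooth_on c W (\<lambda>x. K x j)" for j
        using h(1) smooth_on_coord[OF W(1)] by (cases "j = i") (simp_all add: K_def)
    qed (use hT W(1) T in \<open>auto simp: K_def\<close>)
    have K0: "K y0 = t0" by (simp add: K_def y0_def h(2)[unfolded y0_def])
    define H where "H j = partial_deriv j h y0" for j
    have dK: "partial_deriv j (\<lambda>y. K y l) y0 = (if l = i then H j else if j = l then 1 else 0)" for j l
      by (cases "l = i") (simp_all add: K_def H_def hpd_partial_deriv[OF hpd_coord])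
    have "1 = partial_deriv i (\<lambda>y. ?U (K y)) y0"
      using partial_deriv_cong[OF W i(1), of "\<lambda>y. ?U (K y)" "\<lambda>y. y i"] hU
      by (simp add: K_def hpd_partial_deriv[OF hpd_coord])
    also have "\<dots> = (\<Sum>l<c. partial_deriv l ?U t0 * partial_deriv i (\<lambda>y. K y l) y0)"
      using partial_deriv_compose_mapping[OF K sU W(2) i(1)] K0 by simp
    also have "\<dots> = (\<Sum>l<c. if l = i then partial_deriv i ?U t0 * H i else 0)"
      unfolding dK by (intro sum.cong) auto
    finally have Hi: "H i \<noteq> 0" using i(1) by auto
    have surK: "\<exists>w'. \<forall>l<c. x l = (\<Sum>j<c. w' j * partial_deriv j (\<lambda>y. K y l) y0)" for x
    proof (intro exI allI impI)
      \<comment> \<open>The derivative of \<open>K\<close> differs from the identity only in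
        component \<open>i\<close>: keep the other coefficients of \<open>x\<close> and solve the
        \<open>i\<close>-th equation, where \<open>H i\<close> is non-zero.\<close>
      define w' where "w' j = (if j = i then (x i - (\<Sum>j\<in>{..<c} - {i}. x j * H j)) / H i else x j)" for j
      fix l assume l: "l < c"
      show "x l = (\<Sum>j<c. w' j * partial_deriv j (\<lambda>y. K y l) y0)"
      proof (cases "l = i")
        case True
        have "(\<Sum>j<c. w' j * H j) = w' i * H i + (\<Sum>j\<in>{..<c} - {i}. w' j * H j)"
          using i(1) by (subst sum.remove[of _ i]) auto
        also have "(\<Sum>j\<in>{..<c} - {i}. w' j * H j) = (\<Sum>j\<in>{..<c} - {i}. x j * H j)"
          by (intro sum.cong) (auto simp: w'_def)
        finally show ?thesis unfolding dK using True Hi by (simp add: w'_def)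
      next
        case False
        then have "(\<Sum>j<c. w' j * partial_deriv j (\<lambda>y. K y l) y0) = (\<Sum>j<c. if j = l then w' l else 0)"
          unfolding dK by (intro sum.cong) auto
        then show ?thesis using l False by (simp add: w'_def)
      qed
    qed
    have "\<forall>z. \<exists>w. \<forall>j<c. z j = (\<Sum>l<c. w l * partial_deriv l (\<lambda>y. \<kappa> (K y) j) y0)"
    proof
      fix z
      obtain x where x: "\<forall>j<c. z j = (\<Sum>l<c. x l * partial_deriv l (\<lambda>y. \<kappa> y j) t0)" using sur by blast
      obtain w' where w': "\<forall>l<c. x l = (\<Sum>j<c. w' j * partial_deriv j (\<lambda>y. K y l) y0)" using surK by blast
      have "z j = (\<Sum>m<c. w' m * partial_deriv m (\<lambda>y. \<kappa> (K y) j) y0)" if j: "j < c" for j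
      proof -
        have s: "smooth_on c T (\<lambda>y. \<kappa> y j)" using I(1) j by (simp add: smooth_mapping_def)
        have "(\<Sum>m<c. w' m * partial_deriv m (\<lambda>y. \<kappa> (K y) j) y0)
          = (\<Sum>m<c. \<Sum>l<c. w' m * (partial_deriv l (\<lambda>y. \<kappa> y j) t0 * partial_deriv m (\<lambda>y. K y l) y0))"
          using partial_deriv_compose_mapping[OF K s W(2)] K0 by (simp add: sum_distrib_left)
        also have "\<dots> = (\<Sum>l<c. \<Sum>m<c. w' m * (partial_deriv l (\<lambda>y. \<kappa> y j) t0 * partial_deriv m (\<lambda>y. K y l) y0))"
          by (rule sum.swap)
        also have "\<dots> = (\<Sum>l<c. x l * partial_deriv l (\<lambda>y. \<kappa> y j) t0)"
          by (intro sum.cong) (auto simp: w' sum_distrib_left sum_distrib_right mult_ac)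
        finally show ?thesis using x j by simp
      qed
      then show "\<exists>w. \<forall>j<c. z j = (\<Sum>l<c. w l * partial_deriv l (\<lambda>y. \<kappa> (K y) j) y0)" by blast
    qed
    moreover have "inj_on (\<iota>(k := i)) {..<Suc k}" "(\<iota>(k := i)) ` {..<Suc k} \<subseteq> {..<c}"
      using I(4,5) i(1,3) by (auto simp: inj_on_def less_Suc_eq image_subset_iff)
    moreover have "\<forall>l<Suc k. \<forall>y\<in>W. u l (\<kappa> (K y)) = y ((\<iota>(k := i)) l)"
    proof (intro allI ballI impI)
      fix l y assume l: "l < Suc k" and y: "y \<in> W"
      show "u l (\<kappa> (K y)) = y ((\<iota>(k := i)) l)"
      proof (cases "l = k")
        case False
        then have "l < k" using l by simp
        moreover have "\<iota> l \<noteq> i" using i(3) \<open>l < k\<close> by auto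
        ultimately show ?thesis using eq hT y by (simp add: K_def)
      qed (use hU y in \<open>simp add: K_def\<close>)
    qed
    moreover have "smooth_mapping c W c V (\<lambda>y. \<kappa> (K y))" "\<kappa> (K y0) = p"
      using smooth_mapping_compose[OF K I(1)] K0 I(3) by auto
    ultimately show ?case using W(2)
      by (intro exI[of _ W] exI[of _ y0] exI[of _ "\<lambda>y. \<kappa> (K y)"] exI[of _ "\<iota>(k := i)"] conjI) assumption+
  qed
  from this[OF order_refl] obtain T t0 \<kappa> \<iota> where I: "smooth_mapping c T c V \<kappa>" "t0 \<in> T" "\<kappa> t0 = p" "inj_on \<iota> {..<n}" "\<iota> ` {..<n} \<subseteq> {..<c}"
      and eq: "\<forall>l<n. \<forall>y\<in>T. u l (\<kappa> y) = y (\<iota> l)" by blast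
  define y0 where "y0 = (\<lambda>k. if k < n then u k p else 0)"
  \<comment> \<open>Used coordinates receive the parameters \<open>y\<close>, the remaining ones are
    frozen at their value in \<open>t0\<close>. This cuts the parametrisation down to a right
    inverse.\<close>
  define E where "E y = (\<lambda>i. if i \<in> \<iota> ` {..<n} then y (the_inv_into {..<n} \<iota> i) else t0 i)" for y
  have E\<iota>: "E y (\<iota> l) = y l" if "l < n" for y l
    using that I(4) by (simp add: E_def the_inv_into_f_f)
  have T: "eopen c T" using I(1) by (simp add: smooth_mapping_def)
  have t0E: "t0 \<in> ES c" using I(2) eopen_subset[OF T] by blast
  have EE: "E y \<in> ES c" for y using I(5) t0E by (auto simp: E_def ES_def)
  have Es: "smooth_on n (ES n) (\<lambda>y. E y j)" for j
    by (cases "j \<in> \<iota> ` {..<n}") (simp_all add: E_def smooth_on_coord smooth_on_const eopen_ES)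
  define W where "W = {y \<in> ES n. E y \<in> T}"
  have "continuous_on (ES n) E"
    by (rule continuous_on_coordinatewise_then_product) (rule smooth_on_continuous[OF eopen_ES Es])
  then have W: "eopen n W" unfolding W_def by (rule eopen_preimage[OF eopen_ES _ T]) (use EE in auto)
  have "E y0 = t0"
  proof
    fix i show "E y0 i = t0 i"
    proof (cases "i \<in> \<iota> ` {..<n}")
      case True
      then obtain l where l: "l < n" "i = \<iota> l" by auto
      then have "E y0 i = y0 l" using E\<iota> by simp
      also have "\<dots> = u l (\<kappa> t0)" using l I(3) by (simp add: y0_def)
      also have "\<dots> = t0 i" using eq l I(2) by blast
      finally show ?thesis .
    qed (simp add: E_def)
  qed
  have EM: "smooth_mapping n W c T E"
    unfolding smooth_mapping_def using W T smooth_on_subset[OF eopen_ES W _ Es] by (auto simp: W_def)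
  show ?thesis
  proof (rule that)
    show "smooth_mapping n W c V (\<lambda>y. \<kappa> (E y))" by (rule smooth_mapping_compose[OF EM I(1)])
    show "(\<lambda>k. if k < n then u k p else 0) \<in> W"
      using \<open>E y0 = t0\<close> I(2) unfolding W_def y0_def by (auto simp: ES_def)
    show "\<kappa> (E (\<lambda>k. if k < n then u k p else 0)) = p"
      using \<open>E y0 = t0\<close> I(3) unfolding y0_def by simp
    show "\<forall>y\<in>W. \<forall>k<n. u k (\<kappa> (E y)) = y k"
      using eq E\<iota> by (auto simp: W_def)
  qed
qed

section \<open>Left inverses of injective matrices and of immersions\<close>

lemma injective_matrix_left_inverse:
  fixes a :: "nat \<Rightarrow> nat \<Rightarrow> real"
  assumes "\<And>c. (\<And>j. j < m \<Longrightarrow> (\<Sum>i<s. a j i * c i) = 0) \<Longrightarrow> (\<forall>i<s. c i = 0)"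
  shows "\<exists>B. \<forall>k<s. \<forall>i<s. (\<Sum>j<m. B k j * a j i) = (if k = i then 1 else 0)"
  using assms
proof (induction s)
  case (Suc s)
  have "\<forall>i<s. c i = 0" if c: "\<And>j. j < m \<Longrightarrow> (\<Sum>i<s. a j i * c i) = 0" for c
  proof -
    have "\<forall>i<Suc s. (c(s := 0)) i = 0"
      by (rule Suc.prems) (simp add: c)
    then show ?thesis by (metis fun_upd_other less_SucI nat_neq_iff)
  qed
  then obtain B where B: "\<And>k i. k < s \<Longrightarrow> i < s \<Longrightarrow> (\<Sum>j<m. B k j * a j i) = (if k = i then 1 else 0)"
    using Suc.IH by blast
  \<comment> \<open>\<open>r\<close> is what remains of the new column after subtracting the
    combination of the earlier columns predicted by \<open>B\<close>. If it were 0, the coefficients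
    \<open>b\<close> followed by -1 would lie in the kernel.\<close>
  define b where "b l = (\<Sum>j<m. B l j * a j s)" for l
  define r where "r j = a j s - (\<Sum>i<s. a j i * b i)" for j
  have "\<exists>j<m. r j \<noteq> 0"
  proof (rule ccontr)
    assume "\<not> ?thesis"
    then have "\<forall>i<Suc s. (\<lambda>i. if i = s then -1 else b i) i = 0"
      by (intro Suc.prems) (auto simp: r_def)
    then show False by auto
  qed
  then obtain j0 where j0: "j0 < m" "r j0 \<noteq> 0" by blast
  \<comment> \<open>The \<open>j0\<close>-th component of the residual, scaled to be 1 on the new
    column; it vanishes on all earlier columns.\<close>
  define \<beta> where "\<beta> j = ((if j = j0 then 1 else 0) - (\<Sum>i<s. a j0 i * B i j)) / r j0" for j
  have \<beta>: "(\<Sum>j<m. \<beta> j * x j) = (x j0 - (\<Sum>i<s. a j0 i * (\<Sum>j<m. B i j * x j))) / r j0" for x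
  proof -
    have "(\<Sum>j<m. \<beta> j * x j) = (\<Sum>j<m. (if j = j0 then x j else 0) - (\<Sum>i<s. a j0 i * (B i j * x j))) / r j0"
    proof -
      have "\<beta> j * x j = ((if j = j0 then x j else 0) - (\<Sum>i<s. a j0 i * (B i j * x j))) / r j0" for j
        by (cases "j = j0") (simp_all add: \<beta>_def left_diff_distrib sum_distrib_right mult.assoc)
      then show ?thesis by (simp add: sum_divide_distrib)
    qed
    also have "(\<Sum>j<m. (if j = j0 then x j else 0) - (\<Sum>i<s. a j0 i * (B i j * x j))) = x j0 - (\<Sum>j<m. \<Sum>i<s. a j0 i * (B i j * x j))"
      using j0(1) by (simp add: sum_subtractf)
    also have "(\<Sum>j<m. \<Sum>i<s. a j0 i * (B i j * x j)) = (\<Sum>i<s. a j0 i * (\<Sum>j<m. B i j * x j))"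
      by (subst sum.swap) (simp add: sum_distrib_left)
    finally show ?thesis .
  qed
  have \<beta>0: "(\<Sum>j<m. \<beta> j * a j i) = 0" if "i < s" for i
  proof -
    have "(\<Sum>l<s. a j0 l * (\<Sum>j<m. B l j * a j i)) = (\<Sum>l<s. if l = i then a j0 l else 0)"
      using that by (intro sum.cong) (auto simp: B)
    then show ?thesis unfolding \<beta> using that by simp
  qed
  have \<beta>1: "(\<Sum>j<m. \<beta> j * a j s) = 1"
    unfolding \<beta> b_def[symmetric] r_def[symmetric] using j0 by simp
  \<comment> \<open>The old rows are corrected by multiples of \<open>\<beta>\<close> so that they
    vanish on the new column.\<close>
  define B' where "B' k j = (if k = s then \<beta> j else B k j - b k * \<beta> j)" for k j
  have "(\<Sum>j<m. B' k j * a j i) = (if k = i then 1 else 0)" if "k < Suc s" "i < Suc s" for k i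
  proof (cases "k = s")
    case True
    then show ?thesis using \<beta>0[of i] \<beta>1 that by (cases "i = s") (auto simp: B'_def)
  next
    case False
    then have k: "k < s" using that by simp
    have "(\<Sum>j<m. B' k j * a j i) = (\<Sum>j<m. B k j * a j i) - b k * (\<Sum>j<m. \<beta> j * a j i)"
      using False by (simp add: B'_def sum_distrib_left sum_subtractf algebra_simps)
    then show ?thesis using \<beta>0[of i] \<beta>1 B[OF k, of i] that k by (cases "i = s") (auto simp: b_def)
  qed
  then show ?case by blast
qed simp

text \<open>A linear map \<open>B\<close> turns the functions \<open>w j\<close> into
  \<open>s\<close> functions \<open>\<omega> k\<close> with identity derivative at \<open>p\<close>.
  A right inverse \<open>\<kappa>\<close> of \<open>\<omega>\<close> again has identity derivative,
  hence a right inverse \<open>\<tau>\<close> of its own; therefore \<open>\<kappa>\<close> is a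
  two-sided inverse, and \<open>\<kappa>\<close> after \<open>B\<close> is the left inverse of
  \<open>w\<close>.\<close>

lemma local_left_inverse:
  assumes V: "eopen s V" and p: "p \<in> V" and w: "\<And>j. j < m \<Longrightarrow> smooth_on s V (w j)"
    and inj: "\<And>c. (\<And>j. j < m \<Longrightarrow> (\<Sum>i<s. partial_deriv i (w j) p * c i) = 0) \<Longrightarrow> (\<forall>i<s. c i = 0)"
  obtains O' \<rho> T where "smooth_mapping m T s V \<rho>" "eopen s O'" "p \<in> O'" "O' \<subseteq> V"
    "\<And>x. x \<in> O' \<Longrightarrow> (\<lambda>j. if j < m then w j x else 0) \<in> T"
    "\<And>x. x \<in> O' \<Longrightarrow> \<rho> (\<lambda>j. if j < m then w j x else 0) = x"
proof -
  obtain B where B: "\<And>k i. k < s \<Longrightarrow> i < s \<Longrightarrow> (\<Sum>j<m. B k j * partial_deriv i (w j) p) = (if k = i then 1 else 0)"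
    using injective_matrix_left_inverse[where m = m and s = s and a = "\<lambda>j i. partial_deriv i (w j) p"] inj by blast
  define \<omega> where "\<omega> k x = (\<Sum>j<m. B k j * w j x)" for k x
  have s\<omega>: "smooth_on s V (\<omega> k)" for k
    unfolding \<omega>_def[abs_def] by (intro smooth_on_sum smooth_on_mult smooth_on_const V) (use w in auto)
  have d\<omega>: "partial_deriv i (\<omega> k) p = (if k = i then 1 else 0)" if "i < s" "k < s" for i k
  proof -
    have "hpd i (\<omega> k) (\<Sum>j<m. B k j * partial_deriv i (w j) p) p"
      unfolding hpd_def \<omega>_def using smooth_on_hpd[OF V w that(1) p]
      by (intro DERIV_sum DERIV_cmult) (auto simp: hpd_def)
    from hpd_partial_deriv[OF this] B[OF that(2,1)] show ?thesis by simp
  qed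
  define z0 where "z0 = (\<lambda>k. if k < s then \<omega> k p else 0)"
  have v: "(\<Sum>i<s. (if i = l then 1 else 0) * partial_deriv i (\<omega> k) p) = (if k = l then 1 else 0)" if "k < s" "l < s" for k l
    using that d\<omega> by (simp add: if_distrib[of "\<lambda>x. x * _"] sum.delta cong: if_cong)
  obtain W \<kappa> where \<kappa>: "smooth_mapping s W s V \<kappa>" "z0 \<in> W" "\<kappa> z0 = p" "\<forall>y\<in>W. \<forall>k<s. \<omega> k (\<kappa> y) = y k"
    unfolding z0_def by (rule local_right_inverse[where n = s and v = "\<lambda>l i. if i = l then 1 else 0", OF V p s\<omega> v])
  have W: "eopen s W" using \<kappa>(1) by (simp add: smooth_mapping_def)
  have d\<kappa>: "partial_deriv i (\<lambda>y. \<kappa> y k) z0 = (if k = i then 1 else 0)" if i: "i < s" and k: "k < s" for i k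
  proof -
    have "(if k = i then 1 else 0) = partial_deriv i (\<lambda>y. \<omega> k (\<kappa> y)) z0"
      using partial_deriv_cong[OF W \<kappa>(2) i, of "\<lambda>y. \<omega> k (\<kappa> y)" "\<lambda>y. y k"] \<kappa>(4) k
      by (simp add: hpd_partial_deriv[OF hpd_coord])
    also have "\<dots> = (\<Sum>j<s. partial_deriv j (\<omega> k) p * partial_deriv i (\<lambda>y. \<kappa> y j) z0)"
      using partial_deriv_compose_mapping[OF \<kappa>(1) s\<omega> \<kappa>(2) i] \<kappa>(3) by simp
    also have "\<dots> = (\<Sum>j<s. if j = k then partial_deriv i (\<lambda>y. \<kappa> y k) z0 else 0)"
      by (intro sum.cong) (auto simp: d\<omega> k)
    finally show ?thesis using k by simp
  qed
  have v': "(\<Sum>i<s. (if i = l then 1 else 0) * partial_deriv i (\<lambda>y. \<kappa> y k) z0) = (if k = l then 1 else 0)" if "k < s" "l < s" for k l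
    using that d\<kappa> by (simp add: if_distrib[of "\<lambda>x. x * _"] sum.delta cong: if_cong)
  have s\<kappa>: "smooth_on s W (\<lambda>y. \<kappa> y k)" if "k < s" for k using \<kappa>(1) that by (simp add: smooth_mapping_def)
  have pE: "p \<in> ES s" using p eopen_subset[OF V] by blast
  then have p': "(\<lambda>k. if k < s then \<kappa> z0 k else 0) = p" using \<kappa>(3) by (auto simp: ES_def)
  obtain Z \<tau> where \<tau>: "smooth_mapping s Z s W \<tau>" "p \<in> Z" "\<tau> p = z0" "\<forall>y\<in>Z. \<forall>k<s. \<kappa> (\<tau> y) k = y k"
    by (rule local_right_inverse[where n = s and u = "\<lambda>k y. \<kappa> y k" and v = "\<lambda>l i. if i = l then 1 else 0", OF W \<kappa>(2) s\<kappa> v', unfolded p'])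
  define P where "P z = (\<lambda>k. if k < s then \<Sum>j<m. B k j * z j else 0)" for z :: "nat \<Rightarrow> real"
  define T where "T = {z \<in> ES m. P z \<in> W}"
  have sP: "smooth_on m (ES m) (\<lambda>z. P z k)" for k
    by (cases "k < s") (auto simp: P_def intro!: smooth_on_sum smooth_on_mult smooth_on_const smooth_on_coord eopen_ES)
  have PE: "P z \<in> ES s" for z by (auto simp: P_def ES_def)
  have "continuous_on (ES m) P"
    by (rule continuous_on_coordinatewise_then_product) (rule smooth_on_continuous[OF eopen_ES sP])
  then have To: "eopen m T" unfolding T_def by (rule eopen_preimage[OF eopen_ES _ W]) (use PE in auto)
  have PM: "smooth_mapping m T s W P"
    unfolding smooth_mapping_def using W To smooth_on_subset[OF eopen_ES To _ sP] by (auto simp: T_def)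
  have Z: "eopen s Z" using \<tau>(1) by (simp add: smooth_mapping_def)
  \<comment> \<open>Applying \<open>\<omega>\<close> to \<open>\<kappa> (\<tau> x) = x\<close>
    identifies \<open>\<tau>\<close> with \<open>\<omega>\<close>.\<close>
  have key: "P (\<lambda>j. if j < m then w j x else 0) = \<tau> x \<and> \<kappa> (\<tau> x) = x" if x: "x \<in> Z" for x
  proof -
    have tx: "\<tau> x \<in> W" using \<tau>(1) x by (auto simp: smooth_mapping_def)
    have "\<kappa> (\<tau> x) \<in> ES s" using \<kappa>(1) tx eopen_subset[OF V] by (auto simp: smooth_mapping_def)
    moreover have "x \<in> ES s" using x eopen_subset[OF Z] by blast
    ultimately have e: "\<kappa> (\<tau> x) = x"
    proof (intro ext)
      fix k assume "\<kappa> (\<tau> x) \<in> ES s" "x \<in> ES s"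
      then show "\<kappa> (\<tau> x) k = x k" using \<tau>(4) x by (cases "k < s") (auto simp: ES_def)
    qed
    have tE: "\<tau> x \<in> ES s" using tx eopen_subset[OF W] by blast
    have "P (\<lambda>j. if j < m then w j x else 0) k = \<tau> x k" for k
    proof (cases "k < s")
      case True
      then have "P (\<lambda>j. if j < m then w j x else 0) k = \<omega> k x" by (simp add: P_def \<omega>_def)
      also have "\<dots> = \<tau> x k" using \<kappa>(4) tx True e by force
      finally show ?thesis .
    qed (use tE in \<open>simp add: P_def ES_def\<close>)
    then show ?thesis using e by blast
  qed
  show ?thesis
  proof (rule that)
    show "smooth_mapping m T s V (\<lambda>z. \<kappa> (P z))" by (rule smooth_mapping_compose[OF PM \<kappa>(1)])
    show "eopen s Z" "p \<in> Z" by (rule Z, rule \<tau>(2))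
    show "Z \<subseteq> V"
    proof
      fix x assume x: "x \<in> Z"
      then have "\<kappa> (\<tau> x) \<in> V" using \<tau>(1) \<kappa>(1) by (auto simp: smooth_mapping_def image_subset_iff)
      then show "x \<in> V" using key[OF x] by simp
    qed
    show "(\<lambda>j. if j < m then w j x else 0) \<in> T" if "x \<in> Z" for x
      using key[OF that] \<tau>(1) that by (auto simp: T_def ES_def smooth_mapping_def)
    show "\<kappa> (P (\<lambda>j. if j < m then w j x else 0)) = x" if "x \<in> Z" for x
      using key[OF that] by simp
  qed
qed

section \<open>Commuting vector fields\<close>

definition l1 :: "nat \<Rightarrow> (nat \<Rightarrow> real) \<Rightarrow> real" where
  "l1 m z = (\<Sum>i<m. \<bar>z i\<bar>)"

lemma l1_nonneg: "0 \<le> l1 m z"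
  by (simp add: l1_def sum_nonneg)

lemma l1_bound: "(\<And>i. i < m \<Longrightarrow> \<bar>z i\<bar> \<le> c) \<Longrightarrow> l1 m z \<le> real m * c"
  unfolding l1_def using sum_bounded_above[of "{..<m}" "\<lambda>i. \<bar>z i\<bar>" c] by simp

text \<open>The time interval is always the unit interval; smallness is put on the field instead,
  since the fields of interest are scaled by a parameter. \<open>\<beta> < \<rho>\<close> keeps the
  iterates in the box, and the bound on \<open>real m * L\<close> makes each step contract by
  1/2.\<close>

lemma picard_iteration_ode:
  assumes p: "p \<in> ES m" and \<beta>: "0 \<le> \<beta>" "\<beta> < \<rho>"
    and bnd: "\<And>z j. z \<in> ebox m p \<rho> \<Longrightarrow> j < m \<Longrightarrow> \<bar>b j z\<bar> \<le> \<beta>"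
    and lip: "\<And>y z j. y \<in> ebox m p \<rho> \<Longrightarrow> z \<in> ebox m p \<rho> \<Longrightarrow> j < m \<Longrightarrow> \<bar>b j z - b j y\<bar> \<le> L * l1 m (\<lambda>i. z i - y i)"
    and cont: "\<And>j. j < m \<Longrightarrow> continuous_on (ebox m p \<rho>) (b j)"
    and L: "0 \<le> L" "real m * L \<le> 1 / 2"
  obtains \<gamma> where "\<gamma> 0 = p" "\<And>t. t \<in> {0..1} \<Longrightarrow> \<gamma> t \<in> ebox m p \<rho>"
    "\<And>t j. t \<in> {0..1} \<Longrightarrow> j < m \<Longrightarrow> ((\<lambda>t. \<gamma> t j) has_real_derivative b j (\<gamma> t)) (at t within {0..1})"
proof -
  define P where "P g = (\<lambda>t j. if j < m then p j + integral {0..t} (\<lambda>s. b j (g s)) else 0)" for g :: "real \<Rightarrow> nat \<Rightarrow> real"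
  define g where "g n = (P ^^ n) (\<lambda>_. p)" for n
  have gS: "g (Suc n) = P (g n)" for n by (simp add: g_def)
  define ok where "ok g \<longleftrightarrow> continuous_on {0..1} g \<and> (\<forall>t\<in>{0..1}. g t \<in> ES m \<and> (\<forall>j<m. \<bar>g t j - p j\<bar> \<le> \<beta>))" for g :: "real \<Rightarrow> nat \<Rightarrow> real"
  have ok_box: "g t \<in> ebox m p \<rho>" if "ok g" "t \<in> {0..1}" for g t
    using that \<beta> by (force simp: ok_def ebox_def)
  have contb: "continuous_on {0..1} (\<lambda>s. b j (g s))" if "ok g" "j < m" for g j
    by (rule continuous_on_compose2[OF cont[OF that(2)]]) (use that(1) ok_box[OF that(1)] in \<open>auto simp: ok_def\<close>)
  have intb: "(\<lambda>s. b j (g s)) integrable_on {0..t}" if "ok g" "j < m" "t \<in> {0..1}" for g j t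
    by (rule integrable_continuous_real) (rule continuous_on_subset[OF contb[OF that(1,2)]], use that in auto)
  have bint: "\<bar>integral {0..t} f\<bar> \<le> c" if "f integrable_on {0..t}" "\<And>s. s \<in> {0..t} \<Longrightarrow> \<bar>f s\<bar> \<le> c" "t \<in> {0..1}" "0 \<le> c" for f :: "real \<Rightarrow> real" and t c
  proof -
    have "norm (integral {0..t} f) \<le> integral {0..t} (\<lambda>_. c)"
      by (rule integral_norm_bound_integral) (use that in auto)
    also have "\<dots> = c * t" using that by simp
    also have "\<dots> \<le> c" using that by (simp add: mult_left_le)
    finally show ?thesis by simp
  qed
  have okP: "ok (P g)" if g: "ok g" for g
  proof -
    have "continuous_on {0..1} (P g)"
    proof (rule continuous_on_coordinatewise_then_product)
      fix j
      show "continuous_on {0..1} (\<lambda>t. P g t j)"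
      proof (cases "j < m")
        case True
        then show ?thesis unfolding P_def
          using indefinite_integral_continuous_1[of "\<lambda>s. b j (g s)" 0 1] intb[OF g True, of 1]
          by (auto intro!: continuous_intros)
      qed (simp add: P_def)
    qed
    moreover have "\<bar>P g t j - p j\<bar> \<le> \<beta>" if "t \<in> {0..1}" "j < m" for t j
      using bint[OF intb[OF g that(2,1)] _ that(1) \<beta>(1)] bnd ok_box[OF g] that by (auto simp: P_def)
    ultimately show ?thesis by (auto simp: ok_def P_def ES_def)
  qed
  have ok0: "ok (g n)" for n
  proof (induction n)
    case 0
    then show ?case using p \<beta> by (auto simp: ok_def g_def)
  qed (use okP gS in auto)
  have step: "\<bar>g (Suc n) t j - g n t j\<bar> \<le> \<beta> * (1/2) ^ n" if "t \<in> {0..1}" "j < m" for n t j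
    using that
  proof (induction n arbitrary: t j)
    case 0
    then show ?case using ok0[of 1] by (simp add: ok_def g_def)
  next
    case (Suc n)
    have "\<bar>b j (g (Suc n) s) - b j (g n s)\<bar> \<le> \<beta> * (1/2) ^ Suc n" if s: "s \<in> {0..1}" for s
    proof -
      have "\<bar>b j (g (Suc n) s) - b j (g n s)\<bar> \<le> L * l1 m (\<lambda>i. g (Suc n) s i - g n s i)"
        by (rule lip[OF ok_box[OF ok0 s] ok_box[OF ok0 s] Suc.prems(2)])
      also have "\<dots> \<le> L * (real m * (\<beta> * (1/2) ^ n))"
        by (intro mult_left_mono l1_bound Suc.IH s L(1))
      also have "\<dots> = (real m * L) * (\<beta> * (1/2) ^ n)" by simp
      also have "\<dots> \<le> 1/2 * (\<beta> * (1/2) ^ n)" using \<beta> by (intro mult_right_mono L(2)) auto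
      finally show ?thesis by simp
    qed
    then have "\<bar>integral {0..t} (\<lambda>s. b j (g (Suc n) s) - b j (g n s))\<bar> \<le> \<beta> * (1/2) ^ Suc n"
      using Suc.prems \<beta> by (intro bint integrable_diff intb ok0) auto
    moreover have "integral {0..t} (\<lambda>s. b j (g (Suc n) s) - b j (g n s)) = g (Suc (Suc n)) t j - g (Suc n) t j"
      using Suc.prems integral_diff[OF intb[OF ok0 Suc.prems(2,1)] intb[OF ok0 Suc.prems(2,1)], of "Suc n" n]
      by (simp add: gS[of "Suc n"] gS[of n] P_def)
    ultimately show ?case by simp
  qed
  \<comment> \<open>The limit is written as a telescoping series, so that the Weierstrass M-test
    with a geometric majorant gives uniform convergence.\<close>
  define \<gamma> where "\<gamma> t j = (if j < m then p j + suminf (\<lambda>n. g (Suc n) t j - g n t j) else 0)" for t j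
  have ul: "uniform_limit {0..1} (\<lambda>n t. g n t j) (\<lambda>t. \<gamma> t j) sequentially" if j: "j < m" for j
  proof -
    have "uniform_limit {0..1} (\<lambda>n t. \<Sum>i<n. g (Suc i) t j - g i t j) (\<lambda>t. suminf (\<lambda>i. g (Suc i) t j - g i t j)) sequentially"
      by (rule Weierstrass_m_test[where M = "\<lambda>n. \<beta> * (1/2) ^ n"]) (use step[OF _ j] in \<open>auto intro!: summable_mult summable_geometric\<close>)
    moreover have "(\<Sum>i<n. g (Suc i) t j - g i t j) = g n t j - p j" for n t
      using sum_lessThan_telescope[of "\<lambda>i. g i t j" n] by (simp add: g_def)
    ultimately have "uniform_limit {0..1} (\<lambda>n t. g n t j - p j) (\<lambda>t. \<gamma> t j - p j) sequentially"
      using j by (simp add: \<gamma>_def)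
    from uniform_limit_add[OF this uniform_limit_const[where c = "\<lambda>_. p j"]] show ?thesis by simp
  qed
  have \<gamma>ok: "ok \<gamma>"
    unfolding ok_def
  proof (intro conjI ballI allI impI)
    show "continuous_on {0..1} \<gamma>"
    proof (rule continuous_on_into_ES[of m])
      show "continuous_on {0..1} (\<lambda>t. \<gamma> t j)" if "j < m" for j
      proof (rule uniform_limit_theorem[OF _ ul[OF that]])
        have "continuous_on {0..1} (\<lambda>t. g n t j)" for n
        proof (rule continuous_on_product_then_coordinatewise[of "{0..1}" "g n" j])
          show "continuous_on {0..1} (g n)" using ok0[of n] unfolding ok_def by (rule conjunct1)
        qed
        then show "\<forall>\<^sub>F n in sequentially. continuous_on {0..1} (\<lambda>t. g n t j)"
          by (rule always_eventually[OF allI])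
      qed simp
    qed (auto simp: \<gamma>_def ES_def)
    fix t :: real assume t: "t \<in> {0..1}"
    show "\<gamma> t \<in> ES m" by (auto simp: \<gamma>_def ES_def)
    fix j assume j: "j < m"
    have "(\<lambda>n. \<bar>g n t j - p j\<bar>) \<longlonglongrightarrow> \<bar>\<gamma> t j - p j\<bar>"
      by (intro tendsto_intros tendsto_uniform_limitI[OF ul[OF j] t])
    then show "\<bar>\<gamma> t j - p j\<bar> \<le> \<beta>"
      using ok0 t j by (intro LIMSEQ_le_const2) (auto simp: ok_def)
  qed
  \<comment> \<open>Uniform convergence and the Lipschitz bound let the limit pass under the
    integral.\<close>
  have fix_eq: "\<gamma> t j = p j + integral {0..t} (\<lambda>s. b j (\<gamma> s))" if t: "t \<in> {0..1}" and j: "j < m" for t j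
  proof -
    have "uniform_limit {0..t} (\<lambda>n s. b j (g n s)) (\<lambda>s. b j (\<gamma> s)) sequentially"
    proof (rule uniform_limitI)
      fix e :: real assume e: "e > 0"
      define e' where "e' = e / 2"
      have "\<forall>\<^sub>F n in sequentially. \<forall>i\<in>{..<m}. \<forall>s\<in>{0..1}. dist (g n s i) (\<gamma> s i) < e'"
        using uniform_limitD[OF ul, of _ e'] e by (intro eventually_ball_finite) (auto simp: e'_def)
      then show "\<forall>\<^sub>F n in sequentially. \<forall>s\<in>{0..t}. dist (b j (g n s)) (b j (\<gamma> s)) < e"
      proof eventually_elim
        case (elim n)
        show ?case
        proof
          fix s assume "s \<in> {0..t}"
          then have s: "s \<in> {0..1}" using t by auto
          have "dist (b j (g n s)) (b j (\<gamma> s)) \<le> L * l1 m (\<lambda>i. g n s i - \<gamma> s i)"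
            using lip[OF ok_box[OF \<gamma>ok s] ok_box[OF ok0 s] j] by (simp add: dist_real_def)
          also have "\<dots> \<le> L * (real m * e')"
            using elim s by (intro mult_left_mono l1_bound L(1)) (auto simp: dist_real_def intro: less_imp_le)
          also have "\<dots> = (real m * L) * e'" by simp
          also have "\<dots> \<le> 1/2 * e'" using e by (intro mult_right_mono L(2)) (auto simp: e'_def)
          also have "\<dots> < e" using e by (simp add: e'_def)
          finally show "dist (b j (g n s)) (b j (\<gamma> s)) < e" .
        qed
      qed
    qed
    then obtain I J where IJ: "\<And>n. ((\<lambda>s. b j (g n s)) has_integral I n) {0..t}" "((\<lambda>s. b j (\<gamma> s)) has_integral J) {0..t}" "I \<longlonglongrightarrow> J"
    proof (rule uniform_limit_integral)
      show "continuous_on {0..t} (\<lambda>s. b j (g n s))" for n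
        by (rule continuous_on_subset[OF contb[OF ok0 j]]) (use t in auto)
    qed auto
    have "(\<lambda>n. g (Suc n) t j) \<longlonglongrightarrow> p j + J"
    proof -
      have "g (Suc n) t j = p j + I n" for n
        using integral_unique[OF IJ(1)] j by (simp add: gS P_def)
      then show ?thesis using IJ(3) by (auto intro!: tendsto_intros)
    qed
    moreover have "(\<lambda>n. g (Suc n) t j) \<longlonglongrightarrow> \<gamma> t j"
      using tendsto_uniform_limitI[OF ul[OF j] t] LIMSEQ_Suc by blast
    ultimately show ?thesis using LIMSEQ_unique integral_unique[OF IJ(2)] by blast
  qed
  show ?thesis
  proof (rule that)
    show "\<gamma> 0 = p"
    proof
      fix j show "\<gamma> 0 j = p j" using fix_eq[of 0 j] p by (cases "j < m") (auto simp: \<gamma>_def ES_def)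
    qed
    show "\<gamma> t \<in> ebox m p \<rho>" if "t \<in> {0..1}" for t using ok_box[OF \<gamma>ok that] .
    fix t :: real and j assume t: "t \<in> {0..1}" and j: "j < m"
    have "((\<lambda>t. p j + integral {0..t} (\<lambda>s. b j (\<gamma> s))) has_real_derivative 0 + b j (\<gamma> t)) (at t within {0..1})"
      by (intro DERIV_add DERIV_const integral_has_real_derivative contb[OF \<gamma>ok j] t)
    then have "((\<lambda>t. \<gamma> t j) has_real_derivative 0 + b j (\<gamma> t)) (at t within {0..1})"
      by (rule has_field_derivative_transform_within[OF _ zero_less_one t]) (simp add: fix_eq[OF _ j])
    then show "((\<lambda>t. \<gamma> t j) has_real_derivative b j (\<gamma> t)) (at t within {0..1})" by simp
  qed
qed

text \<open>Look at a time \<open>s\<close> where the norm is largest: the mean value bound there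
  gives at most half of that norm plus \<open>real m * \<epsilon>\<close>, and the half is absorbed
  on the left.\<close>

lemma gronwall_unit_interval:
  assumes d: "\<And>t j. t \<in> {0..1} \<Longrightarrow> j < m \<Longrightarrow> ((\<lambda>t. w t j) has_real_derivative w' t j) (at t within {0..1})"
    and b: "\<And>t j. t \<in> {0..1} \<Longrightarrow> j < m \<Longrightarrow> \<bar>w' t j\<bar> \<le> K * l1 m (w t) + \<epsilon>"
    and 0: "\<And>j. j < m \<Longrightarrow> w 0 j = 0" and K: "0 \<le> K" "real m * K \<le> 1 / 2" and \<epsilon>: "0 \<le> \<epsilon>" and t: "t \<in> {0..1::real}"
  shows "l1 m (w t) \<le> 2 * real m * \<epsilon>"
proof -
  have "continuous_on {0..1} (\<lambda>t. w t j)" if "j < m" for j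
    by (rule DERIV_continuous_on[OF d[OF _ that]])
  then have "continuous_on {0..1} (\<lambda>t. l1 m (w t))"
    unfolding l1_def by (intro continuous_intros) auto
  then obtain s where s: "s \<in> {0..1}" "\<And>t. t \<in> {0..1} \<Longrightarrow> l1 m (w t) \<le> l1 m (w s)"
    using continuous_attains_sup[of "{0..1::real}" "\<lambda>t. l1 m (w t)"] by auto
  have "\<bar>w s j\<bar> \<le> K * l1 m (w s) + \<epsilon>" if j: "j < m" for j
  proof -
    have B: "\<bar>w' t j\<bar> \<le> K * l1 m (w s) + \<epsilon>" if "t \<in> {0..1}" for t
      using b[OF that j] s(2)[OF that] K(1) by (meson add_right_mono mult_left_mono order_trans)
    have "norm (w s j - w 0 j) \<le> (K * l1 m (w s) + \<epsilon>) * norm (s - 0)"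
      by (rule field_differentiable_bound[of "{0..1}" "\<lambda>t. w t j" "\<lambda>t. w' t j"]) (use d j B s in auto)
    also have "\<dots> \<le> (K * l1 m (w s) + \<epsilon>) * 1"
      using s(1) K(1) \<epsilon> l1_nonneg by (intro mult_left_mono) auto
    finally show ?thesis using 0[OF j] by simp
  qed
  then have "l1 m (w s) \<le> real m * (K * l1 m (w s) + \<epsilon>)" by (rule l1_bound)
  also have "\<dots> = (real m * K) * l1 m (w s) + real m * \<epsilon>" by (simp add: algebra_simps)
  also have "\<dots> \<le> 1 / 2 * l1 m (w s) + real m * \<epsilon>" using mult_right_mono[OF K(2) l1_nonneg] by simp
  finally show ?thesis using s(2)[OF t] by simp
qed

lemma abs_sum_mult_le:
  fixes a c :: "nat \<Rightarrow> real"
  assumes "\<And>i. i < n \<Longrightarrow> \<bar>a i\<bar> \<le> M"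
  shows "\<bar>\<Sum>i<n. a i * c i\<bar> \<le> M * l1 n c"
proof -
  have "\<bar>\<Sum>i<n. a i * c i\<bar> \<le> (\<Sum>i<n. \<bar>a i * c i\<bar>)" by (rule sum_abs)
  also have "\<dots> \<le> (\<Sum>i<n. M * \<bar>c i\<bar>)"
    using assms by (intro sum_mono) (auto simp: abs_mult mult_right_mono)
  finally show ?thesis by (simp add: l1_def sum_distrib_left)
qed

lemma l1_fun_upd:
  assumes "k < r"
  shows "l1 r (\<lambda>l. (x(k := x k + s)) l - x l) = \<bar>s\<bar>"
proof -
  have "l1 r (\<lambda>l. (x(k := x k + s)) l - x l) = (\<Sum>l<r. if l = k then \<bar>s\<bar> else 0)"
    unfolding l1_def by (intro sum.cong) auto
  then show ?thesis using assms by simp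
qed

text \<open>\<open>G x\<close> is the value at time 1 of the integral curve through \<open>p\<close> of the field \<open>\<Sum>l<r. x l * A l\<close>. As the
  fields commute, \<open>t * A k\<close> solves the linearised equation along this curve, and Gronwall's
  inequality compares it with the actual variation of the curve in direction \<open>k\<close>.\<close>

lemma commuting_fields_integral:
  assumes V: "eopen m V" and p: "p \<in> V"
    and A: "\<And>l j. l < r \<Longrightarrow> j < m \<Longrightarrow> smooth_on m V (A l j)"
    and comm: "\<And>x k l j. x \<in> V \<Longrightarrow> k < r \<Longrightarrow> l < r \<Longrightarrow> j < m \<Longrightarrow>
       (\<Sum>i<m. partial_deriv i (A l j) x * A k i x) = (\<Sum>i<m. partial_deriv i (A k j) x * A l i x)"
  obtains e G where "e > 0" "smooth_mapping r (ebox r (\<lambda>_. 0) e) m V G" "G (\<lambda>_. 0) = p"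
    "\<forall>x\<in>ebox r (\<lambda>_. 0) e. \<forall>l<r. \<forall>j<m. hpd l (\<lambda>x. G x j) (A l j (G x)) x"
proof -
  define D where "D l j i = partial_deriv i (A l j)" for l j i
  have sD: "smooth_on m V (D l j i)" if "l < r" "j < m" "i < m" for l j i
    unfolding D_def by (rule smooth_on_partial_deriv[OF V A[OF that(1,2)] that(3)])
  have sDD: "smooth_on m V (partial_deriv i' (D l j i))" if "l < r" "j < m" "i < m" "i' < m" for l j i i'
    by (rule smooth_on_partial_deriv[OF V sD[OF that(1-3)] that(4)])
  \<comment> \<open>All coefficients with their derivatives up to order two; \<open>M\<close> bounds
    them on one box. Order two is what the Lipschitz bound for \<open>D\<close> in the Taylor
    estimate requires.\<close>
  define F where "F = (\<lambda>(l, j). A l j) ` ({..<r} \<times> {..<m}) \<union> (\<lambda>(l, j, i). D l j i) ` ({..<r} \<times> {..<m} \<times> {..<m})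
     \<union> (\<lambda>(l, j, i, i'). partial_deriv i' (D l j i)) ` ({..<r} \<times> {..<m} \<times> {..<m} \<times> {..<m})"
  have "finite F" by (simp add: F_def)
  moreover have "continuous_on V f" if "f \<in> F" for f
  proof -
    have "smooth_on m V f" using that A sD sDD by (auto simp: F_def)
    then show ?thesis by (rule smooth_on_continuous[OF V])
  qed
  ultimately obtain \<rho> where \<rho>: "\<rho> > 0" "ebox m p \<rho> \<subseteq> V" "\<forall>y\<in>ebox m p \<rho>. \<forall>f\<in>F. \<bar>f y - f p\<bar> < 1"
    using continuous_on_eboxD_finite[OF V, of F "\<lambda>f. f" p 1] p by auto
  define B where "B = ebox m p \<rho>"
  define M where "M = 1 + (\<Sum>f\<in>F. \<bar>f p\<bar>)"
  have M: "M \<ge> 1" by (simp add: M_def sum_nonneg)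
  have bF: "\<bar>f y\<bar> \<le> M" if "f \<in> F" "y \<in> B" for f y
  proof -
    have "\<bar>f y - f p\<bar> < 1" using that \<rho> by (simp add: B_def)
    moreover have "\<bar>f p\<bar> \<le> (\<Sum>f\<in>F. \<bar>f p\<bar>)" using \<open>finite F\<close> that by (intro member_le_sum) auto
    ultimately show ?thesis by (auto simp: M_def)
  qed
  have bA: "\<bar>A l j y\<bar> \<le> M" if "l < r" "j < m" "y \<in> B" for l j y
    using that by (intro bF) (auto simp: F_def)
  have bD: "\<bar>D l j i y\<bar> \<le> M" if "l < r" "j < m" "i < m" "y \<in> B" for l j i y
  proof (rule bF[OF _ that(4)])
    show "D l j i \<in> F"
      unfolding F_def by (rule UnI1, rule UnI2, rule image_eqI[of _ _ "(l, j, i)"]) (use that in auto)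
  qed
  have bDD: "\<bar>partial_deriv i' (D l j i) y\<bar> \<le> M" if "l < r" "j < m" "i < m" "i' < m" "y \<in> B" for l j i i' y
  proof (rule bF[OF _ that(5)])
    show "partial_deriv i' (D l j i) \<in> F"
      unfolding F_def by (rule UnI2, rule image_eqI[of _ _ "(l, j, i, i')"]) (use that in auto)
  qed
  have lipF: "\<bar>f z - f y\<bar> \<le> M * l1 m (\<lambda>i. z i - y i)"
    if "smooth_on m V f" "\<And>i z. i < m \<Longrightarrow> z \<in> B \<Longrightarrow> \<bar>partial_deriv i f z\<bar> \<le> M" "y \<in> B" "z \<in> B" for f y z
  proof -
    have "\<exists>\<xi>. (\<forall>j<m. \<xi> j \<in> B \<and> (\<forall>i. \<bar>\<xi> j i - y i\<bar> \<le> \<bar>z i - y i\<bar>)) \<and> f z - f y = (\<Sum>j<m. partial_deriv j f (\<xi> j) * (z j - y j))"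
      unfolding B_def by (rule ebox_mvt) (use smooth_on_hpd[OF V that(1)] \<rho>(2) that(3,4) in \<open>auto simp: B_def\<close>)
    then obtain \<xi> where "\<forall>j<m. \<xi> j \<in> B" "f z - f y = (\<Sum>j<m. partial_deriv j f (\<xi> j) * (z j - y j))" by blast
    then show ?thesis using abs_sum_mult_le[of m "\<lambda>j. partial_deriv j f (\<xi> j)" M "\<lambda>j. z j - y j"] that(2) by auto
  qed
  have lipA: "\<bar>A l j z - A l j y\<bar> \<le> M * l1 m (\<lambda>i. z i - y i)" if "l < r" "j < m" "y \<in> B" "z \<in> B" for l j y z
    using lipF[OF A[OF that(1,2)] _ that(3,4)] bD[OF that(1,2)] by (simp add: D_def)
  have lipD: "\<bar>D l j i z - D l j i y\<bar> \<le> M * l1 m (\<lambda>i. z i - y i)" if "l < r" "j < m" "i < m" "y \<in> B" "z \<in> B" for l j i y z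
    using lipF[OF sD[OF that(1-3)] _ that(4,5)] bDD[OF that(1-3)] by simp
  have taylor: "\<bar>A l j z - A l j y - (\<Sum>i<m. D l j i y * (z i - y i))\<bar> \<le> M * (l1 m (\<lambda>i. z i - y i))\<^sup>2"
    if l: "l < r" and j: "j < m" and y: "y \<in> B" and z: "z \<in> B" for l j y z
  proof -
    have "\<exists>\<xi>. (\<forall>i<m. \<xi> i \<in> B \<and> (\<forall>k. \<bar>\<xi> i k - y k\<bar> \<le> \<bar>z k - y k\<bar>)) \<and> A l j z - A l j y = (\<Sum>i<m. D l j i (\<xi> i) * (z i - y i))"
      unfolding B_def by (rule ebox_mvt) (use smooth_on_hpd[OF V A[OF l j]] \<rho>(2) y z in \<open>auto simp: B_def D_def\<close>)
    then obtain \<xi> where \<xi>: "\<And>i. i < m \<Longrightarrow> \<xi> i \<in> B" "\<And>i k. i < m \<Longrightarrow> \<bar>\<xi> i k - y k\<bar> \<le> \<bar>z k - y k\<bar>"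
      "A l j z - A l j y = (\<Sum>i<m. D l j i (\<xi> i) * (z i - y i))" by blast
    have "\<bar>D l j i (\<xi> i) - D l j i y\<bar> \<le> M * l1 m (\<lambda>i. z i - y i)" if i: "i < m" for i
    proof -
      have "\<bar>D l j i (\<xi> i) - D l j i y\<bar> \<le> M * l1 m (\<lambda>k. \<xi> i k - y k)"
        by (rule lipD[OF l j i y \<xi>(1)[OF i]])
      also have "\<dots> \<le> M * l1 m (\<lambda>i. z i - y i)"
        unfolding l1_def using M \<xi>(2)[OF i] by (intro mult_left_mono sum_mono) auto
      finally show ?thesis .
    qed
    then have "\<bar>\<Sum>i<m. (D l j i (\<xi> i) - D l j i y) * (z i - y i)\<bar> \<le> (M * l1 m (\<lambda>i. z i - y i)) * l1 m (\<lambda>i. z i - y i)"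
      by (rule abs_sum_mult_le)
    then show ?thesis by (simp add: \<xi>(3) left_diff_distrib sum_subtractf power2_eq_square mult.assoc)
  qed
  \<comment> \<open>For \<open>l1 r x \<le> \<delta>\<close> each component of the field
    \<open>b x\<close> is bounded by \<open>M * \<delta> < \<rho>\<close>, and
    \<open>M * \<delta>\<close> is also its Lipschitz constant. The second entry of the minimum
    makes \<open>real m\<close> times this constant at most 1/2.\<close>
  define \<delta> where "\<delta> = min (\<rho> / 2) (1 / (2 * (real m + 1))) / M"
  have \<delta>: "\<delta> > 0" using \<rho>(1) M by (simp add: \<delta>_def)
  have \<delta>M: "M * \<delta> < \<rho>" "real m * (M * \<delta>) \<le> 1 / 2"
  proof -
    have e: "M * \<delta> = min (\<rho> / 2) (1 / (2 * (real m + 1)))" using M by (simp add: \<delta>_def)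
    show "M * \<delta> < \<rho>" unfolding e using \<rho>(1) by linarith
    have "real m * (M * \<delta>) \<le> real m * (1 / (2 * (real m + 1)))" unfolding e by (intro mult_left_mono) auto
    also have "\<dots> \<le> 1 / 2" by (simp add: field_simps)
    finally show "real m * (M * \<delta>) \<le> 1 / 2" .
  qed
  define S where "S = {x. l1 r x \<le> \<delta>}"
  define b where "b x j z = (\<Sum>l<r. A l j z * x l)" for x j z
  have pE: "p \<in> ES m" using p eopen_subset[OF V] by blast
  have "\<exists>\<gamma>. \<gamma> 0 = p \<and> (\<forall>t\<in>{0..1}. \<gamma> t \<in> B) \<and>
    (\<forall>t\<in>{0..1}. \<forall>j<m. ((\<lambda>t. \<gamma> t j) has_real_derivative b x j (\<gamma> t)) (at t within {0..1}))" if x: "x \<in> S" for x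
  proof -
    have xS: "l1 r x \<le> \<delta>" using x by (simp add: S_def)
    obtain \<gamma> where "\<gamma> 0 = p" "\<And>t. t \<in> {0..1} \<Longrightarrow> \<gamma> t \<in> ebox m p \<rho>"
    "\<And>t j. t \<in> {0..1} \<Longrightarrow> j < m \<Longrightarrow> ((\<lambda>t. \<gamma> t j) has_real_derivative b x j (\<gamma> t)) (at t within {0..1})"
    proof (rule picard_iteration_ode[OF pE _ \<delta>M(1) _ _ _ _ \<delta>M(2), of "b x"])
      show "\<bar>b x j z\<bar> \<le> M * \<delta>" if "z \<in> ebox m p \<rho>" "j < m" for z j
      proof -
        have "\<bar>b x j z\<bar> \<le> M * l1 r x" unfolding b_def using bA that by (intro abs_sum_mult_le) (auto simp: B_def)
        also have "\<dots> \<le> M * \<delta>" using xS M by (intro mult_left_mono) auto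
        finally show ?thesis .
      qed
      show "\<bar>b x j z - b x j y\<bar> \<le> M * \<delta> * l1 m (\<lambda>i. z i - y i)" if "y \<in> ebox m p \<rho>" "z \<in> ebox m p \<rho>" "j < m" for y z j
      proof -
        have "b x j z - b x j y = (\<Sum>l<r. (A l j z - A l j y) * x l)"
          by (simp add: b_def left_diff_distrib sum_subtractf)
        also have "\<bar>\<dots>\<bar> \<le> (M * l1 m (\<lambda>i. z i - y i)) * l1 r x"
          using lipA that by (intro abs_sum_mult_le) (auto simp: B_def)
        also have "\<dots> \<le> (M * l1 m (\<lambda>i. z i - y i)) * \<delta>" using xS M l1_nonneg by (intro mult_left_mono) auto
        finally show ?thesis by (simp add: mult_ac)
      qed
      show "continuous_on (ebox m p \<rho>) (b x j)" if "j < m" for j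
        unfolding b_def using smooth_on_continuous[OF V A[OF _ that]] \<rho>(2)
        by (intro continuous_intros) (auto intro: continuous_on_subset)
    qed (use M \<delta> in auto)
    then show ?thesis unfolding B_def by blast
  qed
  then have "\<forall>x\<in>S. \<exists>\<gamma>. \<gamma> 0 = p \<and> (\<forall>t\<in>{0..1}. \<gamma> t \<in> B) \<and>
    (\<forall>t\<in>{0..1}. \<forall>j<m. ((\<lambda>t. \<gamma> t j) has_real_derivative b x j (\<gamma> t)) (at t within {0..1}))" by blast
  from bchoice[OF this] obtain g where g: "\<And>x. x \<in> S \<Longrightarrow> g x 0 = p" "\<And>x t. x \<in> S \<Longrightarrow> t \<in> {0..1} \<Longrightarrow> g x t \<in> B"
    "\<And>x t j. x \<in> S \<Longrightarrow> t \<in> {0..1} \<Longrightarrow> j < m \<Longrightarrow> ((\<lambda>t. g x t j) has_real_derivative b x j (g x t)) (at t within {0..1})"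
    by blast
  have bdiff: "\<bar>\<Sum>l<r. (A l j z - A l j y) * x l\<bar> \<le> M * \<delta> * l1 m (\<lambda>i. z i - y i)" if "x \<in> S" "y \<in> B" "z \<in> B" "j < m" for x y z j
  proof -
    have "\<bar>\<Sum>l<r. (A l j z - A l j y) * x l\<bar> \<le> (M * l1 m (\<lambda>i. z i - y i)) * l1 r x"
      using lipA that by (intro abs_sum_mult_le) auto
    also have "\<dots> \<le> (M * l1 m (\<lambda>i. z i - y i)) * \<delta>" using that M l1_nonneg by (intro mult_left_mono) (auto simp: S_def)
    finally show ?thesis by (simp add: mult_ac)
  qed
  \<comment> \<open>Lipschitz dependence of the curve on the parameter: the difference of two curves
    starts at 0 and is driven by the difference of the parameters.\<close>
  have lipg: "l1 m (\<lambda>j. g x' t j - g x t j) \<le> 2 * real m * (M * l1 r (\<lambda>l. x' l - x l))"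
    if x: "x \<in> S" and x': "x' \<in> S" and t: "t \<in> {0..1}" for x x' t
  proof (rule gronwall_unit_interval[where w = "\<lambda>t j. g x' t j - g x t j" and K = "M * \<delta>"
        and w' = "\<lambda>t j. b x' j (g x' t) - b x j (g x t)"])
    fix t :: real and j assume t: "t \<in> {0..1}" and j: "j < m"
    show "((\<lambda>t. g x' t j - g x t j) has_real_derivative b x' j (g x' t) - b x j (g x t)) (at t within {0..1})"
      by (intro DERIV_diff g(3) x x' t j)
    have "b x' j (g x' t) - b x j (g x t) = (\<Sum>l<r. (A l j (g x' t) - A l j (g x t)) * x l) + (\<Sum>l<r. A l j (g x' t) * (x' l - x l))"
      by (simp add: b_def sum.distrib[symmetric] sum_subtractf[symmetric] algebra_simps)
    also have "\<bar>\<dots>\<bar> \<le> M * \<delta> * l1 m (\<lambda>j. g x' t j - g x t j) + M * l1 r (\<lambda>l. x' l - x l)"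
      by (intro order_trans[OF abs_triangle_ineq] add_mono bdiff abs_sum_mult_le bA g x x' t j) auto
    finally show "\<bar>b x' j (g x' t) - b x j (g x t)\<bar> \<le> M * \<delta> * l1 m (\<lambda>j. g x' t j - g x t j) + M * l1 r (\<lambda>l. x' l - x l)" .
  qed (use g(1) x x' t \<delta>M(2) \<delta> M l1_nonneg in auto)
  \<comment> \<open>Two errors quadratic in \<open>s\<close>: the Taylor remainder along the curve,
    where \<open>lipg\<close> enters squared, and the variation of \<open>A k\<close> between the
    two curves, where it enters once beside a factor \<open>s\<close>.\<close>
  define C where "C = M * \<delta> * (2 * real m * M)\<^sup>2 + M * (2 * real m * M)"
  have key: "\<bar>g (x(k := x k + s)) 1 j - g x 1 j - s * A k j (g x 1)\<bar> \<le> 2 * real m * (C * s\<^sup>2)"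
    if x: "x \<in> S" and x': "x(k := x k + s) \<in> S" and k: "k < r" and j: "j < m" for x k s j
  proof -
    define x' where "x' = x(k := x k + s)"
    have x'S: "x' \<in> S" using x' by (simp add: x'_def)
    define X where "X = g x'"
    define Y where "Y = g x"
    define n where "n t = l1 m (\<lambda>j. X t j - Y t j)" for t
    \<comment> \<open>The deviation of the actual variation of the curve from the candidate
      \<open>(t * s) * A k\<close>. It vanishes at time 0, and its derivative is bounded by a small
      multiple of itself plus \<open>C * s\<^sup>2\<close>.\<close>
    define W where "W t j = X t j - Y t j - (t * s) * A k j (Y t)" for t j
    define W' where "W' t j = b x' j (X t) - b x j (Y t) - (s * A k j (Y t) + (t * s) * (\<Sum>i<m. D k j i (Y t) * b x i (Y t)))" for t j
    have nb: "n t \<le> 2 * real m * M * \<bar>s\<bar>" if "t \<in> {0..1}" for t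
      using lipg[OF x x'S that] l1_fun_upd[OF k, of x s] by (simp add: n_def X_def Y_def x'_def mult.assoc)
    have "l1 m (W 1) \<le> 2 * real m * (C * s\<^sup>2)"
    proof (rule gronwall_unit_interval[where w' = W' and K = "M * \<delta>"])
      fix t :: real and j assume t: "t \<in> {0..1}" and j: "j < m"
      have XB: "X t \<in> B" and YB: "Y t \<in> B" using g(2) x x'S t by (auto simp: X_def Y_def)
      have "((\<lambda>t. A k j (Y t)) has_real_derivative (\<Sum>i<m. D k j i (Y t) * b x i (Y t))) (at t within {0..1})"
      proof (rule chain_rule_curve[OF V])
        show "continuous_on V (D k j i)" if "i < m" for i
          by (rule smooth_on_continuous[OF V sD[OF k j that]])
        show "hpd i (A k j) (D k j i z) z" if "i < m" "z \<in> V" for i z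
          unfolding D_def by (rule smooth_on_hpd[OF V A[OF k j] that])
      qed (use g(2,3)[OF x] t \<rho>(2) in \<open>auto simp: Y_def B_def\<close>)
      from DERIV_mult[OF DERIV_cmult_right[OF DERIV_ident, of s] this]
      have d: "((\<lambda>t. (t * s) * A k j (Y t)) has_real_derivative s * A k j (Y t) + (t * s) * (\<Sum>i<m. D k j i (Y t) * b x i (Y t))) (at t within {0..1})"
        by (simp add: mult_ac add_ac)
      show "((\<lambda>t. W t j) has_real_derivative W' t j) (at t within {0..1})"
        unfolding W_def W'_def X_def Y_def
        by (intro DERIV_diff g(3) x x'S t j d[unfolded Y_def])
      define T where "T l = A l j (X t) - A l j (Y t) - (\<Sum>i<m. D l j i (Y t) * (X t i - Y t i))" for l
      define U where "U l = (\<Sum>i<m. D l j i (Y t) * W t i)" for l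
      define E where "E l = (\<Sum>i<m. D l j i (Y t) * A k i (Y t))" for l
      \<comment> \<open>Commutation enters here: the derivative of \<open>A k\<close> along the
        curve is rewritten through the derivatives of the fields \<open>A l\<close> in direction
        \<open>A k\<close>, which is the linearised equation.\<close>
      have swap: "(\<Sum>i<m. D k j i (Y t) * b x i (Y t)) = (\<Sum>l<r. E l * x l)"
      proof -
        have "(\<Sum>i<m. D k j i (Y t) * b x i (Y t)) = (\<Sum>i<m. \<Sum>l<r. D k j i (Y t) * A l i (Y t) * x l)"
          by (simp add: b_def sum_distrib_left mult.assoc)
        also have "\<dots> = (\<Sum>l<r. \<Sum>i<m. D k j i (Y t) * A l i (Y t) * x l)" by (rule sum.swap)
        also have "\<dots> = (\<Sum>l<r. (\<Sum>i<m. D k j i (Y t) * A l i (Y t)) * x l)" by (simp add: sum_distrib_right)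
        also have "\<dots> = (\<Sum>l<r. E l * x l)"
          using comm[of "Y t" _ k j] YB \<rho>(2) k j by (intro sum.cong) (auto simp: D_def B_def E_def)
        finally show ?thesis .
      qed
      have bx': "b x' j z = b x j z + s * A k j z" for z
      proof -
        have "b x' j z - b x j z = (\<Sum>l<r. A l j z * (x' l - x l))"
          by (simp add: b_def right_diff_distrib sum_subtractf)
        also have "\<dots> = (\<Sum>l<r. if l = k then A k j z * s else 0)"
          by (intro sum.cong) (auto simp: x'_def)
        finally show ?thesis using k by (simp add: algebra_simps)
      qed
      have TU: "T l + U l = A l j (X t) - A l j (Y t) - (t * s) * E l" for l
        by (simp add: E_def T_def U_def W_def right_diff_distrib sum_subtractf sum_distrib_left mult_ac)
      have "W' t j = (\<Sum>l<r. (T l + U l) * x l) + s * (A k j (X t) - A k j (Y t))"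
        unfolding W'_def swap bx' TU
        by (simp add: b_def left_diff_distrib right_diff_distrib sum_subtractf sum_distrib_left mult.assoc)
      also have "\<dots> = (\<Sum>l<r. T l * x l) + (\<Sum>l<r. U l * x l) + s * (A k j (X t) - A k j (Y t))"
        by (simp add: distrib_right sum.distrib)
      also have "\<bar>\<dots>\<bar> \<le> (M * (n t)\<^sup>2) * \<delta> + (M * l1 m (W t)) * \<delta> + \<bar>s\<bar> * (M * n t)"
      proof -
        have "\<bar>\<Sum>l<r. T l * x l\<bar> \<le> (M * (n t)\<^sup>2) * l1 r x"
          unfolding T_def n_def by (intro abs_sum_mult_le taylor j XB YB)
        then have 1: "\<bar>\<Sum>l<r. T l * x l\<bar> \<le> (M * (n t)\<^sup>2) * \<delta>"
          by (rule order_trans) (use x M in \<open>auto simp: S_def intro!: mult_left_mono\<close>)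
        have "\<bar>\<Sum>l<r. U l * x l\<bar> \<le> (M * l1 m (W t)) * l1 r x"
          unfolding U_def by (intro abs_sum_mult_le bD j YB)
        then have 2: "\<bar>\<Sum>l<r. U l * x l\<bar> \<le> (M * l1 m (W t)) * \<delta>"
          by (rule order_trans) (use x M l1_nonneg in \<open>auto simp: S_def intro!: mult_left_mono\<close>)
        have 3: "\<bar>s * (A k j (X t) - A k j (Y t))\<bar> \<le> \<bar>s\<bar> * (M * n t)"
          unfolding abs_mult n_def by (intro mult_left_mono lipA k j XB YB) auto
        show ?thesis using 1 2 3 by linarith
      qed
      also have "\<dots> \<le> M * \<delta> * l1 m (W t) + C * s\<^sup>2"
      proof -
        have n0: "0 \<le> n t" by (simp add: n_def l1_nonneg)
        have "(n t)\<^sup>2 \<le> (2 * real m * M * \<bar>s\<bar>)\<^sup>2" by (rule power_mono[OF nb[OF t] n0])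
        then have "(M * (n t)\<^sup>2) * \<delta> \<le> (M * (2 * real m * M * \<bar>s\<bar>)\<^sup>2) * \<delta>"
          using M \<delta> by (intro mult_right_mono mult_left_mono) auto
        moreover have "\<bar>s\<bar> * (M * n t) \<le> \<bar>s\<bar> * (M * (2 * real m * M * \<bar>s\<bar>))"
          using M nb[OF t] by (intro mult_left_mono) auto
        moreover have "(M * (2 * real m * M * \<bar>s\<bar>)\<^sup>2) * \<delta> + \<bar>s\<bar> * (M * (2 * real m * M * \<bar>s\<bar>)) = C * s\<^sup>2"
          by (simp add: C_def power_mult_distrib power2_eq_square algebra_simps)
        ultimately show ?thesis by (simp add: mult_ac)
      qed
      finally show "\<bar>W' t j\<bar> \<le> M * \<delta> * l1 m (W t) + C * s\<^sup>2" .
    next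
      show "W 0 j = 0" for j using g(1)[OF x] g(1)[OF x'S] by (simp add: W_def X_def Y_def)
      show "0 \<le> C * s\<^sup>2" using M \<delta> by (simp add: C_def)
    qed (use M \<delta> \<delta>M(2) in auto)
    moreover have "\<bar>W 1 j\<bar> \<le> l1 m (W 1)" unfolding l1_def using j by (intro member_le_sum) auto
    ultimately show ?thesis by (simp add: W_def X_def Y_def x'_def)
  qed
  \<comment> \<open>Makes the cube \<open>Q\<close> lie in the l1 ball \<open>S\<close>; the added 1
    covers \<open>r = 0\<close>.\<close>
  define e where "e = \<delta> / (real r + 1)"
  have e: "e > 0" using \<delta> by (simp add: e_def)
  define Q where "Q = ebox r (\<lambda>_. 0) e"
  have QS: "x \<in> S" if "x \<in> Q" for x
  proof -
    have "l1 r x \<le> real r * e" using that by (intro l1_bound) (auto simp: Q_def ebox_def intro: less_imp_le)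
    also have "\<dots> \<le> \<delta>" using \<delta> by (simp add: e_def field_simps)
    finally show ?thesis by (simp add: S_def)
  qed
  have Qo: "eopen r Q" unfolding Q_def by (rule eopen_ebox)
  define G where "G x = g x 1" for x
  have GB: "G x \<in> B" if "x \<in> Q" for x using g(2)[OF QS[OF that]] by (simp add: G_def)
  have Bo: "eopen m B" unfolding B_def by (rule eopen_ebox)
  have hp: "hpd k (\<lambda>x. G x j) (A k j (G x)) x" if x: "x \<in> Q" and k: "k < r" and j: "j < m" for x k j
  proof -
    obtain d where d: "d > 0" "\<And>t. \<bar>t - x k\<bar> < d \<Longrightarrow> x(k := t) \<in> Q" using eopen_upd[OF Qo x k] by metis
    define \<phi> where "\<phi> s = (G (x(k := x k + s)) j - G (x(k := x k)) j) / s - A k j (G x)" for s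
    have "\<bar>\<phi> s\<bar> \<le> 2 * real m * C * \<bar>s\<bar>" if "s \<noteq> 0" "\<bar>s\<bar> < d" for s
    proof -
      have "x(k := x k + s) \<in> S" using d(2)[of "x k + s"] that QS by simp
      from key[OF QS[OF x] this k j]
      have "\<bar>G (x(k := x k + s)) j - G x j - s * A k j (G x)\<bar> \<le> (2 * real m * C * \<bar>s\<bar>) * \<bar>s\<bar>"
        by (simp add: G_def power2_eq_square mult_ac abs_mult_self_eq)
      moreover have "\<phi> s * s = G (x(k := x k + s)) j - G x j - s * A k j (G x)" using that by (simp add: \<phi>_def field_simps)
      ultimately have "\<bar>\<phi> s\<bar> * \<bar>s\<bar> \<le> (2 * real m * C * \<bar>s\<bar>) * \<bar>s\<bar>" by (metis abs_mult)
      then show ?thesis using that by simp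
    qed
    then have "eventually (\<lambda>s. norm (\<phi> s) \<le> 2 * real m * C * \<bar>s\<bar>) (at 0)"
      unfolding eventually_at using d(1) by (intro exI[of _ d]) (auto simp: dist_real_def)
    moreover have "((\<lambda>s. 2 * real m * C * \<bar>s\<bar>) \<longlongrightarrow> 0) (at 0)"
      by (rule tendsto_eq_intros refl)+ simp
    ultimately have "(\<phi> \<longlongrightarrow> 0) (at 0)" by (rule Lim_null_comparison)
    then have "((\<lambda>s. (G (x(k := x k + s)) j - G (x(k := x k)) j) / s) \<longlongrightarrow> A k j (G x)) (at 0)"
      unfolding \<phi>_def by (simp add: LIM_zero_iff)
    then show ?thesis unfolding hpd_def DERIV_def .
  qed
  have cG: "continuous_on Q (\<lambda>x. G x j)" if j: "j < m" for j
  proof (rule continuous_on_eboxI[OF eopen_subset[OF Qo]])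
    fix x and \<epsilon> :: real assume x: "x \<in> Q" and \<epsilon>: "\<epsilon> > 0"
    define d where "d = \<epsilon> / (2 * real m * M * (real r + 1) + 1)"
    have den: "2 * real m * M * (real r + 1) + 1 > 0" using M by (intro add_nonneg_pos mult_nonneg_nonneg) auto
    have d: "d > 0" using den \<epsilon> by (simp add: d_def)
    have "\<bar>G y j - G x j\<bar> < \<epsilon>" if y: "y \<in> Q" "y \<in> ebox r x d" for y
    proof -
      have "\<bar>G y j - G x j\<bar> \<le> l1 m (\<lambda>j. G y j - G x j)" unfolding l1_def using j by (intro member_le_sum) auto
      also have "\<dots> \<le> 2 * real m * (M * l1 r (\<lambda>l. y l - x l))"
        unfolding G_def by (rule lipg[OF QS[OF x] QS[OF y(1)]]) simp
      also have "\<dots> \<le> 2 * real m * (M * (real r * d))"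
        using M y(2) by (intro mult_left_mono l1_bound) (auto simp: ebox_def intro: less_imp_le)
      also have "\<dots> \<le> (2 * real m * M * (real r + 1)) * d"
        using d M by (simp add: algebra_simps)
      also have "\<dots> < (2 * real m * M * (real r + 1) + 1) * d" using d by simp
      also have "\<dots> = \<epsilon>" using den by (simp add: d_def)
      finally show ?thesis .
    qed
    then show "\<exists>d>0. \<forall>y\<in>Q \<inter> ebox r x d. \<bar>G y j - G x j\<bar> < \<epsilon>" using d by blast
  qed
  have "smooth_on r Q (\<lambda>x. G x j)" if "j < m" for j
    by (rule smooth_on_bootstrap[OF Qo V _ cG hp A that]) (use GB \<rho>(2) in \<open>auto simp: B_def\<close>)
  then have "smooth_mapping r Q m V G"
    using Qo V GB \<rho>(2) by (auto simp: smooth_mapping_def B_def)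
  moreover have "G (\<lambda>_. 0) = p"
  proof -
    \<comment> \<open>For the zero parameter the field vanishes and the curve stays at
      \<open>p\<close>.\<close>
    have z: "(\<lambda>_. 0) \<in> S" using \<delta> by (simp add: S_def l1_def)
    have "l1 m (\<lambda>j. g (\<lambda>_. 0) 1 j - p j) \<le> 2 * real m * 0"
    proof (rule gronwall_unit_interval[where w = "\<lambda>t j. g (\<lambda>_. 0) t j - p j" and w' = "\<lambda>t j. 0" and K = 0])
      show "((\<lambda>t. g (\<lambda>_. 0) t j - p j) has_real_derivative 0) (at t within {0..1})" if "t \<in> {0..1}" "j < m" for t j
        using DERIV_diff[OF g(3)[OF z that] DERIV_const[of "p j"]] by (simp add: b_def)
    qed (use g(1)[OF z] in auto)
    then have "(\<Sum>j<m. \<bar>g (\<lambda>_. 0) 1 j - p j\<bar>) = 0" using l1_nonneg by (metis l1_def mult_zero_right order_antisym)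
    then have "\<forall>j<m. g (\<lambda>_. 0) 1 j = p j" by (simp add: sum_nonneg_eq_0_iff)
    moreover have "g (\<lambda>_. 0) 1 \<in> ES m" using g(2)[OF z, of 1] by (simp add: B_def ebox_def)
    ultimately show ?thesis using pE unfolding G_def ES_def by (intro ext) (metis (mono_tags, lifting) mem_Collect_eq not_le)
  qed
  ultimately show ?thesis using that[of e G] e hp unfolding Q_def by blast
qed

section \<open>Smooth functions on manifolds\<close>

lemma chart_openin: "is_manifold M \<Longrightarrow> (U, \<phi>) \<in> atlas M \<Longrightarrow> openin (mtop M) U"
  and chart_eopen: "is_manifold M \<Longrightarrow> (U, \<phi>) \<in> atlas M \<Longrightarrow> eopen (mdim M) (\<phi> ` U)"
  and chart_homeo: "is_manifold M \<Longrightarrow> (U, \<phi>) \<in> atlas M \<Longrightarrow>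
     homeomorphic_map (subtopology (mtop M) U) (subtopology (Euclidean_space (mdim M)) (\<phi> ` U)) \<phi>"
  by (auto simp: is_manifold_def)

lemma chart_transition:
  assumes "is_manifold M" "(U, \<phi>) \<in> atlas M" "(V, \<psi>) \<in> atlas M" "j < mdim M"
  shows "smooth_on (mdim M) (\<phi> ` (U \<inter> V)) (\<lambda>x. \<psi> (inv_into U \<phi> x) j)"
proof -
  have "\<forall>(U, \<phi>)\<in>atlas M. \<forall>(V, \<psi>)\<in>atlas M. \<forall>j<mdim M.
        smooth_on (mdim M) (\<phi> ` (U \<inter> V)) (\<lambda>x. \<psi> (inv_into U \<phi> x) j)"
    using assms(1) unfolding is_manifold_def by (elim conjE)
  from bspec[OF this assms(2)] have "\<forall>(V, \<psi>)\<in>atlas M. \<forall>j<mdim M.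
        smooth_on (mdim M) (\<phi> ` (U \<inter> V)) (\<lambda>x. \<psi> (inv_into U \<phi> x) j)" by simp
  from bspec[OF this assms(3)] assms(4) show ?thesis by simp
qed

lemma smooth_on_eq: "smooth_on n V f \<Longrightarrow> eopen n V \<Longrightarrow> (\<And>x. x \<in> V \<Longrightarrow> f x = g x) \<Longrightarrow> smooth_on n V g"
  using smooth_on_cong by blast

lemma chart_subset: "is_manifold M \<Longrightarrow> (U, \<phi>) \<in> atlas M \<Longrightarrow> U \<subseteq> points M"
  using chart_openin openin_subset by blast

lemma chart_inj:
  assumes "is_manifold M" "(U, \<phi>) \<in> atlas M" shows "inj_on \<phi> U"
  using homeomorphic_imp_injective_map[OF chart_homeo[OF assms]] chart_subset[OF assms]
  by (simp add: inf.absorb2)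

lemma chart_inv: "is_manifold M \<Longrightarrow> (U, \<phi>) \<in> atlas M \<Longrightarrow> q \<in> U \<Longrightarrow> inv_into U \<phi> (\<phi> q) = q"
  by (rule inv_into_f_f[OF chart_inj])

lemma chart_exists:
  assumes "is_manifold M" "p \<in> points M"
  obtains U \<phi> where "(U, \<phi>) \<in> atlas M" "p \<in> U"
  using assms unfolding is_manifold_def by blast

lemma chart_image_eopen:
  assumes M: "is_manifold M" "(U, \<phi>) \<in> atlas M" and W: "openin (mtop M) W" "W \<subseteq> U"
  shows "eopen (mdim M) (\<phi> ` W)"
proof -
  have "openin (subtopology (mtop M) U) W"
    using W chart_openin[OF M] by (simp add: openin_open_subtopology)
  then have "openin (subtopology (Euclidean_space (mdim M)) (\<phi> ` U)) (\<phi> ` W)"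
    using homeomorphic_imp_open_map[OF chart_homeo[OF M]] unfolding open_map_def by blast
  then show ?thesis using chart_eopen[OF M] by (simp add: openin_open_subtopology)
qed

lemma chart_image_eopen_Int:
  assumes M: "is_manifold M" "(U, \<phi>) \<in> atlas M" and W: "openin (mtop M) W"
  shows "eopen (mdim M) (\<phi> ` (U \<inter> W))"
  using chart_image_eopen[OF M] W chart_openin[OF M] by (simp add: openin_Int)

lemma chart_preimage_openin:
  assumes M: "is_manifold M" "(U, \<phi>) \<in> atlas M" and W: "eopen (mdim M) W"
  shows "openin (mtop M) {q \<in> U. \<phi> q \<in> W}"
proof -
  have c: "continuous_map (subtopology (mtop M) U) (subtopology (Euclidean_space (mdim M)) (\<phi> ` U)) \<phi>"
    by (rule homeomorphic_imp_continuous_map[OF chart_homeo[OF M]])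
  have "openin (subtopology (Euclidean_space (mdim M)) (\<phi> ` U)) (W \<inter> \<phi> ` U)"
    using W chart_eopen[OF M] by (simp add: openin_open_subtopology openin_Int)
  note pre = openin_continuous_map_preimage[OF c this]
  have "openin (subtopology (mtop M) U) {q \<in> U. \<phi> q \<in> W}"
  proof -
    have "{x \<in> topspace (subtopology (mtop M) U). \<phi> x \<in> W \<inter> \<phi> ` U} = {q \<in> U. \<phi> q \<in> W}" using chart_subset[OF M] by auto
    then show ?thesis using pre by simp
  qed
  then show ?thesis using chart_openin[OF M] by (simp add: openin_open_subtopology)
qed

lemma chart_image_inv:
  assumes M: "is_manifold M" "(U, \<phi>) \<in> atlas M" and "x \<in> \<phi> ` (U \<inter> W)"
  shows "inv_into U \<phi> x \<in> U \<inter> W" "\<phi> (inv_into U \<phi> x) = x"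
  using assms chart_inj[OF M] by auto

text \<open>One chart per point suffices: in any other chart the function is composed with a smooth
  transition map.\<close>

lemma smooth_fun_onI:
  assumes M: "is_manifold M" and W: "openin (mtop M) W"
    and loc: "\<And>p. p \<in> W \<Longrightarrow> \<exists>U \<phi> W'. (U, \<phi>) \<in> atlas M \<and> openin (mtop M) W' \<and> p \<in> W' \<and> W' \<subseteq> U \<and>
       smooth_on (mdim M) (\<phi> ` W') (\<lambda>x. f (inv_into U \<phi> x))"
  shows "smooth_fun_on M W f"
  unfolding smooth_fun_on_def
proof (clarify)
  fix V \<psi> assume V: "(V, \<psi>) \<in> atlas M"
  show "smooth_on (mdim M) (\<psi> ` (V \<inter> W)) (\<lambda>x. f (inv_into V \<psi> x))"
  proof (rule smooth_on_local[OF chart_image_eopen_Int[OF M V W]])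
    fix x assume x: "x \<in> \<psi> ` (V \<inter> W)"
    define p where "p = inv_into V \<psi> x"
    have p: "p \<in> V" "p \<in> W" "\<psi> p = x" using chart_image_inv[OF M V x] by (auto simp: p_def)
    obtain U \<phi> W' where U: "(U, \<phi>) \<in> atlas M" and W': "openin (mtop M) W'" "p \<in> W'" "W' \<subseteq> U"
      and sm: "smooth_on (mdim M) (\<phi> ` W') (\<lambda>x. f (inv_into U \<phi> x))" using loc[OF p(2)] by blast
    have o: "eopen (mdim M) (\<psi> ` (V \<inter> W'))" by (rule chart_image_eopen_Int[OF M V W'(1)])
    have "smooth_on (mdim M) (\<psi> ` (V \<inter> W')) (\<lambda>x. f (inv_into U \<phi> (\<phi> (inv_into V \<psi> x))))"
    proof (rule smooth_on_compose[OF chart_image_eopen[OF M U W'(1,3)] o _ sm])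
      show "\<phi> (inv_into V \<psi> x) \<in> \<phi> ` W'" if "x \<in> \<psi> ` (V \<inter> W')" for x
        using chart_image_inv[OF M V that] by blast
      show "smooth_on (mdim M) (\<psi> ` (V \<inter> W')) (\<lambda>x. \<phi> (inv_into V \<psi> x) j)" if "j < mdim M" for j
        by (rule smooth_on_subset[OF chart_image_eopen_Int[OF M V chart_openin[OF M U]] o _ chart_transition[OF M V U that]])
          (use W'(3) in blast)
    qed
    moreover have "f (inv_into U \<phi> (\<phi> (inv_into V \<psi> x))) = f (inv_into V \<psi> x)" if "x \<in> \<psi> ` (V \<inter> W')" for x
      using chart_image_inv[OF M V that] W'(3) chart_inv[OF M U] by auto
    ultimately have "smooth_on (mdim M) (\<psi> ` (V \<inter> W')) (\<lambda>x. f (inv_into V \<psi> x))"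
      by (rule smooth_on_eq[OF _ o])
    then show "\<exists>T. eopen (mdim M) T \<and> x \<in> T \<and> smooth_on (mdim M) T (\<lambda>x. f (inv_into V \<psi> x))"
      using o p W' by blast
  qed
qed

lemma smooth_fun_onD:
  "smooth_fun_on M W f \<Longrightarrow> (U, \<phi>) \<in> atlas M \<Longrightarrow> smooth_on (mdim M) (\<phi> ` (U \<inter> W)) (\<lambda>x. f (inv_into U \<phi> x))"
  by (auto simp: smooth_fun_on_def)

lemma smooth_fun_onD_subset:
  assumes M: "is_manifold M" and f: "smooth_fun_on M W f" and W: "openin (mtop M) W" and U: "(U, \<phi>) \<in> atlas M"
    and T: "eopen (mdim M) T" "T \<subseteq> \<phi> ` (U \<inter> W)"
  shows "smooth_on (mdim M) T (\<lambda>x. f (inv_into U \<phi> x))"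
  by (rule smooth_on_subset[OF chart_image_eopen_Int[OF M U W] T smooth_fun_onD[OF f U]])

lemma smooth_fun_on_subset:
  assumes M: "is_manifold M" and "openin (mtop M) W" "openin (mtop M) W'" "W' \<subseteq> W" "smooth_fun_on M W f"
  shows "smooth_fun_on M W' f"
  unfolding smooth_fun_on_def
  using smooth_fun_onD_subset[OF M assms(5,2)] chart_image_eopen_Int[OF M _ assms(3)] assms(4) by blast

lemma smooth_fun_on_local:
  assumes M: "is_manifold M" and W: "openin (mtop M) W"
    and loc: "\<And>p. p \<in> W \<Longrightarrow> \<exists>W'. openin (mtop M) W' \<and> p \<in> W' \<and> smooth_fun_on M W' f"
  shows "smooth_fun_on M W f"
proof (rule smooth_fun_onI[OF M W])
  fix p assume p: "p \<in> W"
  then have "p \<in> points M" using W openin_subset by blast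
  then obtain U \<phi> where U: "(U, \<phi>) \<in> atlas M" "p \<in> U" using chart_exists[OF M] by blast
  obtain W' where W': "openin (mtop M) W'" "p \<in> W'" "smooth_fun_on M W' f" using loc[OF p] by blast
  show "\<exists>U \<phi> W'. (U, \<phi>) \<in> atlas M \<and> openin (mtop M) W' \<and> p \<in> W' \<and> W' \<subseteq> U \<and>
       smooth_on (mdim M) (\<phi> ` W') (\<lambda>x. f (inv_into U \<phi> x))"
    using U W' smooth_fun_onD[OF W'(3) U(1)] chart_openin[OF M U(1)]
    by (intro exI[of _ U] exI[of _ \<phi>] exI[of _ "U \<inter> W'"]) (auto simp: openin_Int)
qed

lemma smooth_fun_on_cong:
  assumes M: "is_manifold M" and W: "openin (mtop M) W" and "\<And>q. q \<in> W \<Longrightarrow> f q = g q"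
  shows "smooth_fun_on M W f \<longleftrightarrow> smooth_fun_on M W g"
proof -
  have "smooth_on (mdim M) (\<phi> ` (U \<inter> W)) (\<lambda>x. f (inv_into U \<phi> x)) \<longleftrightarrow> smooth_on (mdim M) (\<phi> ` (U \<inter> W)) (\<lambda>x. g (inv_into U \<phi> x))"
    if "(U, \<phi>) \<in> atlas M" for U \<phi>
    by (rule smooth_on_cong[OF chart_image_eopen_Int[OF M that W]]) (use chart_image_inv(1)[OF M that] assms(3) in blast)
  then show ?thesis by (force simp: smooth_fun_on_def)
qed

lemma smooth_fun_on_const: "is_manifold M \<Longrightarrow> openin (mtop M) W \<Longrightarrow> smooth_fun_on M W (\<lambda>_. c)"
  by (auto simp: smooth_fun_on_def intro: smooth_on_const chart_image_eopen_Int)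

lemma smooth_fun_on_add: "is_manifold M \<Longrightarrow> openin (mtop M) W \<Longrightarrow> smooth_fun_on M W f \<Longrightarrow> smooth_fun_on M W g \<Longrightarrow>
  smooth_fun_on M W (\<lambda>q. f q + g q)"
  unfolding smooth_fun_on_def by (auto intro!: smooth_on_add chart_image_eopen_Int)

lemma smooth_fun_on_mult: "is_manifold M \<Longrightarrow> openin (mtop M) W \<Longrightarrow> smooth_fun_on M W f \<Longrightarrow> smooth_fun_on M W g \<Longrightarrow>
  smooth_fun_on M W (\<lambda>q. f q * g q)"
  unfolding smooth_fun_on_def by (auto intro!: smooth_on_mult chart_image_eopen_Int)

lemma smooth_fun_on_sum: "is_manifold M \<Longrightarrow> openin (mtop M) W \<Longrightarrow> finite J \<Longrightarrow> (\<And>j. j \<in> J \<Longrightarrow> smooth_fun_on M W (f j)) \<Longrightarrow>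
  smooth_fun_on M W (\<lambda>q. \<Sum>j\<in>J. f j q)"
  unfolding smooth_fun_on_def by (auto intro!: smooth_on_sum chart_image_eopen_Int)

lemma smooth_fun_on_inverse: "is_manifold M \<Longrightarrow> openin (mtop M) W \<Longrightarrow> smooth_fun_on M W f \<Longrightarrow> (\<And>q. q \<in> W \<Longrightarrow> f q \<noteq> 0) \<Longrightarrow>
  smooth_fun_on M W (\<lambda>q. inverse (f q))"
  unfolding smooth_fun_on_def
proof (clarify)
  fix U \<phi> assume a: "is_manifold M" "openin (mtop M) W" "\<And>q. q \<in> W \<Longrightarrow> f q \<noteq> 0" "(U, \<phi>) \<in> atlas M"
    and b: "\<forall>(U, \<phi>)\<in>atlas M. smooth_on (mdim M) (\<phi> ` (U \<inter> W)) (\<lambda>x. f (inv_into U \<phi> x))"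
  show "smooth_on (mdim M) (\<phi> ` (U \<inter> W)) (\<lambda>x. inverse (f (inv_into U \<phi> x)))"
    by (rule smooth_on_inverse[OF chart_image_eopen_Int[OF a(1,4,2)]])
       (use b a(4) a(3) chart_image_inv(1)[OF a(1,4)] in auto)
qed

lemma smooth_fun_on_compose:
  assumes M: "is_manifold M" and W: "openin (mtop M) W" and T: "eopen n T" and G: "\<And>q. q \<in> W \<Longrightarrow> G q \<in> T"
    and F: "smooth_on n T F" and Gj: "\<And>j. j < n \<Longrightarrow> smooth_fun_on M W (\<lambda>q. G q j)"
  shows "smooth_fun_on M W (\<lambda>q. F (G q))"
  unfolding smooth_fun_on_def
proof (clarify)
  fix U \<phi> assume U: "(U, \<phi>) \<in> atlas M"
  show "smooth_on (mdim M) (\<phi> ` (U \<inter> W)) (\<lambda>x. F (G (inv_into U \<phi> x)))"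
    by (rule smooth_on_compose[OF T chart_image_eopen_Int[OF M U W] _ F smooth_fun_onD[OF Gj U]])
       (use G chart_image_inv(1)[OF M U] in blast)
qed

lemma smooth_fun_on_coord:
  assumes M: "is_manifold M" and U: "(U, \<phi>) \<in> atlas M"
  shows "smooth_fun_on M U (\<lambda>q. \<phi> q j)"
proof (rule smooth_fun_onI[OF M chart_openin[OF M U]])
  fix p assume p: "p \<in> U"
  have o: "eopen (mdim M) (\<phi> ` U)" by (rule chart_eopen[OF M U])
  have "smooth_on (mdim M) (\<phi> ` U) (\<lambda>x. \<phi> (inv_into U \<phi> x) j)"
    using smooth_on_cong[OF o, of "\<lambda>x. \<phi> (inv_into U \<phi> x) j" "\<lambda>x. x j"] smooth_on_coord[OF o]
    by (simp add: f_inv_into_f)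
  then show "\<exists>U \<phi>' W'. (U, \<phi>') \<in> atlas M \<and> openin (mtop M) W' \<and> p \<in> W' \<and> W' \<subseteq> U \<and>
       smooth_on (mdim M) (\<phi>' ` W') (\<lambda>x. \<phi> (inv_into U \<phi>' x) j)"
    using U p chart_openin[OF M U] by blast
qed

lemma smooth_fun_on_coord_subset:
  "is_manifold M \<Longrightarrow> (U, \<phi>) \<in> atlas M \<Longrightarrow> openin (mtop M) W \<Longrightarrow> W \<subseteq> U \<Longrightarrow> smooth_fun_on M W (\<lambda>q. \<phi> q j)"
  by (rule smooth_fun_on_subset[OF _ _ _ _ smooth_fun_on_coord]) (auto intro: chart_openin)

text \<open>Continuity of the chart representation, carried back by the chart. It provides the open
  sets on which a pivot is non-zero or a bump function exceeds 1/2.\<close>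

lemma smooth_fun_on_preimage_openin:
  assumes M: "is_manifold M" and W: "openin (mtop M) W" and f: "smooth_fun_on M W f" and S: "open S"
  shows "openin (mtop M) {q \<in> W. f q \<in> S}"
proof (subst openin_subopen, intro ballI)
  fix p assume p: "p \<in> {q \<in> W. f q \<in> S}"
  then have "p \<in> points M" using W openin_subset by blast
  then obtain U \<phi> where U: "(U, \<phi>) \<in> atlas M" "p \<in> U" using chart_exists[OF M] by blast
  let ?V = "\<phi> ` (U \<inter> W)"
  let ?f = "\<lambda>x. f (inv_into U \<phi> x)"
  have V: "eopen (mdim M) ?V" by (rule chart_image_eopen_Int[OF M U(1) W])
  have c: "continuous_on ?V ?f" by (rule smooth_on_continuous[OF V smooth_fun_onD[OF f U(1)]])
  then obtain A where A: "open A" "A \<inter> ?V = ?f -` S \<inter> ?V" using S unfolding continuous_on_open_invariant by blast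
  obtain B where B: "open B" "?V = ES (mdim M) \<inter> B" using V unfolding eopen_open by blast
  have "eopen (mdim M) (A \<inter> ?V)"
    unfolding eopen_open by (rule exI[of _ "A \<inter> B"]) (use A B in auto)
  then have "openin (mtop M) {q \<in> U. \<phi> q \<in> A \<inter> ?V}" by (rule chart_preimage_openin[OF M U(1)])
  moreover have "p \<in> {q \<in> U. \<phi> q \<in> A \<inter> ?V}" using A(2) p U chart_inv[OF M U(1)] by auto
  moreover have "{q \<in> U. \<phi> q \<in> A \<inter> ?V} \<subseteq> {q \<in> W. f q \<in> S}"
  proof
    fix q assume "q \<in> {q \<in> U. \<phi> q \<in> A \<inter> ?V}"
    then have q: "q \<in> U" "\<phi> q \<in> ?V" "?f (\<phi> q) \<in> S" using A(2) by auto
    then have "inv_into U \<phi> (\<phi> q) \<in> W" using chart_image_inv(1)[OF M U(1) q(2)] by blast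
    then show "q \<in> {q \<in> W. f q \<in> S}" using q chart_inv[OF M U(1) q(1)] by simp
  qed
  ultimately show "\<exists>T. openin (mtop M) T \<and> p \<in> T \<and> T \<subseteq> {q \<in> W. f q \<in> S}" by blast
qed

subsection \<open>The algebra of smooth functions and bump functions\<close>

lemma points_openin [simp]: "openin (mtop M) (points M)"
  by simp

lemma C_inf_smooth: "f \<in> C_inf M \<Longrightarrow> smooth_fun_on M (points M) f"
  by (simp add: C_inf_def)

lemma C_inf_smooth_on: "is_manifold M \<Longrightarrow> f \<in> C_inf M \<Longrightarrow> openin (mtop M) W \<Longrightarrow> smooth_fun_on M W f"
  using smooth_fun_on_subset[OF _ points_openin] C_inf_smooth openin_subset by metis

lemma C_inf_restrict: "is_manifold M \<Longrightarrow> smooth_fun_on M (points M) f \<Longrightarrow> (\<lambda>q\<in>points M. f q) \<in> C_inf M"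
  using smooth_fun_on_cong[OF _ points_openin, of M "\<lambda>q\<in>points M. f q" f] by (simp add: C_inf_def)

lemma C_inf_const: "is_manifold M \<Longrightarrow> (\<lambda>q\<in>points M. c) \<in> C_inf M"
  by (intro C_inf_restrict smooth_fun_on_const) auto

lemma C_inf_add: "is_manifold M \<Longrightarrow> f \<in> C_inf M \<Longrightarrow> g \<in> C_inf M \<Longrightarrow> (\<lambda>q\<in>points M. f q + g q) \<in> C_inf M"
  by (intro C_inf_restrict smooth_fun_on_add C_inf_smooth) auto

lemma C_inf_mult: "is_manifold M \<Longrightarrow> f \<in> C_inf M \<Longrightarrow> g \<in> C_inf M \<Longrightarrow> (\<lambda>q\<in>points M. f q * g q) \<in> C_inf M"
  by (intro C_inf_restrict smooth_fun_on_mult C_inf_smooth) auto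

lemma C_inf_scale: "is_manifold M \<Longrightarrow> f \<in> C_inf M \<Longrightarrow> (\<lambda>q\<in>points M. c * f q) \<in> C_inf M"
  by (intro C_inf_restrict smooth_fun_on_mult smooth_fun_on_const C_inf_smooth) auto

lemma compact_cube: "compact {x \<in> ES n. \<forall>i<n. \<bar>x i - p i\<bar> \<le> e}"
proof -
  have "compactin (powertop_real UNIV) (\<Pi>\<^sub>E i\<in>UNIV. if i < n then {p i - e..p i + e} else {0})"
    by (subst compactin_PiE) auto
  moreover have "(\<Pi>\<^sub>E i\<in>UNIV. if i < n then {p i - e..p i + e} else {0}) = {x \<in> ES n. \<forall>i<n. \<bar>x i - p i\<bar> \<le> e}"
  proof (rule Set.set_eqI)
    fix x :: "nat \<Rightarrow> real"
    have "x \<in> (\<Pi>\<^sub>E i\<in>UNIV. if i < n then {p i - e..p i + e} else {0}) \<longleftrightarrow> (\<forall>i. x i \<in> (if i < n then {p i - e..p i + e} else {0}))"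
      by (simp add: PiE_iff)
    also have "\<dots> \<longleftrightarrow> (\<forall>i. (i < n \<longrightarrow> \<bar>x i - p i\<bar> \<le> e) \<and> (i \<ge> n \<longrightarrow> x i = 0))"
      by (intro all_cong1) (auto simp: abs_le_iff)
    finally show "x \<in> (\<Pi>\<^sub>E i\<in>UNIV. if i < n then {p i - e..p i + e} else {0}) \<longleftrightarrow> x \<in> {x \<in> ES n. \<forall>i<n. \<bar>x i - p i\<bar> \<le> e}"
      unfolding ES_def by blast
  qed
  ultimately show ?thesis by (simp add: euclidean_product_topology)
qed

text \<open>The closed set \<open>K\<close> inside \<open>W\<close> carries the support, so that
  products with functions defined only on \<open>W\<close> extend by 0.\<close>

lemma bump_function:
  assumes M: "is_manifold M" and W: "openin (mtop M) W" and p: "p \<in> W"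
  obtains \<beta> K B where "\<beta> \<in> C_inf M" "openin (mtop M) B" "p \<in> B" "\<forall>q\<in>B. \<beta> q = 1"
    "closedin (mtop M) K" "K \<subseteq> W" "B \<subseteq> K" "\<forall>q\<in>points M - K. \<beta> q = 0"
proof -
  have pM: "p \<in> points M" using p W openin_subset by blast
  obtain U \<phi> where U: "(U, \<phi>) \<in> atlas M" "p \<in> U" using chart_exists[OF M pM] .
  let ?n = "mdim M"
  have o: "eopen ?n (\<phi> ` (U \<inter> W))" by (rule chart_image_eopen_Int[OF M U(1) W])
  obtain e where e: "e > 0" "ebox ?n (\<phi> p) e \<subseteq> \<phi> ` (U \<inter> W)" using eopen_boxE[OF o] U p by blast
  have pE: "\<phi> p \<in> ES ?n" using U p eopen_subset[OF o] by blast
  obtain b d where b: "d > 0" "smooth_on ?n (ES ?n) b" "\<And>x. x \<in> ebox ?n (\<phi> p) d \<Longrightarrow> b x = 1"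
     "\<And>x i. b x \<noteq> 0 \<Longrightarrow> i < ?n \<Longrightarrow> \<bar>x i - \<phi> p i\<bar> \<le> e / 2"
  proof (rule smooth_bump_ES[OF pE half_gt_zero[OF e(1)]])
    fix b d assume "0 < d" "smooth_on ?n (ES ?n) b" "\<And>x. x \<in> ebox ?n (\<phi> p) d \<Longrightarrow> b x = 1"
     "\<And>x i. b x \<noteq> 0 \<Longrightarrow> i < ?n \<Longrightarrow> \<bar>x i - \<phi> p i\<bar> \<le> e / 2"
    then show thesis by (rule that)
  qed
  define C where "C = {x \<in> ES ?n. \<forall>i<?n. \<bar>x i - \<phi> p i\<bar> \<le> e / 2}"
  have CW: "C \<subseteq> \<phi> ` (U \<inter> W)" using e by (force simp: C_def ebox_def)
  define K where "K = inv_into U \<phi> ` C"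
  have KW: "K \<subseteq> U \<inter> W"
  proof
    fix q assume "q \<in> K"
    then obtain x where "x \<in> C" "q = inv_into U \<phi> x" unfolding K_def by blast
    then show "q \<in> U \<inter> W" using chart_image_inv(1)[OF M U(1), of x W] CW by blast
  qed
  \<comment> \<open>A closed cube in chart coordinates is compact, and its image is closed in all of
    \<open>M\<close>, not only in \<open>U\<close>, because \<open>M\<close> is Hausdorff.\<close>
  have "compactin (mtop M) K"
  proof -
    have "compactin (Euclidean_space ?n) C"
      unfolding Euclidean_space_ES compactin_subtopology using compact_cube[of ?n "\<phi> p" "e / 2"] by (auto simp: C_def)
    then have "compactin (subtopology (Euclidean_space ?n) (\<phi> ` U)) C"
      using CW by (auto simp: compactin_subtopology)
    moreover obtain g where g: "homeomorphic_maps (subtopology (mtop M) U) (subtopology (Euclidean_space ?n) (\<phi> ` U)) \<phi> g"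
      using chart_homeo[OF M U(1)] homeomorphic_map_maps by blast
    ultimately have "compactin (subtopology (mtop M) U) (g ` C)"
      using image_compactin unfolding homeomorphic_maps_def by blast
    moreover have "g ` C = K"
    proof -
      have "g x = inv_into U \<phi> x" if x: "x \<in> C" for x
      proof -
        obtain q where q: "q \<in> U" "x = \<phi> q" using x CW by blast
        then have "g x = q" using g chart_subset[OF M U(1)]
          unfolding homeomorphic_maps_def by (auto simp: topspace_subtopology_subset)
        then show ?thesis using q chart_inv[OF M U(1)] by simp
      qed
      then show ?thesis by (auto simp: K_def)
    qed
    ultimately show ?thesis by (simp add: compactin_subtopology)
  qed
  then have K: "closedin (mtop M) K"
    using M compactin_imp_closedin[of "mtop M" K] unfolding is_manifold_def by metis
  define f where "f q = (if q \<in> U then b (\<phi> q) else 0)" for q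
  have f0: "f q = 0" if "q \<in> points M - K" for q
  proof (rule ccontr)
    assume "f q \<noteq> 0"
    then have q: "q \<in> U" "b (\<phi> q) \<noteq> 0" by (auto simp: f_def split: if_splits)
    have "\<phi> q \<in> ES ?n" using q eopen_subset[OF chart_eopen[OF M U(1)]] by blast
    then have "\<phi> q \<in> C" using b(4)[OF q(2)] by (auto simp: C_def)
    then show False using that chart_inv[OF M U(1) q(1)] by (auto simp: K_def image_iff)
  qed
  have fs: "smooth_fun_on M (points M) f"
  proof (rule smooth_fun_on_local[OF M points_openin])
    fix q assume q: "q \<in> points M"
    show "\<exists>W'. openin (mtop M) W' \<and> q \<in> W' \<and> smooth_fun_on M W' f"
    proof (cases "q \<in> U")
      case True
      have UE: "\<phi> q \<in> ES ?n" if "q \<in> U" for q using that eopen_subset[OF chart_eopen[OF M U(1)]] by blast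
      have "smooth_fun_on M U (\<lambda>q. b (\<phi> q))"
        by (rule smooth_fun_on_compose[OF M chart_openin[OF M U(1)] eopen_ES UE b(2) smooth_fun_on_coord[OF M U(1)]])
      then have "smooth_fun_on M U f"
        using smooth_fun_on_cong[OF M chart_openin[OF M U(1)], of f "\<lambda>q. b (\<phi> q)"] by (simp add: f_def)
      then show ?thesis using True chart_openin[OF M U(1)] by blast
    next
      case False
      then have "q \<in> points M - K" using KW q by blast
      moreover have o: "openin (mtop M) (points M - K)" using K by blast
      moreover have "smooth_fun_on M (points M - K) f"
        using smooth_fun_on_cong[OF M o, of f "\<lambda>_. 0"] f0 smooth_fun_on_const[OF M o] by simp
      ultimately show ?thesis by blast
    qed
  qed
  define B where "B = {q \<in> U. \<phi> q \<in> ebox ?n (\<phi> p) (min d (e / 2))}"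
  have Bo: "openin (mtop M) B" unfolding B_def by (rule chart_preimage_openin[OF M U(1) eopen_ebox])
  have pB: "p \<in> B" using U(2) centre_in_ebox[OF pE, of "min d (e / 2)"] b(1) e(1) by (simp add: B_def)
  have f1: "f q = 1" if "q \<in> B" for q
    using that b(3)[of "\<phi> q"] by (auto simp: B_def f_def ebox_def)
  have BK: "B \<subseteq> K"
  proof
    fix q assume "q \<in> B"
    then have "q \<in> U" "\<phi> q \<in> C" by (auto simp: B_def C_def ebox_def)
    then show "q \<in> K" unfolding K_def using chart_inv[OF M U(1)] by (metis image_eqI)
  qed
  show ?thesis
  proof (rule that)
    show "(\<lambda>q\<in>points M. f q) \<in> C_inf M" by (rule C_inf_restrict[OF M fs])
    show "openin (mtop M) B" "p \<in> B" "closedin (mtop M) K" "K \<subseteq> W" "B \<subseteq> K" using Bo pB K KW BK by auto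
    show "\<forall>q\<in>B. (\<lambda>q\<in>points M. f q) q = 1" using f1 openin_subset[OF Bo] by auto
    show "\<forall>q\<in>points M - K. (\<lambda>q\<in>points M. f q) q = 0" using f0 by auto
  qed
qed

text \<open>\<open>W\<close> and the complement of \<open>K\<close> form an open cover; the extended
  product is visibly smooth on the first and 0 on the second.\<close>

lemma C_inf_cutoff:
  assumes M: "is_manifold M" and W: "openin (mtop M) W" and f: "smooth_fun_on M W f"
    and \<beta>: "\<beta> \<in> C_inf M" and K: "closedin (mtop M) K" "K \<subseteq> W" "\<forall>q\<in>points M - K. \<beta> q = 0"
  shows "(\<lambda>q\<in>points M. if q \<in> W then \<beta> q * f q else 0) \<in> C_inf M"
proof (rule C_inf_restrict[OF M smooth_fun_on_local[OF M points_openin]])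
  fix q assume q: "q \<in> points M"
  let ?h = "\<lambda>q. if q \<in> W then \<beta> q * f q else 0"
  show "\<exists>W'. openin (mtop M) W' \<and> q \<in> W' \<and> smooth_fun_on M W' ?h"
  proof (cases "q \<in> W")
    case True
    have "smooth_fun_on M W (\<lambda>q. \<beta> q * f q)"
      by (rule smooth_fun_on_mult[OF M W C_inf_smooth_on[OF M \<beta> W] f])
    then have "smooth_fun_on M W ?h" using smooth_fun_on_cong[OF M W, of ?h "\<lambda>q. \<beta> q * f q"] by simp
    then show ?thesis using True W by blast
  next
    case False
    have o: "openin (mtop M) (points M - K)" using K by blast
    moreover have "smooth_fun_on M (points M - K) ?h"
      using smooth_fun_on_cong[OF M o, of ?h "\<lambda>_. 0"] K(3) smooth_fun_on_const[OF M o] by simp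
    ultimately show ?thesis using False q K(2) by blast
  qed
qed

lemma smooth_extension:
  assumes M: "is_manifold M" and W: "openin (mtop M) W" and f: "smooth_fun_on M W f" and p: "p \<in> W"
  obtains g B where "g \<in> C_inf M" "openin (mtop M) B" "p \<in> B" "B \<subseteq> W" "\<forall>q\<in>B. g q = f q"
proof -
  obtain \<beta> K B where b: "\<beta> \<in> C_inf M" "openin (mtop M) B" "p \<in> B" "\<forall>q\<in>B. \<beta> q = 1"
    "closedin (mtop M) K" "K \<subseteq> W" "B \<subseteq> K" "\<forall>q\<in>points M - K. \<beta> q = 0" by (rule bump_function[OF M W p])
  have "B \<subseteq> points M" using openin_subset[OF b(2)] .
  then show ?thesis
    by (intro that[OF C_inf_cutoff[OF M W f b(1,5,6,8)] b(2,3)]) (use b(4,6,7) in auto)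
qed

text \<open>A bump function at \<open>p\<close> supported in a neighbourhood that avoids
  \<open>q\<close>. Equality of points of the leaf space is later proved this way.\<close>

lemma C_inf_separates:
  assumes M: "is_manifold M" and pq: "p \<in> points M" "q \<in> points M" "\<And>f. f \<in> C_inf M \<Longrightarrow> f p = f q"
  shows "p = q"
proof (rule ccontr)
  assume "p \<noteq> q"
  then obtain U V where "openin (mtop M) U" "openin (mtop M) V" "p \<in> U" "q \<in> V" "disjnt U V"
    using M pq unfolding is_manifold_def Hausdorff_space_def by blast
  then obtain \<beta> K B where b: "\<beta> \<in> C_inf M" "openin (mtop M) B" "p \<in> B" "\<forall>q\<in>B. \<beta> q = 1"
    "closedin (mtop M) K" "K \<subseteq> U" "B \<subseteq> K" "\<forall>q\<in>points M - K. \<beta> q = 0" using bump_function[OF M] by metis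
  have "q \<notin> K" using b(6) \<open>q \<in> V\<close> \<open>disjnt U V\<close> by (auto simp: disjnt_def)
  then have "\<beta> q = 0" "\<beta> p = 1" using b pq by auto
  then show False using pq(3)[OF b(1)] by simp
qed

subsection \<open>Smooth maps\<close>

lemma smooth_maps_ext: "F \<in> smooth_maps M N \<Longrightarrow> F \<in> extensional (points M)"
  by (simp add: smooth_maps_def)

lemma smooth_maps_continuous: "F \<in> smooth_maps M N \<Longrightarrow> continuous_map (mtop M) (mtop N) F"
  by (simp add: smooth_maps_def)

lemma smooth_maps_into: "F \<in> smooth_maps M N \<Longrightarrow> q \<in> points M \<Longrightarrow> F q \<in> points N"
  using smooth_maps_continuous continuous_map_funspace by fastforce

lemma smooth_maps_pullback_on:
  assumes M: "is_manifold M" and N: "is_manifold N" and F: "F \<in> smooth_maps M N"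
    and W: "openin (mtop N) W" and g: "smooth_fun_on N W g"
  shows "smooth_fun_on M {q \<in> points M. F q \<in> W} (\<lambda>q. g (F q))"
proof -
  have oF: "openin (mtop M) {q \<in> points M. F q \<in> W}" if "openin (mtop N) W" for W
    using openin_continuous_map_preimage[OF smooth_maps_continuous[OF F] that] .
  show ?thesis
  proof (rule smooth_fun_onI[OF M oF[OF W]])
    fix p assume p: "p \<in> {q \<in> points M. F q \<in> W}"
    obtain U \<phi> where U: "(U, \<phi>) \<in> atlas M" "p \<in> U" using chart_exists[OF M] p by blast
    obtain V \<psi> where V: "(V, \<psi>) \<in> atlas N" "F p \<in> V" using chart_exists[OF N] p smooth_maps_into[OF F] by blast
    have VW: "openin (mtop N) (V \<inter> W)" using chart_openin[OF N V(1)] W by blast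
    define W' where "W' = U \<inter> {q \<in> points M. F q \<in> V \<inter> W}"
    have W': "openin (mtop M) W'" unfolding W'_def using chart_openin[OF M U(1)] oF[OF VW] by blast
    have o: "eopen (mdim M) (\<phi> ` W')" by (rule chart_image_eopen[OF M U(1) W']) (auto simp: W'_def)
    have "U \<inter> F -` V = U \<inter> {q \<in> points M. F q \<in> V}" using chart_subset[OF M U(1)] by auto
    then have o': "eopen (mdim M) (\<phi> ` (U \<inter> F -` V))"
      using chart_image_eopen_Int[OF M U(1) oF[OF chart_openin[OF N V(1)]]] by simp
    have "smooth_on (mdim M) (\<phi> ` W') (\<lambda>x. g (inv_into V \<psi> (\<psi> (F (inv_into U \<phi> x)))))"
    proof (rule smooth_on_compose[where f = "\<lambda>x. g (inv_into V \<psi> x)" and G = "\<lambda>x. \<psi> (F (inv_into U \<phi> x))",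
          OF chart_image_eopen[OF N V(1) VW inf_le1] o])
      show "smooth_on (mdim N) (\<psi> ` (V \<inter> W)) (\<lambda>x. g (inv_into V \<psi> x))" by (rule smooth_fun_onD[OF g V(1)])
      show "\<psi> (F (inv_into U \<phi> x)) \<in> \<psi> ` (V \<inter> W)" if "x \<in> \<phi> ` W'" for x
        using chart_image_inv(1)[OF M U(1), of x W'] that by (auto simp: W'_def)
      show "smooth_on (mdim M) (\<phi> ` W') (\<lambda>x. \<psi> (F (inv_into U \<phi> x)) j)" if "j < mdim N" for j
      proof (rule smooth_on_subset[OF o' o])
        show "smooth_on (mdim M) (\<phi> ` (U \<inter> F -` V)) (\<lambda>x. \<psi> (F (inv_into U \<phi> x)) j)"
          using F U(1) V(1) that unfolding smooth_maps_def by blast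
      qed (auto simp: W'_def)
    qed
    moreover have "g (inv_into V \<psi> (\<psi> (F (inv_into U \<phi> x)))) = g (F (inv_into U \<phi> x))" if "x \<in> \<phi> ` W'" for x
      using chart_image_inv(1)[OF M U(1), of x W'] that chart_inv[OF N V(1)] by (auto simp: W'_def)
    ultimately have "smooth_on (mdim M) (\<phi> ` W') (\<lambda>x. g (F (inv_into U \<phi> x)))"
      by (rule smooth_on_eq[OF _ o])
    then show "\<exists>U \<phi> W'. (U, \<phi>) \<in> atlas M \<and> openin (mtop M) W' \<and> p \<in> W' \<and> W' \<subseteq> U \<and>
       smooth_on (mdim M) (\<phi> ` W') (\<lambda>x. g (F (inv_into U \<phi> x)))"
      using U W' p V by (intro exI[of _ U] exI[of _ \<phi>] exI[of _ W']) (auto simp: W'_def)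
  qed
qed

lemma smooth_maps_pullback:
  assumes M: "is_manifold M" and N: "is_manifold N" and F: "F \<in> smooth_maps M N" and g: "g \<in> C_inf N"
  shows "compose (points M) g F \<in> C_inf M"
proof -
  have "{q \<in> points M. F q \<in> points N} = points M" using smooth_maps_into[OF F] by auto
  then show ?thesis
    using C_inf_restrict[OF M] smooth_maps_pullback_on[OF M N F points_openin C_inf_smooth[OF g]]
    unfolding compose_def by simp
qed

text \<open>Smooth maps are exactly the maps that pull back smooth functions to smooth functions; this
  reduces composition and descent of smooth maps to statements about functions.\<close>

lemma smooth_mapsI:
  assumes M: "is_manifold M" and N: "is_manifold N" and F: "F \<in> extensional (points M)" "F ` points M \<subseteq> points N"
    and pb: "\<And>g. g \<in> C_inf N \<Longrightarrow> compose (points M) g F \<in> C_inf M"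
  shows "F \<in> smooth_maps M N"
proof -
  have near: "\<exists>B. openin (mtop M) B \<and> p \<in> B \<and> F ` B \<subseteq> W" if W: "openin (mtop N) W" and p: "p \<in> points M" "F p \<in> W" for W p
  proof -
    obtain \<beta> K B where b: "\<beta> \<in> C_inf N" "openin (mtop N) B" "F p \<in> B" "\<forall>q\<in>B. \<beta> q = 1"
      "closedin (mtop N) K" "K \<subseteq> W" "B \<subseteq> K" "\<forall>q\<in>points N - K. \<beta> q = 0" by (rule bump_function[OF N W p(2)])
    \<comment> \<open>Continuity of \<open>F\<close> has to be derived: the neighbourhood is
      obtained as an open condition on the smooth pullback of a bump function.\<close>
    define O' where "O' = {q \<in> points M. compose (points M) \<beta> F q \<in> {1/2<..}}"
    have "openin (mtop M) O'" unfolding O'_def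
      by (rule smooth_fun_on_preimage_openin[OF M points_openin C_inf_smooth[OF pb[OF b(1)]]]) auto
    moreover have "p \<in> O'" using p b(3,4) by (simp add: O'_def compose_def)
    moreover have "F ` O' \<subseteq> W"
    proof
      fix y assume "y \<in> F ` O'"
      then obtain q where q: "q \<in> points M" "\<beta> (F q) > 1/2" "y = F q" by (auto simp: O'_def compose_def)
      then have "F q \<in> K" using b(8) F(2) by force
      then show "y \<in> W" using q b(6) by blast
    qed
    ultimately show ?thesis by blast
  qed
  have oF: "openin (mtop M) {q \<in> points M. F q \<in> W}" if W: "openin (mtop N) W" for W
  proof (subst openin_subopen, intro ballI)
    fix p assume "p \<in> {q \<in> points M. F q \<in> W}"
    then obtain B where "openin (mtop M) B" "p \<in> B" "F ` B \<subseteq> W" using near[OF W] by blast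
    then show "\<exists>T. openin (mtop M) T \<and> p \<in> T \<and> T \<subseteq> {q \<in> points M. F q \<in> W}"
      using openin_subset by (intro exI[of _ B]) blast
  qed
  have "continuous_map (mtop M) (mtop N) F"
    unfolding continuous_map_def using F(2) oF by auto
  moreover have "smooth_on (mdim M) (\<phi> ` (U \<inter> F -` V)) (\<lambda>x. \<psi> (F (inv_into U \<phi> x)) j)"
    if U: "(U, \<phi>) \<in> atlas M" and V: "(V, \<psi>) \<in> atlas N" for U \<phi> V \<psi> j
  proof -
    let ?W = "{q \<in> points M. F q \<in> V}"
    have W: "openin (mtop M) ?W" by (rule oF[OF chart_openin[OF N V]])
    have "smooth_fun_on M ?W (\<lambda>q. \<psi> (F q) j)"
    proof (rule smooth_fun_on_local[OF M W])
      fix p assume p: "p \<in> ?W"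
      \<comment> \<open>Chart coordinates of \<open>N\<close> are only local; they are extended to
        global functions before the hypothesis on pullbacks applies.\<close>
      obtain g B where g: "g \<in> C_inf N" "openin (mtop N) B" "F p \<in> B" "B \<subseteq> V" "\<forall>q\<in>B. g q = \<psi> q j"
        using smooth_extension[OF N chart_openin[OF N V] smooth_fun_on_coord[OF N V]] p by blast
      let ?B = "{q \<in> points M. F q \<in> B}"
      have o: "openin (mtop M) ?B" by (rule oF[OF g(2)])
      have "smooth_fun_on M ?B (compose (points M) g F)" by (rule C_inf_smooth_on[OF M pb[OF g(1)] o])
      then have "smooth_fun_on M ?B (\<lambda>q. \<psi> (F q) j)"
        using smooth_fun_on_cong[OF M o, of "compose (points M) g F" "\<lambda>q. \<psi> (F q) j"] g(5) by (simp add: compose_def)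
      then show "\<exists>W'. openin (mtop M) W' \<and> p \<in> W' \<and> smooth_fun_on M W' (\<lambda>q. \<psi> (F q) j)"
        using o p g(3) by (intro exI[of _ ?B]) auto
    qed
    moreover have "U \<inter> F -` V = U \<inter> ?W" using chart_subset[OF M U] by auto
    ultimately show ?thesis using smooth_fun_onD[OF _ U] by simp
  qed
  ultimately show ?thesis using F(1) unfolding smooth_maps_def by blast
qed

lemma compose_assoc_points:
  assumes "F ` S \<subseteq> T"
  shows "compose S (compose T h G) F = compose S h (compose S G F)"
  using assms by (auto simp: compose_def fun_eq_iff)

lemma smooth_maps_compose:
  assumes M: "is_manifold M" and N: "is_manifold N" and P: "is_manifold P"
    and F: "F \<in> smooth_maps M N" and G: "G \<in> smooth_maps N P"
  shows "compose (points M) G F \<in> smooth_maps M P"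
proof (rule smooth_mapsI[OF M P])
  show "compose (points M) G F ` points M \<subseteq> points P"
    using smooth_maps_into[OF F] smooth_maps_into[OF G] by (auto simp: compose_def)
  fix h assume h: "h \<in> C_inf P"
  have "F ` points M \<subseteq> points N" using smooth_maps_into[OF F] by blast
  from compose_assoc_points[OF this, of h G]
  show "compose (points M) h (compose (points M) G F) \<in> C_inf M"
    using smooth_maps_pullback[OF M N F smooth_maps_pullback[OF N P G h]] by simp
qed (simp add: compose_def)

lemma smooth_maps_id: "is_manifold M \<Longrightarrow> (\<lambda>p\<in>points M. p) \<in> smooth_maps M M"
proof (rule smooth_mapsI)
  fix g assume g: "g \<in> C_inf M"
  then have "compose (points M) g (\<lambda>p\<in>points M. p) = g"
    by (auto simp: compose_def C_inf_def extensional_def fun_eq_iff)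
  then show "compose (points M) g (\<lambda>p\<in>points M. p) \<in> C_inf M" using g by simp
qed auto

section \<open>Tangent vectors in coordinates\<close>

lemma tangent_add: "v \<in> tangent_space M p \<Longrightarrow> f \<in> C_inf M \<Longrightarrow> g \<in> C_inf M \<Longrightarrow> v (\<lambda>q\<in>points M. f q + g q) = v f + v g"
  and tangent_mult: "v \<in> tangent_space M p \<Longrightarrow> f \<in> C_inf M \<Longrightarrow> g \<in> C_inf M \<Longrightarrow> v (\<lambda>q\<in>points M. f q * g q) = v f * g p + f p * v g"
  and tangent_scale: "v \<in> tangent_space M p \<Longrightarrow> f \<in> C_inf M \<Longrightarrow> v (\<lambda>q\<in>points M. c * f q) = c * v f"
  by (simp_all add: tangent_space_def)

text \<open>The Leibniz rule on \<open>1 * 1 = 1\<close>, followed by scaling.\<close>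

lemma tangent_const:
  assumes M: "is_manifold M" and p: "p \<in> points M" and v: "v \<in> tangent_space M p"
  shows "v (\<lambda>q\<in>points M. c) = 0"
proof -
  let ?one = "\<lambda>q\<in>points M. 1::real"
  have 1: "?one \<in> C_inf M" by (rule C_inf_const[OF M])
  have "v (\<lambda>q\<in>points M. ?one q * ?one q) = v ?one * ?one p + ?one p * v ?one" by (rule tangent_mult[OF v 1 1])
  moreover have "(\<lambda>q\<in>points M. ?one q * ?one q) = ?one" by (auto simp: fun_eq_iff)
  ultimately have "v ?one = 0" using p by simp
  moreover have "v (\<lambda>q\<in>points M. c * ?one q) = c * v ?one" by (rule tangent_scale[OF v 1])
  moreover have "(\<lambda>q\<in>points M. c * ?one q) = (\<lambda>q\<in>points M. c)" by (auto simp: fun_eq_iff)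
  ultimately show ?thesis by simp
qed

lemma tangent_sum:
  assumes M: "is_manifold M" and p: "p \<in> points M" and v: "v \<in> tangent_space M p"
    and "finite J" and f: "\<And>j. j \<in> J \<Longrightarrow> f j \<in> C_inf M"
  shows "v (\<lambda>q\<in>points M. \<Sum>j\<in>J. f j q) = (\<Sum>j\<in>J. v (f j))"
proof -
  define s where "s J = (\<lambda>q\<in>points M. \<Sum>j\<in>J. f j q)" for J
  have "v (s J) = (\<Sum>j\<in>J. v (f j))"
    using assms(4,5)
  proof (induction J)
    case empty
    have "s {} = (\<lambda>q\<in>points M. 0)" by (simp add: s_def)
    then show ?case using tangent_const[OF M p v, of 0] by (simp only: sum.empty)
  next
    case (insert a J)
    have "s J \<in> C_inf M" unfolding s_def
      using insert by (intro C_inf_restrict[OF M] smooth_fun_on_sum[OF M points_openin] C_inf_smooth) auto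
    then have "v (\<lambda>q\<in>points M. f a q + s J q) = v (f a) + v (s J)"
      using insert by (intro tangent_add[OF v]) auto
    moreover have "s (insert a J) = (\<lambda>q\<in>points M. f a q + s J q)"
      using insert by (auto simp: fun_eq_iff s_def)
    ultimately have "v (s (insert a J)) = v (f a) + v (s J)" by (simp only:)
    also have "v (s J) = (\<Sum>j\<in>J. v (f j))" using insert by blast
    finally show ?case by (simp only: sum.insert[OF insert(1,2)])
  qed
  then show ?thesis by (simp only: s_def)
qed

text \<open>Multiply \<open>f - g\<close> by a bump function supported in \<open>B\<close>: the
  product is 0, and the Leibniz rule at \<open>p\<close>, where the bump is 1 and the difference is
  0, leaves \<open>v (f - g) = 0\<close>.\<close>

lemma tangent_local:
  assumes M: "is_manifold M" and v: "v \<in> tangent_space M p" and f: "f \<in> C_inf M" and g: "g \<in> C_inf M"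
    and B: "openin (mtop M) B" "p \<in> B" "\<And>q. q \<in> B \<Longrightarrow> f q = g q"
  shows "v f = v g"
proof -
  have p: "p \<in> points M" using B openin_subset by blast
  obtain \<beta> K B' where b: "\<beta> \<in> C_inf M" "openin (mtop M) B'" "p \<in> B'" "\<forall>q\<in>B'. \<beta> q = 1"
    "closedin (mtop M) K" "K \<subseteq> B" "B' \<subseteq> K" "\<forall>q\<in>points M - K. \<beta> q = 0" by (rule bump_function[OF M B(1,2)])
  let ?ng = "\<lambda>q\<in>points M. - 1 * g q"
  let ?h = "\<lambda>q\<in>points M. f q + ?ng q"
  have ng: "?ng \<in> C_inf M" by (rule C_inf_scale[OF M g])
  have h: "?h \<in> C_inf M" by (rule C_inf_add[OF M f ng])
  have "v (\<lambda>q\<in>points M. ?h q * \<beta> q) = v ?h * \<beta> p + ?h p * v \<beta>" by (rule tangent_mult[OF v h b(1)])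
  moreover have "?h q * \<beta> q = 0" if "q \<in> points M" for q
    using B(3)[of q] b(6,8) that by (cases "q \<in> K") auto
  then have "(\<lambda>q\<in>points M. ?h q * \<beta> q) = (\<lambda>q\<in>points M. 0)" by (auto simp: fun_eq_iff)
  ultimately have "v ?h = 0" using tangent_const[OF M p v, of 0] b(3,4) B p by simp
  moreover have "v ?h = v f + v ?ng" by (rule tangent_add[OF v f ng])
  moreover have "v ?ng = - 1 * v g" by (rule tangent_scale[OF v g])
  ultimately show ?thesis by simp
qed

text \<open>Derivations take global functions only, so chart coordinates are multiplied by a bump
  function and extended by 0.\<close>

lemma chart_coordinate_functions:
  assumes M: "is_manifold M" and U: "(U, \<phi>) \<in> atlas M" and p: "p \<in> U"
  obtains x B where "\<And>j. x j \<in> C_inf M" "openin (mtop M) B" "p \<in> B" "B \<subseteq> U" "\<And>j q. q \<in> B \<Longrightarrow> x j q = \<phi> q j"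
proof -
  obtain \<beta> K B where b: "\<beta> \<in> C_inf M" "openin (mtop M) B" "p \<in> B" "\<forall>q\<in>B. \<beta> q = 1"
    "closedin (mtop M) K" "K \<subseteq> U" "B \<subseteq> K" "\<forall>q\<in>points M - K. \<beta> q = 0" by (rule bump_function[OF M chart_openin[OF M U] p])
  have "B \<subseteq> points M" using openin_subset[OF b(2)] .
  then show ?thesis
    using C_inf_cutoff[OF M chart_openin[OF M U] smooth_fun_on_coord[OF M U] b(1,5,6,8)] b(2,3,4,6,7)
    by (intro that[of "\<lambda>j. \<lambda>q\<in>points M. if q \<in> U then \<beta> q * \<phi> q j else 0" B]) auto
qed

abbreviation chart_rep :: "'a set \<Rightarrow> ('a \<Rightarrow> nat \<Rightarrow> real) \<Rightarrow> ('a \<Rightarrow> real) \<Rightarrow> (nat \<Rightarrow> real) \<Rightarrow> real" where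
  "chart_rep U \<phi> f \<equiv> \<lambda>x. f (inv_into U \<phi> x)"

lemma chart_rep_smooth:
  assumes "is_manifold M" "(U, \<phi>) \<in> atlas M" "f \<in> C_inf M"
  shows "smooth_on (mdim M) (\<phi> ` U) (chart_rep U \<phi> f)"
  using smooth_fun_onD[OF C_inf_smooth_on[OF assms(1,3) chart_openin[OF assms(1,2)]] assms(2)] by simp

text \<open>Insert Hadamard's expansion of \<open>f\<close> at \<open>p\<close>: in each product of
  a coordinate increment with \<open>g j\<close> the increment vanishes at \<open>p\<close>, so the
  Leibniz rule retains only \<open>v (x j)\<close> times \<open>g j\<close> at \<open>p\<close>, and
  the latter is the partial derivative.\<close>

lemma tangent_coordinates:
  assumes M: "is_manifold M" and U: "(U, \<phi>) \<in> atlas M" and p: "p \<in> U" and v: "v \<in> tangent_space M p"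
    and x: "\<And>j. j < mdim M \<Longrightarrow> x j \<in> C_inf M" and B: "openin (mtop M) B" "p \<in> B" "\<And>j q. j < mdim M \<Longrightarrow> q \<in> B \<Longrightarrow> x j q = \<phi> q j"
    and f: "f \<in> C_inf M"
  shows "v f = (\<Sum>j<mdim M. v (x j) * partial_deriv j (chart_rep U \<phi> f) (\<phi> p))"
proof -
  let ?n = "mdim M"
  have pM: "p \<in> points M" using B openin_subset by blast
  have oU: "eopen ?n (\<phi> ` U)" by (rule chart_eopen[OF M U])
  obtain e where e: "e > 0" "ebox ?n (\<phi> p) e \<subseteq> \<phi> ` U" using eopen_boxE[OF oU] p by blast
  have pE: "\<phi> p \<in> ES ?n" using p eopen_subset[OF oU] by blast
  have sf: "smooth_on ?n (ebox ?n (\<phi> p) e) (chart_rep U \<phi> f)"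
    by (rule smooth_on_subset[OF oU eopen_ebox e(2) chart_rep_smooth[OF M U f]])
  obtain g where g: "\<And>j. j < ?n \<Longrightarrow> smooth_on ?n (ebox ?n (\<phi> p) e) (g j)"
    "\<And>x. x \<in> ebox ?n (\<phi> p) e \<Longrightarrow> chart_rep U \<phi> f x = chart_rep U \<phi> f (\<phi> p) + (\<Sum>j<?n. (x j - \<phi> p j) * g j x)"
    "\<And>j. j < ?n \<Longrightarrow> g j (\<phi> p) = partial_deriv j (chart_rep U \<phi> f) (\<phi> p)"
  proof (rule hadamard[OF pE e(1) sf])
    fix g assume "\<And>j. j < ?n \<Longrightarrow> smooth_on ?n (ebox ?n (\<phi> p) e) (g j)"
      "\<And>x. x \<in> ebox ?n (\<phi> p) e \<Longrightarrow> chart_rep U \<phi> f x = chart_rep U \<phi> f (\<phi> p) + (\<Sum>j<?n. (x j - \<phi> p j) * g j x)"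
      "\<And>j. j < ?n \<Longrightarrow> g j (\<phi> p) = partial_deriv j (chart_rep U \<phi> f) (\<phi> p)"
    then show thesis by (rule that)
  qed
  define W where "W = {q \<in> U. \<phi> q \<in> ebox ?n (\<phi> p) e}"
  have W: "openin (mtop M) W" unfolding W_def by (rule chart_preimage_openin[OF M U eopen_ebox])
  have pW: "p \<in> W" using p centre_in_ebox[OF pE e(1)] by (simp add: W_def)
  have gs: "smooth_fun_on M W (\<lambda>q. g j (\<phi> q))" if "j < ?n" for j
    by (rule smooth_fun_on_compose[OF M W eopen_ebox _ g(1)[OF that] smooth_fun_on_coord_subset[OF M U W]]) (auto simp: W_def)
  obtain \<beta> K B' where b: "\<beta> \<in> C_inf M" "openin (mtop M) B'" "p \<in> B'" "\<forall>q\<in>B'. \<beta> q = 1"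
    "closedin (mtop M) K" "K \<subseteq> W" "B' \<subseteq> K" "\<forall>q\<in>points M - K. \<beta> q = 0" by (rule bump_function[OF M W pW])
  define h where "h j = (\<lambda>q\<in>points M. if q \<in> W then \<beta> q * g j (\<phi> q) else 0)" for j
  have h: "h j \<in> C_inf M" if "j < ?n" for j
    unfolding h_def by (rule C_inf_cutoff[OF M W gs[OF that] b(1,5,6,8)])
  have hB: "h j q = g j (\<phi> q)" if "q \<in> B'" for j q
    using that b openin_subset[OF b(2)] by (auto simp: h_def)
  define y where "y j = (\<lambda>q\<in>points M. x j q + (\<lambda>q\<in>points M. - \<phi> p j) q)" for j
  have y: "y j \<in> C_inf M" if "j < ?n" for j
    unfolding y_def by (rule C_inf_add[OF M x[OF that] C_inf_const[OF M]])
  define z where "z j = (\<lambda>q\<in>points M. y j q * h j q)" for j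
  have z: "z j \<in> C_inf M" if "j < ?n" for j
    unfolding z_def by (rule C_inf_mult[OF M y[OF that] h[OF that]])
  define s where "s = (\<lambda>q\<in>points M. \<Sum>j<?n. z j q)"
  have s: "s \<in> C_inf M" unfolding s_def
    by (intro C_inf_restrict[OF M] smooth_fun_on_sum[OF M points_openin] C_inf_smooth z) auto
  \<comment> \<open>Global version of the expansion. The coefficients are cut off, so
    \<open>k\<close> agrees with \<open>f\<close> only near \<open>p\<close>, which is enough for
    \<open>tangent_local\<close>.\<close>
  define k where "k = (\<lambda>q\<in>points M. (\<lambda>q\<in>points M. f p) q + s q)"
  have k: "k \<in> C_inf M" unfolding k_def by (rule C_inf_add[OF M C_inf_const[OF M] s])
  have "v f = v k"
  proof (rule tangent_local[OF M v f k])
    show "openin (mtop M) (B \<inter> B')" "p \<in> B \<inter> B'" using B b by auto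
    fix q assume q: "q \<in> B \<inter> B'"
    then have qW: "q \<in> W" "q \<in> points M" using b openin_subset[OF B(1)] by auto
    then have qU: "q \<in> U" "\<phi> q \<in> ebox ?n (\<phi> p) e" by (auto simp: W_def)
    have "f q = f p + (\<Sum>j<?n. (\<phi> q j - \<phi> p j) * g j (\<phi> q))"
      using g(2)[OF qU(2)] chart_inv[OF M U qU(1)] chart_inv[OF M U p] by simp
    also have "\<dots> = k q" using q qW B(3) hB by (simp add: k_def s_def z_def y_def)
    finally show "f q = k q" .
  qed
  also have "v k = 0 + v s" unfolding k_def tangent_add[OF v C_inf_const[OF M] s] tangent_const[OF M pM v] ..
  also have "v s = (\<Sum>j<?n. v (z j))" unfolding s_def by (rule tangent_sum[OF M pM v _ z]) auto
  also have "\<dots> = (\<Sum>j<?n. v (x j) * partial_deriv j (chart_rep U \<phi> f) (\<phi> p))"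
  proof (rule sum.cong)
    fix j assume "j \<in> {..<?n}"
    then have j: "j < ?n" by simp
    have "v (z j) = v (y j) * h j p + y j p * v (h j)" unfolding z_def by (rule tangent_mult[OF v y[OF j] h[OF j]])
    moreover have "y j p = 0" using pM B j by (simp add: y_def)
    moreover have "v (y j) = v (x j)" unfolding y_def using tangent_add[OF v x[OF j] C_inf_const[OF M]] tangent_const[OF M pM v] by simp
    ultimately show "v (z j) = v (x j) * partial_deriv j (chart_rep U \<phi> f) (\<phi> p)" using hB[OF b(3)] g(3)[OF j] by simp
  qed simp
  finally show ?thesis by simp
qed

text \<open>The vector with components \<open>w\<close> in the coordinate basis of the
  chart.\<close>

definition coord_vector :: "'a manifold \<Rightarrow> 'a set \<Rightarrow> ('a \<Rightarrow> nat \<Rightarrow> real) \<Rightarrow> 'a \<Rightarrow> (nat \<Rightarrow> real) \<Rightarrow> 'a tvec" where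
  "coord_vector M U \<phi> p w = (\<lambda>f\<in>C_inf M. \<Sum>i<mdim M. w i * partial_deriv i (chart_rep U \<phi> f) (\<phi> p))"

lemma coord_vector_tangent:
  assumes M: "is_manifold M" and U: "(U, \<phi>) \<in> atlas M" and p: "p \<in> U"
  shows "coord_vector M U \<phi> p w \<in> tangent_space M p"
proof -
  let ?n = "mdim M"
  let ?d = "\<lambda>i f. partial_deriv i (chart_rep U \<phi> f) (\<phi> p)"
  have o: "eopen ?n (\<phi> ` U)" by (rule chart_eopen[OF M U])
  have pU: "\<phi> p \<in> \<phi> ` U" using p by blast
  have hp: "hpd i (chart_rep U \<phi> f) (?d i f) (\<phi> p)" if "f \<in> C_inf M" "i < ?n" for f i
    by (rule smooth_on_hpd[OF o chart_rep_smooth[OF M U that(1)] that(2) pU])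
  have inU: "inv_into U \<phi> x \<in> points M" if "x \<in> \<phi> ` U" for x
    using chart_image_inv(1)[OF M U, of x U] that chart_subset[OF M U] by auto
  have cong: "?d i (\<lambda>q\<in>points M. F q) = partial_deriv i (\<lambda>x. F (inv_into U \<phi> x)) (\<phi> p)" if "i < ?n" for i F
    by (rule partial_deriv_cong[OF o pU that]) (use inU in auto)
  have add: "?d i (\<lambda>q\<in>points M. f q + g q) = ?d i f + ?d i g" if "f \<in> C_inf M" "g \<in> C_inf M" "i < ?n" for f g i
    unfolding cong[OF that(3)] by (rule hpd_partial_deriv[OF hpd_add[OF hp hp]]) (use that in auto)
  have mult: "?d i (\<lambda>q\<in>points M. f q * g q) = ?d i f * g p + ?d i g * f p" if "f \<in> C_inf M" "g \<in> C_inf M" "i < ?n" for f g i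
    unfolding cong[OF that(3)] hpd_partial_deriv[OF hpd_mult[OF hp[OF that(1,3)] hp[OF that(2,3)]]]
    by (simp add: chart_inv[OF M U p])
  have scale: "?d i (\<lambda>q\<in>points M. c * f q) = c * ?d i f" if "f \<in> C_inf M" "i < ?n" for c f i
    unfolding cong[OF that(2)] using hpd_partial_deriv[OF hpd_mult[OF hpd_const hp[OF that]]] by simp
  define d where "d i f = ?d i f" for i f
  note D = add[folded d_def] mult[folded d_def] scale[folded d_def]
  show ?thesis
    unfolding tangent_space_def coord_vector_def d_def[symmetric]
    by (auto simp: C_inf_add[OF M] C_inf_mult[OF M] C_inf_scale[OF M] D sum.distrib[symmetric]
        sum_distrib_left sum_distrib_right algebra_simps intro!: sum.cong)
qed

lemma coord_vector_coordinate:
  assumes M: "is_manifold M" and U: "(U, \<phi>) \<in> atlas M" and x: "x \<in> C_inf M"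
    and B: "openin (mtop M) B" "p \<in> B" "B \<subseteq> U" "\<And>q. q \<in> B \<Longrightarrow> x q = \<phi> q j" and j: "j < mdim M"
  shows "coord_vector M U \<phi> p w x = w j"
proof -
  have p: "p \<in> U" using B by blast
  have o: "eopen (mdim M) (\<phi> ` B)" by (rule chart_image_eopen[OF M U B(1,3)])
  have "partial_deriv i (chart_rep U \<phi> x) (\<phi> p) = (if i = j then 1 else 0)" if i: "i < mdim M" for i
  proof -
    have "partial_deriv i (chart_rep U \<phi> x) (\<phi> p) = partial_deriv i (\<lambda>x. x j) (\<phi> p)"
    proof (rule partial_deriv_cong[OF o _ i])
      fix y assume "y \<in> \<phi> ` B"
      then obtain q where "q \<in> B" "y = \<phi> q" by blast
      then show "x (inv_into U \<phi> y) = y j" using B chart_inv[OF M U] by auto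
    qed (use B in blast)
    then show ?thesis using hpd_partial_deriv[OF hpd_coord] by metis
  qed
  then have "(\<Sum>i<mdim M. w i * partial_deriv i (chart_rep U \<phi> x) (\<phi> p)) = (\<Sum>i<mdim M. if i = j then w i else 0)"
    by (intro sum.cong) auto
  then show ?thesis using j x by (simp add: coord_vector_def)
qed

lemma tangent_extensional: "v \<in> tangent_space M p \<Longrightarrow> v \<in> extensional (C_inf M)"
  by (simp add: tangent_space_def)

lemma tangent_coord_vector:
  assumes M: "is_manifold M" and U: "(U, \<phi>) \<in> atlas M" and p: "p \<in> U" and v: "v \<in> tangent_space M p"
  obtains w where "v = coord_vector M U \<phi> p w"
proof -
  obtain x B where x: "\<And>j. x j \<in> C_inf M" and B: "openin (mtop M) B" "p \<in> B" "B \<subseteq> U" "\<And>j q. q \<in> B \<Longrightarrow> x j q = \<phi> q j"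
    using chart_coordinate_functions[OF M U p] by metis
  have "v = coord_vector M U \<phi> p (\<lambda>j. v (x j))"
  proof (rule extensionalityI[OF tangent_extensional[OF v]])
    show "coord_vector M U \<phi> p (\<lambda>j. v (x j)) \<in> extensional (C_inf M)" by (simp add: coord_vector_def)
    fix f assume f: "f \<in> C_inf M"
    show "v f = coord_vector M U \<phi> p (\<lambda>j. v (x j)) f"
      using tangent_coordinates[OF M U p v x B(1,2,4) f] f by (simp add: coord_vector_def)
  qed
  then show ?thesis by (rule that)
qed

text \<open>The functions \<open>u k\<close> need not be coordinates of \<open>M\<close>. For a
  submanifold they are the restricted ambient coordinates: a vector that kills these kills every
  restricted function.\<close>

lemma tangent_chain_rule:
  assumes M: "is_manifold M" and v: "v \<in> tangent_space M p" and f: "f \<in> C_inf M" and u: "\<And>k. k < n \<Longrightarrow> u k \<in> C_inf M"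
    and T: "eopen n T" and H: "smooth_on n T H" and B: "openin (mtop M) B" "p \<in> B"
    and mem: "\<And>q. q \<in> B \<Longrightarrow> (\<lambda>k. if k < n then u k q else 0) \<in> T"
    and eq: "\<And>q. q \<in> B \<Longrightarrow> f q = H (\<lambda>k. if k < n then u k q else 0)"
  shows "v f = (\<Sum>k<n. partial_deriv k H (\<lambda>k. if k < n then u k p else 0) * v (u k))"
proof -
  have pM: "p \<in> points M" using B openin_subset by blast
  obtain U \<phi> where U: "(U, \<phi>) \<in> atlas M" "p \<in> U" using chart_exists[OF M pM] by blast
  obtain x B' where x: "\<And>j. x j \<in> C_inf M" and B': "openin (mtop M) B'" "p \<in> B'" "B' \<subseteq> U" "\<And>j q. q \<in> B' \<Longrightarrow> x j q = \<phi> q j"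
    using chart_coordinate_functions[OF M U] by metis
  let ?n = "mdim M"
  let ?V = "\<phi> ` (U \<inter> B)"
  let ?G = "\<lambda>x k. if k < n then u k (inv_into U \<phi> x) else 0"
  have V: "eopen ?n ?V" by (rule chart_image_eopen_Int[OF M U(1) B(1)])
  have pV: "\<phi> p \<in> ?V" using U B by blast
  have GM: "smooth_mapping ?n ?V n T ?G"
    unfolding smooth_mapping_def
  proof (intro conjI V T allI impI)
    show "?G ` ?V \<subseteq> T" using mem chart_image_inv(1)[OF M U(1)] by fastforce
    show "smooth_on ?n ?V (\<lambda>x. ?G x j)" if "j < n" for j
      using smooth_fun_onD[OF C_inf_smooth_on[OF M u[OF that] B(1)] U(1)] that by simp
  qed
  have d: "partial_deriv j (chart_rep U \<phi> f) (\<phi> p) = (\<Sum>k<n. partial_deriv k H (?G (\<phi> p)) * partial_deriv j (chart_rep U \<phi> (u k)) (\<phi> p))"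
    if j: "j < ?n" for j
  proof -
    have "partial_deriv j (chart_rep U \<phi> f) (\<phi> p) = partial_deriv j (\<lambda>x. H (?G x)) (\<phi> p)"
      by (rule partial_deriv_cong[OF V pV j]) (use eq chart_image_inv(1)[OF M U(1)] in blast)
    also have "\<dots> = (\<Sum>k<n. partial_deriv k H (?G (\<phi> p)) * partial_deriv j (\<lambda>x. ?G x k) (\<phi> p))"
      by (rule partial_deriv_compose_mapping[OF GM H pV j])
    finally show ?thesis by simp
  qed
  have "v f = (\<Sum>j<?n. v (x j) * partial_deriv j (chart_rep U \<phi> f) (\<phi> p))"
    by (rule tangent_coordinates[OF M U v x B'(1,2,4) f])
  also have "\<dots> = (\<Sum>j<?n. \<Sum>k<n. v (x j) * (partial_deriv k H (?G (\<phi> p)) * partial_deriv j (chart_rep U \<phi> (u k)) (\<phi> p)))"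
    by (intro sum.cong) (auto simp: d sum_distrib_left)
  also have "\<dots> = (\<Sum>k<n. \<Sum>j<?n. v (x j) * (partial_deriv k H (?G (\<phi> p)) * partial_deriv j (chart_rep U \<phi> (u k)) (\<phi> p)))"
    by (rule sum.swap)
  also have "\<dots> = (\<Sum>k<n. partial_deriv k H (?G (\<phi> p)) * v (u k))"
  proof (rule sum.cong)
    fix k assume "k \<in> {..<n}"
    then have "v (u k) = (\<Sum>j<?n. v (x j) * partial_deriv j (chart_rep U \<phi> (u k)) (\<phi> p))"
      by (intro tangent_coordinates[OF M U v x B'(1,2,4) u]) auto
    then show "(\<Sum>j<?n. v (x j) * (partial_deriv k H (?G (\<phi> p)) * partial_deriv j (chart_rep U \<phi> (u k)) (\<phi> p))) = partial_deriv k H (?G (\<phi> p)) * v (u k)"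
      by (simp add: sum_distrib_left mult_ac)
  qed simp
  finally show ?thesis by (simp add: chart_inv[OF M U] cong: if_cong)
qed

text \<open>In a chart all partial derivatives vanish, so the function is locally constant by the
  mean value formula. Its level sets are then open and closed, and connectedness is part of
  \<open>is_manifold\<close>.\<close>

lemma derivations_vanish_imp_constant:
  assumes M: "is_manifold M" and f: "f \<in> C_inf M"
    and 0: "\<And>p v. p \<in> points M \<Longrightarrow> v \<in> tangent_space M p \<Longrightarrow> v f = 0"
    and pq: "p \<in> points M" "q \<in> points M"
  shows "f p = f q"
proof -
  have loc: "\<exists>B. openin (mtop M) B \<and> p \<in> B \<and> (\<forall>q\<in>B. f q = f p)" if p: "p \<in> points M" for p
  proof -
    obtain U \<phi> where U: "(U, \<phi>) \<in> atlas M" "p \<in> U" using chart_exists[OF M p] by blast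
    let ?n = "mdim M"
    have oU: "eopen ?n (\<phi> ` U)" by (rule chart_eopen[OF M U(1)])
    obtain e where e: "e > 0" "ebox ?n (\<phi> p) e \<subseteq> \<phi> ` U" using eopen_boxE[OF oU] U(2) by blast
    have pE: "\<phi> p \<in> ebox ?n (\<phi> p) e" using U(2) eopen_subset[OF oU] e(1) by (intro centre_in_ebox) auto
    have d0: "hpd j (chart_rep U \<phi> f) 0 z" if j: "j < ?n" and z: "z \<in> \<phi> ` U" for j z
    proof -
      obtain q where q: "q \<in> U" "z = \<phi> q" using z by blast
      have "coord_vector M U \<phi> q (\<lambda>i. if i = j then 1 else 0) f = 0"
        by (rule 0[OF _ coord_vector_tangent[OF M U(1) q(1)]]) (use q chart_subset[OF M U(1)] in blast)
      then have "(\<Sum>i<?n. (if i = j then 1 else 0) * partial_deriv i (chart_rep U \<phi> f) z) = 0"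
        using f q(2) by (simp add: coord_vector_def)
      then have "partial_deriv j (chart_rep U \<phi> f) z = 0"
        using j by (simp add: if_distrib[of "\<lambda>x. x * _"] cong: if_cong)
      then show ?thesis using smooth_on_hpd[OF oU chart_rep_smooth[OF M U(1) f] j z] by simp
    qed
    define B where "B = {q \<in> U. \<phi> q \<in> ebox ?n (\<phi> p) e}"
    have "openin (mtop M) B" unfolding B_def by (rule chart_preimage_openin[OF M U(1) eopen_ebox])
    moreover have "f q = f p" if "q \<in> B" for q
    proof -
      have qB: "\<phi> q \<in> ebox ?n (\<phi> p) e" "q \<in> U" using that by (auto simp: B_def)
      have "\<exists>\<xi>. (\<forall>j<?n. \<xi> j \<in> ebox ?n (\<phi> p) e \<and> (\<forall>i. \<bar>\<xi> j i - \<phi> p i\<bar> \<le> \<bar>\<phi> q i - \<phi> p i\<bar>)) \<and>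
        chart_rep U \<phi> f (\<phi> q) - chart_rep U \<phi> f (\<phi> p) = (\<Sum>j<?n. 0 * (\<phi> q j - \<phi> p j))"
        by (rule ebox_mvt[OF _ pE qB(1), where g = "\<lambda>_ _. 0"]) (use d0 e in blast)
      then show ?thesis using chart_inv[OF M U(1)] U(2) qB(2) by simp
    qed
    ultimately show ?thesis using U(2) pE unfolding B_def by blast
  qed
  define A where "A = {q \<in> points M. f q = f p}"
  have "openin (mtop M) A"
  proof (subst openin_subopen, intro ballI)
    fix x assume "x \<in> A"
    then have x: "x \<in> points M" "f x = f p" by (auto simp: A_def)
    obtain B where B: "openin (mtop M) B" "x \<in> B" "\<forall>q\<in>B. f q = f x" using loc[OF x(1)] by blast
    have "B \<subseteq> A" using openin_subset[OF B(1)] B(3) x(2) by (auto simp: A_def)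
    then show "\<exists>T. openin (mtop M) T \<and> x \<in> T \<and> T \<subseteq> A"
      using B by blast
  qed
  moreover have "openin (mtop M) (points M - A)"
  proof (subst openin_subopen, intro ballI)
    fix x assume "x \<in> points M - A"
    then have x: "x \<in> points M" "f x \<noteq> f p" by (auto simp: A_def)
    obtain B where B: "openin (mtop M) B" "x \<in> B" "\<forall>q\<in>B. f q = f x" using loc[OF x(1)] by blast
    have "B \<subseteq> points M - A" using openin_subset[OF B(1)] B(3) x(2) by (auto simp: A_def)
    then show "\<exists>T. openin (mtop M) T \<and> x \<in> T \<and> T \<subseteq> points M - A"
      using B by blast
  qed
  then have "closedin (mtop M) A" by (auto simp: closedin_def A_def)
  ultimately have "A = {} \<or> A = points M"
    using M by (simp add: is_manifold_def connected_space_clopen_in)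
  moreover have "p \<in> A" using pq by (simp add: A_def)
  ultimately have "q \<in> A" using pq by blast
  then show ?thesis by (simp add: A_def)
qed

section \<open>Surjective submersions and closed embedded submanifolds\<close>

lemma tangent_map_apply: "g \<in> C_inf N \<Longrightarrow> tangent_map M N F v g = v (compose (points M) g F)"
  by (simp add: tangent_map_def)

text \<open>Near each point \<open>g\<close> is the given pullback composed with a local section.
  Lifting the coordinate vectors of \<open>N\<close> through the surjective tangent map yields the
  dual family that \<open>local_right_inverse\<close> asks for.\<close>

lemma surjective_submersion_descent:
  assumes M: "is_manifold M" and N: "is_manifold N" and \<pi>: "surjective_submersion M N \<pi>"
    and g: "g \<in> extensional (points N)" "compose (points M) g \<pi> \<in> C_inf M"
  shows "g \<in> C_inf N"
proof -
  have \<pi>s: "\<pi> \<in> smooth_maps M N" and \<pi>sur: "\<pi> ` points M = points N"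
    and \<pi>T: "\<And>p. p \<in> points M \<Longrightarrow> tangent_map M N \<pi> ` tangent_space M p = tangent_space N (\<pi> p)"
    using \<pi> by (auto simp: surjective_submersion_def)
  have "smooth_fun_on N (points N) g"
  proof (rule smooth_fun_onI[OF N points_openin])
    fix y assume "y \<in> points N"
    then obtain p where p: "p \<in> points M" "y = \<pi> p" using \<pi>sur by blast
    let ?c = "mdim M" and ?n = "mdim N"
    obtain V \<psi> where V: "(V, \<psi>) \<in> atlas N" "y \<in> V" using chart_exists[OF N \<open>y \<in> points N\<close>] .
    obtain z B where z: "\<And>j. z j \<in> C_inf N" and B: "openin (mtop N) B" "y \<in> B" "B \<subseteq> V" "\<And>j q. q \<in> B \<Longrightarrow> z j q = \<psi> q j"
      using chart_coordinate_functions[OF N V] by metis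
    obtain U \<phi> where U: "(U, \<phi>) \<in> atlas M" "p \<in> U" using chart_exists[OF M p(1)] .
    obtain x B' where x: "\<And>j. x j \<in> C_inf M" and B': "openin (mtop M) B'" "p \<in> B'" "B' \<subseteq> U" "\<And>j q. q \<in> B' \<Longrightarrow> x j q = \<phi> q j"
      using chart_coordinate_functions[OF M U] by metis
    define P where "P = {q \<in> points M. \<pi> q \<in> B}"
    have P: "openin (mtop M) P" unfolding P_def
      by (rule openin_continuous_map_preimage[OF smooth_maps_continuous[OF \<pi>s] B(1)])
    define T where "T = \<phi> ` (U \<inter> P)"
    have T: "eopen ?c T" unfolding T_def by (rule chart_image_eopen_Int[OF M U(1) P])
    have pT: "\<phi> p \<in> T" using U(2) p B(2) by (auto simp: T_def P_def)
    define u where "u k = compose (points M) (z k) \<pi>" for k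
    have u: "u k \<in> C_inf M" for k unfolding u_def by (rule smooth_maps_pullback[OF M N \<pi>s z])
    have su: "smooth_on ?c T (chart_rep U \<phi> (u k))" for k
      unfolding T_def by (rule smooth_fun_onD[OF C_inf_smooth_on[OF M u P] U(1)])
    have "\<exists>v. v \<in> tangent_space M p \<and> tangent_map M N \<pi> v = coord_vector N V \<psi> y (\<lambda>i. if i = l then 1 else 0)" for l
      using \<pi>T[OF p(1)] coord_vector_tangent[OF N V] p(2) by (metis (no_types, lifting) imageE)
    then obtain v where v: "\<And>l. v l \<in> tangent_space M p" "\<And>l. tangent_map M N \<pi> (v l) = coord_vector N V \<psi> y (\<lambda>i. if i = l then 1 else 0)"
      by metis
    have vu: "v l (u k) = (if k = l then 1 else 0)" if "k < ?n" for k l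
    proof -
      have "v l (u k) = coord_vector N V \<psi> y (\<lambda>i. if i = l then 1 else 0) (z k)"
        unfolding v(2)[symmetric] by (simp add: tangent_map_apply[OF z] u_def)
      also have "\<dots> = (if k = l then 1 else 0)"
        by (rule coord_vector_coordinate[OF N V(1) z B that])
      finally show ?thesis .
    qed
    have dual: "(\<Sum>i<?c. v l (x i) * partial_deriv i (chart_rep U \<phi> (u k)) (\<phi> p)) = (if k = l then 1 else 0)"
      if "k < ?n" "l < ?n" for k l
      using tangent_coordinates[OF M U v(1) x B'(1,2,4) u, of l k] vu[OF that(1), of l] by simp
    obtain W s where s: "smooth_mapping ?n W ?c T s" "(\<lambda>k. if k < ?n then chart_rep U \<phi> (u k) (\<phi> p) else 0) \<in> W"
      "s (\<lambda>k. if k < ?n then chart_rep U \<phi> (u k) (\<phi> p) else 0) = \<phi> p"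
      and su: "\<forall>t\<in>W. \<forall>k<?n. chart_rep U \<phi> (u k) (s t) = t k"
      by (rule local_right_inverse[OF T pT su dual])
    have W: "eopen ?n W" using s(1) by (simp add: smooth_mapping_def)
    \<comment> \<open>The point of \<open>M\<close> with coordinates \<open>s t\<close> projects to
      the point of \<open>N\<close> with coordinates \<open>t\<close>, as the equations solved by
      \<open>s\<close> say component by component.\<close>
    have key: "inv_into U \<phi> (s t) \<in> U \<inter> P \<and> \<pi> (inv_into U \<phi> (s t)) = inv_into V \<psi> t \<and> t \<in> \<psi> ` V" if t: "t \<in> W" for t
    proof -
      define q where "q = inv_into U \<phi> (s t)"
      have "s t \<in> T" using s(1) t by (auto simp: smooth_mapping_def)
      then have q: "q \<in> U" "q \<in> P" using chart_image_inv(1)[OF M U(1)] unfolding q_def T_def by blast+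
      then have \<pi>q: "\<pi> q \<in> B" "q \<in> points M" by (auto simp: P_def)
      have "\<psi> (\<pi> q) = t"
      proof
        fix k
        have "\<psi> (\<pi> q) \<in> ES ?n" using \<pi>q B(3) eopen_subset[OF chart_eopen[OF N V(1)]] by blast
        moreover have "t \<in> ES ?n" using t eopen_subset[OF W] by blast
        moreover have "\<psi> (\<pi> q) k = t k" if "k < ?n"
        proof -
          have "u k q = t k" using su t that by (simp add: q_def)
          then show ?thesis using B(4)[OF \<pi>q(1), of k] \<pi>q(2) by (simp add: u_def compose_def)
        qed
        ultimately show "\<psi> (\<pi> q) k = t k" by (cases "k < ?n") (auto simp: ES_def)
      qed
      moreover have "\<pi> q \<in> V" using \<pi>q B(3) by blast
      ultimately show ?thesis using q chart_inv[OF N V(1), of "\<pi> q"] unfolding q_def[symmetric] by auto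
    qed
    define W' where "W' = {q \<in> V. \<psi> q \<in> W}"
    have W': "openin (mtop N) W'" unfolding W'_def by (rule chart_preimage_openin[OF N V(1) W])
    have \<psi>W': "\<psi> ` W' = W" using key by (auto simp: W'_def)
    have "smooth_on ?n W (\<lambda>t. chart_rep U \<phi> (compose (points M) g \<pi>) (s t))"
    proof (rule smooth_on_compose_mapping[OF s(1)])
      show "smooth_on ?c T (chart_rep U \<phi> (compose (points M) g \<pi>))"
        unfolding T_def by (rule smooth_fun_onD[OF C_inf_smooth_on[OF M g(2) P] U(1)])
    qed
    then have "smooth_on ?n W (chart_rep V \<psi> g)"
      by (rule smooth_on_eq[OF _ W]) (use key in \<open>auto simp: compose_def P_def\<close>)
    moreover have "y \<in> W'"
    proof -
      have "(\<lambda>k. if k < ?n then chart_rep U \<phi> (u k) (\<phi> p) else 0) = \<psi> y"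
      proof
        fix k
        have "\<psi> y \<in> ES ?n" using V eopen_subset[OF chart_eopen[OF N V(1)]] by blast
        then show "(if k < ?n then chart_rep U \<phi> (u k) (\<phi> p) else 0) = \<psi> y k"
          using chart_inv[OF M U] B(2,4) p by (auto simp: ES_def u_def compose_def)
      qed
      then show ?thesis using s(2) V(2) by (simp add: W'_def)
    qed
    ultimately show "\<exists>U \<phi> W'. (U, \<phi>) \<in> atlas N \<and> openin (mtop N) W' \<and> y \<in> W' \<and> W' \<subseteq> U \<and>
       smooth_on (mdim N) (\<phi> ` W') (\<lambda>x. g (inv_into U \<phi> x))"
      using V W' \<psi>W' by (intro exI[of _ V] exI[of _ \<psi>] exI[of _ W']) (auto simp: W'_def)
  qed
  then show ?thesis using g(1) by (simp add: C_inf_def)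
qed

text \<open>The ambient coordinates restricted to \<open>S\<close> have an injective Jacobian, so a
  smooth left inverse \<open>\<rho>\<close> recovers the chart of \<open>S\<close> from that of
  \<open>M\<close>; the extension is \<open>f\<close> read through \<open>\<rho>\<close>.\<close>

lemma submanifold_local_extension:
  assumes M: "is_manifold M" and S: "is_manifold S" and top: "mtop S = subtopology (mtop M) (points S)"
    and imm: "immersion S M (incl S)" and f: "f \<in> C_inf S" and p: "p \<in> points S"
  obtains W F where "openin (mtop M) W" "p \<in> W" "smooth_fun_on M W F" "\<forall>q\<in>W \<inter> points S. F q = f q"
proof -
  have iS: "incl S \<in> smooth_maps S M" and inj: "inj_on (tangent_map S M (incl S)) (tangent_space S p)"
    using imm p by (auto simp: immersion_def)
  have SM: "points S \<subseteq> points M" using smooth_maps_into[OF iS] by (auto simp: incl_def)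
  have opS: "openin (mtop S) X \<longleftrightarrow> (\<exists>T. openin (mtop M) T \<and> X = T \<inter> points S)" for X
    by (subst top) (rule openin_subtopology)
  let ?m = "mdim M" and ?s = "mdim S"
  obtain U \<phi> where U: "(U, \<phi>) \<in> atlas M" "p \<in> U" using chart_exists[OF M] SM p by blast
  obtain y B where y: "\<And>j. y j \<in> C_inf M" and B: "openin (mtop M) B" "p \<in> B" "B \<subseteq> U" "\<And>j q. q \<in> B \<Longrightarrow> y j q = \<phi> q j"
    using chart_coordinate_functions[OF M U] by metis
  obtain V \<psi> where V: "(V, \<psi>) \<in> atlas S" "p \<in> V" using chart_exists[OF S p] .
  obtain x B' where x: "\<And>j. x j \<in> C_inf S" and B': "openin (mtop S) B'" "p \<in> B'" "B' \<subseteq> V" "\<And>j q. q \<in> B' \<Longrightarrow> x j q = \<psi> q j"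
    using chart_coordinate_functions[OF S V] by metis
  define w where "w j = compose (points S) (y j) (incl S)" for j
  have w: "w j \<in> C_inf S" for j unfolding w_def by (rule smooth_maps_pullback[OF S M iS y])
  have wq: "w j q = y j q" if "q \<in> points S" for j q using that by (simp add: w_def compose_def incl_def)
  define Z where "Z = B \<inter> points S"
  have Z: "openin (mtop S) Z" unfolding opS Z_def using B(1) by blast
  define T where "T = \<psi> ` (V \<inter> Z)"
  have T: "eopen ?s T" unfolding T_def by (rule chart_image_eopen_Int[OF S V(1) Z])
  have pT: "\<psi> p \<in> T" using V(2) B(2) p by (auto simp: T_def Z_def)
  have sw: "smooth_on ?s T (chart_rep V \<psi> (w k))" for k
    unfolding T_def by (rule smooth_fun_onD[OF C_inf_smooth_on[OF S w Z] V(1)])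
  \<comment> \<open>A kernel vector of the Jacobian defines a derivation that kills all
    \<open>w j\<close>. By the chain rule the tangent map sends it to 0, so it is 0 by
    injectivity.\<close>
  have ker: "\<forall>i<?s. c i = 0" if c: "\<And>j. j < ?m \<Longrightarrow> (\<Sum>i<?s. partial_deriv i (chart_rep V \<psi> (w j)) (\<psi> p) * c i) = 0" for c
  proof -
    define v where "v = coord_vector S V \<psi> p c"
    define v0 where "v0 = coord_vector S V \<psi> p (\<lambda>_. 0)"
    have vT: "v \<in> tangent_space S p" "v0 \<in> tangent_space S p"
      unfolding v_def v0_def by (rule coord_vector_tangent[OF S V])+
    have vw: "v (w j) = 0" if "j < ?m" for j
      using c[OF that] w by (simp add: v_def coord_vector_def mult.commute)
    have "tangent_map S M (incl S) v = tangent_map S M (incl S) v0"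
    proof (rule extensionalityI[of _ "C_inf M"])
      fix g assume g: "g \<in> C_inf M"
      define h where "h = compose (points S) g (incl S)"
      have h: "h \<in> C_inf S" unfolding h_def by (rule smooth_maps_pullback[OF S M iS g])
      have c: "(\<lambda>k. if k < ?m then w k q else 0) = \<phi> q" if "q \<in> Z" for q
      proof
        fix k
        have "\<phi> q \<in> ES ?m" using that B(3) eopen_subset[OF chart_eopen[OF M U(1)]] by (auto simp: Z_def)
        then show "(if k < ?m then w k q else 0) = \<phi> q k" using that B(4)[of q k] wq[of q k] by (auto simp: Z_def ES_def)
      qed
      have "v h = (\<Sum>k<?m. partial_deriv k (chart_rep U \<phi> g) (\<lambda>k. if k < ?m then w k p else 0) * v (w k))"
      proof (rule tangent_chain_rule[OF S vT(1) h w chart_eopen[OF M U(1)] chart_rep_smooth[OF M U(1) g] Z])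
        show "p \<in> Z" using B(2) p by (simp add: Z_def)
        fix q assume q: "q \<in> Z"
        then have qU: "q \<in> U" "q \<in> points S" using B(3) by (auto simp: Z_def)
        show "(\<lambda>k. if k < ?m then w k q else 0) \<in> \<phi> ` U" unfolding c[OF q] using qU by blast
        show "h q = chart_rep U \<phi> g (\<lambda>k. if k < ?m then w k q else 0)"
          unfolding c[OF q] using chart_inv[OF M U(1) qU(1)] qU by (simp add: h_def compose_def incl_def)
      qed
      also have "\<dots> = 0" using vw by (intro sum.neutral) auto
      finally show "tangent_map S M (incl S) v g = tangent_map S M (incl S) v0 g"
        using h g by (simp add: tangent_map_def h_def v0_def coord_vector_def)
    qed (simp_all add: tangent_map_def)
    then have "v = v0" using inj vT by (auto simp: inj_on_def)
    then show ?thesis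
      using coord_vector_coordinate[OF S V(1) x B'(1,2,3,4), of _ c] coord_vector_coordinate[OF S V(1) x B'(1,2,3,4), of _ "\<lambda>_. 0"]
      unfolding v_def v0_def by metis
  qed
  obtain O' \<rho> R where \<rho>: "smooth_mapping ?m R ?s T \<rho>" and O': "eopen ?s O'" "\<psi> p \<in> O'" "O' \<subseteq> T"
    and OR: "\<And>t. t \<in> O' \<Longrightarrow> (\<lambda>j. if j < ?m then chart_rep V \<psi> (w j) t else 0) \<in> R"
    and \<rho>w: "\<And>t. t \<in> O' \<Longrightarrow> \<rho> (\<lambda>j. if j < ?m then chart_rep V \<psi> (w j) t else 0) = t"
  proof (rule local_left_inverse[OF T pT sw ker])
    fix O' \<rho> R assume "smooth_mapping ?m R ?s T \<rho>" "eopen ?s O'" "\<psi> p \<in> O'" "O' \<subseteq> T"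
      "\<And>t. t \<in> O' \<Longrightarrow> (\<lambda>j. if j < ?m then chart_rep V \<psi> (w j) t else 0) \<in> R"
      "\<And>t. t \<in> O' \<Longrightarrow> \<rho> (\<lambda>j. if j < ?m then chart_rep V \<psi> (w j) t else 0) = t"
    then show thesis by (rule that)
  qed
  have R: "eopen ?m R" using \<rho> by (simp add: smooth_mapping_def)
  define W1 where "W1 = {q \<in> U. \<phi> q \<in> R}"
  have W1: "openin (mtop M) W1" unfolding W1_def by (rule chart_preimage_openin[OF M U(1) R])
  have "openin (mtop S) {q \<in> V. \<psi> q \<in> O'}" by (rule chart_preimage_openin[OF S V(1) O'(1)])
  \<comment> \<open>The subspace topology enters here: the neighbourhood in \<open>S\<close> is cut
    out by an open set of \<open>M\<close>, so no other sheet of \<open>S\<close> comes near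
    \<open>p\<close>.\<close>
  then obtain W2 where W2: "openin (mtop M) W2" "{q \<in> V. \<psi> q \<in> O'} = W2 \<inter> points S"
    unfolding opS by blast
  define F where "F q = chart_rep V \<psi> f (\<rho> (\<phi> q))" for q
  have "smooth_fun_on M W1 F" unfolding F_def
  proof (rule smooth_fun_on_compose[where F = "\<lambda>t. chart_rep V \<psi> f (\<rho> t)" and G = \<phi>, OF M W1 R])
    have "smooth_on ?s T (chart_rep V \<psi> f)" unfolding T_def by (rule smooth_fun_onD[OF C_inf_smooth_on[OF S f Z] V(1)])
    then show "smooth_on ?m R (\<lambda>t. chart_rep V \<psi> f (\<rho> t))" by (rule smooth_on_compose_mapping[OF \<rho>])
    show "smooth_fun_on M W1 (\<lambda>q. \<phi> q j)" for j
      by (rule smooth_fun_on_coord_subset[OF M U(1) W1]) (auto simp: W1_def)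
  qed (auto simp: W1_def)
  then have sF: "smooth_fun_on M (W1 \<inter> W2) F"
    using smooth_fun_on_subset[OF M W1 openin_Int[OF W1 W2(1)]] by blast
  have eq: "(\<lambda>j. if j < ?m then chart_rep V \<psi> (w j) (\<psi> q) else 0) = \<phi> q \<and> q \<in> V \<and> \<psi> q \<in> O'" if q: "q \<in> W2 \<inter> points S" for q
  proof -
    have qV: "q \<in> V" "\<psi> q \<in> O'" using q W2(2) by auto
    then have "\<psi> q \<in> \<psi> ` (V \<inter> Z)" using O'(3) by (auto simp: T_def)
    then have "q \<in> Z" using chart_image_inv(1)[OF S V(1)] chart_inv[OF S V(1) qV(1)] by (metis IntE)
    then have qB: "q \<in> B" "q \<in> points S" by (auto simp: Z_def)
    have "\<phi> q \<in> ES ?m" using qB B(3) eopen_subset[OF chart_eopen[OF M U(1)]] by blast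
    then have "(if j < ?m then chart_rep V \<psi> (w j) (\<psi> q) else 0) = \<phi> q j" for j
      using chart_inv[OF S V(1) qV(1)] wq[OF qB(2)] B(4)[OF qB(1)] by (auto simp: ES_def)
    then show ?thesis using qV by (auto simp: fun_eq_iff)
  qed
  have pW: "p \<in> W2 \<inter> points S" using W2(2) V(2) O'(2) by blast
  show ?thesis
  proof (rule that[OF openin_Int[OF W1 W2(1)] _ sF])
    have "\<phi> p \<in> R" using OR[of "\<psi> p"] eq[OF pW] by metis
    then show "p \<in> W1 \<inter> W2" using pW U(2) by (simp add: W1_def)
    show "\<forall>q\<in>W1 \<inter> W2 \<inter> points S. F q = f q"
    proof
      fix q assume "q \<in> W1 \<inter> W2 \<inter> points S"
      then have q: "q \<in> W2 \<inter> points S" by blast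
      have "\<rho> (\<phi> q) = \<psi> q" using \<rho>w[of "\<psi> q"] eq[OF q] by metis
      then show "F q = f q" using eq[OF q] chart_inv[OF S V(1)] by (simp add: F_def)
    qed
  qed
qed

text \<open>The products \<open>\<beta> k * (\<Prod>j<k. 1 - \<beta> j)\<close> form a partition of unity that is locally finite on the
  sets where some \<open>\<beta> j\<close> equals 1, so countability of the cover is all that is needed.\<close>

lemma closed_submanifold_extension:
  assumes M: "is_manifold M" and S: "closed_embedded_submanifold S M" and f: "f \<in> C_inf S"
  obtains F where "F \<in> C_inf M" "\<forall>q\<in>points S. F q = f q"
proof -
  have S': "is_manifold S" "closedin (mtop M) (points S)" "mtop S = subtopology (mtop M) (points S)" "immersion S M (incl S)"
    using S by (auto simp: closed_embedded_submanifold_def)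
  have SM: "points S \<subseteq> points M" using closedin_subset[OF S'(2)] .
  \<comment> \<open>\<open>h\<close> is a global function that equals \<open>\<beta> * f\<close> on
    \<open>S\<close>: a cut-off local extension if \<open>p\<close> lies in \<open>S\<close>, and 0
    on the open complement of \<open>S\<close> otherwise.\<close>
  have ex: "\<exists>\<beta> h B. \<beta> \<in> C_inf M \<and> h \<in> C_inf M \<and> openin (mtop M) B \<and> p \<in> B \<and> (\<forall>q\<in>B. \<beta> q = 1) \<and> (\<forall>q\<in>points S. h q = \<beta> q * f q)"
    if p: "p \<in> points M" for p
  proof -
    have "\<exists>W F. openin (mtop M) W \<and> p \<in> W \<and> smooth_fun_on M W F \<and> (\<forall>q\<in>W \<inter> points S. F q = f q)"
    proof (cases "p \<in> points S")
      case True
      then show ?thesis using submanifold_local_extension[OF M S'(1,3,4) f True] by metis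
    next
      case False
      have o: "openin (mtop M) (points M - points S)" using S'(2) by blast
      then show ?thesis using False p smooth_fun_on_const[OF M o, of 0]
        by (intro exI[of _ "points M - points S"] exI[of _ "\<lambda>_. 0"]) auto
    qed
    then obtain W F where W: "openin (mtop M) W" "p \<in> W" "smooth_fun_on M W F" "\<forall>q\<in>W \<inter> points S. F q = f q" by blast
    obtain \<beta> K B where b: "\<beta> \<in> C_inf M" "openin (mtop M) B" "p \<in> B" "\<forall>q\<in>B. \<beta> q = 1"
      "closedin (mtop M) K" "K \<subseteq> W" "B \<subseteq> K" "\<forall>q\<in>points M - K. \<beta> q = 0" by (rule bump_function[OF M W(1,2)])
    have "(\<lambda>q\<in>points M. if q \<in> W then \<beta> q * F q else 0) q = \<beta> q * f q" if "q \<in> points S" for q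
      using that W(4) b(6,8) SM by auto
    then show ?thesis using b C_inf_cutoff[OF M W(1,3) b(1,5,6,8)] by blast
  qed
  define \<O> where "\<O> = {B. \<exists>\<beta> h. \<beta> \<in> C_inf M \<and> h \<in> C_inf M \<and> openin (mtop M) B \<and> (\<forall>q\<in>B. \<beta> q = 1) \<and> (\<forall>q\<in>points S. h q = \<beta> q * f q)}"
  have L: "Lindelof_space (mtop M)" using second_countable_imp_Lindelof_space[of "mtop M"] M by (simp add: is_manifold_def)
  have o: "openin (mtop M) B" if "B \<in> \<O>" for B using that by (auto simp: \<O>_def)
  have U: "\<Union>\<O> = points M"
  proof
    show "\<Union>\<O> \<subseteq> points M" unfolding \<O>_def using openin_subset by blast
    show "points M \<subseteq> \<Union>\<O>" using ex unfolding \<O>_def by blast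
  qed
  from Lindelof_spaceD[OF L o U] obtain \<V> where "countable \<V> \<and> \<V> \<subseteq> \<O> \<and> \<Union>\<V> = points M"
    by (rule exE)
  then have \<V>: "countable \<V>" "\<V> \<subseteq> \<O>" "\<Union>\<V> = points M" by blast+
  show ?thesis
  proof (cases "points M = {}")
    case True
    then show ?thesis using that[of "\<lambda>q\<in>points M. 0"] C_inf_const[OF M] SM by auto
  next
    case False
    then have "\<V> \<noteq> {}" using \<V>(3) by (metis Union_empty)
    define A where "A = from_nat_into \<V>"
    have rA: "range A = \<V>" unfolding A_def by (rule range_from_nat_into[OF \<open>\<V> \<noteq> {}\<close> \<V>(1)])
    have "\<forall>k. \<exists>\<beta>h. fst \<beta>h \<in> C_inf M \<and> snd \<beta>h \<in> C_inf M \<and> openin (mtop M) (A k) \<and> (\<forall>q\<in>A k. fst \<beta>h q = 1) \<and> (\<forall>q\<in>points S. snd \<beta>h q = fst \<beta>h q * f q)"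
    proof
      fix k
      have "A k \<in> \<O>" using rA \<V>(2) by blast
      then obtain \<beta> h where "\<beta> \<in> C_inf M \<and> h \<in> C_inf M \<and> openin (mtop M) (A k) \<and> (\<forall>q\<in>A k. \<beta> q = 1) \<and> (\<forall>q\<in>points S. h q = \<beta> q * f q)"
        unfolding \<O>_def by blast
      then show "\<exists>\<beta>h. fst \<beta>h \<in> C_inf M \<and> snd \<beta>h \<in> C_inf M \<and> openin (mtop M) (A k) \<and> (\<forall>q\<in>A k. fst \<beta>h q = 1) \<and> (\<forall>q\<in>points S. snd \<beta>h q = fst \<beta>h q * f q)"
        by (intro exI[of _ "(\<beta>, h)"]) simp
    qed
    from choice[OF this] obtain \<beta>h where \<beta>h: "\<forall>k. fst (\<beta>h k) \<in> C_inf M \<and> snd (\<beta>h k) \<in> C_inf M \<and> openin (mtop M) (A k) \<and> (\<forall>q\<in>A k. fst (\<beta>h k) q = 1) \<and> (\<forall>q\<in>points S. snd (\<beta>h k) q = fst (\<beta>h k) q * f q)" ..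
    define \<beta> where "\<beta> k = fst (\<beta>h k)" for k
    define h where "h k = snd (\<beta>h k)" for k
    have b: "\<beta> k \<in> C_inf M" "h k \<in> C_inf M" "openin (mtop M) (A k)" "\<And>q. q \<in> A k \<Longrightarrow> \<beta> k q = 1" "\<And>q. q \<in> points S \<Longrightarrow> h k q = \<beta> k q * f q" for k
      using \<beta>h by (auto simp: \<beta>_def h_def)
    \<comment> \<open>\<open>h k\<close> already contains the factor \<open>\<beta> k\<close>, so on
      \<open>S\<close> the term \<open>t k\<close> is the \<open>k\<close>-th partition function
      times \<open>f\<close>.\<close>
    define t where "t k q = h k q * (\<Prod>j<k. 1 - \<beta> j q)" for k q
    define N where "N q = (LEAST k. q \<in> A k)" for q
    define F where "F q = (\<Sum>k\<le>N q. t k q)" for q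
    have cover: "q \<in> A (N q)" if "q \<in> points M" for q
      unfolding N_def by (rule LeastI_ex) (use that \<V>(3) rA in blast)
    \<comment> \<open>Every term beyond the first index \<open>N q\<close> contains the factor
      \<open>1 - \<beta> (N q) q = 0\<close>, so all longer sums agree and \<open>F\<close> is one
      fixed finite sum on each \<open>A n\<close>.\<close>
    have Feq: "F q = (\<Sum>k\<le>n. t k q)" if "q \<in> A n" for n q
    proof -
      have le: "N q \<le> n" unfolding N_def using that by (rule Least_le)
      have "q \<in> A (N q)" unfolding N_def using that by (rule LeastI)
      then have "t k q = 0" if "k > N q" for k
        using that b(4)[of q "N q"] by (auto simp: t_def)
      then show ?thesis unfolding F_def using le by (intro sum.mono_neutral_left) auto
    qed
    have "smooth_fun_on M (points M) F"
    proof (rule smooth_fun_on_local[OF M points_openin])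
      fix p assume p: "p \<in> points M"
      let ?A = "A (N p)"
      have pr: "smooth_fun_on M ?A (\<lambda>q. \<Prod>j<k. 1 - \<beta> j q)" for k
      proof (induction k)
        case (Suc k)
        have "smooth_fun_on M ?A (\<lambda>q. 1 + (- 1) * \<beta> k q)"
          by (intro smooth_fun_on_add smooth_fun_on_mult smooth_fun_on_const M b(3) C_inf_smooth_on b(1))
        then show ?case using smooth_fun_on_mult[OF M b(3) Suc] by simp
      qed (simp add: smooth_fun_on_const[OF M b(3)])
      have "smooth_fun_on M ?A (\<lambda>q. \<Sum>k\<le>N p. t k q)"
        unfolding t_def by (intro smooth_fun_on_sum smooth_fun_on_mult M b(3) C_inf_smooth_on b(2) pr) auto
      then have "smooth_fun_on M ?A F"
        using smooth_fun_on_cong[OF M b(3), of "N p" F "\<lambda>q. \<Sum>k\<le>N p. t k q"] Feq by blast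
      then show "\<exists>W'. openin (mtop M) W' \<and> p \<in> W' \<and> smooth_fun_on M W' F" using b(3) cover[OF p] by blast
    qed
    then have "(\<lambda>q\<in>points M. F q) \<in> C_inf M" by (rule C_inf_restrict[OF M])
    moreover have "F q = f q" if q: "q \<in> points S" for q
    proof -
      \<comment> \<open>The partition functions telescope to 1 minus the full product, which
        vanishes as soon as one of the \<open>\<beta> j\<close> is 1.\<close>
      have "(\<Sum>k<n. t k q) = (1 - (\<Prod>j<n. 1 - \<beta> j q)) * f q" for n
        by (induction n) (simp_all add: t_def b(5)[OF q] algebra_simps)
      then have "F q = (1 - (\<Prod>j<Suc (N q). 1 - \<beta> j q)) * f q"
        unfolding F_def lessThan_Suc_atMost[symmetric] .
      moreover have "(\<Prod>j<Suc (N q). 1 - \<beta> j q) = 0"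
        using b(4)[OF cover] q SM by auto
      ultimately show ?thesis by simp
    qed
    then have "\<forall>q\<in>points S. (\<lambda>q\<in>points M. F q) q = f q" using SM by auto
    ultimately show ?thesis by (rule that)
  qed
qed

section \<open>Integral manifolds of involutive distributions\<close>

text \<open>The frame condition of \<open>regular_distribution\<close> at one point, isolated so
  that a change of frame can be checked pointwise.\<close>

definition frame_at :: "'a manifold \<Rightarrow> ('a \<Rightarrow> 'a tvec set) \<Rightarrow> nat \<Rightarrow> (nat \<Rightarrow> 'a \<Rightarrow> 'a tvec) \<Rightarrow> 'a \<Rightarrow> bool" where
  "frame_at M D r Y q \<longleftrightarrow> D q = {v. \<exists>c. v = (\<lambda>f\<in>C_inf M. \<Sum>i<r. c i * Y i q f)} \<and>
     (\<forall>c. (\<forall>f\<in>C_inf M. (\<Sum>i<r. c i * Y i q f) = 0) \<longrightarrow> (\<forall>i<r. c i = 0))"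

lemma regular_distribution_frame:
  "regular_distribution M D \<longleftrightarrow> (\<exists>r. \<forall>p\<in>points M. \<exists>W X. openin (mtop M) W \<and> p \<in> W \<and>
     (\<forall>i<r. vector_field_on M W (X i)) \<and> (\<forall>q\<in>W. frame_at M D r X q))"
  by (simp only: regular_distribution_def frame_at_def)

lemma frame_at_member: "frame_at M D r Y q \<Longrightarrow> (\<lambda>f\<in>C_inf M. \<Sum>i<r. c i * Y i q f) \<in> D q"
  unfolding frame_at_def by blast

lemma frame_at_independent:
  "frame_at M D r Y q \<Longrightarrow> (\<And>f. f \<in> C_inf M \<Longrightarrow> (\<Sum>i<r. c i * Y i q f) = 0) \<Longrightarrow> i < r \<Longrightarrow> c i = 0"
  unfolding frame_at_def by blast

lemma sum_mult_delta:
  fixes a :: "nat \<Rightarrow> real"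
  shows "(\<Sum>i<r. a i * (if i = l then 1 else 0)) = (if l < r then a l else 0)"
  by (simp add: if_distrib sum.delta cong: if_cong)

text \<open>One pivot step: \<open>Z k\<close> is the normalised pivot row and its multiples are
  removed from the other rows. The change is invertible on coefficients, so span and independence
  are kept.\<close>

lemma frame_at_eliminate:
  assumes Y: "frame_at M D r Y q" and k: "k < r" and u: "u \<noteq> 0"
    and Zk: "\<And>f. f \<in> C_inf M \<Longrightarrow> Z k q f = inverse u * Y k q f"
    and Zi: "\<And>i f. f \<in> C_inf M \<Longrightarrow> i < r \<Longrightarrow> i \<noteq> k \<Longrightarrow> Z i q f = Y i q f - y i * Z k q f"
  shows "frame_at M D r Z q"
proof -
  define S where "S c = (\<Sum>i\<in>{..<r} - {k}. c i * y i)" for c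
  \<comment> \<open>\<open>\<tau>\<close> turns coefficients with respect to \<open>Z\<close> into
    coefficients with respect to \<open>Y\<close>; \<open>\<sigma>\<close> goes back and shows that
    every combination of \<open>Y\<close> is reached.\<close>
  define \<tau> where "\<tau> c = c(k := (c k - S c) * inverse u)" for c
  define \<sigma> where "\<sigma> c = c(k := u * c k + S c)" for c
  have S_upd: "S (c(k := t)) = S c" for c t unfolding S_def by (intro sum.cong) auto
  have \<tau>\<sigma>: "\<tau> (\<sigma> c) = c" for c using u by (auto simp: \<tau>_def \<sigma>_def S_upd fun_eq_iff)
  have eq: "(\<Sum>i<r. c i * Z i q f) = (\<Sum>i<r. \<tau> c i * Y i q f)" if f: "f \<in> C_inf M" for c f
  proof -
    have "(\<Sum>i<r. c i * Z i q f) = c k * Z k q f + (\<Sum>i\<in>{..<r} - {k}. c i * Z i q f)"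
      using k by (subst sum.remove[of _ k]) auto
    also have "(\<Sum>i\<in>{..<r} - {k}. c i * Z i q f) = (\<Sum>i\<in>{..<r} - {k}. c i * Y i q f - (c i * y i) * Z k q f)"
      by (intro sum.cong) (auto simp: Zi[OF f] algebra_simps)
    also have "\<dots> = (\<Sum>i\<in>{..<r} - {k}. c i * Y i q f) - S c * Z k q f"
      by (simp add: sum_subtractf S_def sum_distrib_right)
    also have "(\<Sum>i\<in>{..<r} - {k}. c i * Y i q f) = (\<Sum>i\<in>{..<r} - {k}. \<tau> c i * Y i q f)"
      by (intro sum.cong) (auto simp: \<tau>_def)
    also have "c k * Z k q f + ((\<Sum>i\<in>{..<r} - {k}. \<tau> c i * Y i q f) - S c * Z k q f) = \<tau> c k * Y k q f + (\<Sum>i\<in>{..<r} - {k}. \<tau> c i * Y i q f)"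
      by (simp add: Zk[OF f] \<tau>_def algebra_simps)
    also have "\<dots> = (\<Sum>i<r. \<tau> c i * Y i q f)" using k by (subst sum.remove[of _ k]) auto
    finally show ?thesis .
  qed
  have D: "D q = {v. \<exists>c. v = (\<lambda>f\<in>C_inf M. \<Sum>i<r. c i * Y i q f)}"
    and ind: "\<And>c. \<forall>f\<in>C_inf M. (\<Sum>i<r. c i * Y i q f) = 0 \<Longrightarrow> \<forall>i<r. c i = 0"
    using Y unfolding frame_at_def by blast+
  have res: "(\<lambda>f\<in>C_inf M. \<Sum>i<r. c i * Z i q f) = (\<lambda>f\<in>C_inf M. \<Sum>i<r. \<tau> c i * Y i q f)" for c
    by (rule restrict_ext) (rule eq)
  show ?thesis
    unfolding frame_at_def
  proof (intro conjI allI impI)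
    define H where "H c = (\<lambda>f\<in>C_inf M. \<Sum>i<r. c i * Y i q f)" for c
    have "{v. \<exists>c. v = H c} = {v. \<exists>c. v = H (\<tau> c)}"
    proof (intro Collect_cong iffI)
      fix v assume "\<exists>c. v = H c"
      then obtain c where "v = H (\<tau> (\<sigma> c))" unfolding \<tau>\<sigma> by blast
      then show "\<exists>c. v = H (\<tau> c)" by blast
    qed blast
    then show "D q = {v. \<exists>c. v = (\<lambda>f\<in>C_inf M. \<Sum>i<r. c i * Z i q f)}"
      unfolding D res H_def .
  next
    fix c i assume c: "\<forall>f\<in>C_inf M. (\<Sum>i<r. c i * Z i q f) = 0" and i: "i < r"
    have \<tau>0: "\<forall>i<r. \<tau> c i = 0" by (rule ind) (use c eq in simp)
    have ne: "c i = 0" if "i < r" "i \<noteq> k" for i using \<tau>0 that by (auto simp: \<tau>_def split: if_splits)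
    then have "S c = 0" unfolding S_def by (intro sum.neutral) auto
    then have "c k = 0" using \<tau>0[rule_format, OF k] u by (simp add: \<tau>_def)
    then show "c i = 0" using ne i by (cases "i = k") auto
  qed
qed

lemma tangent_lincomb:
  assumes M: "is_manifold M" and v: "v \<in> tangent_space M p" and w: "w \<in> tangent_space M p"
  shows "(\<lambda>f\<in>C_inf M. a * v f + b * w f) \<in> tangent_space M p"
  unfolding tangent_space_def
proof (intro CollectI conjI ballI allI)
  fix f g assume f: "f \<in> C_inf M" and g: "g \<in> C_inf M"
  show "(\<lambda>f\<in>C_inf M. a * v f + b * w f) (\<lambda>q\<in>points M. f q + g q) = (\<lambda>f\<in>C_inf M. a * v f + b * w f) f + (\<lambda>f\<in>C_inf M. a * v f + b * w f) g"
    using f g C_inf_add[OF M f g] tangent_add[OF v f g] tangent_add[OF w f g] by (simp add: algebra_simps del: restrict_apply add: restrict_apply')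
  show "(\<lambda>f\<in>C_inf M. a * v f + b * w f) (\<lambda>q\<in>points M. f q * g q) = (\<lambda>f\<in>C_inf M. a * v f + b * w f) f * g p + f p * (\<lambda>f\<in>C_inf M. a * v f + b * w f) g"
    using f g C_inf_mult[OF M f g] tangent_mult[OF v f g] tangent_mult[OF w f g] by (simp add: algebra_simps del: restrict_apply add: restrict_apply')
next
  fix c f assume f: "f \<in> C_inf M"
  show "(\<lambda>f\<in>C_inf M. a * v f + b * w f) (\<lambda>q\<in>points M. c * f q) = c * (\<lambda>f\<in>C_inf M. a * v f + b * w f) f"
    using f C_inf_scale[OF M f] tangent_scale[OF v f] tangent_scale[OF w f] by (simp add: algebra_simps del: restrict_apply add: restrict_apply')
qed simp

text \<open>Gauss-Jordan elimination of a local frame with respect to the coordinates of a chart.\<close>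

lemma reduced_frame:
  assumes M: "is_manifold M" and D: "regular_distribution M D" and p: "p \<in> points M"
    and U: "(U, \<phi>) \<in> atlas M" and x: "\<And>j. x j \<in> C_inf M"
    and B: "openin (mtop M) B" "p \<in> B" "B \<subseteq> U" "\<And>j q. q \<in> B \<Longrightarrow> x j q = \<phi> q j"
  obtains r W Y c where "openin (mtop M) W" "p \<in> W" "W \<subseteq> B" "\<And>i. i < r \<Longrightarrow> vector_field_on M W (Y i)"
    "\<And>q. q \<in> W \<Longrightarrow> frame_at M D r Y q" "\<And>l. l < r \<Longrightarrow> c l < mdim M"
    "\<And>i l q. i < r \<Longrightarrow> l < r \<Longrightarrow> q \<in> W \<Longrightarrow> Y i q (x (c l)) = (if i = l then 1 else 0)"
proof -
  obtain r W0 X where W0: "openin (mtop M) W0" "p \<in> W0" and X: "\<And>i. i < r \<Longrightarrow> vector_field_on M W0 (X i)"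
    "\<And>q. q \<in> W0 \<Longrightarrow> frame_at M D r X q"
  proof -
    from D[unfolded regular_distribution_frame] obtain r where "\<forall>p\<in>points M. \<exists>W X. openin (mtop M) W \<and> p \<in> W \<and>
     (\<forall>i<r. vector_field_on M W (X i)) \<and> (\<forall>q\<in>W. frame_at M D r X q)" by (rule exE)
    from bspec[OF this p] obtain W X where "openin (mtop M) W \<and> p \<in> W \<and>
     (\<forall>i<r. vector_field_on M W (X i)) \<and> (\<forall>q\<in>W. frame_at M D r X q)" by (elim exE)
    then show thesis by (intro that[of W r X]) auto
  qed
  \<comment> \<open>After \<open>k\<close> steps the first \<open>k\<close> pivot columns are unit
    columns for all rows \<open>i < r\<close>, those above the pivot included.\<close>
  have "\<exists>W Y c. openin (mtop M) W \<and> p \<in> W \<and> W \<subseteq> B \<and> (\<forall>i<r. vector_field_on M W (Y i)) \<and>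
    (\<forall>q\<in>W. frame_at M D r Y q) \<and> (\<forall>l<k. c l < mdim M) \<and>
    (\<forall>i<r. \<forall>l<k. \<forall>q\<in>W. Y i q (x (c l)) = (if i = l then 1 else 0))" if "k \<le> r" for k
    using that
  proof (induction k)
    case 0
    have "vector_field_on M (W0 \<inter> B) (X i)" if "i < r" for i
      using X(1)[OF that] smooth_fun_on_subset[OF M W0(1) openin_Int[OF W0(1) B(1)]]
      unfolding vector_field_on_def by blast
    then show ?case using W0 B X(2) by (intro exI[of _ "W0 \<inter> B"] exI[of _ X]) auto
  next
    case (Suc k)
    then obtain W Y c where W: "openin (mtop M) W" "p \<in> W" "W \<subseteq> B" and Y: "\<forall>i<r. vector_field_on M W (Y i)"
      and fr: "\<forall>q\<in>W. frame_at M D r Y q" and c: "\<forall>l<k. c l < mdim M"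
      and dl: "\<forall>i<r. \<forall>l<k. \<forall>q\<in>W. Y i q (x (c l)) = (if i = l then 1 else 0)"
      using Suc_leD by blast
    have k: "k < r" using Suc.prems by simp
    have Yt: "Y i q \<in> tangent_space M q" if "i < r" "q \<in> W" for i q
      using Y that unfolding vector_field_on_def by blast
    have Ys: "smooth_fun_on M W (\<lambda>q. Y i q f)" if "i < r" "f \<in> C_inf M" for i f
      using Y that unfolding vector_field_on_def by blast
    \<comment> \<open>Without a pivot the vector \<open>Y k p\<close> would kill all coordinates and
      hence be 0, contrary to independence of the frame.\<close>
    have "\<exists>j<mdim M. Y k p (x j) \<noteq> 0"
    proof (rule ccontr)
      assume "\<not> ?thesis"
      then have z: "Y k p (x j) = 0" if "j < mdim M" for j using that by blast
      have "Y k p f = 0" if "f \<in> C_inf M" for f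
        using tangent_coordinates[OF M U _ Yt[OF k W(2)] x B(1,2,4) that] z B by auto
      then have Y0: "(\<Sum>i<r. (if i = k then 1 else 0) * Y i p f) = 0" if "f \<in> C_inf M" for f
        using that by (intro sum.neutral) auto
      have "frame_at M D r Y p" using fr W(2) by blast
      from frame_at_independent[where c = "\<lambda>i. if i = k then 1 else 0", OF this Y0 k]
      have "(if k = k then 1 else 0 :: real) = 0" by simp
      then show False by simp
    qed
    then obtain j where j: "j < mdim M" "Y k p (x j) \<noteq> 0" by blast
    define u where "u q = Y k q (x j)" for q
    define W' where "W' = {q \<in> W. u q \<in> - {0}}"
    have us: "smooth_fun_on M W u" unfolding u_def by (rule Ys[OF k x])
    have W': "openin (mtop M) W'" unfolding W'_def by (rule smooth_fun_on_preimage_openin[OF M W(1) us]) auto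
    have WW: "W' \<subseteq> W" by (auto simp: W'_def)
    have u0: "u q \<noteq> 0" if "q \<in> W'" for q using that by (auto simp: W'_def)
    define y where "y i q = Y i q (x j)" for i q
    \<comment> \<open>Both branches are written as two-term combinations, the first with a zero
      term, so that \<open>tangent_lincomb\<close> applies to each.\<close>
    define Z where "Z i q = (if i = k then (\<lambda>f\<in>C_inf M. inverse (u q) * Y k q f + 0 * Y k q f)
       else (\<lambda>f\<in>C_inf M. 1 * Y i q f + (- y i q * inverse (u q)) * Y k q f))" for i q
    have Zk: "Z k q f = inverse (u q) * Y k q f" if "f \<in> C_inf M" for q f using that by (simp add: Z_def)
    have Zi: "Z i q f = Y i q f - y i q * Z k q f" if "f \<in> C_inf M" "i \<noteq> k" for i q f using that by (simp add: Z_def)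
    have Zfr: "frame_at M D r Z q" if "q \<in> W'" for q
    proof (rule frame_at_eliminate[where Y = Y and Z = Z and y = "\<lambda>i. y i q", OF _ k u0[OF that]])
      show "frame_at M D r Y q" using fr that WW by blast
    qed (use Zk Zi in blast)+
    have Zv: "vector_field_on M W' (Z i)" if i: "i < r" for i
      unfolding vector_field_on_def
    proof (intro conjI ballI)
      fix q assume "q \<in> W'"
      then have q: "q \<in> W" using WW by blast
      show "Z i q \<in> tangent_space M q"
      proof (cases "i = k")
        case True
        show ?thesis using tangent_lincomb[OF M Yt[OF k q] Yt[OF k q], of "inverse (u q)" 0] by (simp only: Z_def True if_True refl)
      next
        case False
        show ?thesis using tangent_lincomb[OF M Yt[OF i q] Yt[OF k q], of 1 "- y i q * inverse (u q)"] by (simp only: Z_def False if_False)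
      qed
    next
      fix f assume f: "f \<in> C_inf M"
      have sub: "smooth_fun_on M W' g" if "smooth_fun_on M W g" for g
        by (rule smooth_fun_on_subset[OF M W(1) W' WW that])
      have sk: "smooth_fun_on M W' (\<lambda>q. inverse (u q) * Y k q f)"
        by (intro smooth_fun_on_mult[OF M W'] smooth_fun_on_inverse[OF M W'] sub us Ys k f u0)
      show "smooth_fun_on M W' (\<lambda>q. Z i q f)"
      proof (cases "i = k")
        case True
        then show ?thesis using sk Zk[OF f] by simp
      next
        case False
        have "smooth_fun_on M W' (\<lambda>q. Y i q f + (- 1) * (y i q * (inverse (u q) * Y k q f)))"
          unfolding y_def by (intro smooth_fun_on_add[OF M W'] smooth_fun_on_mult[OF M W' smooth_fun_on_const[OF M W']] smooth_fun_on_mult[OF M W'] sk sub Ys i f x)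
        then show ?thesis using False Zk[OF f] Zi[OF f] by simp
      qed
    qed
    have "Z i q (x ((c(k := j)) l)) = (if i = l then 1 else 0)" if i: "i < r" and l: "l < Suc k" and q: "q \<in> W'" for i l q
    proof (cases "l = k")
      case True
      then show ?thesis using Zk[OF x] Zi[OF x[of j], of i q] u0[OF q] by (cases "i = k") (auto simp: u_def y_def)
    next
      case False
      then have "Y i q (x (c l)) = (if i = l then 1 else 0)" "Y k q (x (c l)) = 0" using dl l i k q WW by auto
      then show ?thesis using False Zk[OF x] Zi[OF x] by (cases "i = k") auto
    qed
    then show ?case using W' WW W(2,3) j u0 c Zfr Zv
      by (intro exI[of _ W'] exI[of _ Z] exI[of _ "c(k := j)"]) (auto simp: W'_def u_def less_Suc_eq)
  qed
  from this[OF order_refl] obtain W Y c where "openin (mtop M) W" "p \<in> W" "W \<subseteq> B" "\<forall>i<r. vector_field_on M W (Y i)"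
    "\<forall>q\<in>W. frame_at M D r Y q" "\<forall>l<r. c l < mdim M" "\<forall>i<r. \<forall>l<r. \<forall>q\<in>W. Y i q (x (c l)) = (if i = l then 1 else 0)"
    by blast
  then show ?thesis by (intro that[of W r Y c]) auto
qed

text \<open>By involutivity the bracket of \<open>Y i\<close> and \<open>Y k\<close> is a combination of the frame, and its coefficients
  are its values on the functions \<open>x (c l)\<close>, which vanish as the \<open>Y i (x (c l))\<close> are constant.\<close>

lemma reduced_frame_commutes:
  assumes M: "is_manifold M" and D: "regular_distribution M D" "involutive M D"
    and W: "openin (mtop M) W" and Y: "\<And>i. i < r \<Longrightarrow> vector_field_on M W (Y i)"
    and fr: "\<And>q. q \<in> W \<Longrightarrow> frame_at M D r Y q"
    and x: "\<And>j. x j \<in> C_inf M" and dl: "\<And>i l q. i < r \<Longrightarrow> l < r \<Longrightarrow> q \<in> W \<Longrightarrow> Y i q (x (c l)) = (if i = l then 1 else 0)"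
    and ik: "i < r" "k < r" and q: "q \<in> W" and f: "f \<in> C_inf M" and F: "F i \<in> C_inf M" "F k \<in> C_inf M"
    and B: "openin (mtop M) B" "q \<in> B" "B \<subseteq> W" "\<And>y. y \<in> B \<Longrightarrow> F i y = Y i y f" "\<And>y. y \<in> B \<Longrightarrow> F k y = Y k y f"
  shows "Y i q (F k) = Y k q (F i)"
proof -
  obtain \<beta> K B' where b: "\<beta> \<in> C_inf M" "openin (mtop M) B'" "q \<in> B'" "\<forall>q\<in>B'. \<beta> q = 1"
    "closedin (mtop M) K" "K \<subseteq> W" "B' \<subseteq> K" "\<forall>q\<in>points M - K. \<beta> q = 0" by (rule bump_function[OF M W q])
  have qM: "q \<in> points M" using q W openin_subset by blast
  \<comment> \<open>Involutivity speaks of global sections, so the local fields are cut off. Near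
    \<open>q\<close> nothing changes, as the bump function is 1 there.\<close>
  define E where "E i y = (if y \<in> W then (\<lambda>f\<in>C_inf M. \<beta> y * Y i y f + 0 * Y i y f) else (\<lambda>f\<in>C_inf M. 0))" for i y
  have Yt: "Y i q \<in> tangent_space M q" if "i < r" "q \<in> W" for i q
    using Y that unfolding vector_field_on_def by blast
  have Ef: "E i y f = (if y \<in> W then \<beta> y * Y i y f else 0)" if "f \<in> C_inf M" for i y f
    using that by (simp add: E_def)
  have EC: "(\<lambda>y\<in>points M. E i y f) \<in> C_inf M" if i: "i < r" and f: "f \<in> C_inf M" for i f
  proof -
    have "smooth_fun_on M W (\<lambda>y. Y i y f)" using Y[OF i] f unfolding vector_field_on_def by blast
    from C_inf_cutoff[OF M W this b(1,5,6,8)] show ?thesis by (simp add: Ef[OF f])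
  qed
  have Esec: "E i \<in> sections M D" if i: "i < r" for i
    unfolding sections_def vector_field_on_def
  proof (intro CollectI conjI ballI)
    fix y assume y: "y \<in> points M"
    obtain r' X where "frame_at M D r' X y"
      using D(1) y unfolding regular_distribution_frame by blast
    from frame_at_member[OF this, of "\<lambda>_. 0"] have D0: "(\<lambda>f\<in>C_inf M. 0) \<in> D y" by simp
    have T0: "(\<lambda>f\<in>C_inf M. 0) \<in> tangent_space M y"
      by (auto simp: tangent_space_def C_inf_add[OF M] C_inf_mult[OF M] C_inf_scale[OF M])
    show "E i y \<in> tangent_space M y"
    proof (cases "y \<in> W")
      case True
      show ?thesis using tangent_lincomb[OF M Yt[OF i True] Yt[OF i True], of "\<beta> y" 0] by (simp only: E_def True if_True)
    qed (use T0 in \<open>simp only: E_def if_False\<close>)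
    show "E i y \<in> D y"
    proof (cases "y \<in> W")
      case True
      have "E i y = (\<lambda>f\<in>C_inf M. \<Sum>l<r. (if l = i then \<beta> y else 0) * Y l y f)"
        unfolding E_def using True i by (auto intro!: restrict_ext simp: if_distrib[of "\<lambda>a. a * _"] cong: if_cong)
      then show ?thesis using frame_at_member[OF fr[OF True]] by simp
    qed (use D0 in \<open>simp add: E_def\<close>)
  next
    fix f assume f: "f \<in> C_inf M"
    have "smooth_fun_on M (points M) (\<lambda>y\<in>points M. E i y f)" by (rule C_inf_smooth[OF EC[OF i f]])
    then show "smooth_fun_on M (points M) (\<lambda>y. E i y f)"
      using smooth_fun_on_cong[OF M points_openin, of "\<lambda>y\<in>points M. E i y f" "\<lambda>y. E i y f"] by simp
  qed
  define br where "br = lie_bracket M (E i) (E k) q"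
  have "lie_bracket M (E i) (E k) \<in> sections M D"
    using D(2) Esec ik unfolding involutive_def by blast
  then have "br \<in> D q" using qM unfolding sections_def br_def by blast
  then obtain a where a: "br = (\<lambda>f\<in>C_inf M. \<Sum>l<r. a l * Y l q f)"
    using fr[OF q] unfolding frame_at_def by blast
  have Eq: "E i q g = Y i q g" if "g \<in> C_inf M" for i g
    using that b(3,4) q by (simp add: Ef)
  have brf: "br g = Y i q (\<lambda>y\<in>points M. E k y g) - Y k q (\<lambda>y\<in>points M. E i y g)" if "g \<in> C_inf M" for g
    using that EC ik by (simp add: br_def lie_bracket_def lie_deriv_def Eq)
  have EB: "E i y g = Y i y g" if "g \<in> C_inf M" "y \<in> B'" for i g y
    using that b(4,6,7) by (auto simp: Ef)
  \<comment> \<open>Near \<open>q\<close> the argument is the constant 0 or 1, and derivations kill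
    constants.\<close>
  have zero: "Y i q (\<lambda>y\<in>points M. E k y (x (c l))) = 0" if "i < r" "k < r" "l < r" for i k l
  proof -
    have "Y i q (\<lambda>y\<in>points M. E k y (x (c l))) = Y i q (\<lambda>y\<in>points M. if k = l then 1 else 0)"
    proof (rule tangent_local[OF M Yt[OF that(1) q] EC[OF that(2) x] C_inf_const[OF M] b(2,3)])
      fix y assume y: "y \<in> B'"
      then have "y \<in> W" "y \<in> points M" using b(6,7) openin_subset[OF b(2)] by auto
      then show "(\<lambda>y\<in>points M. E k y (x (c l))) y = (\<lambda>y\<in>points M. if k = l then 1 else 0) y"
        using EB[OF x y] dl[OF that(2,3)] by simp
    qed
    then show ?thesis using tangent_const[OF M qM Yt[OF that(1) q]] by simp
  qed
  have "a l = 0" if l: "l < r" for l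
  proof -
    have "br (x (c l)) = 0" using brf[OF x] zero ik l by simp
    moreover have "br (x (c l)) = (\<Sum>m<r. a m * (if m = l then 1 else 0))"
      unfolding a restrict_apply'[OF x] by (intro sum.cong) (use dl[OF _ l q] in auto)
    ultimately show ?thesis using l by (simp add: sum_mult_delta)
  qed
  then have "br f = 0" using f by (simp add: a)
  then have "Y i q (\<lambda>y\<in>points M. E k y f) = Y k q (\<lambda>y\<in>points M. E i y f)" using brf[OF f] by simp
  moreover have "Y i q (\<lambda>y\<in>points M. E k y f) = Y i q (F k)" if "i < r" "k < r" "F k \<in> C_inf M" "\<And>y. y \<in> B \<Longrightarrow> F k y = Y k y f" for i k
  proof (rule tangent_local[OF M Yt[OF that(1) q] EC[OF that(2) f] that(3)])
    show "openin (mtop M) (B \<inter> B')" "q \<in> B \<inter> B'" using B b by auto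
    fix y assume y: "y \<in> B \<inter> B'"
    then have "y \<in> points M" using openin_subset[OF B(1)] by auto
    then show "(\<lambda>y\<in>points M. E k y f) y = F k y" using y EB[OF f, of y k] that(4)[of y] by simp
  qed
  ultimately show ?thesis using ik F B(4,5) by metis
qed

lemma smooth_fun_on_continuous_map:
  assumes M: "is_manifold M" and W: "openin (mtop M) W" and f: "smooth_fun_on M W f"
  shows "continuous_map (subtopology (mtop M) W) euclideanreal f"
  unfolding continuous_map_def
proof (intro conjI allI impI)
  fix S :: "real set" assume "openin euclideanreal S"
  then have "openin (mtop M) {q \<in> W. f q \<in> S}" using smooth_fun_on_preimage_openin[OF M W f] by simp
  moreover have "{q \<in> topspace (subtopology (mtop M) W). f q \<in> S} = {q \<in> W. f q \<in> S}"
    using openin_subset[OF W] by auto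
  ultimately show "openin (subtopology (mtop M) W) {q \<in> topspace (subtopology (mtop M) W). f q \<in> S}"
    using W by (auto simp: openin_open_subtopology)
qed simp

lemma connected_ebox: "connectedin (Euclidean_space r) (ebox r a e)"
proof -
  have "connectedin (powertop_real UNIV) (\<Pi>\<^sub>E i\<in>UNIV. if i < r then {a i - e<..<a i + e} else {0})"
    by (subst connectedin_PiE) (auto simp: connected_Ioo)
  moreover have "(\<Pi>\<^sub>E i\<in>UNIV. if i < r then {a i - e<..<a i + e} else {0}) = ebox r a e"
  proof (rule Set.set_eqI)
    fix x :: "nat \<Rightarrow> real"
    have "x \<in> (\<Pi>\<^sub>E i\<in>UNIV. if i < r then {a i - e<..<a i + e} else {0}) \<longleftrightarrow> (\<forall>i. x i \<in> (if i < r then {a i - e<..<a i + e} else {0}))"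
      by (simp add: PiE_iff)
    also have "\<dots> \<longleftrightarrow> (\<forall>i. (i < r \<longrightarrow> \<bar>x i - a i\<bar> < e) \<and> (i \<ge> r \<longrightarrow> x i = 0))"
      by (intro all_cong1) (auto simp: abs_less_iff)
    finally show "x \<in> (\<Pi>\<^sub>E i\<in>UNIV. if i < r then {a i - e<..<a i + e} else {0}) \<longleftrightarrow> x \<in> ebox r a e"
      unfolding ES_def ebox_def by blast
  qed
  ultimately show ?thesis
    by (simp add: Euclidean_space_ES euclidean_product_topology connectedin_subtopology ebox_def)
qed

text \<open>The reduced frame integrates to a map \<open>G\<close> along which the coordinates \<open>c l\<close> are the parameters up to
  a translation. They therefore form a global chart of the image of \<open>G\<close>.\<close>

theorem frobenius_integral_manifold:
  assumes M: "is_manifold M" and D: "regular_distribution M D" "involutive M D" and p: "p \<in> points M"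
  obtains L where "integral_manifold M D L" "p \<in> points L"
proof -
  let ?n = "mdim M"
  obtain U \<phi> where U: "(U, \<phi>) \<in> atlas M" "p \<in> U" using chart_exists[OF M p] .
  obtain x B where x: "\<And>j. x j \<in> C_inf M" and B: "openin (mtop M) B" "p \<in> B" "B \<subseteq> U" "\<And>j q. q \<in> B \<Longrightarrow> x j q = \<phi> q j"
    using chart_coordinate_functions[OF M U] by metis
  obtain r W Y c where W: "openin (mtop M) W" "p \<in> W" "W \<subseteq> B" and Y: "\<And>i. i < r \<Longrightarrow> vector_field_on M W (Y i)"
    and fr: "\<And>q. q \<in> W \<Longrightarrow> frame_at M D r Y q" and c: "\<And>l. l < r \<Longrightarrow> c l < ?n"
    and dl: "\<And>i l q. i < r \<Longrightarrow> l < r \<Longrightarrow> q \<in> W \<Longrightarrow> Y i q (x (c l)) = (if i = l then 1 else 0)"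
  proof (rule reduced_frame[where x = x and B = B and \<phi> = \<phi>, OF M D(1) p U(1) x B])
    fix r W Y c assume "openin (mtop M) W" "p \<in> W" "W \<subseteq> B" "\<And>i. i < r \<Longrightarrow> vector_field_on M W (Y i)"
      "\<And>q. q \<in> W \<Longrightarrow> frame_at M D r Y q" "\<And>l. l < r \<Longrightarrow> c l < ?n"
      "\<And>i l q. i < r \<Longrightarrow> l < r \<Longrightarrow> q \<in> W \<Longrightarrow> Y i q (x (c l)) = (if i = l then 1 else 0)"
    then show thesis by (rule that)
  qed
  have WU: "W \<subseteq> U" using W(3) B(3) by blast
  have Yt: "Y i q \<in> tangent_space M q" if "i < r" "q \<in> W" for i q
    using Y that unfolding vector_field_on_def by blast
  have Ys: "smooth_fun_on M W (\<lambda>q. Y i q f)" if "i < r" "f \<in> C_inf M" for i f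
    using Y that unfolding vector_field_on_def by blast
  have Yc: "Y i q f = (\<Sum>j<?n. Y i q (x j) * partial_deriv j (chart_rep U \<phi> f) (\<phi> q))"
    if "i < r" "q \<in> W" "f \<in> C_inf M" for i q f
    by (rule tangent_coordinates[OF M U(1) _ Yt[OF that(1,2)] x B(1) _ B(4) that(3)]) (use that W(3) B(3) in auto)
  define V where "V = \<phi> ` W"
  have V: "eopen ?n V" unfolding V_def by (rule chart_image_eopen[OF M U(1) W(1) WU])
  have UW: "U \<inter> W = W" using WU by blast
  define A where "A l j = (\<lambda>t. Y l (inv_into U \<phi> t) (x j))" for l j
  have A: "smooth_on ?n V (A l j)" if "l < r" "j < ?n" for l j
    unfolding A_def V_def using smooth_fun_onD[OF Ys[OF that(1) x] U(1), of j] UW by simp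
  have Aq: "A l j (\<phi> q) = Y l q (x j)" if "q \<in> W" for l j q
    using chart_inv[OF M U(1)] that WU by (auto simp: A_def)
  have pV: "\<phi> p \<in> V" using W(2) by (simp add: V_def)
  \<comment> \<open>The commutation of the frame in coordinates. The coefficients of the fields live
    on \<open>W\<close> only, so \<open>F\<close> is their global stand-in near the point
    considered.\<close>
  have comm: "(\<Sum>i<?n. partial_deriv i (A l j) t * A k i t) = (\<Sum>i<?n. partial_deriv i (A k j) t * A l i t)"
    if t: "t \<in> V" and kl: "k < r" "l < r" "j < ?n" for t k l j
  proof -
    obtain q where q: "q \<in> W" "t = \<phi> q" using t by (auto simp: V_def)
    obtain \<beta> K B' where b: "\<beta> \<in> C_inf M" "openin (mtop M) B'" "q \<in> B'" "\<forall>q\<in>B'. \<beta> q = 1"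
      "closedin (mtop M) K" "K \<subseteq> W" "B' \<subseteq> K" "\<forall>q\<in>points M - K. \<beta> q = 0" by (rule bump_function[OF M W(1) q(1)])
    define F where "F i = (\<lambda>q\<in>points M. if q \<in> W then \<beta> q * Y i q (x j) else 0)" for i
    have F: "F i \<in> C_inf M" if "i < r" for i
      unfolding F_def by (rule C_inf_cutoff[OF M W(1) Ys[OF that x] b(1,5,6,8)])
    have FB: "F i y = Y i y (x j)" if "y \<in> B'" for i y
      using that b(4,6,7) openin_subset[OF b(2)] by (auto simp: F_def)
    have o: "eopen ?n (\<phi> ` B')" by (rule chart_image_eopen[OF M U(1) b(2)]) (use b(6,7) WU in blast)
    have d: "partial_deriv i (chart_rep U \<phi> (F m)) (\<phi> q) = partial_deriv i (A m j) (\<phi> q)" if "i < ?n" for i m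
    proof (rule partial_deriv_cong[OF o _ that])
      fix y assume "y \<in> \<phi> ` B'"
      then obtain z where z: "z \<in> B'" "y = \<phi> z" by blast
      then have "z \<in> W" using b(6,7) by blast
      then show "chart_rep U \<phi> (F m) y = A m j y" using z FB Aq chart_inv[OF M U(1), of z] WU by auto
    qed (use b(3) in blast)
    have YF: "Y k q (F l) = (\<Sum>i<?n. partial_deriv i (A l j) t * A k i t)" if "k < r" "l < r" for k l
      using Yc[OF that(1) q(1) F[OF that(2)]] d Aq[OF q(1)] by (simp add: q(2) mult.commute)
    have BW: "B' \<subseteq> W" using b(6,7) by blast
    have "Y k q (F l) = Y l q (F k)"
      by (rule reduced_frame_commutes[where x = x and Y = Y and c = c and F = F,
            OF M D W(1) Y fr x dl kl(1,2) q(1) x[of j] F[OF kl(1)] F[OF kl(2)] b(2,3) BW FB FB])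
    then show ?thesis using YF[OF kl(1,2)] YF[OF kl(2,1)] by simp
  qed
  obtain e G where e: "e > 0" and GM: "smooth_mapping r (ebox r (\<lambda>_. 0) e) ?n V G" and G0: "G (\<lambda>_. 0) = \<phi> p"
    and Gd: "\<forall>x\<in>ebox r (\<lambda>_. 0) e. \<forall>l<r. \<forall>j<?n. hpd l (\<lambda>x. G x j) (A l j (G x)) x"
    by (rule commuting_fields_integral[OF V pV A comm])
  define Q where "Q = ebox r (\<lambda>_. 0) e"
  have Qo: "eopen r Q" unfolding Q_def by (rule eopen_ebox)
  have z: "(\<lambda>_. 0) \<in> Q" using centre_in_ebox[of "\<lambda>_. 0" r e] e by (simp add: Q_def ES_def)
  define \<Gamma> where "\<Gamma> t = inv_into U \<phi> (G t)" for t
  have GV: "G t \<in> V" if "t \<in> Q" for t using GM that by (auto simp: smooth_mapping_def Q_def)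
  have \<Gamma>: "\<Gamma> t \<in> W" "\<phi> (\<Gamma> t) = G t" if "t \<in> Q" for t
    using chart_image_inv[OF M U(1), of "G t" W] GV[OF that] UW by (auto simp: \<Gamma>_def V_def)
  \<comment> \<open>Along \<open>G\<close> the coordinate \<open>c l\<close> has derivative 1 in
    parameter \<open>l\<close> and 0 in the others, because the frame is reduced.\<close>
  have Gc: "G t (c l) = \<phi> p (c l) + t l" if t: "t \<in> Q" and l: "l < r" for t l
  proof -
    have "\<exists>\<xi>. (\<forall>j<r. \<xi> j \<in> ebox r (\<lambda>_. 0) e \<and> (\<forall>i. \<bar>\<xi> j i - 0\<bar> \<le> \<bar>t i - 0\<bar>)) \<and>
      G t (c l) - G (\<lambda>_. 0) (c l) = (\<Sum>j<r. (if j = l then 1 else 0) * (t j - 0))"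
    proof (rule ebox_mvt[where f = "\<lambda>t. G t (c l)" and g = "\<lambda>j _. if j = l then 1 else 0"])
      show "hpd j (\<lambda>t. G t (c l)) (if j = l then 1 else 0) s" if "j < r" "s \<in> ebox r (\<lambda>_. 0) e" for j s
      proof -
        have "A j (c l) (G s) = (if j = l then 1 else 0)"
          using dl[OF that(1) l \<Gamma>(1)] that(2) by (simp add: A_def \<Gamma>_def Q_def)
        then show ?thesis using Gd that c[OF l] by metis
      qed
    qed (use t z in \<open>auto simp: Q_def\<close>)
    then have "G t (c l) - \<phi> p (c l) = (\<Sum>j<r. if j = l then t j else 0)"
      by (simp add: G0 if_distrib[of "\<lambda>a. a * _"] cong: if_cong)
    then show ?thesis using l by simp
  qed
  define P where "P = \<Gamma> ` Q"
  \<comment> \<open>The pivot coordinates, shifted so that \<open>p\<close> goes to 0, recover the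
    parameters.\<close>
  define \<kappa> where "\<kappa> q = (\<lambda>l. if l < r then \<phi> q (c l) - \<phi> p (c l) else 0)" for q
  define L where "L = \<lparr>mtop = subtopology (mtop M) P, mdim = r, atlas = {(P, \<kappa>)}\<rparr>"
  have PW: "P \<subseteq> W" using \<Gamma> by (auto simp: P_def)
  have PM: "P \<subseteq> points M" using PW openin_subset[OF W(1)] by blast
  have pL: "points L = P" using PM by (auto simp: L_def)
  have \<kappa>\<Gamma>: "\<kappa> (\<Gamma> t) = t" if t: "t \<in> Q" for t
    using Gc[OF t] \<Gamma>(2)[OF t] t by (auto simp: \<kappa>_def Q_def ebox_def ES_def fun_eq_iff)
  have \<kappa>P: "\<kappa> ` P = Q" using \<kappa>\<Gamma> by (force simp: P_def)
  have inj: "inj_on \<kappa> P" using \<kappa>\<Gamma> by (auto simp: P_def inj_on_def)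
  have inv: "inv_into P \<kappa> t = \<Gamma> t" if "t \<in> Q" for t
    using inv_into_f_f[OF inj, of "\<Gamma> t"] \<kappa>\<Gamma>[OF that] that by (simp add: P_def)
  have c\<Gamma>: "continuous_map (subtopology (Euclidean_space r) Q) (mtop M) \<Gamma>"
    unfolding continuous_map_def
  proof (intro conjI allI impI)
    show "\<Gamma> \<in> topspace (subtopology (Euclidean_space r) Q) \<rightarrow> points M" using PM by (auto simp: P_def)
    fix T assume T: "openin (mtop M) T"
    have "eopen r {t \<in> Q. G t \<in> \<phi> ` (W \<inter> T)}"
    proof (rule eopen_preimage[OF Qo])
      show "continuous_on Q G" using smooth_mapping_continuous[OF GM] by (simp add: Q_def)
      show "eopen ?n (\<phi> ` (W \<inter> T))" by (rule chart_image_eopen[OF M U(1)]) (use W(1) T WU in auto)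
      show "G ` Q \<subseteq> ES ?n" using GV eopen_subset[OF V] by blast
    qed
    moreover have "{t \<in> Q. G t \<in> \<phi> ` (W \<inter> T)} = {t \<in> topspace (subtopology (Euclidean_space r) Q). \<Gamma> t \<in> T}"
    proof -
      have "G t \<in> \<phi> ` (W \<inter> T) \<longleftrightarrow> \<Gamma> t \<in> T" if t: "t \<in> Q" for t
      proof
        assume "G t \<in> \<phi> ` (W \<inter> T)"
        then obtain q where "q \<in> W \<inter> T" "G t = \<phi> q" by blast
        then show "\<Gamma> t \<in> T" using chart_inv[OF M U(1), of q] WU by (auto simp: \<Gamma>_def)
      next
        assume "\<Gamma> t \<in> T"
        then show "G t \<in> \<phi> ` (W \<inter> T)" using \<Gamma>[OF t] by (metis IntI imageI)
      qed
      then show ?thesis using eopen_subset[OF Qo] by auto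
    qed
    ultimately show "openin (subtopology (Euclidean_space r) Q) {t \<in> topspace (subtopology (Euclidean_space r) Q). \<Gamma> t \<in> T}"
      using Qo by (auto simp: openin_open_subtopology)
  qed
  have c\<kappa>: "continuous_map (subtopology (mtop M) P) (Euclidean_space r) \<kappa>"
  proof -
    have "continuous_map (subtopology (mtop M) P) euclideanreal (\<lambda>q. \<phi> q (c l) - \<phi> p (c l))" for l
    proof -
      have "continuous_map (subtopology (mtop M) U) euclideanreal (\<lambda>q. \<phi> q (c l))"
        by (rule smooth_fun_on_continuous_map[OF M chart_openin[OF M U(1)] smooth_fun_on_coord[OF M U(1)]])
      then have "continuous_map (subtopology (mtop M) P) euclideanreal (\<lambda>q. \<phi> q (c l))"
        by (rule continuous_map_from_subtopology_mono) (use PW WU in blast)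
      then show ?thesis by (intro continuous_intros)
    qed
    then show ?thesis unfolding \<kappa>_def by (subst continuous_map_componentwise_Euclidean_space) auto
  qed
  have Lman: "is_manifold L"
  proof -
    have "Hausdorff_space (mtop L)" "second_countable (mtop L)"
      using M by (auto simp: L_def is_manifold_def Hausdorff_space_subtopology second_countable_subtopology)
    moreover have "connected_space (mtop L)"
    proof -
      have "connectedin (subtopology (Euclidean_space r) Q) Q"
        using connected_ebox[of r "\<lambda>_. 0" e] eopen_subset[OF Qo] by (simp add: connectedin_subtopology Q_def)
      from connectedin_continuous_map_image[OF c\<Gamma> this] show ?thesis
        by (simp add: L_def P_def connectedin_def)
    qed
    moreover have "homeomorphic_map (subtopology (mtop L) P) (subtopology (Euclidean_space r) (\<kappa> ` P)) \<kappa>"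
    proof -
      have "homeomorphic_maps (subtopology (mtop M) P) (subtopology (Euclidean_space r) Q) \<kappa> \<Gamma>"
        unfolding homeomorphic_maps_def
      proof (intro conjI ballI)
        show "continuous_map (subtopology (mtop M) P) (subtopology (Euclidean_space r) Q) \<kappa>"
          using c\<kappa> \<kappa>P PM by (auto simp: continuous_map_in_subtopology)
        show "continuous_map (subtopology (Euclidean_space r) Q) (subtopology (mtop M) P) \<Gamma>"
          using c\<Gamma> by (auto simp: continuous_map_in_subtopology P_def)
      qed (use \<kappa>\<Gamma> in \<open>auto simp: P_def\<close>)
      then have "homeomorphic_map (subtopology (mtop M) P) (subtopology (Euclidean_space r) Q) \<kappa>"
        using homeomorphic_map_maps by blast
      then show ?thesis by (simp add: L_def \<kappa>P subtopology_subtopology)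
    qed
    moreover have "smooth_on r (\<kappa> ` P) (\<lambda>t. \<kappa> (inv_into P \<kappa> t) j)" for j
      unfolding \<kappa>P by (rule smooth_on_eq[OF smooth_on_coord[OF Qo] Qo]) (simp add: inv \<kappa>\<Gamma>)
    moreover have "openin (mtop L) P" using points_openin[of L] pL by simp
    ultimately show ?thesis
      unfolding is_manifold_def using pL Qo \<kappa>P by (simp add: L_def)
  qed
  have LA: "(P, \<kappa>) \<in> atlas L" by (simp add: L_def)
  have dimL: "mdim L = r" by (simp add: L_def)
  have incq: "compose P g (incl L) q = g q" if "q \<in> P" for g q using that pL by (simp add: compose_def incl_def)
  have rep: "chart_rep P \<kappa> (compose P g (incl L)) t = chart_rep U \<phi> g (G t)" if "t \<in> Q" for g t
    using inv[OF that] incq[of "\<Gamma> t"] that by (simp add: P_def \<Gamma>_def)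
  have iL: "incl L \<in> smooth_maps L M"
  proof (rule smooth_mapsI[OF Lman M])
    fix g assume g: "g \<in> C_inf M"
    have "smooth_fun_on L P (compose P g (incl L))"
      unfolding smooth_fun_on_def
    proof (clarify)
      fix U' \<phi>' assume "(U', \<phi>') \<in> atlas L"
      then have [simp]: "U' = P" "\<phi>' = \<kappa>" by (auto simp: L_def)
      have "smooth_on r Q (\<lambda>t. chart_rep U \<phi> g (G t))"
        unfolding Q_def
      proof (rule smooth_on_compose_mapping[OF GM])
        show "smooth_on ?n V (chart_rep U \<phi> g)"
          unfolding V_def using smooth_fun_onD[OF C_inf_smooth_on[OF M g W(1)] U(1)] UW by simp
      qed
      then have "smooth_on r Q (chart_rep P \<kappa> (compose P g (incl L)))"
        by (rule smooth_on_eq[OF _ Qo]) (simp add: rep)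
      then show "smooth_on (mdim L) (\<phi>' ` (U' \<inter> P)) (\<lambda>t. compose P g (incl L) (inv_into U' \<phi>' t))"
        using \<kappa>P dimL by simp
    qed
    then show "compose (points L) g (incl L) \<in> C_inf L"
      using pL by (simp add: C_inf_def compose_def)
  qed (use PM pL in \<open>auto simp: incl_def\<close>)
  \<comment> \<open>Coordinate vectors of \<open>L\<close> go to the combinations of the frame with
    the same coefficients. This identifies the tangent spaces of \<open>L\<close> with
    \<open>D\<close> and also gives injectivity, since the coefficients are the values on the
    functions \<open>x (c l)\<close>.\<close>
  have tm: "tangent_map L M (incl L) (coord_vector L P \<kappa> q w) = (\<lambda>g\<in>C_inf M. \<Sum>i<r. w i * Y i q g)" if q: "q \<in> P" for q w
    unfolding tangent_map_def
  proof (rule restrict_ext)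
    fix g assume g: "g \<in> C_inf M"
    obtain t where t: "t \<in> Q" "q = \<Gamma> t" using q by (auto simp: P_def)
    have \<kappa>q: "\<kappa> q = t" using t \<kappa>\<Gamma> by simp
    have qW: "q \<in> W" using q PW by blast
    have "compose P g (incl L) \<in> C_inf L" using smooth_maps_pullback[OF Lman M iL g] pL by simp
    then have "coord_vector L P \<kappa> q w (compose (points L) g (incl L)) = (\<Sum>i<r. w i * partial_deriv i (chart_rep P \<kappa> (compose P g (incl L))) t)"
      by (simp add: coord_vector_def dimL pL \<kappa>q)
    also have "\<dots> = (\<Sum>i<r. w i * Y i q g)"
    proof (rule sum.cong)
      fix i assume "i \<in> {..<r}"
      then have i: "i < r" by simp
      have sg: "smooth_on ?n V (chart_rep U \<phi> g)"
        unfolding V_def using smooth_fun_onD[OF C_inf_smooth_on[OF M g W(1)] U(1)] UW by simp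
      have "partial_deriv i (chart_rep P \<kappa> (compose P g (incl L))) t = partial_deriv i (\<lambda>t. chart_rep U \<phi> g (G t)) t"
        by (rule partial_deriv_cong[OF Qo t(1) i rep])
      also have "\<dots> = (\<Sum>j<?n. partial_deriv j (chart_rep U \<phi> g) (G t) * partial_deriv i (\<lambda>t. G t j) t)"
        by (rule partial_deriv_compose_mapping[OF GM sg _ i]) (use t in \<open>simp add: Q_def\<close>)
      also have "\<dots> = (\<Sum>j<?n. Y i q (x j) * partial_deriv j (chart_rep U \<phi> g) (\<phi> q))"
      proof (rule sum.cong)
        fix j assume "j \<in> {..<?n}"
        then have "partial_deriv i (\<lambda>t. G t j) t = A i j (G t)"
          using Gd t(1) i by (intro hpd_partial_deriv) (auto simp: Q_def)
        also have "\<dots> = Y i q (x j)" using t by (simp add: A_def \<Gamma>_def)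
        finally show "partial_deriv j (chart_rep U \<phi> g) (G t) * partial_deriv i (\<lambda>t. G t j) t = Y i q (x j) * partial_deriv j (chart_rep U \<phi> g) (\<phi> q)"
          using \<Gamma>(2)[OF t(1)] t(2) by simp
      qed simp
      also have "\<dots> = Y i q g" by (rule Yc[OF i qW g, symmetric])
      finally show "w i * partial_deriv i (chart_rep P \<kappa> (compose P g (incl L))) t = w i * Y i q g" by simp
    qed simp
    finally show "coord_vector L P \<kappa> q w (compose (points L) g (incl L)) = (\<Sum>i<r. w i * Y i q g)" .
  qed
  have "integral_manifold M D L"
    unfolding integral_manifold_def immersion_def
  proof (intro conjI ballI Lman iL)
    fix q assume "q \<in> points L"
    then have q: "q \<in> P" using pL by simp
    then have qW: "q \<in> W" using PW by blast
    show "inj_on (tangent_map L M (incl L)) (tangent_space L q)"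
    proof (rule inj_onI)
      fix v v' assume v: "v \<in> tangent_space L q" "v' \<in> tangent_space L q"
        and eq: "tangent_map L M (incl L) v = tangent_map L M (incl L) v'"
      obtain w where w: "v = coord_vector L P \<kappa> q w" using tangent_coord_vector[OF Lman LA q v(1)] .
      obtain w' where w': "v' = coord_vector L P \<kappa> q w'" using tangent_coord_vector[OF Lman LA q v(2)] .
      have pick: "(\<lambda>g\<in>C_inf M. \<Sum>i<r. w i * Y i q g) (x (c l)) = w l" if l: "l < r" for l w
      proof -
        have "(\<lambda>g\<in>C_inf M. \<Sum>i<r. w i * Y i q g) (x (c l)) = (\<Sum>i<r. w i * (if i = l then 1 else 0))"
          unfolding restrict_apply'[OF x] by (intro sum.cong) (use dl[OF _ l qW] in auto)
        then show ?thesis using l by (simp add: sum_mult_delta)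
      qed
      have "w l = w' l" if "l < r" for l
        using pick[OF that, of w] pick[OF that, of w'] eq tm[OF q] unfolding w w' by metis
      then show "v = v'" unfolding w w' coord_vector_def dimL by (auto intro!: restrict_ext sum.cong)
    qed
    show "tangent_map L M (incl L) ` tangent_space L q = D q"
    proof
      show "tangent_map L M (incl L) ` tangent_space L q \<subseteq> D q"
      proof
        fix u assume "u \<in> tangent_map L M (incl L) ` tangent_space L q"
        then obtain v where v: "v \<in> tangent_space L q" "u = tangent_map L M (incl L) v" by blast
        obtain w where w: "v = coord_vector L P \<kappa> q w" using tangent_coord_vector[OF Lman LA q v(1)] .
        show "u \<in> D q" unfolding v(2) w tm[OF q] by (rule frame_at_member[OF fr[OF qW]])
      qed
      show "D q \<subseteq> tangent_map L M (incl L) ` tangent_space L q"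
      proof
        fix u assume "u \<in> D q"
        then obtain w where "u = (\<lambda>f\<in>C_inf M. \<Sum>i<r. w i * Y i q f)" using fr[OF qW] unfolding frame_at_def by blast
        then have "u = tangent_map L M (incl L) (coord_vector L P \<kappa> q w)" using tm[OF q] by simp
        then show "u \<in> tangent_map L M (incl L) ` tangent_space L q"
          using coord_vector_tangent[OF Lman LA q] by blast
      qed
    qed
  qed
  moreover have "p \<in> points L"
  proof -
    have "\<Gamma> (\<lambda>_. 0) = p" using G0 chart_inv[OF M U] by (simp add: \<Gamma>_def)
    then show ?thesis using z pL by (auto simp: P_def)
  qed
  ultimately show ?thesis by (rule that)
qed

section \<open>Leaves and the leaf space\<close>

lemma integral_manifold_subset:
  assumes "integral_manifold M D L" shows "points L \<subseteq> points M"
proof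
  fix p assume p: "p \<in> points L"
  have "incl L \<in> smooth_maps L M" using assms by (simp add: integral_manifold_def immersion_def)
  from smooth_maps_into[OF this p] p show "p \<in> points M" by (simp add: incl_def)
qed

lemma leaf_rel_sym: "(p, q) \<in> leaf_rel M D \<Longrightarrow> (q, p) \<in> leaf_rel M D"
proof -
  have "sym {(p, q). \<exists>L. integral_manifold M D L \<and> p \<in> points L \<and> q \<in> points L}" by (auto simp: sym_def)
  from sym_rtrancl[OF this] show "(p, q) \<in> leaf_rel M D \<Longrightarrow> (q, p) \<in> leaf_rel M D"
    unfolding leaf_rel_def by (rule symD)
qed

lemma leaf_rel_refl: "(p, p) \<in> leaf_rel M D"
  by (simp add: leaf_rel_def)

lemma leaf_rel_trans: "(p, q) \<in> leaf_rel M D \<Longrightarrow> (q, s) \<in> leaf_rel M D \<Longrightarrow> (p, s) \<in> leaf_rel M D"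
  unfolding leaf_rel_def by (rule rtrancl_trans)

text \<open>\<open>leaf_rel\<close> is a reflexive closure over the whole type, so a point outside
  \<open>M\<close> is related to itself; hence the assumption on the starting point.\<close>

lemma leaf_rel_points:
  assumes "(p, q) \<in> leaf_rel M D" "p \<in> points M" shows "q \<in> points M"
  using assms(1) unfolding leaf_rel_def
proof (induction rule: rtrancl_induct)
  case (step y z)
  then show ?case using integral_manifold_subset by blast
qed (rule assms(2))

lemma leaf_proj_eq_iff:
  assumes "p \<in> points M" "q \<in> points M"
  shows "leaf_proj M D p = leaf_proj M D q \<longleftrightarrow> (p, q) \<in> leaf_rel M D"
proof -
  have "leaf_rel M D `` {p} = leaf_rel M D `` {q} \<longleftrightarrow> (p, q) \<in> leaf_rel M D"
  proof
    assume "leaf_rel M D `` {p} = leaf_rel M D `` {q}"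
    moreover have "q \<in> leaf_rel M D `` {q}" by (simp add: leaf_rel_refl)
    ultimately show "(p, q) \<in> leaf_rel M D" by blast
  next
    assume pq: "(p, q) \<in> leaf_rel M D"
    show "leaf_rel M D `` {p} = leaf_rel M D `` {q}"
    proof (intro Set.set_eqI iffI)
      show "x \<in> leaf_rel M D `` {q}" if "x \<in> leaf_rel M D `` {p}" for x
        using leaf_rel_trans[OF leaf_rel_sym[OF pq], of x] that by blast
      show "x \<in> leaf_rel M D `` {p}" if "x \<in> leaf_rel M D `` {q}" for x
        using leaf_rel_trans[OF pq, of x] that by blast
    qed
  qed
  then show ?thesis using assms by (simp add: leaf_proj_def)
qed

lemma leaf_space_proj: "leaf_space M D = leaf_proj M D ` points M"
  by (auto simp: leaf_space_def leaf_proj_def quotient_def)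

lemma leaf_proj_member: "p \<in> points M \<Longrightarrow> p \<in> leaf_proj M D p"
  by (simp add: leaf_proj_def leaf_rel_refl)

lemma leaf_proj_memberD:
  assumes "q \<in> leaf_proj M D p" "p \<in> points M"
  shows "q \<in> points M" "leaf_proj M D q = leaf_proj M D p"
proof -
  have r: "(p, q) \<in> leaf_rel M D" using assms by (simp add: leaf_proj_def)
  show q: "q \<in> points M" using leaf_rel_points[OF r assms(2)] .
  show "leaf_proj M D q = leaf_proj M D p" using leaf_proj_eq_iff[OF assms(2) q] r by blast
qed

section \<open>Vectors and sections of a regular distribution\<close>

lemma tangent_sum_vectors:
  assumes M: "is_manifold M" and X: "\<And>i. i < r \<Longrightarrow> X i \<in> tangent_space M p"
  shows "(\<lambda>f\<in>C_inf M. \<Sum>i<(r::nat). c i * X i f) \<in> tangent_space M p"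
  using X
proof (induction r)
  case 0
  have "(\<lambda>f\<in>C_inf M. 0) \<in> tangent_space M p"
    by (auto simp: tangent_space_def C_inf_add[OF M] C_inf_mult[OF M] C_inf_scale[OF M])
  then show ?case by (simp only: lessThan_0 sum.empty)
next
  case (Suc r)
  have "(\<lambda>f\<in>C_inf M. 1 * (\<lambda>f\<in>C_inf M. \<Sum>i<r. c i * X i f) f + c r * X r f) \<in> tangent_space M p"
    by (rule tangent_lincomb[OF M]) (use Suc in auto)
  moreover have "(\<lambda>f\<in>C_inf M. 1 * (\<lambda>f\<in>C_inf M. \<Sum>i<r. c i * X i f) f + c r * X r f) = (\<lambda>f\<in>C_inf M. \<Sum>i<Suc r. c i * X i f)"
    by (rule restrict_ext) simp
  ultimately show ?case by (simp only:)
qed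

lemma regular_distribution_frameE:
  assumes "regular_distribution M D" "p \<in> points M"
  obtains r W X where "openin (mtop M) W" "p \<in> W" "\<forall>i<r. vector_field_on M W (X i)" "\<forall>q\<in>W. frame_at M D r X q"
proof -
  from assms(1)[unfolded regular_distribution_frame] obtain r where "\<forall>p\<in>points M. \<exists>W X. openin (mtop M) W \<and> p \<in> W \<and>
     (\<forall>i<r. vector_field_on M W (X i)) \<and> (\<forall>q\<in>W. frame_at M D r X q)" by (rule exE)
  from bspec[OF this assms(2)] obtain W X where "openin (mtop M) W \<and> p \<in> W \<and>
     (\<forall>i<r. vector_field_on M W (X i)) \<and> (\<forall>q\<in>W. frame_at M D r X q)" by (elim exE)
  then show thesis by (intro that[of W r X]) auto
qed

lemma distribution_tangent:
  assumes M: "is_manifold M" and D: "regular_distribution M D" and p: "p \<in> points M" and v: "v \<in> D p"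
  shows "v \<in> tangent_space M p"
proof -
  obtain r W X where W: "openin (mtop M) W" "p \<in> W" "\<forall>i<r. vector_field_on M W (X i)" "\<forall>q\<in>W. frame_at M D r X q"
    by (rule regular_distribution_frameE[OF D p])
  have "frame_at M D r X p" using W by blast
  then obtain c where "v = (\<lambda>f\<in>C_inf M. \<Sum>i<r. c i * X i p f)" using v unfolding frame_at_def by blast
  moreover have "X i p \<in> tangent_space M p" if "i < r" for i
    using W that unfolding vector_field_on_def by blast
  ultimately show ?thesis using tangent_sum_vectors[OF M, of r "\<lambda>i. X i p" p c] by simp
qed

text \<open>Take the combination of a local frame with the coefficients of \<open>v\<close> at
  \<open>p\<close> and cut it off. It mediates between annihilation by all sections, as in the
  constraint algebra, and annihilation by all vectors of \<open>D\<close>.\<close>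

lemma distribution_section:
  assumes M: "is_manifold M" and D: "regular_distribution M D" and p: "p \<in> points M" and v: "v \<in> D p"
  obtains X where "X \<in> sections M D" "X p = v"
proof -
  obtain r W X where W: "openin (mtop M) W" "p \<in> W" and X: "\<forall>i<r. vector_field_on M W (X i)" and fr: "\<forall>q\<in>W. frame_at M D r X q"
    by (rule regular_distribution_frameE[OF D p])
  have "frame_at M D r X p" using W fr by blast
  then obtain c where c: "v = (\<lambda>f\<in>C_inf M. \<Sum>i<r. c i * X i p f)" using v unfolding frame_at_def by blast
  obtain \<beta> K B where b: "\<beta> \<in> C_inf M" "openin (mtop M) B" "p \<in> B" "\<forall>q\<in>B. \<beta> q = 1"
    "closedin (mtop M) K" "K \<subseteq> W" "B \<subseteq> K" "\<forall>q\<in>points M - K. \<beta> q = 0" by (rule bump_function[OF M W])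
  define E where "E y = (if y \<in> W then (\<lambda>f\<in>C_inf M. \<Sum>i<r. (\<beta> y * c i) * X i y f) else (\<lambda>f\<in>C_inf M. 0))" for y
  have ED: "E y \<in> D y" if y: "y \<in> points M" for y
  proof (cases "y \<in> W")
    case True
    then have "frame_at M D r X y" using fr by blast
    from frame_at_member[OF this, of "\<lambda>i. \<beta> y * c i"] show ?thesis using True by (simp only: E_def if_True)
  next
    case False
    obtain r' W' X' where "y \<in> W'" "\<forall>q\<in>W'. frame_at M D r' X' q"
      by (rule regular_distribution_frameE[OF D y])
    then have "frame_at M D r' X' y" by blast
    from frame_at_member[OF this, of "\<lambda>_. 0"] show ?thesis using False by (simp add: E_def)
  qed
  have "E \<in> sections M D"
    unfolding sections_def vector_field_on_def
  proof (intro CollectI conjI ballI)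
    show "E y \<in> tangent_space M y" "E y \<in> D y" if "y \<in> points M" for y
      using ED[OF that] distribution_tangent[OF M D that] by auto
    fix f assume f: "f \<in> C_inf M"
    have "smooth_fun_on M W (\<lambda>y. \<Sum>i<r. c i * X i y f)"
      by (intro smooth_fun_on_sum[OF M W(1)] smooth_fun_on_mult[OF M W(1)] smooth_fun_on_const[OF M W(1)])
         (use X f in \<open>auto simp: vector_field_on_def\<close>)
    from C_inf_cutoff[OF M W(1) this b(1,5,6,8)]
    have "smooth_fun_on M (points M) (\<lambda>y\<in>points M. if y \<in> W then \<beta> y * (\<Sum>i<r. c i * X i y f) else 0)" by (rule C_inf_smooth)
    moreover have "(\<lambda>y\<in>points M. if y \<in> W then \<beta> y * (\<Sum>i<r. c i * X i y f) else 0) y = E y f" if "y \<in> points M" for y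
      using f that by (simp add: E_def sum_distrib_left mult.assoc)
    ultimately show "smooth_fun_on M (points M) (\<lambda>y. E y f)"
      by (rule iffD1[OF smooth_fun_on_cong[OF M points_openin], rotated])
  qed
  moreover have "E p = v" using b(3,4) W(2) by (simp add: E_def c)
  ultimately show ?thesis by (rule that)
qed

lemma leaf_manifold_facts:
  assumes "leaf_manifold M D N"
  shows "is_manifold N" "points N = leaf_proj M D ` points M" "surjective_submersion M N (leaf_proj M D)"
    "leaf_proj M D \<in> smooth_maps M N"
  using assms unfolding leaf_manifold_def leaf_space_proj surjective_submersion_def by blast+

text \<open>This is where involutivity enters: every point lies on an integral manifold, which the
  projection collapses to a point.\<close>

lemma distribution_pullback_zero:
  assumes M: "is_manifold M" and D: "regular_distribution M D" "involutive M D" and N: "leaf_manifold M D N"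
    and p: "p \<in> points M" and v: "v \<in> D p" and g: "g \<in> C_inf N"
  shows "v (compose (points M) g (leaf_proj M D)) = 0"
proof -
  obtain L where L: "integral_manifold M D L" "p \<in> points L" by (rule frobenius_integral_manifold[OF M D p])
  have Lm: "is_manifold L" using L(1) by (simp add: integral_manifold_def)
  have LM: "points L \<subseteq> points M" by (rule integral_manifold_subset[OF L(1)])
  obtain u where u: "u \<in> tangent_space L p" "v = tangent_map L M (incl L) u"
    using L v unfolding integral_manifold_def by blast
  let ?h = "compose (points M) g (leaf_proj M D)"
  have h: "?h \<in> C_inf M" by (rule smooth_maps_pullback[OF M leaf_manifold_facts(1,4)[OF N] g])
  have "leaf_proj M D q = leaf_proj M D p" if "q \<in> points L" for q
  proof -
    have "(q, p) \<in> leaf_rel M D" using L that unfolding leaf_rel_def by (intro r_into_rtrancl) blast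
    then show ?thesis using leaf_proj_eq_iff[of q M p D] LM that p by blast
  qed
  then have "compose (points L) ?h (incl L) = (\<lambda>q\<in>points L. g (leaf_proj M D p))"
    using LM by (auto simp: compose_def incl_def fun_eq_iff)
  then show ?thesis using tangent_const[OF Lm L(2) u(1)] u(2) h by (simp add: tangent_map_def)
qed

text \<open>Points of a leaf are joined by a chain of integral manifolds. Each of them has its
  tangent vectors mapped into \<open>D\<close>, so the restricted function has vanishing derivations
  and is constant.\<close>

lemma basic_constant_on_leaves:
  assumes M: "is_manifold M" and h: "h \<in> C_inf M" and 0: "\<And>p v. p \<in> points M \<Longrightarrow> v \<in> D p \<Longrightarrow> v h = 0"
    and pq: "(p, q) \<in> leaf_rel M D"
  shows "h p = h q"
  using pq unfolding leaf_rel_def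
proof (induction rule: rtrancl_induct)
  case (step y z)
  then obtain L where L: "integral_manifold M D L" "y \<in> points L" "z \<in> points L" by blast
  have Lm: "is_manifold L" and iL: "incl L \<in> smooth_maps L M"
    using L(1) by (auto simp: integral_manifold_def immersion_def)
  have LM: "points L \<subseteq> points M" by (rule integral_manifold_subset[OF L(1)])
  let ?k = "compose (points L) h (incl L)"
  have k: "?k \<in> C_inf L" by (rule smooth_maps_pullback[OF Lm M iL h])
  have "?k y = ?k z"
  proof (rule derivations_vanish_imp_constant[OF Lm k _ L(2,3)])
    fix x u assume x: "x \<in> points L" and u: "u \<in> tangent_space L x"
    have "tangent_map L M (incl L) u \<in> D x" using L(1) x u unfolding integral_manifold_def by blast
    then have "tangent_map L M (incl L) u h = 0" using 0 x LM by blast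
    then show "u ?k = 0" using h by (simp add: tangent_map_def)
  qed
  then show ?case using L step by (simp add: compose_def incl_def)
qed simp

lemma sections_annihilate_iff:
  assumes M: "is_manifold M" and D: "regular_distribution M D" and h: "h \<in> C_inf M"
  shows "(\<forall>X\<in>sections M D. \<forall>p\<in>points M. lie_deriv M X h p = 0) \<longleftrightarrow> (\<forall>p\<in>points M. \<forall>v\<in>D p. v h = 0)"
proof
  assume l: "\<forall>X\<in>sections M D. \<forall>p\<in>points M. lie_deriv M X h p = 0"
  show "\<forall>p\<in>points M. \<forall>v\<in>D p. v h = 0"
  proof (intro ballI)
    fix p v assume p: "p \<in> points M" and v: "v \<in> D p"
    obtain X where "X \<in> sections M D" "X p = v" by (rule distribution_section[OF M D p v])
    then show "v h = 0" using l p by (auto simp: lie_deriv_def)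
  qed
next
  assume "\<forall>p\<in>points M. \<forall>v\<in>D p. v h = 0"
  then show "\<forall>X\<in>sections M D. \<forall>p\<in>points M. lie_deriv M X h p = 0"
    by (auto simp: lie_deriv_def sections_def)
qed

text \<open>The isomorphism before extension to the ambient manifold: one direction combines
  constancy on leaves with descent along the submersion, the other is
  \<open>distribution_pullback_zero\<close>.\<close>

lemma basic_function_descends:
  assumes M: "is_manifold M" and D: "regular_distribution M D" "involutive M D" and N: "leaf_manifold M D N"
    and h: "h \<in> C_inf M"
  shows "(\<forall>p\<in>points M. \<forall>v\<in>D p. v h = 0) \<longleftrightarrow> (\<exists>g\<in>C_inf N. h = compose (points M) g (leaf_proj M D))"
proof
  assume 0: "\<forall>p\<in>points M. \<forall>v\<in>D p. v h = 0"
  \<comment> \<open>The choice of a representative is harmless, as \<open>h\<close> is constant on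
    the leaf.\<close>
  define g where "g = (\<lambda>y\<in>points N. h (SOME p. p \<in> y))"
  have gp: "g (leaf_proj M D p) = h p" if p: "p \<in> points M" for p
  proof -
    let ?q = "SOME q. q \<in> leaf_proj M D p"
    have q: "?q \<in> leaf_proj M D p" using leaf_proj_member[OF p, of D] by (rule someI)
    have "(p, ?q) \<in> leaf_rel M D" using q p by (simp add: leaf_proj_def)
    then have "h p = h ?q" using basic_constant_on_leaves[OF M h, of D] 0 by blast
    then show ?thesis using p leaf_manifold_facts(2)[OF N] by (simp add: g_def)
  qed
  then have hg: "h = compose (points M) g (leaf_proj M D)"
    using h by (auto simp: compose_def C_inf_def extensional_def fun_eq_iff)
  have "g \<in> C_inf N"
  proof (rule surjective_submersion_descent[OF M leaf_manifold_facts(1,3)[OF N]])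
    show "g \<in> extensional (points N)" by (simp add: g_def)
    show "compose (points M) g (leaf_proj M D) \<in> C_inf M" using h by (simp only: hg[symmetric])
  qed
  then show "\<exists>g\<in>C_inf N. h = compose (points M) g (leaf_proj M D)" using hg by blast
qed (use distribution_pullback_zero[OF M D N] in blast)

section \<open>Constraint manifolds\<close>

lemma constraint_manifold_facts:
  assumes "constraint_manifold \<M>"
  shows "is_manifold (amb \<M>)" "is_manifold (sub \<M>)" "points (sub \<M>) \<subseteq> points (amb \<M>)"
    "regular_distribution (sub \<M>) (distr \<M>)" "involutive (sub \<M>) (distr \<M>)"
    "closed_embedded_submanifold (sub \<M>) (amb \<M>)" "incl (sub \<M>) \<in> smooth_maps (sub \<M>) (amb \<M>)"
proof -
  have *: "is_manifold (amb \<M>)" "closed_embedded_submanifold (sub \<M>) (amb \<M>)" "simple_distribution (sub \<M>) (distr \<M>)"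
    using assms unfolding constraint_manifold_def by blast+
  show "is_manifold (amb \<M>)" "closed_embedded_submanifold (sub \<M>) (amb \<M>)" by (rule *)+
  show "is_manifold (sub \<M>)" "incl (sub \<M>) \<in> smooth_maps (sub \<M>) (amb \<M>)"
    using *(2) unfolding closed_embedded_submanifold_def immersion_def by blast+
  show "regular_distribution (sub \<M>) (distr \<M>)" "involutive (sub \<M>) (distr \<M>)"
    using *(3) unfolding simple_distribution_def by blast+
  have "closedin (mtop (amb \<M>)) (points (sub \<M>))" using *(2) unfolding closed_embedded_submanifold_def by blast
  then show "points (sub \<M>) \<subseteq> points (amb \<M>)" by (rule closedin_subset)
qed

lemma red_mfd_leaf_manifold:
  assumes "constraint_manifold \<M>"
  shows "leaf_manifold (sub \<M>) (distr \<M>) (red_mfd \<M>)"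
proof -
  have "\<exists>N. leaf_manifold (sub \<M>) (distr \<M>) N"
    using assms by (auto simp: constraint_manifold_def simple_distribution_def)
  then show ?thesis unfolding red_mfd_def by (rule someI_ex)
qed

lemma restrict_to_sub:
  assumes "constraint_manifold \<M>" "f \<in> C_inf (amb \<M>)"
  shows "restrict f (points (sub \<M>)) \<in> C_inf (sub \<M>)"
proof -
  have "compose (points (sub \<M>)) f (incl (sub \<M>)) \<in> C_inf (sub \<M>)"
    by (rule smooth_maps_pullback[OF constraint_manifold_facts(2,1,7)[OF assms(1)] assms(2)])
  moreover have "compose (points (sub \<M>)) f (incl (sub \<M>)) = restrict f (points (sub \<M>))"
    by (auto simp: compose_def incl_def fun_eq_iff)
  ultimately show ?thesis by (simp only:)
qed

text \<open>A function on the target submanifold is extended to the ambient manifold, pulled back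
  along the smooth ambient map and restricted. This makes smoothness into the submanifold depend on
  the extension theorem.\<close>

lemma constraint_map_sub:
  assumes M: "constraint_manifold \<M>" and N: "constraint_manifold \<N>" and \<phi>: "\<phi> \<in> constraint_maps \<M> \<N>"
  shows "restrict \<phi> (points (sub \<M>)) \<in> smooth_maps (sub \<M>) (sub \<N>)"
proof (rule smooth_mapsI[OF constraint_manifold_facts(2)[OF M] constraint_manifold_facts(2)[OF N]])
  have \<phi>s: "\<phi> \<in> smooth_maps (amb \<M>) (amb \<N>)" and \<phi>S: "\<phi> ` points (sub \<M>) \<subseteq> points (sub \<N>)"
    using \<phi> by (auto simp: constraint_maps_def)
  show "restrict \<phi> (points (sub \<M>)) ` points (sub \<M>) \<subseteq> points (sub \<N>)" using \<phi>S by auto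
  fix g assume "g \<in> C_inf (sub \<N>)"
  then obtain G where G: "G \<in> C_inf (amb \<N>)" "\<forall>q\<in>points (sub \<N>). G q = g q"
    using closed_submanifold_extension[OF constraint_manifold_facts(1,6)[OF N]] by metis
  have "restrict (compose (points (amb \<M>)) G \<phi>) (points (sub \<M>)) \<in> C_inf (sub \<M>)"
    by (rule restrict_to_sub[OF M smooth_maps_pullback[OF constraint_manifold_facts(1)[OF M] constraint_manifold_facts(1)[OF N] \<phi>s G(1)]])
  moreover have "restrict (compose (points (amb \<M>)) G \<phi>) (points (sub \<M>)) = compose (points (sub \<M>)) g (restrict \<phi> (points (sub \<M>)))"
    using G(2) \<phi>S constraint_manifold_facts(3)[OF M] by (auto simp: compose_def fun_eq_iff image_subset_iff subset_iff)
  ultimately show "compose (points (sub \<M>)) g (restrict \<phi> (points (sub \<M>))) \<in> C_inf (sub \<M>)" by (simp only:)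
qed simp

lemma constraint_map_pullback_basic:
  assumes M: "constraint_manifold \<M>" and N: "constraint_manifold \<N>" and \<phi>: "\<phi> \<in> constraint_maps \<M> \<N>"
    and h: "h \<in> C_inf (sub \<N>)" "\<forall>p\<in>points (sub \<N>). \<forall>v\<in>distr \<N> p. v h = 0"
    and p: "p \<in> points (sub \<M>)" and v: "v \<in> distr \<M> p"
  shows "v (compose (points (sub \<M>)) h (restrict \<phi> (points (sub \<M>)))) = 0"
proof -
  have "tangent_map (sub \<M>) (sub \<N>) (restrict \<phi> (points (sub \<M>))) v \<in> distr \<N> (\<phi> p)" "\<phi> p \<in> points (sub \<N>)"
    using \<phi> p v by (auto simp: constraint_maps_def)
  then have "tangent_map (sub \<M>) (sub \<N>) (restrict \<phi> (points (sub \<M>))) v h = 0" using h(2) by blast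
  then show ?thesis using h(1) by (simp add: tangent_map_def)
qed

text \<open>A test function \<open>g\<close> on the target leaf space pulls back to a function on
  \<open>sub \<M>\<close> that \<open>distr \<M>\<close> annihilates, hence constant on leaves. Such
  functions separate the points of the target leaf space.\<close>

lemma constraint_map_leaf_proj:
  assumes M: "constraint_manifold \<M>" and N: "constraint_manifold \<N>" and \<phi>: "\<phi> \<in> constraint_maps \<M> \<N>"
    and pq: "p \<in> points (sub \<M>)" "q \<in> points (sub \<M>)" "leaf_proj (sub \<M>) (distr \<M>) p = leaf_proj (sub \<M>) (distr \<M>) q"
  shows "leaf_proj (sub \<N>) (distr \<N>) (\<phi> p) = leaf_proj (sub \<N>) (distr \<N>) (\<phi> q)"
proof -
  note mM = constraint_manifold_facts[OF M] and mN = constraint_manifold_facts[OF N]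
  note lN = red_mfd_leaf_manifold[OF N]
  let ?\<pi> = "leaf_proj (sub \<N>) (distr \<N>)"
  have \<phi>S: "\<phi> x \<in> points (sub \<N>)" if "x \<in> points (sub \<M>)" for x using \<phi> that by (auto simp: constraint_maps_def)
  show ?thesis
  proof (rule C_inf_separates[OF leaf_manifold_facts(1)[OF lN]])
    show "?\<pi> (\<phi> p) \<in> points (red_mfd \<N>)" "?\<pi> (\<phi> q) \<in> points (red_mfd \<N>)"
      using leaf_manifold_facts(2)[OF lN] \<phi>S pq by auto
    fix g assume g: "g \<in> C_inf (red_mfd \<N>)"
    let ?h = "compose (points (sub \<N>)) g ?\<pi>"
    let ?k = "compose (points (sub \<M>)) ?h (restrict \<phi> (points (sub \<M>)))"
    have h: "?h \<in> C_inf (sub \<N>)" by (rule smooth_maps_pullback[OF mN(2) leaf_manifold_facts(1,4)[OF lN] g])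
    have h0: "\<forall>p\<in>points (sub \<N>). \<forall>v\<in>distr \<N> p. v ?h = 0"
      using distribution_pullback_zero[OF mN(2,4,5) lN _ _ g] by blast
    have k: "?k \<in> C_inf (sub \<M>)" by (rule smooth_maps_pullback[OF mM(2) mN(2) constraint_map_sub[OF M N \<phi>] h])
    have "(p, q) \<in> leaf_rel (sub \<M>) (distr \<M>)" using leaf_proj_eq_iff[OF pq(1,2)] pq(3) by blast
    moreover have "v ?k = 0" if "p \<in> points (sub \<M>)" "v \<in> distr \<M> p" for p v
      by (rule constraint_map_pullback_basic[OF M N \<phi> h h0 that])
    ultimately have "?k p = ?k q"
      by (intro basic_constant_on_leaves[where h = ?k and D = "distr \<M>", OF mM(2) k]) blast+
    then show "g (?\<pi> (\<phi> p)) = g (?\<pi> (\<phi> q))" using pq(1,2) \<phi>S by (simp add: compose_def)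
  qed
qed

text \<open>The arrow is a union over the points of a leaf; all of them contribute the same
  class.\<close>

lemma red_arrow_proj:
  assumes M: "constraint_manifold \<M>" and N: "constraint_manifold \<N>" and \<phi>: "\<phi> \<in> constraint_maps \<M> \<N>"
    and p: "p \<in> points (sub \<M>)"
  shows "on_arr red_mfd_func \<M> \<N> \<phi> (leaf_proj (sub \<M>) (distr \<M>) p) = leaf_proj (sub \<N>) (distr \<N>) (\<phi> p)"
proof -
  let ?K = "leaf_proj (sub \<M>) (distr \<M>) p"
  have KL: "?K \<in> leaf_space (sub \<M>) (distr \<M>)" using p by (auto simp: leaf_space_proj)
  have "leaf_proj (sub \<N>) (distr \<N>) (\<phi> q) = leaf_proj (sub \<N>) (distr \<N>) (\<phi> p)" if "q \<in> ?K" for q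
    using constraint_map_leaf_proj[OF M N \<phi> _ p] leaf_proj_memberD[OF that p] by blast
  moreover have "p \<in> ?K" by (rule leaf_proj_member[OF p])
  ultimately have "(\<Union>q\<in>?K. leaf_proj (sub \<N>) (distr \<N>) (\<phi> q)) = leaf_proj (sub \<N>) (distr \<N>) (\<phi> p)"
    by (metis (no_types, lifting) SUP_eq_const empty_iff)
  then show ?thesis using KL by (simp add: red_mfd_func_def)
qed

text \<open>After composition with the projection the pullback becomes one along
  \<open>\<phi>\<close>, which is smooth; the submersion then lets it descend.\<close>

lemma red_arrow_smooth:
  assumes M: "constraint_manifold \<M>" and N: "constraint_manifold \<N>" and \<phi>: "\<phi> \<in> constraint_maps \<M> \<N>"
  shows "on_arr red_mfd_func \<M> \<N> \<phi> \<in> smooth_maps (red_mfd \<M>) (red_mfd \<N>)"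
proof -
  note mM = constraint_manifold_facts[OF M] and mN = constraint_manifold_facts[OF N]
  note lM = leaf_manifold_facts[OF red_mfd_leaf_manifold[OF M]] and lN = leaf_manifold_facts[OF red_mfd_leaf_manifold[OF N]]
  let ?F = "on_arr red_mfd_func \<M> \<N> \<phi>"
  let ?\<pi> = "leaf_proj (sub \<M>) (distr \<M>)" and ?\<pi>' = "leaf_proj (sub \<N>) (distr \<N>)"
  have \<phi>S: "\<phi> x \<in> points (sub \<N>)" if "x \<in> points (sub \<M>)" for x using \<phi> that by (auto simp: constraint_maps_def)
  have pN: "points (red_mfd \<M>) = leaf_space (sub \<M>) (distr \<M>)" using lM(2) by (simp add: leaf_space_proj)
  show ?thesis
  proof (rule smooth_mapsI[OF lM(1) lN(1)])
    show "?F \<in> extensional (points (red_mfd \<M>))" unfolding pN by (simp add: red_mfd_func_def)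
    show "?F ` points (red_mfd \<M>) \<subseteq> points (red_mfd \<N>)"
      unfolding lM(2) lN(2) using red_arrow_proj[OF M N \<phi>] \<phi>S by auto
    fix g assume g: "g \<in> C_inf (red_mfd \<N>)"
    show "compose (points (red_mfd \<M>)) g ?F \<in> C_inf (red_mfd \<M>)"
    proof (rule surjective_submersion_descent[OF mM(2) lM(1,3)])
      have "compose (points (sub \<M>)) (compose (points (sub \<N>)) g ?\<pi>') (restrict \<phi> (points (sub \<M>))) \<in> C_inf (sub \<M>)"
        by (rule smooth_maps_pullback[OF mM(2) mN(2) constraint_map_sub[OF M N \<phi>] smooth_maps_pullback[OF mN(2) lN(1,4) g]])
      moreover have "compose (points (sub \<M>)) (compose (points (sub \<N>)) g ?\<pi>') (restrict \<phi> (points (sub \<M>)))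
        = compose (points (sub \<M>)) (compose (points (red_mfd \<M>)) g ?F) ?\<pi>"
        using \<phi>S lM(2) red_arrow_proj[OF M N \<phi>] by (auto simp: compose_def fun_eq_iff)
      ultimately show "compose (points (sub \<M>)) (compose (points (red_mfd \<M>)) g ?F) ?\<pi> \<in> C_inf (sub \<M>)" by (simp only:)
    qed (simp add: compose_def)
  qed
qed

section \<open>Concrete categories\<close>

lemma category_op: "category C \<Longrightarrow> category (op_cat C)"
  unfolding category_def op_cat_def by simp

lemma op_cat_simps [simp]:
  "Obj (op_cat C) = Obj C" "Hom (op_cat C) X Y = Hom C Y X" "Ident (op_cat C) = Ident C"
  "Comp (op_cat C) X Y Z g f = Comp C Z Y X f g"
  by (simp_all add: op_cat_def)

lemma is_functor_op: "is_functor C D F \<Longrightarrow> is_functor (op_cat C) (op_cat D) (op_func F)"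
  unfolding is_functor_def op_func_def by (auto intro: category_op)

lemma is_functor_compose:
  assumes "is_functor C D F" "is_functor D E G"
  shows "is_functor C E (G \<circ>\<^sub>F F)"
  using assms unfolding is_functor_def comp_func_def by simp

text \<open>All four categories have extensional functions between carriers as arrows, which reduces
  the axioms to closure of the hom-sets.\<close>

lemma concrete_category:
  assumes Hom: "\<And>X Y f. X \<in> Obj C \<Longrightarrow> Y \<in> Obj C \<Longrightarrow> f \<in> Hom C X Y \<Longrightarrow> f \<in> extensional (car X) \<and> f \<in> car X \<rightarrow> car Y"
    and id: "\<And>X. X \<in> Obj C \<Longrightarrow> Ident C X = (\<lambda>x\<in>car X. x)" "\<And>X. X \<in> Obj C \<Longrightarrow> (\<lambda>x\<in>car X. x) \<in> Hom C X X"
    and cmp: "\<And>X Y Z g f. X \<in> Obj C \<Longrightarrow> Comp C X Y Z g f = compose (car X) g f"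
      "\<And>X Y Z g f. X \<in> Obj C \<Longrightarrow> Y \<in> Obj C \<Longrightarrow> Z \<in> Obj C \<Longrightarrow> f \<in> Hom C X Y \<Longrightarrow> g \<in> Hom C Y Z \<Longrightarrow> compose (car X) g f \<in> Hom C X Z"
  shows "category C"
  unfolding category_def
proof (intro conjI ballI)
  fix W X Y Z f g h
  assume o: "W \<in> Obj C" "X \<in> Obj C" "Y \<in> Obj C" "Z \<in> Obj C" and f: "f \<in> Hom C W X" and "g \<in> Hom C X Y" "h \<in> Hom C Y Z"
  have "f \<in> car W \<rightarrow> car X" using Hom[OF o(1,2) f] by blast
  then show "Comp C W X Z (Comp C X Y Z h g) f = Comp C W Y Z h (Comp C W X Y g f)"
    using o cmp(1) by (simp add: compose_assoc)
next
  fix X Y f assume o: "X \<in> Obj C" "Y \<in> Obj C" and f: "f \<in> Hom C X Y"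
  have e: "f \<in> extensional (car X)" "f \<in> car X \<rightarrow> car Y" using Hom[OF o f] by auto
  show "Comp C X X Y f (Ident C X) = f" "Comp C X Y Y (Ident C Y) f = f"
    using e by (auto simp: cmp(1)[OF o(1)] id(1)[OF o(1)] id(1)[OF o(2)] compose_def fun_eq_iff extensional_def Pi_iff)
qed (simp_all add: id cmp)

section \<open>Algebra homomorphisms, constraint algebras and the four categories\<close>

lemma alg_homD:
  assumes "h \<in> alg_hom A B"
  shows "h \<in> ring_hom A B" "h \<in> extensional (carrier A)" "h \<in> carrier A \<rightarrow> carrier B"
    "\<And>r x. x \<in> carrier A \<Longrightarrow> h (r \<odot>\<^bsub>A\<^esub> x) = r \<odot>\<^bsub>B\<^esub> h x"
  using assms by (auto simp: alg_hom_def ring_hom_def)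

lemma unital_algebraD:
  assumes "unital_algebra A"
  shows "ring A" "Module.module real_ring A" "\<And>r x. x \<in> carrier A \<Longrightarrow> r \<odot>\<^bsub>A\<^esub> x \<in> carrier A"
    "\<And>r x y. x \<in> carrier A \<Longrightarrow> y \<in> carrier A \<Longrightarrow> (r \<odot>\<^bsub>A\<^esub> x) \<otimes>\<^bsub>A\<^esub> y = r \<odot>\<^bsub>A\<^esub> (x \<otimes>\<^bsub>A\<^esub> y)"
    "\<And>r x y. x \<in> carrier A \<Longrightarrow> y \<in> carrier A \<Longrightarrow> x \<otimes>\<^bsub>A\<^esub> (r \<odot>\<^bsub>A\<^esub> y) = r \<odot>\<^bsub>A\<^esub> (x \<otimes>\<^bsub>A\<^esub> y)"
proof -
  show m: "ring A" "Module.module real_ring A" using assms by (auto simp: unital_algebra_def)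
  show "r \<odot>\<^bsub>A\<^esub> x \<in> carrier A" if "x \<in> carrier A" for r x
    using module.smult_closed[OF m(2) _ that, of r] by (simp add: real_ring_def)
qed (use assms in \<open>auto simp: unital_algebra_def\<close>)

lemma strong_constraint_algebraD:
  assumes "strong_constraint_algebra A"
  shows "unital_algebra (compT A)" "ring (compT A)" "subring (compN A) (compT A)" "ideal (comp0 A) (compT A)"
    "comp0 A \<subseteq> compN A" "compN A \<subseteq> carrier (compT A)" "\<And>r x. x \<in> compN A \<Longrightarrow> r \<odot>\<^bsub>compT A\<^esub> x \<in> compN A"
proof -
  show *: "unital_algebra (compT A)" "subring (compN A) (compT A)" "ideal (comp0 A) (compT A)" "comp0 A \<subseteq> compN A"
    "\<And>r x. x \<in> compN A \<Longrightarrow> r \<odot>\<^bsub>compT A\<^esub> x \<in> compN A"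
    using assms unfolding strong_constraint_algebra_def unital_subalgebra_def by blast+
  show "ring (compT A)" by (rule unital_algebraD(1)[OF *(1)])
  show "compN A \<subseteq> carrier (compT A)" by (rule subringE(1)[OF *(2)])
qed

lemma alg_hom_id: "unital_algebra A \<Longrightarrow> (\<lambda>x\<in>carrier A. x) \<in> alg_hom A A"
  by (auto simp: alg_hom_def ring_hom_def unital_algebraD(3) ring.ring_simprules(1,5,6)[OF unital_algebraD(1)])

lemma alg_hom_compose:
  assumes A: "unital_algebra A" and f: "f \<in> alg_hom A B" and g: "g \<in> alg_hom B E"
  shows "compose (carrier A) g f \<in> alg_hom A E"
proof -
  have fA: "f x \<in> carrier B" if "x \<in> carrier A" for x using alg_homD(3)[OF f] that by blast
  show ?thesis
    using alg_homD[OF f] alg_homD[OF g] fA unital_algebraD(3)[OF A] ring.ring_simprules(1,5,6)[OF unital_algebraD(1)[OF A]]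
    unfolding alg_hom_def ring_hom_def by (simp add: compose_def Pi_iff)
qed

lemma category_alg_cat: "category (alg_cat :: ('x alg, 'x \<Rightarrow> 'x) cat)"
proof (rule concrete_category[where car = carrier])
  fix X Y Z :: "'x alg" and f g
  show "X \<in> Obj alg_cat \<Longrightarrow> Y \<in> Obj alg_cat \<Longrightarrow> f \<in> Hom alg_cat X Y \<Longrightarrow> f \<in> extensional (carrier X) \<and> f \<in> carrier X \<rightarrow> carrier Y"
    using alg_homD(2,3)[of f X Y] by (simp add: alg_cat_def)
  show "X \<in> Obj alg_cat \<Longrightarrow> (\<lambda>x\<in>carrier X. x) \<in> Hom alg_cat X X" by (simp add: alg_cat_def alg_hom_id)
  show "X \<in> Obj alg_cat \<Longrightarrow> f \<in> Hom alg_cat X Y \<Longrightarrow> g \<in> Hom alg_cat Y Z \<Longrightarrow> compose (carrier X) g f \<in> Hom alg_cat X Z"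
    by (simp add: alg_cat_def alg_hom_compose)
qed (simp_all add: alg_cat_def)

lemma category_scalg_cat: "category (scalg_cat :: ('x scalg, 'x \<Rightarrow> 'x) cat)"
proof (rule concrete_category[where car = "\<lambda>A. carrier (compT A)"])
  fix X Y Z :: "'x scalg" and f g
  show "f \<in> extensional (carrier (compT X)) \<and> f \<in> carrier (compT X) \<rightarrow> carrier (compT Y)" if "f \<in> Hom scalg_cat X Y"
    using that alg_homD(2,3)[of f "compT X" "compT Y"] by (simp add: scalg_cat_def scalg_hom_def)
  show "(\<lambda>x\<in>carrier (compT X). x) \<in> Hom scalg_cat X X" if "X \<in> Obj scalg_cat"
    using that alg_hom_id strong_constraint_algebraD(1,5,6)[of X] by (auto simp: scalg_cat_def scalg_hom_def)
  show "compose (carrier (compT X)) g f \<in> Hom scalg_cat X Z"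
    if X: "X \<in> Obj scalg_cat" and f: "f \<in> Hom scalg_cat X Y" and g: "g \<in> Hom scalg_cat Y Z"
  proof -
    have "compN X \<subseteq> carrier (compT X)" "comp0 X \<subseteq> carrier (compT X)"
      using X strong_constraint_algebraD(5,6)[of X] by (auto simp: scalg_cat_def)
    then show ?thesis
      using X f g alg_hom_compose[of "compT X" f "compT Y" g "compT Z"]
      by (auto simp: scalg_cat_def scalg_hom_def strong_constraint_algebra_def compose_def image_subset_iff subset_iff)
  qed
qed (simp_all add: scalg_cat_def)

lemma category_mfd_cat: "category (mfd_cat :: ('a manifold, 'a \<Rightarrow> 'a) cat)"
proof (rule concrete_category[where car = points])
  fix X Y Z :: "'a manifold" and f g
  show "f \<in> extensional (points X) \<and> f \<in> points X \<rightarrow> points Y" if "f \<in> Hom mfd_cat X Y"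
    using that smooth_maps_ext smooth_maps_into by (auto simp: mfd_cat_def)
  show "(\<lambda>x\<in>points X. x) \<in> Hom mfd_cat X X" if "X \<in> Obj mfd_cat"
    using that smooth_maps_id by (auto simp: mfd_cat_def)
  show "compose (points X) g f \<in> Hom mfd_cat X Z"
    if "X \<in> Obj mfd_cat" "Y \<in> Obj mfd_cat" "Z \<in> Obj mfd_cat" "f \<in> Hom mfd_cat X Y" "g \<in> Hom mfd_cat Y Z"
    using that smooth_maps_compose[of X Y Z f g] by (simp add: mfd_cat_def)
qed (simp_all add: mfd_cat_def)

lemma category_cmfd_cat: "category (cmfd_cat :: ('a cmfd, 'a \<Rightarrow> 'a) cat)"
proof (rule concrete_category[where car = "\<lambda>\<M>. points (amb \<M>)"])
  fix X Y Z :: "'a cmfd" and f g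
  show "f \<in> extensional (points (amb X)) \<and> f \<in> points (amb X) \<rightarrow> points (amb Y)" if "f \<in> Hom cmfd_cat X Y"
    using that smooth_maps_ext smooth_maps_into by (auto simp: cmfd_cat_def constraint_maps_def)
  show "(\<lambda>x\<in>points (amb X). x) \<in> Hom cmfd_cat X X" if "X \<in> Obj cmfd_cat"
  proof -
    have X: "constraint_manifold X" using that by (simp add: cmfd_cat_def)
    note mX = constraint_manifold_facts[OF X]
    have r: "restrict (\<lambda>x\<in>points (amb X). x) (points (sub X)) = (\<lambda>x\<in>points (sub X). x)"
      using mX(3) by (auto simp: fun_eq_iff)
    \<comment> \<open>The tangent map of the identity returns a function restricted to
      \<open>C_inf\<close>. It equals \<open>v\<close> because vectors of a regular distribution are
      tangent vectors, hence extensional.\<close>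
    have "tangent_map (sub X) (sub X) (\<lambda>x\<in>points (sub X). x) v = v" if "p \<in> points (sub X)" "v \<in> distr X p" for p v
    proof (rule extensionalityI[of _ "C_inf (sub X)"])
      show "v \<in> extensional (C_inf (sub X))"
        by (rule tangent_extensional[OF distribution_tangent[OF mX(2,4) that]])
      fix g assume g: "g \<in> C_inf (sub X)"
      then have "compose (points (sub X)) g (\<lambda>x\<in>points (sub X). x) = g"
        by (auto simp: compose_def C_inf_def extensional_def fun_eq_iff)
      then show "tangent_map (sub X) (sub X) (\<lambda>x\<in>points (sub X). x) v g = v g" using g by (simp add: tangent_map_def)
    qed (simp add: tangent_map_def)
    then show ?thesis
      using smooth_maps_id[OF mX(1)] mX(3) by (auto simp: cmfd_cat_def constraint_maps_def r inf.absorb2[OF mX(3)] subset_iff)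
  qed
  show "compose (points (amb X)) g f \<in> Hom cmfd_cat X Z"
    if o: "X \<in> Obj cmfd_cat" "Y \<in> Obj cmfd_cat" "Z \<in> Obj cmfd_cat" and f: "f \<in> Hom cmfd_cat X Y" and g: "g \<in> Hom cmfd_cat Y Z"
  proof -
    have c: "constraint_manifold X" "constraint_manifold Y" "constraint_manifold Z" "f \<in> constraint_maps X Y" "g \<in> constraint_maps Y Z"
      using o f g by (simp_all add: cmfd_cat_def)
    note mX = constraint_manifold_facts[OF c(1)] and mY = constraint_manifold_facts[OF c(2)] and mZ = constraint_manifold_facts[OF c(3)]
    have fs: "f \<in> smooth_maps (amb X) (amb Y)" and fS: "\<And>x. x \<in> points (sub X) \<Longrightarrow> f x \<in> points (sub Y)"
      and fD: "\<And>p v. p \<in> points (sub X) \<Longrightarrow> v \<in> distr X p \<Longrightarrow> tangent_map (sub X) (sub Y) (restrict f (points (sub X))) v \<in> distr Y (f p)"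
      using c(4) by (auto simp: constraint_maps_def)
    have gs: "g \<in> smooth_maps (amb Y) (amb Z)" and gS: "\<And>x. x \<in> points (sub Y) \<Longrightarrow> g x \<in> points (sub Z)"
      and gD: "\<And>p v. p \<in> points (sub Y) \<Longrightarrow> v \<in> distr Y p \<Longrightarrow> tangent_map (sub Y) (sub Z) (restrict g (points (sub Y))) v \<in> distr Z (g p)"
      using c(5) by (auto simp: constraint_maps_def)
    let ?h = "compose (points (amb X)) g f"
    \<comment> \<open>The chain rule: pullback along the composite is the iterated pullback, and the
      inner one is smooth, so the outer tangent map may be evaluated on it.\<close>
    have tm: "tangent_map (sub X) (sub Z) (restrict ?h (points (sub X))) v =
        tangent_map (sub Y) (sub Z) (restrict g (points (sub Y))) (tangent_map (sub X) (sub Y) (restrict f (points (sub X))) v)" for v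
    proof -
      have "compose (points (sub X)) k (restrict ?h (points (sub X))) =
         compose (points (sub X)) (compose (points (sub Y)) k (restrict g (points (sub Y)))) (restrict f (points (sub X)))" for k :: "'a \<Rightarrow> real"
        using fS mX(3) by (auto simp: compose_def fun_eq_iff subset_iff)
      moreover have "compose (points (sub Y)) k (restrict g (points (sub Y))) \<in> C_inf (sub Y)" if "k \<in> C_inf (sub Z)" for k
        by (rule smooth_maps_pullback[OF mY(2) mZ(2) constraint_map_sub[OF c(2,3,5)] that])
      ultimately show ?thesis unfolding tangent_map_def by (intro restrict_ext) simp
    qed
    have "?h \<in> smooth_maps (amb X) (amb Z)" by (rule smooth_maps_compose[OF mX(1) mY(1) mZ(1) fs gs])
    moreover have "?h p \<in> points (sub Z)" if "p \<in> points (sub X)" for p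
      using that fS gS mX(3) by (auto simp: compose_def)
    moreover have "tangent_map (sub X) (sub Z) (restrict ?h (points (sub X))) v \<in> distr Z (?h p)"
      if "p \<in> points (sub X)" "v \<in> distr X p" for p v
    proof -
      have "?h p = g (f p)" using that mX(3) by (auto simp: compose_def)
      then show ?thesis unfolding tm using gD[OF fS[OF that(1)] fD[OF that]] by simp
    qed
    ultimately show ?thesis by (auto simp: cmfd_cat_def constraint_maps_def)
  qed
qed (simp_all add: cmfd_cat_def)

section \<open>The algebra of smooth functions\<close>

lemma C_inf_alg_simps [simp]:
  "carrier (C_inf_alg M) = C_inf M" "mult (C_inf_alg M) f g = (\<lambda>p\<in>points M. f p * g p)"
  "one (C_inf_alg M) = (\<lambda>p\<in>points M. 1)" "zero (C_inf_alg M) = (\<lambda>p\<in>points M. 0)"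
  "add (C_inf_alg M) f g = (\<lambda>p\<in>points M. f p + g p)" "smult (C_inf_alg M) r f = (\<lambda>p\<in>points M. r * f p)"
  by (simp_all add: C_inf_alg_def)

lemma cring_real_ring: "cring real_ring"
proof (rule cringI)
  show "abelian_group real_ring"
  proof (rule abelian_groupI)
    show "\<exists>y\<in>carrier real_ring. y \<oplus>\<^bsub>real_ring\<^esub> x = \<zero>\<^bsub>real_ring\<^esub>" for x
      by (auto simp: real_ring_def intro: exI[of _ "- x"])
  qed (auto simp: real_ring_def)
  show "comm_monoid real_ring" by (rule comm_monoidI) (auto simp: real_ring_def)
qed (auto simp: real_ring_def algebra_simps)

lemma C_inf_undefined: "f \<in> C_inf M \<Longrightarrow> q \<notin> points M \<Longrightarrow> f q = undefined"
  by (simp add: C_inf_def extensional_def)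

lemma C_inf_alg_unital:
  assumes M: "is_manifold M"
  shows "unital_algebra (C_inf_alg M)"
proof -
  have ab: "abelian_group (C_inf_alg M)"
  proof (rule abelian_groupI)
    fix f assume f: "f \<in> carrier (C_inf_alg M)"
    then show "\<exists>g\<in>carrier (C_inf_alg M). g \<oplus>\<^bsub>C_inf_alg M\<^esub> f = \<zero>\<^bsub>C_inf_alg M\<^esub>"
      using C_inf_scale[OF M, of f "-1"] by (intro bexI[of _ "\<lambda>p\<in>points M. - 1 * f p"]) (auto simp: fun_eq_iff)
    show "\<zero>\<^bsub>C_inf_alg M\<^esub> \<oplus>\<^bsub>C_inf_alg M\<^esub> f = f"
      using f by (auto simp: fun_eq_iff C_inf_undefined)
  qed (auto simp: C_inf_add[OF M] C_inf_const[OF M] fun_eq_iff)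
  have mo: "monoid (C_inf_alg M)"
    by (rule monoidI) (auto simp: C_inf_mult[OF M] C_inf_const[OF M] fun_eq_iff C_inf_undefined)
  have "ring (C_inf_alg M)"
    by (rule ringI[OF ab mo]) (auto simp: fun_eq_iff algebra_simps)
  moreover have "Module.module real_ring (C_inf_alg M)"
    by (rule moduleI[OF cring_real_ring ab])
       (auto simp: real_ring_def C_inf_scale[OF M] fun_eq_iff algebra_simps C_inf_undefined)
  ultimately show ?thesis unfolding unital_algebra_def by (auto simp: fun_eq_iff)
qed

lemma pullback_alg_hom:
  assumes M: "is_manifold M" and N: "is_manifold N" and F: "F \<in> smooth_maps M N"
  shows "pullback M N F \<in> alg_hom (C_inf_alg N) (C_inf_alg M)"
  unfolding alg_hom_def ring_hom_def pullback_def
  using smooth_maps_pullback[OF M N F] smooth_maps_into[OF F]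
  by (auto simp: C_inf_add[OF N] C_inf_mult[OF N] C_inf_scale[OF N] C_inf_const[OF N] compose_def fun_eq_iff)

lemma C_inf_functor: "is_functor (mfd_cat :: ('a manifold, 'a \<Rightarrow> 'a) cat) (op_cat alg_cat) C_inf_func"
  unfolding is_functor_def
proof (intro conjI ballI category_mfd_cat category_op[OF category_alg_cat])
  fix X Y Z :: "'a manifold" and f g
  show "on_obj C_inf_func X \<in> Obj (op_cat alg_cat)" if "X \<in> Obj mfd_cat"
    using that C_inf_alg_unital by (simp add: mfd_cat_def alg_cat_def C_inf_func_def)
  show "on_arr C_inf_func X Y f \<in> Hom (op_cat alg_cat) (on_obj C_inf_func X) (on_obj C_inf_func Y)"
    if "X \<in> Obj mfd_cat" "Y \<in> Obj mfd_cat" "f \<in> Hom mfd_cat X Y"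
    using that pullback_alg_hom by (simp add: mfd_cat_def alg_cat_def C_inf_func_def)
  show "on_arr C_inf_func X X (Ident mfd_cat X) = Ident (op_cat alg_cat) (on_obj C_inf_func X)" if "X \<in> Obj mfd_cat"
    by (auto simp: mfd_cat_def alg_cat_def C_inf_func_def pullback_def compose_def fun_eq_iff C_inf_def extensional_def)
  show "on_arr C_inf_func X Z (Comp mfd_cat X Y Z g f) =
        Comp (op_cat alg_cat) (on_obj C_inf_func X) (on_obj C_inf_func Y) (on_obj C_inf_func Z) (on_arr C_inf_func Y Z g) (on_arr C_inf_func X Y f)"
    if o: "X \<in> Obj mfd_cat" "Y \<in> Obj mfd_cat" "Z \<in> Obj mfd_cat" and f: "f \<in> Hom mfd_cat X Y" and g: "g \<in> Hom mfd_cat Y Z"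
  proof -
    have *: "is_manifold Y" "is_manifold Z" "f \<in> smooth_maps X Y" "g \<in> smooth_maps Y Z" using o f g by (simp_all add: mfd_cat_def)
    have "f ` points X \<subseteq> points Y" using smooth_maps_into[OF *(3)] by blast
    note ca = compose_assoc_points[OF this]
    show ?thesis using smooth_maps_pullback[OF *(1,2,4)]
      by (simp add: mfd_cat_def alg_cat_def C_inf_func_def pullback_def ca compose_def[of "C_inf Z"] cong: restrict_cong)
  qed
qed

lemma C_inf_alg_minus:
  assumes M: "is_manifold M" and f: "f \<in> C_inf M"
  shows "\<ominus>\<^bsub>C_inf_alg M\<^esub> f = (\<lambda>p\<in>points M. - f p)"
proof -
  interpret ring "C_inf_alg M" by (rule unital_algebraD(1)[OF C_inf_alg_unital[OF M]])
  have g: "(\<lambda>p\<in>points M. - f p) \<in> C_inf M" using C_inf_scale[OF M f, of "-1"] by simp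
  have "(\<lambda>p\<in>points M. - f p) \<oplus>\<^bsub>C_inf_alg M\<^esub> f = \<zero>\<^bsub>C_inf_alg M\<^esub>" by (auto simp: fun_eq_iff)
  then show ?thesis using f g by (intro minus_equality) auto
qed

section \<open>The strong constraint algebra of a constraint manifold\<close>

lemma CC_inf_simps [simp]:
  "compT (CC_inf \<M>) = C_inf_alg (amb \<M>)"
  "comp0 (CC_inf \<M>) = {f \<in> C_inf (amb \<M>). \<forall>p\<in>points (sub \<M>). f p = 0}"
  by (simp_all add: CC_inf_def)

lemma CC_inf_compN_iff:
  assumes M: "constraint_manifold \<M>"
  shows "f \<in> compN (CC_inf \<M>) \<longleftrightarrow> f \<in> C_inf (amb \<M>) \<and> (\<forall>p\<in>points (sub \<M>). \<forall>v\<in>distr \<M> p. v (restrict f (points (sub \<M>))) = 0)"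
  using sections_annihilate_iff[OF constraint_manifold_facts(2,4)[OF M] restrict_to_sub[OF M]]
  by (auto simp: CC_inf_def)

text \<open>With this form the closure of the \<open>N\<close>-component under the operations is
  inherited from the smooth functions on the leaf space.\<close>

lemma CC_inf_compN_iff_descends:
  assumes M: "constraint_manifold \<M>"
  shows "f \<in> compN (CC_inf \<M>) \<longleftrightarrow> f \<in> C_inf (amb \<M>) \<and>
    (\<exists>g\<in>C_inf (red_mfd \<M>). restrict f (points (sub \<M>)) = compose (points (sub \<M>)) g (leaf_proj (sub \<M>) (distr \<M>)))"
  unfolding CC_inf_compN_iff[OF M]
  using basic_function_descends[OF constraint_manifold_facts(2,4,5)[OF M] red_mfd_leaf_manifold[OF M] restrict_to_sub[OF M]]
  by blast

lemma CC_inf_strong: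
  assumes M: "constraint_manifold \<M>"
  shows "strong_constraint_algebra (CC_inf \<M>)"
proof -
  note mM = constraint_manifold_facts[OF M]
  let ?A = "C_inf_alg (amb \<M>)" and ?N = "compN (CC_inf \<M>)" and ?S = "points (sub \<M>)"
  let ?\<pi> = "leaf_proj (sub \<M>) (distr \<M>)" and ?R = "red_mfd \<M>"
  note U = C_inf_alg_unital[OF mM(1)]
  interpret A: ring ?A by (rule unital_algebraD(1)[OF U])
  have lN: "is_manifold ?R" "\<And>p. p \<in> ?S \<Longrightarrow> ?\<pi> p \<in> points ?R"
    using leaf_manifold_facts(1,2)[OF red_mfd_leaf_manifold[OF M]] by auto
  have SM: "p \<in> points (amb \<M>)" if "p \<in> ?S" for p using mM(3) that by blast
  have NC: "f \<in> C_inf (amb \<M>)" if "f \<in> ?N" for f using that CC_inf_compN_iff[OF M] by blast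
  \<comment> \<open>Apply the operation to the two descended functions; the combined function
    descends to the result.\<close>
  have Nop: "(\<lambda>p\<in>points (amb \<M>). op2 (f p) (g p)) \<in> ?N"
    if fN: "f \<in> ?N" and gN: "g \<in> ?N" and cl: "(\<lambda>p\<in>points (amb \<M>). op2 (f p) (g p)) \<in> C_inf (amb \<M>)"
      "\<And>f' g'. f' \<in> C_inf ?R \<Longrightarrow> g' \<in> C_inf ?R \<Longrightarrow> (\<lambda>p\<in>points ?R. op2 (f' p) (g' p)) \<in> C_inf ?R" for f g and op2 :: "real \<Rightarrow> real \<Rightarrow> real"
  proof -
    obtain f' where f': "f' \<in> C_inf ?R" "restrict f ?S = compose ?S f' ?\<pi>" using fN CC_inf_compN_iff_descends[OF M] by blast
    obtain g' where g': "g' \<in> C_inf ?R" "restrict g ?S = compose ?S g' ?\<pi>" using gN CC_inf_compN_iff_descends[OF M] by blast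
    have "f p = f' (?\<pi> p)" "g p = g' (?\<pi> p)" if "p \<in> ?S" for p
      using fun_cong[OF f'(2), of p] fun_cong[OF g'(2), of p] that by (simp_all add: compose_def)
    then have "restrict (\<lambda>p\<in>points (amb \<M>). op2 (f p) (g p)) ?S = compose ?S (\<lambda>p\<in>points ?R. op2 (f' p) (g' p)) ?\<pi>"
      using lN(2) SM by (auto simp: compose_def fun_eq_iff)
    then show ?thesis unfolding CC_inf_compN_iff_descends[OF M] using cl f' g' by blast
  qed
  have Nconst: "(\<lambda>p\<in>points (amb \<M>). c) \<in> ?N" for c
  proof -
    have "restrict (\<lambda>p\<in>points (amb \<M>). c) ?S = compose ?S (\<lambda>p\<in>points ?R. c) ?\<pi>"
      using lN(2) SM by (auto simp: compose_def fun_eq_iff)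
    then show ?thesis unfolding CC_inf_compN_iff_descends[OF M] using C_inf_const[OF mM(1)] C_inf_const[OF lN(1)] by blast
  qed
  have Nmult: "(\<lambda>p\<in>points (amb \<M>). f p * g p) \<in> ?N" if "f \<in> ?N" "g \<in> ?N" for f g
    by (rule Nop[of f g "(*)"]) (use that NC C_inf_mult[OF mM(1)] C_inf_mult[OF lN(1)] in auto)
  have Nadd: "(\<lambda>p\<in>points (amb \<M>). f p + g p) \<in> ?N" if "f \<in> ?N" "g \<in> ?N" for f g
    by (rule Nop[of f g "(+)"]) (use that NC C_inf_add[OF mM(1)] C_inf_add[OF lN(1)] in auto)
  have Nscale: "(\<lambda>p\<in>points (amb \<M>). c * f p) \<in> ?N" if "f \<in> ?N" for c f
  proof -
    have "(\<lambda>p\<in>points (amb \<M>). (\<lambda>p\<in>points (amb \<M>). c) p * f p) = (\<lambda>p\<in>points (amb \<M>). c * f p)" by (auto simp: fun_eq_iff)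
    then show ?thesis using Nmult[OF Nconst that] by metis
  qed
  have "subring ?N ?A"
  proof (rule A.subringI)
    show "\<ominus>\<^bsub>?A\<^esub> f \<in> ?N" if "f \<in> ?N" for f
      using Nscale[OF that, of "-1"] C_inf_alg_minus[OF mM(1) NC[OF that]] by simp
  qed (use NC Nconst Nmult Nadd in auto)
  then have "unital_subalgebra ?N ?A" using Nscale by (simp add: unital_subalgebra_def)
  moreover have "ideal (comp0 (CC_inf \<M>)) ?A"
  proof (rule idealI[OF A.ring_axioms])
    show "subgroup (comp0 (CC_inf \<M>)) (add_monoid ?A)"
    proof (rule A.add.subgroupI)
      show "comp0 (CC_inf \<M>) \<noteq> {}" using C_inf_const[OF mM(1), of 0] SM by auto
      show "\<ominus>\<^bsub>?A\<^esub> f \<in> comp0 (CC_inf \<M>)" if "f \<in> comp0 (CC_inf \<M>)" for f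
        using that C_inf_alg_minus[OF mM(1), of f] C_inf_scale[OF mM(1), of f "-1"] SM by simp
    qed (use C_inf_add[OF mM(1)] SM in auto)
  qed (use C_inf_mult[OF mM(1)] SM in auto)
  moreover have "comp0 (CC_inf \<M>) \<subseteq> ?N"
  proof
    fix f assume f: "f \<in> comp0 (CC_inf \<M>)"
    then have "restrict f ?S = compose ?S (\<lambda>p\<in>points ?R. 0) ?\<pi>" using lN(2) by (auto simp: compose_def fun_eq_iff)
    then show "f \<in> ?N" unfolding CC_inf_compN_iff_descends[OF M] using f C_inf_const[OF lN(1)] by auto
  qed
  ultimately show ?thesis using U by (simp add: strong_constraint_algebra_def)
qed

lemma CC_inf_pullback_hom:
  assumes M: "constraint_manifold \<M>" and N: "constraint_manifold \<N>" and \<phi>: "\<phi> \<in> constraint_maps \<M> \<N>"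
  shows "pullback (amb \<M>) (amb \<N>) \<phi> \<in> scalg_hom (CC_inf \<N>) (CC_inf \<M>)"
proof -
  note mM = constraint_manifold_facts[OF M] and mN = constraint_manifold_facts[OF N]
  have \<phi>s: "\<phi> \<in> smooth_maps (amb \<M>) (amb \<N>)" and \<phi>S: "\<And>p. p \<in> points (sub \<M>) \<Longrightarrow> \<phi> p \<in> points (sub \<N>)"
    using \<phi> by (auto simp: constraint_maps_def)
  let ?P = "pullback (amb \<M>) (amb \<N>) \<phi>"
  have P: "?P f = compose (points (amb \<M>)) f \<phi>" if "f \<in> C_inf (amb \<N>)" for f using that by (simp add: pullback_def)
  have PC: "compose (points (amb \<M>)) f \<phi> \<in> C_inf (amb \<M>)" if "f \<in> C_inf (amb \<N>)" for f
    by (rule smooth_maps_pullback[OF mM(1) mN(1) \<phi>s that])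
  have "?P f \<in> compN (CC_inf \<M>)" if "f \<in> compN (CC_inf \<N>)" for f
  proof -
    have f: "f \<in> C_inf (amb \<N>)" "\<forall>p\<in>points (sub \<N>). \<forall>v\<in>distr \<N> p. v (restrict f (points (sub \<N>))) = 0"
      using that CC_inf_compN_iff[OF N] by auto
    have eq: "restrict (compose (points (amb \<M>)) f \<phi>) (points (sub \<M>)) = compose (points (sub \<M>)) (restrict f (points (sub \<N>))) (restrict \<phi> (points (sub \<M>)))"
      using \<phi>S mM(3) by (auto simp: compose_def fun_eq_iff subset_iff)
    show ?thesis
      unfolding CC_inf_compN_iff[OF M] P[OF f(1)] eq
      using PC[OF f(1)] constraint_map_pullback_basic[OF M N \<phi> restrict_to_sub[OF N f(1)] f(2)] by blast
  qed
  moreover have "?P f \<in> comp0 (CC_inf \<M>)" if "f \<in> comp0 (CC_inf \<N>)" for f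
    using that P[of f] PC[of f] \<phi>S mM(3) by (auto simp: compose_def)
  ultimately show ?thesis using pullback_alg_hom[OF mM(1) mN(1) \<phi>s] by (auto simp: scalg_hom_def simp del: CC_inf_simps(2))
qed

lemma CC_inf_functor: "is_functor (cmfd_cat :: ('a cmfd, 'a \<Rightarrow> 'a) cat) (op_cat scalg_cat) CC_inf_func"
  unfolding is_functor_def
proof (intro conjI ballI category_cmfd_cat category_op[OF category_scalg_cat])
  fix X Y Z :: "'a cmfd" and f g
  show "on_obj CC_inf_func X \<in> Obj (op_cat scalg_cat)" if "X \<in> Obj cmfd_cat"
    using that CC_inf_strong by (simp add: cmfd_cat_def scalg_cat_def CC_inf_func_def)
  show "on_arr CC_inf_func X Y f \<in> Hom (op_cat scalg_cat) (on_obj CC_inf_func X) (on_obj CC_inf_func Y)"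
    if "X \<in> Obj cmfd_cat" "Y \<in> Obj cmfd_cat" "f \<in> Hom cmfd_cat X Y"
    using that CC_inf_pullback_hom by (simp add: cmfd_cat_def scalg_cat_def CC_inf_func_def)
  show "on_arr CC_inf_func X X (Ident cmfd_cat X) = Ident (op_cat scalg_cat) (on_obj CC_inf_func X)" if "X \<in> Obj cmfd_cat"
    by (auto simp: cmfd_cat_def scalg_cat_def CC_inf_func_def pullback_def compose_def fun_eq_iff C_inf_def extensional_def)
  show "on_arr CC_inf_func X Z (Comp cmfd_cat X Y Z g f) =
        Comp (op_cat scalg_cat) (on_obj CC_inf_func X) (on_obj CC_inf_func Y) (on_obj CC_inf_func Z) (on_arr CC_inf_func Y Z g) (on_arr CC_inf_func X Y f)"
    if o: "X \<in> Obj cmfd_cat" "Y \<in> Obj cmfd_cat" "Z \<in> Obj cmfd_cat" and f: "f \<in> Hom cmfd_cat X Y" and g: "g \<in> Hom cmfd_cat Y Z"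
  proof -
    have *: "is_manifold (amb Y)" "is_manifold (amb Z)" "f \<in> smooth_maps (amb X) (amb Y)" "g \<in> smooth_maps (amb Y) (amb Z)"
      using o f g constraint_manifold_facts(1) by (auto simp: cmfd_cat_def constraint_maps_def)
    have "f ` points (amb X) \<subseteq> points (amb Y)" using smooth_maps_into[OF *(3)] by blast
    note ca = compose_assoc_points[OF this]
    show ?thesis using smooth_maps_pullback[OF *(1,2,4)]
      by (simp add: cmfd_cat_def scalg_cat_def CC_inf_func_def pullback_def ca compose_def[of "C_inf (amb Z)"] cong: restrict_cong)
  qed
qed

section \<open>Reduction of constraint manifolds as a functor\<close>

lemma red_mfd_functor: "is_functor (cmfd_cat :: ('a cmfd, 'a \<Rightarrow> 'a) cat) mfd_cat red_mfd_func"
  unfolding is_functor_def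
proof (intro conjI ballI category_cmfd_cat category_mfd_cat)
  fix X Y Z :: "'a cmfd" and f g
  have o: "on_obj red_mfd_func W = red_mfd W" for W :: "'a cmfd" by (simp add: red_mfd_func_def)
  show "on_obj red_mfd_func X \<in> Obj mfd_cat" if "X \<in> Obj cmfd_cat"
    using that leaf_manifold_facts(1)[OF red_mfd_leaf_manifold] by (simp add: cmfd_cat_def mfd_cat_def o)
  show "on_arr red_mfd_func X Y f \<in> Hom mfd_cat (on_obj red_mfd_func X) (on_obj red_mfd_func Y)"
    if "X \<in> Obj cmfd_cat" "Y \<in> Obj cmfd_cat" "f \<in> Hom cmfd_cat X Y"
    using that red_arrow_smooth by (simp add: cmfd_cat_def mfd_cat_def o)
  have ext: "on_arr red_mfd_func X Y f \<in> extensional (leaf_proj (sub X) (distr X) ` points (sub X))" for X Y :: "'a cmfd" and f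
    by (simp add: red_mfd_func_def leaf_space_proj)
  show "on_arr red_mfd_func X X (Ident cmfd_cat X) = Ident mfd_cat (on_obj red_mfd_func X)" if "X \<in> Obj cmfd_cat"
  proof (rule extensionalityI[OF ext])
    have X: "constraint_manifold X" using that by (simp add: cmfd_cat_def)
    have I: "Ident cmfd_cat X \<in> constraint_maps X X"
      using category_cmfd_cat that unfolding category_def by (auto simp: cmfd_cat_def)
    have p: "points (red_mfd X) = leaf_proj (sub X) (distr X) ` points (sub X)"
      by (rule leaf_manifold_facts(2)[OF red_mfd_leaf_manifold[OF X]])
    show "Ident mfd_cat (on_obj red_mfd_func X) \<in> extensional (leaf_proj (sub X) (distr X) ` points (sub X))"
      by (simp add: mfd_cat_def o p)
    fix K assume "K \<in> leaf_proj (sub X) (distr X) ` points (sub X)"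
    then obtain q where q: "q \<in> points (sub X)" "K = leaf_proj (sub X) (distr X) q" by blast
    have "q \<in> points (amb X)" using q constraint_manifold_facts(3)[OF X] by blast
    then show "on_arr red_mfd_func X X (Ident cmfd_cat X) K = Ident mfd_cat (on_obj red_mfd_func X) K"
      using red_arrow_proj[OF X X I q(1)] q by (simp add: mfd_cat_def o p cmfd_cat_def)
  qed
  show "on_arr red_mfd_func X Z (Comp cmfd_cat X Y Z g f) =
        Comp mfd_cat (on_obj red_mfd_func X) (on_obj red_mfd_func Y) (on_obj red_mfd_func Z) (on_arr red_mfd_func Y Z g) (on_arr red_mfd_func X Y f)"
    if ob: "X \<in> Obj cmfd_cat" "Y \<in> Obj cmfd_cat" "Z \<in> Obj cmfd_cat" and f: "f \<in> Hom cmfd_cat X Y" and g: "g \<in> Hom cmfd_cat Y Z"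
  proof (rule extensionalityI[OF ext])
    have c: "constraint_manifold X" "constraint_manifold Y" "constraint_manifold Z" "f \<in> constraint_maps X Y" "g \<in> constraint_maps Y Z"
      using ob f g by (simp_all add: cmfd_cat_def)
    have gf: "Comp cmfd_cat X Y Z g f \<in> constraint_maps X Z"
      using category_cmfd_cat ob f g unfolding category_def by (auto simp: cmfd_cat_def)
    have p: "points (red_mfd X) = leaf_proj (sub X) (distr X) ` points (sub X)"
      by (rule leaf_manifold_facts(2)[OF red_mfd_leaf_manifold[OF c(1)]])
    show "Comp mfd_cat (on_obj red_mfd_func X) (on_obj red_mfd_func Y) (on_obj red_mfd_func Z) (on_arr red_mfd_func Y Z g) (on_arr red_mfd_func X Y f)
      \<in> extensional (leaf_proj (sub X) (distr X) ` points (sub X))"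
      by (simp add: mfd_cat_def o p compose_def)
    fix K assume "K \<in> leaf_proj (sub X) (distr X) ` points (sub X)"
    then obtain q where q: "q \<in> points (sub X)" "K = leaf_proj (sub X) (distr X) q" by blast
    have qa: "q \<in> points (amb X)" using q constraint_manifold_facts(3)[OF c(1)] by blast
    have fq: "f q \<in> points (sub Y)" using c(4) q by (auto simp: constraint_maps_def)
    show "on_arr red_mfd_func X Z (Comp cmfd_cat X Y Z g f) K =
      Comp mfd_cat (on_obj red_mfd_func X) (on_obj red_mfd_func Y) (on_obj red_mfd_func Z) (on_arr red_mfd_func Y Z g) (on_arr red_mfd_func X Y f) K"
      using red_arrow_proj[OF c(1,3) gf q(1)] red_arrow_proj[OF c(1,2,4) q(1)] red_arrow_proj[OF c(2,3,5) fq] q qa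
      by (simp add: mfd_cat_def o p compose_def cmfd_cat_def)
  qed
qed

section \<open>Reduction of strong constraint algebras\<close>

abbreviation red_class :: "'x scalg \<Rightarrow> 'x \<Rightarrow> 'x set" where
  "red_class A x \<equiv> comp0 A +>\<^bsub>compT A\<^esub> x"

text \<open>Scalars act as multiplication by \<open>r\<close> times the unit, so a ring ideal is
  closed under them. The scalar multiplication of the quotient depends on this.\<close>

lemma ideal_smult_closed:
  assumes A: "unital_algebra T" and I: "ideal I T" and x: "x \<in> I"
  shows "r \<odot>\<^bsub>T\<^esub> x \<in> I"
proof -
  interpret ring T by (rule unital_algebraD(1)[OF A])
  have xT: "x \<in> carrier T" using x ideal.Icarr[OF I] by blast
  have "(r \<odot>\<^bsub>T\<^esub> \<one>\<^bsub>T\<^esub>) \<otimes>\<^bsub>T\<^esub> x = r \<odot>\<^bsub>T\<^esub> x"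
    using unital_algebraD(4)[OF A one_closed xT] xT by simp
  moreover have "(r \<odot>\<^bsub>T\<^esub> \<one>\<^bsub>T\<^esub>) \<otimes>\<^bsub>T\<^esub> x \<in> I"
    by (rule ideal.I_l_closed[OF I x unital_algebraD(3)[OF A one_closed]])
  ultimately show ?thesis by simp
qed

lemma red_class_eq_iff:
  assumes A: "strong_constraint_algebra A" and x: "x \<in> carrier (compT A)" and y: "y \<in> carrier (compT A)"
  shows "red_class A x = red_class A y \<longleftrightarrow> x \<ominus>\<^bsub>compT A\<^esub> y \<in> comp0 A"
  using ring.quotient_eq_iff_same_a_r_cos[OF strong_constraint_algebraD(2,4)[OF A] x y] by blast

lemma red_class_member:
  assumes A: "strong_constraint_algebra A" and x: "x \<in> carrier (compT A)"
  shows "x \<in> red_class A x"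
proof -
  interpret ideal "comp0 A" "compT A" by (rule strong_constraint_algebraD(4)[OF A])
  show ?thesis by (rule a_rcos_self[OF x])
qed

lemma red_class_memberD:
  assumes A: "strong_constraint_algebra A" and x: "x \<in> compN A" and y: "y \<in> red_class A x"
  shows "y \<in> compN A" "red_class A y = red_class A x"
proof -
  note a = strong_constraint_algebraD[OF A]
  interpret ideal "comp0 A" "compT A" by (rule a(4))
  obtain i where i: "i \<in> comp0 A" "y = i \<oplus>\<^bsub>compT A\<^esub> x" using y by (auto simp: a_r_coset_def')
  show "y \<in> compN A" using subringE(7)[OF a(3)] i a(5) x by blast
  show "red_class A y = red_class A x" using a_repr_independence'[OF y] x a(6) by blast
qed

text \<open>Operations on classes are encoded as unions over representatives; independence of the
  representative collapses the union to one value.\<close>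

lemma red_class_UN:
  assumes A: "strong_constraint_algebra A" and x: "x \<in> compN A"
    and h: "\<And>y. y \<in> red_class A x \<Longrightarrow> F y = F x"
  shows "(\<Union>y\<in>red_class A x. F y) = F x"
proof -
  have "x \<in> red_class A x" using red_class_member[OF A] x strong_constraint_algebraD(6)[OF A] by blast
  then show ?thesis using h by blast
qed

lemma red_alg_facts:
  assumes A: "strong_constraint_algebra A"
  shows "ring (red_alg A)" "carrier (red_alg A) = red_class A ` compN A"
    "x \<in> compN A \<Longrightarrow> y \<in> compN A \<Longrightarrow> red_class A x \<oplus>\<^bsub>red_alg A\<^esub> red_class A y = red_class A (x \<oplus>\<^bsub>compT A\<^esub> y)"
    "x \<in> compN A \<Longrightarrow> y \<in> compN A \<Longrightarrow> red_class A x \<otimes>\<^bsub>red_alg A\<^esub> red_class A y = red_class A (x \<otimes>\<^bsub>compT A\<^esub> y)"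
    "\<one>\<^bsub>red_alg A\<^esub> = red_class A \<one>\<^bsub>compT A\<^esub>"
    "x \<in> compN A \<Longrightarrow> r \<odot>\<^bsub>red_alg A\<^esub> red_class A x = red_class A (r \<odot>\<^bsub>compT A\<^esub> x)"
proof -
  note a = strong_constraint_algebraD[OF A]
  interpret T: ring "compT A" by (rule a(2))
  \<comment> \<open>The quotient is formed inside the \<open>N\<close>-component, so the ideal
    property has to be moved from \<open>compT A\<close> to this subring.\<close>
  let ?R = "(compT A)\<lparr>carrier := compN A\<rparr>"
  interpret R: ring ?R by (rule T.subring_is_ring[OF a(3)])
  have I: "ideal (comp0 A) ?R"
  proof (rule idealI[OF R.ring_axioms])
    interpret J: ideal "comp0 A" "compT A" by (rule a(4))
    have m: "\<ominus>\<^bsub>?R\<^esub> x = \<ominus>\<^bsub>compT A\<^esub> x" if "x \<in> compN A" for x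
    proof (rule R.minus_equality)
      show "\<ominus>\<^bsub>compT A\<^esub> x \<oplus>\<^bsub>?R\<^esub> x = \<zero>\<^bsub>?R\<^esub>" using that a(6) by (simp add: T.l_neg subset_iff)
    qed (use that subringE(5)[OF a(3)] in auto)
    show "subgroup (comp0 A) (add_monoid ?R)"
    proof (rule R.add.subgroupI)
      show "comp0 A \<noteq> {}" using J.zero_closed by blast
      show "\<ominus>\<^bsub>?R\<^esub> x \<in> comp0 A" if "x \<in> comp0 A" for x
        using m[of x] J.a_inv_closed[OF that] that a(5) by auto
    qed (use a(5) J.a_closed in auto)
  qed (use ideal.I_l_closed[OF a(4)] ideal.I_r_closed[OF a(4)] a(6) in auto)
  interpret I: ideal "comp0 A" ?R by (rule I)
  have cos: "comp0 A +>\<^bsub>?R\<^esub> x = red_class A x" for x by (simp add: a_r_coset_def r_coset_def)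
  \<comment> \<open>\<open>red_alg\<close> is a new record with a scalar multiplication added; the
    ring laws of the quotient are transported to it through the selectors.\<close>
  have sel: "carrier (red_alg A) = carrier (?R Quot comp0 A)" "add (red_alg A) = add (?R Quot comp0 A)"
    "mult (red_alg A) = mult (?R Quot comp0 A)" "one (red_alg A) = one (?R Quot comp0 A)" "zero (red_alg A) = zero (?R Quot comp0 A)"
    by (simp_all add: red_alg_def Let_def)
  have Q: "ring (?R Quot comp0 A)" by (rule I.quotient_is_ring)
  interpret Q: ring "?R Quot comp0 A" by (rule Q)
  have "abelian_group (red_alg A)"
    by (rule abelian_groupI) (use Q.l_neg Q.a_inv_closed in \<open>auto simp: sel Q.a_assoc Q.a_comm Q.a_lcomm\<close>)
  moreover have "monoid (red_alg A)" by (rule monoidI) (auto simp: sel Q.m_assoc)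
  ultimately show "ring (red_alg A)" by (rule ringI) (auto simp: sel Q.l_distr Q.r_distr)
  show "carrier (red_alg A) = red_class A ` compN A"
    by (auto simp: sel FactRing_def A_RCOSETS_def' cos)
  show "x \<in> compN A \<Longrightarrow> y \<in> compN A \<Longrightarrow> red_class A x \<oplus>\<^bsub>red_alg A\<^esub> red_class A y = red_class A (x \<oplus>\<^bsub>compT A\<^esub> y)"
    using I.a_rcos_sum[of x y] by (simp add: sel FactRing_def cos)
  show "x \<in> compN A \<Longrightarrow> y \<in> compN A \<Longrightarrow> red_class A x \<otimes>\<^bsub>red_alg A\<^esub> red_class A y = red_class A (x \<otimes>\<^bsub>compT A\<^esub> y)"
    using I.rcoset_mult_add[of x y] by (simp add: sel FactRing_def cos)
  show "\<one>\<^bsub>red_alg A\<^esub> = red_class A \<one>\<^bsub>compT A\<^esub>" by (simp add: sel FactRing_def cos)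
  assume x: "x \<in> compN A"
  have "red_class A (r \<odot>\<^bsub>compT A\<^esub> y) = red_class A (r \<odot>\<^bsub>compT A\<^esub> x)" if y: "y \<in> red_class A x" for y
  proof -
    have yx: "y \<in> compN A" "red_class A y = red_class A x" using red_class_memberD[OF A x y] by auto
    have c: "x \<in> carrier (compT A)" "y \<in> carrier (compT A)" using x yx a(6) by auto
    interpret M: module real_ring "compT A" by (rule unital_algebraD(2)[OF a(1)])
    have "y \<ominus>\<^bsub>compT A\<^esub> x \<in> comp0 A" using red_class_eq_iff[OF A c(2,1)] yx(2) by blast
    then have "r \<odot>\<^bsub>compT A\<^esub> (y \<ominus>\<^bsub>compT A\<^esub> x) \<in> comp0 A" by (rule ideal_smult_closed[OF a(1,4)])
    moreover have "r \<odot>\<^bsub>compT A\<^esub> (y \<ominus>\<^bsub>compT A\<^esub> x) = r \<odot>\<^bsub>compT A\<^esub> y \<ominus>\<^bsub>compT A\<^esub> r \<odot>\<^bsub>compT A\<^esub> x"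
      using M.smult_r_distr[of r y "\<ominus>\<^bsub>compT A\<^esub> x"] M.smult_r_minus[of r x] c by (simp add: a_minus_def real_ring_def)
    ultimately show ?thesis using red_class_eq_iff[OF A] unital_algebraD(3)[OF a(1)] c by metis
  qed
  then have "(\<Union>y\<in>red_class A x. red_class A (r \<odot>\<^bsub>compT A\<^esub> y)) = red_class A (r \<odot>\<^bsub>compT A\<^esub> x)"
    by (rule red_class_UN[OF A x])
  then show "r \<odot>\<^bsub>red_alg A\<^esub> red_class A x = red_class A (r \<odot>\<^bsub>compT A\<^esub> x)"
    by (simp add: red_alg_def Let_def)
qed

lemma red_alg_unital:
  assumes A: "strong_constraint_algebra A"
  shows "unital_algebra (red_alg A)"
proof -
  note a = strong_constraint_algebraD[OF A] and q = red_alg_facts[OF A]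
  interpret T: ring "compT A" by (rule a(2))
  interpret M: module real_ring "compT A" by (rule unital_algebraD(2)[OF a(1)])
  have c: "x \<in> carrier (compT A)" if "x \<in> compN A" for x using a(6) that by blast
  have cl: "x \<oplus>\<^bsub>compT A\<^esub> y \<in> compN A" "x \<otimes>\<^bsub>compT A\<^esub> y \<in> compN A" if "x \<in> compN A" "y \<in> compN A" for x y
    using subringE(6,7)[OF a(3)] that by auto
  have "Module.module real_ring (red_alg A)"
  proof (rule moduleI[OF cring_real_ring ring.is_abelian_group[OF q(1)]])
    fix r s :: real and K L
    assume K: "K \<in> carrier (red_alg A)"
    then obtain x where x: "x \<in> compN A" "K = red_class A x" using q(2) by auto
    show "r \<odot>\<^bsub>red_alg A\<^esub> K \<in> carrier (red_alg A)" using x q(2,6) a(7) by auto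
    show "(r \<oplus>\<^bsub>real_ring\<^esub> s) \<odot>\<^bsub>red_alg A\<^esub> K = r \<odot>\<^bsub>red_alg A\<^esub> K \<oplus>\<^bsub>red_alg A\<^esub> s \<odot>\<^bsub>red_alg A\<^esub> K"
      using x M.smult_l_distr[OF _ _ c[OF x(1)], of r s] by (simp add: q(6) q(3) a(7) real_ring_def)
    show "(r \<otimes>\<^bsub>real_ring\<^esub> s) \<odot>\<^bsub>red_alg A\<^esub> K = r \<odot>\<^bsub>red_alg A\<^esub> (s \<odot>\<^bsub>red_alg A\<^esub> K)"
      using x M.smult_assoc1[OF _ _ c[OF x(1)], of r s] by (simp add: q(6) a(7) real_ring_def)
    show "\<one>\<^bsub>real_ring\<^esub> \<odot>\<^bsub>red_alg A\<^esub> K = K"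
      using x M.smult_one[OF c[OF x(1)]] by (simp add: q(6))
    assume L: "L \<in> carrier (red_alg A)"
    then obtain y where y: "y \<in> compN A" "L = red_class A y" using q(2) by auto
    show "r \<odot>\<^bsub>red_alg A\<^esub> (K \<oplus>\<^bsub>red_alg A\<^esub> L) = r \<odot>\<^bsub>red_alg A\<^esub> K \<oplus>\<^bsub>red_alg A\<^esub> r \<odot>\<^bsub>red_alg A\<^esub> L"
      using x y M.smult_r_distr[OF _ c[OF x(1)] c[OF y(1)], of r] by (simp add: q(6) q(3) a(7) cl real_ring_def)
  qed
  moreover have "(r \<odot>\<^bsub>red_alg A\<^esub> K) \<otimes>\<^bsub>red_alg A\<^esub> L = r \<odot>\<^bsub>red_alg A\<^esub> (K \<otimes>\<^bsub>red_alg A\<^esub> L) \<and>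
        K \<otimes>\<^bsub>red_alg A\<^esub> (r \<odot>\<^bsub>red_alg A\<^esub> L) = r \<odot>\<^bsub>red_alg A\<^esub> (K \<otimes>\<^bsub>red_alg A\<^esub> L)"
    if K: "K \<in> carrier (red_alg A)" and L: "L \<in> carrier (red_alg A)" for r K L
  proof -
    obtain x where "x \<in> compN A" "K = red_class A x" using K q(2) by auto
    moreover obtain y where "y \<in> compN A" "L = red_class A y" using L q(2) by auto
    ultimately show ?thesis using unital_algebraD(4,5)[OF a(1)] c by (simp add: q(6) q(4) a(7) cl)
  qed
  ultimately show ?thesis using q(1) unfolding unital_algebra_def by blast
qed

text \<open>Representatives of a class differ by an element of the ideal, which \<open>h\<close>
  sends into the ideal of \<open>B\<close>; so the union defining the arrow collapses.\<close>

lemma red_arr_class: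
  assumes A: "strong_constraint_algebra A" and B: "strong_constraint_algebra B" and h: "h \<in> scalg_hom A B" and x: "x \<in> compN A"
  shows "on_arr red_alg_func A B h (red_class A x) = red_class B (h x)"
proof -
  note a = strong_constraint_algebraD[OF A] and b = strong_constraint_algebraD[OF B]
  have hh: "h \<in> alg_hom (compT A) (compT B)" and h0: "\<And>i. i \<in> comp0 A \<Longrightarrow> h i \<in> comp0 B"
    using h by (auto simp: scalg_hom_def)
  interpret B: ring "compT B" by (rule b(2))
  have hr: "h \<in> ring_hom (compT A) (compT B)" by (rule alg_homD(1)[OF hh])
  have xT: "x \<in> carrier (compT A)" using x a(6) by blast
  have "red_class B (h y) = red_class B (h x)" if y: "y \<in> red_class A x" for y
  proof -
    obtain i where i: "i \<in> comp0 A" "y = i \<oplus>\<^bsub>compT A\<^esub> x" using y by (auto simp: a_r_coset_def')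
    have iT: "i \<in> carrier (compT A)" using i ideal.Icarr[OF a(4)] by blast
    have "h y = h i \<oplus>\<^bsub>compT B\<^esub> h x" using ring_hom_add[OF hr iT xT] i(2) by simp
    moreover have "h i \<in> carrier (compT B)" "h x \<in> carrier (compT B)" using ring_hom_closed[OF hr] iT xT by auto
    ultimately have "h y \<ominus>\<^bsub>compT B\<^esub> h x = h i" "h y \<in> carrier (compT B)" "h x \<in> carrier (compT B)"
      by (simp_all add: a_minus_def B.a_assoc B.r_neg)
    then show ?thesis using red_class_eq_iff[OF B] h0[OF i(1)] by simp
  qed
  then have "(\<Union>y\<in>red_class A x. red_class B (h y)) = red_class B (h x)" by (rule red_class_UN[OF A x])
  then show ?thesis using x red_alg_facts(2)[OF A] by (simp add: red_alg_func_def)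
qed

lemma red_alg_functor: "is_functor (scalg_cat :: ('x scalg, 'x \<Rightarrow> 'x) cat) alg_cat red_alg_func"
  unfolding is_functor_def
proof (intro conjI ballI category_scalg_cat category_alg_cat)
  fix X Y Z :: "'x scalg" and f g
  have o: "on_obj red_alg_func W = red_alg W" for W :: "'x scalg" by (simp add: red_alg_func_def)
  show "on_obj red_alg_func X \<in> Obj alg_cat" if "X \<in> Obj scalg_cat"
    using that red_alg_unital by (simp add: scalg_cat_def alg_cat_def o)
  have ext: "on_arr red_alg_func X Y f \<in> extensional (carrier (red_alg X))" for X Y :: "'x scalg" and f
    by (simp add: red_alg_func_def)
  show "on_arr red_alg_func X Y f \<in> Hom alg_cat (on_obj red_alg_func X) (on_obj red_alg_func Y)"
    if "X \<in> Obj scalg_cat" "Y \<in> Obj scalg_cat" "f \<in> Hom scalg_cat X Y"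
  proof -
    have c: "strong_constraint_algebra X" "strong_constraint_algebra Y" "f \<in> scalg_hom X Y"
      using that by (simp_all add: scalg_cat_def)
    note x = strong_constraint_algebraD[OF c(1)] and qx = red_alg_facts[OF c(1)] and qy = red_alg_facts[OF c(2)]
    note m = red_arr_class[OF c]
    have fN: "f u \<in> compN Y" if "u \<in> compN X" for u using c(3) that by (auto simp: scalg_hom_def)
    have fh: "f \<in> alg_hom (compT X) (compT Y)" using c(3) by (simp add: scalg_hom_def)
    note fr = alg_homD(1)[OF fh]
    have cX: "u \<in> carrier (compT X)" if "u \<in> compN X" for u using x(6) that by blast
    have cl: "u \<oplus>\<^bsub>compT X\<^esub> w \<in> compN X" "u \<otimes>\<^bsub>compT X\<^esub> w \<in> compN X" if "u \<in> compN X" "w \<in> compN X" for u w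
      using subringE(6,7)[OF x(3)] that by auto
    let ?F = "on_arr red_alg_func X Y f"
    have "?F \<in> ring_hom (red_alg X) (red_alg Y)"
    proof (rule ring_hom_memI)
      fix K L assume K: "K \<in> carrier (red_alg X)"
      then obtain u where u: "u \<in> compN X" "K = red_class X u" using qx(2) by auto
      show "?F K \<in> carrier (red_alg Y)" using u m fN qy(2) by auto
      assume L: "L \<in> carrier (red_alg X)"
      then obtain w where w: "w \<in> compN X" "L = red_class X w" using qx(2) by auto
      show "?F (K \<otimes>\<^bsub>red_alg X\<^esub> L) = ?F K \<otimes>\<^bsub>red_alg Y\<^esub> ?F L"
        using u w by (simp add: qx(4) qy(4) m cl fN ring_hom_mult[OF fr cX cX])
      show "?F (K \<oplus>\<^bsub>red_alg X\<^esub> L) = ?F K \<oplus>\<^bsub>red_alg Y\<^esub> ?F L"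
        using u w by (simp add: qx(3) qy(3) m cl fN ring_hom_add[OF fr cX cX])
    next
      show "?F \<one>\<^bsub>red_alg X\<^esub> = \<one>\<^bsub>red_alg Y\<^esub>"
        using subringE(3)[OF x(3)] by (simp add: qx(5) qy(5) m ring_hom_one[OF fr])
    qed
    moreover have "?F (r \<odot>\<^bsub>red_alg X\<^esub> K) = r \<odot>\<^bsub>red_alg Y\<^esub> ?F K" if K: "K \<in> carrier (red_alg X)" for r K
    proof -
      obtain u where "u \<in> compN X" "K = red_class X u" using K qx(2) by auto
      then show ?thesis by (simp add: qx(6) qy(6) m x(7) fN alg_homD(4)[OF fh cX])
    qed
    ultimately show ?thesis using ext by (simp add: alg_cat_def alg_hom_def o)
  qed
  show "on_arr red_alg_func X X (Ident scalg_cat X) = Ident alg_cat (on_obj red_alg_func X)" if "X \<in> Obj scalg_cat"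
  proof (rule extensionalityI[OF ext])
    have X: "strong_constraint_algebra X" using that by (simp add: scalg_cat_def)
    have I: "Ident scalg_cat X \<in> scalg_hom X X"
      using category_scalg_cat that unfolding category_def by (auto simp: scalg_cat_def)
    show "Ident alg_cat (on_obj red_alg_func X) \<in> extensional (carrier (red_alg X))" by (simp add: alg_cat_def o)
    fix K assume K: "K \<in> carrier (red_alg X)"
    then obtain u where u: "u \<in> compN X" "K = red_class X u" using red_alg_facts(2)[OF X] by auto
    have "u \<in> carrier (compT X)" using u strong_constraint_algebraD(6)[OF X] by blast
    then show "on_arr red_alg_func X X (Ident scalg_cat X) K = Ident alg_cat (on_obj red_alg_func X) K"
      using red_arr_class[OF X X I u(1)] u(2) K by (simp add: alg_cat_def o scalg_cat_def)
  qed
  show "on_arr red_alg_func X Z (Comp scalg_cat X Y Z g f) =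
        Comp alg_cat (on_obj red_alg_func X) (on_obj red_alg_func Y) (on_obj red_alg_func Z) (on_arr red_alg_func Y Z g) (on_arr red_alg_func X Y f)"
    if ob: "X \<in> Obj scalg_cat" "Y \<in> Obj scalg_cat" "Z \<in> Obj scalg_cat" and f: "f \<in> Hom scalg_cat X Y" and g: "g \<in> Hom scalg_cat Y Z"
  proof (rule extensionalityI[OF ext])
    have c: "strong_constraint_algebra X" "strong_constraint_algebra Y" "strong_constraint_algebra Z" "f \<in> scalg_hom X Y" "g \<in> scalg_hom Y Z"
      using ob f g by (simp_all add: scalg_cat_def)
    have gf: "Comp scalg_cat X Y Z g f \<in> scalg_hom X Z"
      using category_scalg_cat ob f g unfolding category_def by (auto simp: scalg_cat_def)
    show "Comp alg_cat (on_obj red_alg_func X) (on_obj red_alg_func Y) (on_obj red_alg_func Z) (on_arr red_alg_func Y Z g) (on_arr red_alg_func X Y f) \<in> extensional (carrier (red_alg X))"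
      by (simp add: alg_cat_def o compose_def)
    fix K assume K: "K \<in> carrier (red_alg X)"
    then obtain u where u: "u \<in> compN X" "K = red_class X u" using red_alg_facts(2)[OF c(1)] by auto
    have uT: "u \<in> carrier (compT X)" using u strong_constraint_algebraD(6)[OF c(1)] by blast
    have fu: "f u \<in> compN Y" using c(4) u(1) by (auto simp: scalg_hom_def)
    show "on_arr red_alg_func X Z (Comp scalg_cat X Y Z g f) K =
      Comp alg_cat (on_obj red_alg_func X) (on_obj red_alg_func Y) (on_obj red_alg_func Z) (on_arr red_alg_func Y Z g) (on_arr red_alg_func X Y f) K"
      using red_arr_class[OF c(1,3) gf u(1)] red_arr_class[OF c(1,2,4) u(1)] red_arr_class[OF c(2,3,5) fu] u(2) uT K
      by (simp add: alg_cat_def o compose_def scalg_cat_def)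
  qed
qed

section \<open>The natural isomorphism\<close>

text \<open>Evaluates some representative of the class at some point of the leaf;
  \<open>red_iso_class\<close> shows that neither choice matters.\<close>

definition red_iso :: "'a cmfd \<Rightarrow> ('a \<Rightarrow> real) set \<Rightarrow> 'a set \<Rightarrow> real" where
  "red_iso \<M> = (\<lambda>K\<in>carrier (red_alg (CC_inf \<M>)). \<lambda>y\<in>points (red_mfd \<M>). (SOME f. f \<in> K) (SOME p. p \<in> y))"

text \<open>Another representative differs by a function vanishing on the submanifold, and there
  \<open>f\<close> factors through the projection. All later properties of \<open>red_iso\<close>
  are read off from this description.\<close>

lemma red_iso_class:
  assumes M: "constraint_manifold \<M>" and f: "f \<in> compN (CC_inf \<M>)" and g: "g \<in> C_inf (red_mfd \<M>)"
    and fg: "restrict f (points (sub \<M>)) = compose (points (sub \<M>)) g (leaf_proj (sub \<M>) (distr \<M>))"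
  shows "red_iso \<M> (red_class (CC_inf \<M>) f) = g"
proof (rule extensionalityI[of _ "points (red_mfd \<M>)"])
  note A = CC_inf_strong[OF M]
  note mM = constraint_manifold_facts[OF M]
  let ?K = "red_class (CC_inf \<M>) f" and ?\<pi> = "leaf_proj (sub \<M>) (distr \<M>)"
  have K: "?K \<in> carrier (red_alg (CC_inf \<M>))" using f red_alg_facts(2)[OF A] by blast
  have fC: "f \<in> carrier (compT (CC_inf \<M>))" using f strong_constraint_algebraD(6)[OF A] by blast
  show "red_iso \<M> ?K \<in> extensional (points (red_mfd \<M>))" using K by (simp add: red_iso_def)
  show "g \<in> extensional (points (red_mfd \<M>))" using g by (simp add: C_inf_def)
  fix y assume y: "y \<in> points (red_mfd \<M>)"
  then obtain p where p: "p \<in> points (sub \<M>)" "y = ?\<pi> p"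
    using leaf_manifold_facts(2)[OF red_mfd_leaf_manifold[OF M]] by auto
  define f' where "f' = (SOME f. f \<in> ?K)"
  define q where "q = (SOME p. p \<in> y)"
  have "f' \<in> ?K" unfolding f'_def using someI[of "\<lambda>f. f \<in> ?K" f] red_class_member[OF A fC] by blast
  then obtain i where i: "i \<in> comp0 (CC_inf \<M>)" "f' = i \<oplus>\<^bsub>compT (CC_inf \<M>)\<^esub> f"
    unfolding a_r_coset_def' by blast
  have "q \<in> ?\<pi> p" unfolding q_def p(2) by (rule someI_ex) (use leaf_proj_member[OF p(1)] in blast)
  then have q: "q \<in> points (sub \<M>)" "?\<pi> q = y" using leaf_proj_memberD[OF _ p(1)] p(2) by auto
  have "red_iso \<M> ?K y = f' q" using K y by (simp add: red_iso_def f'_def q_def)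
  also have "\<dots> = f q" using i q mM(3) by auto
  also have "\<dots> = g (?\<pi> q)" using fun_cong[OF fg, of q] q(1) by (simp add: compose_def)
  finally show "red_iso \<M> ?K y = g y" using q(2) by simp
qed

lemma red_iso_obtain:
  assumes M: "constraint_manifold \<M>" and K: "K \<in> carrier (red_alg (CC_inf \<M>))"
  obtains f g where "f \<in> compN (CC_inf \<M>)" "K = red_class (CC_inf \<M>) f" "g \<in> C_inf (red_mfd \<M>)" "red_iso \<M> K = g"
    "restrict f (points (sub \<M>)) = compose (points (sub \<M>)) g (leaf_proj (sub \<M>) (distr \<M>))"
proof -
  obtain f where f: "f \<in> compN (CC_inf \<M>)" "K = red_class (CC_inf \<M>) f"
    using K red_alg_facts(2)[OF CC_inf_strong[OF M]] by auto
  obtain g where g: "g \<in> C_inf (red_mfd \<M>)" "restrict f (points (sub \<M>)) = compose (points (sub \<M>)) g (leaf_proj (sub \<M>) (distr \<M>))"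
    using f(1) CC_inf_compN_iff_descends[OF M] by blast
  show ?thesis using that[OF f g(1) _ g(2)] red_iso_class[OF M f(1) g] f(2) by simp
qed

lemma red_iso_alg_iso:
  assumes M: "constraint_manifold \<M>"
  shows "red_iso \<M> \<in> alg_iso (red_alg (CC_inf \<M>)) (C_inf_alg (red_mfd \<M>))"
proof -
  note A = CC_inf_strong[OF M]
  note mM = constraint_manifold_facts[OF M] and a = strong_constraint_algebraD[OF A] and q = red_alg_facts[OF A]
  let ?A = "CC_inf \<M>" and ?R = "red_mfd \<M>" and ?S = "points (sub \<M>)" and ?\<pi> = "leaf_proj (sub \<M>) (distr \<M>)"
  have R: "is_manifold ?R" and \<pi>R: "\<And>p. p \<in> ?S \<Longrightarrow> ?\<pi> p \<in> points ?R" and \<pi>sur: "points ?R = ?\<pi> ` ?S"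
    using leaf_manifold_facts(1,2)[OF red_mfd_leaf_manifold[OF M]] by auto
  have SM: "p \<in> points (amb \<M>)" if "p \<in> ?S" for p using mM(3) that by blast
  have val: "f p = g (?\<pi> p)" if "restrict f ?S = compose ?S g ?\<pi>" "p \<in> ?S" for f g p
    using fun_cong[OF that(1), of p] that(2) by (simp add: compose_def)
  have "red_iso \<M> \<in> ring_hom (red_alg ?A) (C_inf_alg ?R)"
  proof (rule ring_hom_memI)
    fix K L assume K: "K \<in> carrier (red_alg ?A)"
    obtain f g where f: "f \<in> compN ?A" "K = red_class ?A f" "g \<in> C_inf ?R" "red_iso \<M> K = g" "restrict f ?S = compose ?S g ?\<pi>"
      by (rule red_iso_obtain[OF M K])
    show "red_iso \<M> K \<in> carrier (C_inf_alg ?R)" using f by simp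
    assume L: "L \<in> carrier (red_alg ?A)"
    obtain f' g' where f': "f' \<in> compN ?A" "L = red_class ?A f'" "g' \<in> C_inf ?R" "red_iso \<M> L = g'" "restrict f' ?S = compose ?S g' ?\<pi>"
      by (rule red_iso_obtain[OF M L])
    note v = val[OF f(5)] val[OF f'(5)]
    have mulN: "f \<otimes>\<^bsub>compT ?A\<^esub> f' \<in> compN ?A" and addN: "f \<oplus>\<^bsub>compT ?A\<^esub> f' \<in> compN ?A"
      by (rule subringE(6)[OF a(3) f(1) f'(1)], rule subringE(7)[OF a(3) f(1) f'(1)])
    have "red_iso \<M> (red_class ?A (f \<otimes>\<^bsub>compT ?A\<^esub> f')) = g \<otimes>\<^bsub>C_inf_alg ?R\<^esub> g'"
      by (rule red_iso_class[OF M mulN])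
         (use C_inf_mult[OF R f(3) f'(3)] v \<pi>R SM in \<open>auto simp: compose_def fun_eq_iff\<close>)
    then show "red_iso \<M> (K \<otimes>\<^bsub>red_alg ?A\<^esub> L) = red_iso \<M> K \<otimes>\<^bsub>C_inf_alg ?R\<^esub> red_iso \<M> L"
      using q(4)[OF f(1) f'(1)] f f' by simp
    have "red_iso \<M> (red_class ?A (f \<oplus>\<^bsub>compT ?A\<^esub> f')) = g \<oplus>\<^bsub>C_inf_alg ?R\<^esub> g'"
      by (rule red_iso_class[OF M addN])
         (use C_inf_add[OF R f(3) f'(3)] v \<pi>R SM in \<open>auto simp: compose_def fun_eq_iff\<close>)
    then show "red_iso \<M> (K \<oplus>\<^bsub>red_alg ?A\<^esub> L) = red_iso \<M> K \<oplus>\<^bsub>C_inf_alg ?R\<^esub> red_iso \<M> L"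
      using q(3)[OF f(1) f'(1)] f f' by simp
  next
    show "red_iso \<M> \<one>\<^bsub>red_alg ?A\<^esub> = \<one>\<^bsub>C_inf_alg ?R\<^esub>"
      unfolding q(5)
      by (rule red_iso_class[OF M subringE(3)[OF a(3)]])
         (use C_inf_const[OF R] \<pi>R SM in \<open>auto simp: compose_def fun_eq_iff\<close>)
  qed
  moreover have "red_iso \<M> \<in> extensional (carrier (red_alg ?A))" by (simp add: red_iso_def)
  moreover have "red_iso \<M> (r \<odot>\<^bsub>red_alg ?A\<^esub> K) = r \<odot>\<^bsub>C_inf_alg ?R\<^esub> red_iso \<M> K" if K: "K \<in> carrier (red_alg ?A)" for r K
  proof -
    obtain f g where f: "f \<in> compN ?A" "K = red_class ?A f" "g \<in> C_inf ?R" "red_iso \<M> K = g" "restrict f ?S = compose ?S g ?\<pi>"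
      by (rule red_iso_obtain[OF M K])
    have "red_iso \<M> (red_class ?A (r \<odot>\<^bsub>compT ?A\<^esub> f)) = r \<odot>\<^bsub>C_inf_alg ?R\<^esub> g"
      by (rule red_iso_class[OF M a(7)[OF f(1)]])
         (use C_inf_scale[OF R f(3)] val[OF f(5)] \<pi>R SM in \<open>auto simp: compose_def fun_eq_iff\<close>)
    then show ?thesis using q(6)[OF f(1)] f by simp
  qed
  moreover have "inj_on (red_iso \<M>) (carrier (red_alg ?A))"
  proof (rule inj_onI)
    fix K L assume K: "K \<in> carrier (red_alg ?A)" and L: "L \<in> carrier (red_alg ?A)" and eq: "red_iso \<M> K = red_iso \<M> L"
    obtain f g where f: "f \<in> compN ?A" "K = red_class ?A f" "g \<in> C_inf ?R" "red_iso \<M> K = g" "restrict f ?S = compose ?S g ?\<pi>"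
      by (rule red_iso_obtain[OF M K])
    obtain f' g' where f': "f' \<in> compN ?A" "L = red_class ?A f'" "g' \<in> C_inf ?R" "red_iso \<M> L = g'" "restrict f' ?S = compose ?S g' ?\<pi>"
      by (rule red_iso_obtain[OF M L])
    have c: "f \<in> C_inf (amb \<M>)" "f' \<in> C_inf (amb \<M>)" using f(1) f'(1) CC_inf_compN_iff[OF M] by auto
    have "f \<ominus>\<^bsub>C_inf_alg (amb \<M>)\<^esub> f' = (\<lambda>p\<in>points (amb \<M>). f p + - 1 * f' p)"
      using C_inf_alg_minus[OF mM(1) c(2)] by (auto simp: a_minus_def fun_eq_iff)
    moreover have "(\<lambda>p\<in>points (amb \<M>). f p + (\<lambda>p\<in>points (amb \<M>). - 1 * f' p) p) \<in> C_inf (amb \<M>)"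
      by (rule C_inf_add[OF mM(1) c(1) C_inf_scale[OF mM(1) c(2)]])
    moreover have "(\<lambda>p\<in>points (amb \<M>). f p + (\<lambda>p\<in>points (amb \<M>). - 1 * f' p) p) = (\<lambda>p\<in>points (amb \<M>). f p + - 1 * f' p)"
      by (auto simp: fun_eq_iff)
    \<comment> \<open>Equal descended functions mean equal restrictions to the submanifold, so the
      representatives differ by an element of the ideal.\<close>
    moreover have "f p = f' p" if "p \<in> ?S" for p
      using val[OF f(5) that] val[OF f'(5) that] eq f(4) f'(4) by simp
    ultimately have "f \<ominus>\<^bsub>compT ?A\<^esub> f' \<in> comp0 ?A" using SM by simp
    then show "K = L" using red_class_eq_iff[OF A, of f f'] c f(2) f'(2) by simp
  qed
  moreover have "red_iso \<M> ` carrier (red_alg ?A) = C_inf ?R"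
  proof
    show "red_iso \<M> ` carrier (red_alg ?A) \<subseteq> C_inf ?R" using red_iso_obtain[OF M] by blast
    show "C_inf ?R \<subseteq> red_iso \<M> ` carrier (red_alg ?A)"
    proof
      fix g assume g: "g \<in> C_inf ?R"
      have h: "compose ?S g ?\<pi> \<in> C_inf (sub \<M>)"
        by (rule smooth_maps_pullback[OF mM(2) R leaf_manifold_facts(4)[OF red_mfd_leaf_manifold[OF M]] g])
      \<comment> \<open>Surjectivity is where the extension from the closed submanifold
        enters.\<close>
      obtain f where f: "f \<in> C_inf (amb \<M>)" "\<forall>p\<in>?S. f p = compose ?S g ?\<pi> p"
        by (rule closed_submanifold_extension[OF mM(1,6) h])
      have eq: "restrict f ?S = compose ?S g ?\<pi>" using f(2) by (auto simp: compose_def fun_eq_iff)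
      have fN: "f \<in> compN ?A" unfolding CC_inf_compN_iff_descends[OF M] using f(1) g eq by blast
      have "red_iso \<M> (red_class ?A f) = g" by (rule red_iso_class[OF M fN g eq])
      moreover have "red_class ?A f \<in> carrier (red_alg ?A)" unfolding q(2) using fN by (rule imageI)
      ultimately show "g \<in> red_iso \<M> ` carrier (red_alg ?A)" by (metis imageI)
    qed
  qed
  ultimately show ?thesis unfolding alg_iso_def alg_hom_def bij_betw_def by simp
qed

text \<open>By \<open>red_iso_class\<close> it suffices to find what the pulled back representative
  descends to. Evaluated at a point of the submanifold, it is \<open>g\<close> after the reduced
  map.\<close>

lemma red_iso_natural:
  assumes M: "constraint_manifold \<M>" and N: "constraint_manifold \<N>" and \<phi>: "\<phi> \<in> constraint_maps \<M> \<N>"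
    and K: "K \<in> carrier (red_alg (CC_inf \<N>))"
  shows "red_iso \<M> (on_arr red_alg_func (CC_inf \<N>) (CC_inf \<M>) (pullback (amb \<M>) (amb \<N>) \<phi>) K) =
    pullback (red_mfd \<M>) (red_mfd \<N>) (on_arr red_mfd_func \<M> \<N> \<phi>) (red_iso \<N> K)"
proof -
  note A = CC_inf_strong[OF M] and B = CC_inf_strong[OF N]
  note mM = constraint_manifold_facts[OF M] and mN = constraint_manifold_facts[OF N]
  note lM = leaf_manifold_facts[OF red_mfd_leaf_manifold[OF M]] and lN = leaf_manifold_facts[OF red_mfd_leaf_manifold[OF N]]
  let ?P = "pullback (amb \<M>) (amb \<N>) \<phi>" and ?F = "on_arr red_mfd_func \<M> \<N> \<phi>"
  have \<phi>S: "\<And>p. p \<in> points (sub \<M>) \<Longrightarrow> \<phi> p \<in> points (sub \<N>)" using \<phi> by (auto simp: constraint_maps_def)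
  have P: "?P \<in> scalg_hom (CC_inf \<N>) (CC_inf \<M>)" by (rule CC_inf_pullback_hom[OF M N \<phi>])
  obtain f g where f: "f \<in> compN (CC_inf \<N>)" "K = red_class (CC_inf \<N>) f" "g \<in> C_inf (red_mfd \<N>)" "red_iso \<N> K = g"
    "restrict f (points (sub \<N>)) = compose (points (sub \<N>)) g (leaf_proj (sub \<N>) (distr \<N>))"
    by (rule red_iso_obtain[OF N K])
  have fC: "f \<in> C_inf (amb \<N>)" using f(1) CC_inf_compN_iff[OF N] by blast
  have Pf: "?P f \<in> compN (CC_inf \<M>)" using P f(1) by (auto simp: scalg_hom_def)
  have eq: "restrict (?P f) (points (sub \<M>)) = compose (points (sub \<M>)) (compose (points (red_mfd \<M>)) g ?F) (leaf_proj (sub \<M>) (distr \<M>))"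
  proof
    fix p
    show "restrict (?P f) (points (sub \<M>)) p = compose (points (sub \<M>)) (compose (points (red_mfd \<M>)) g ?F) (leaf_proj (sub \<M>) (distr \<M>)) p"
    proof (cases "p \<in> points (sub \<M>)")
      case True
      have "p \<in> points (amb \<M>)" using True mM(3) by blast
      then have "restrict (?P f) (points (sub \<M>)) p = f (\<phi> p)" using True fC by (simp add: pullback_def compose_def)
      also have "\<dots> = g (leaf_proj (sub \<N>) (distr \<N>) (\<phi> p))"
        using fun_cong[OF f(5), of "\<phi> p"] \<phi>S[OF True] by (simp add: compose_def)
      also have "\<dots> = g (?F (leaf_proj (sub \<M>) (distr \<M>) p))" using red_arrow_proj[OF M N \<phi> True] by simp
      finally show ?thesis using True lM(2) by (simp add: compose_def)
    qed (simp add: compose_def)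
  qed
  have gC: "compose (points (red_mfd \<M>)) g ?F \<in> C_inf (red_mfd \<M>)"
    by (rule smooth_maps_pullback[OF lM(1) lN(1) red_arrow_smooth[OF M N \<phi>] f(3)])
  have "red_iso \<M> (red_class (CC_inf \<M>) (?P f)) = compose (points (red_mfd \<M>)) g ?F"
    by (rule red_iso_class[OF M Pf gC eq])
  then show ?thesis using red_arr_class[OF B A P f(1)] f(2,3,4) by (simp add: pullback_def)
qed

theorem proposition3p7:
  shows "is_functor (cmfd_cat :: ('a cmfd, 'a \<Rightarrow> 'a) cat) (op_cat scalg_cat) CC_inf_func \<and>
    is_functor (cmfd_cat :: ('a cmfd, 'a \<Rightarrow> 'a) cat) mfd_cat red_mfd_func \<and>
    is_functor (mfd_cat :: ('a set manifold, 'a set \<Rightarrow> 'a set) cat) (op_cat alg_cat) C_inf_func \<and>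
    is_functor (op_cat scalg_cat :: (('a \<Rightarrow> real) scalg, ('a \<Rightarrow> real) \<Rightarrow> ('a \<Rightarrow> real)) cat)
      (op_cat alg_cat) (op_func red_alg_func) \<and>
    (\<exists>\<eta>. natural_alg_iso (cmfd_cat :: ('a cmfd, 'a \<Rightarrow> 'a) cat)
       (op_func red_alg_func \<circ>\<^sub>F CC_inf_func)
       (C_inf_func \<circ>\<^sub>F red_mfd_func) \<eta>)"
proof (intro conjI CC_inf_functor red_mfd_functor C_inf_functor is_functor_op[OF red_alg_functor])
  have "natural_alg_iso (cmfd_cat :: ('a cmfd, 'a \<Rightarrow> 'a) cat)
       (op_func red_alg_func \<circ>\<^sub>F CC_inf_func) (C_inf_func \<circ>\<^sub>F red_mfd_func) red_iso"
    unfolding natural_alg_iso_def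
  proof (intro conjI ballI)
    show "is_functor cmfd_cat (op_cat alg_cat) (op_func red_alg_func \<circ>\<^sub>F CC_inf_func)"
      by (rule is_functor_compose[OF CC_inf_functor is_functor_op[OF red_alg_functor]])
    show "is_functor cmfd_cat (op_cat alg_cat) (C_inf_func \<circ>\<^sub>F red_mfd_func)"
      by (rule is_functor_compose[OF red_mfd_functor C_inf_functor])
  next
    fix X :: "'a cmfd" assume "X \<in> Obj cmfd_cat"
    then have "constraint_manifold X" by (simp add: cmfd_cat_def)
    from red_iso_alg_iso[OF this]
    show "red_iso X \<in> alg_iso (on_obj (op_func red_alg_func \<circ>\<^sub>F CC_inf_func) X) (on_obj (C_inf_func \<circ>\<^sub>F red_mfd_func) X)"
      by (simp add: comp_func_def op_func_def CC_inf_func_def C_inf_func_def red_mfd_func_def red_alg_func_def)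
  next
    fix X Y :: "'a cmfd" and f assume "X \<in> Obj cmfd_cat" "Y \<in> Obj cmfd_cat" "f \<in> Hom cmfd_cat X Y"
    then have c: "constraint_manifold X" "constraint_manifold Y" "f \<in> constraint_maps X Y" by (simp_all add: cmfd_cat_def)
    have o: "on_obj red_mfd_func W = red_mfd W" for W :: "'a cmfd" by (simp add: red_mfd_func_def)
    have oa: "on_obj red_alg_func W = red_alg W" for W :: "('a \<Rightarrow> real) scalg" by (simp add: red_alg_func_def)
    show "compose (carrier (on_obj (op_func red_alg_func \<circ>\<^sub>F CC_inf_func) Y)) (red_iso X) (on_arr (op_func red_alg_func \<circ>\<^sub>F CC_inf_func) X Y f) =
      compose (carrier (on_obj (op_func red_alg_func \<circ>\<^sub>F CC_inf_func) Y)) (on_arr (C_inf_func \<circ>\<^sub>F red_mfd_func) X Y f) (red_iso Y)"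
      unfolding compose_def
      by (rule restrict_ext) (use red_iso_natural[OF c] in \<open>simp add: comp_func_def op_func_def CC_inf_func_def C_inf_func_def o oa\<close>)
  qed
  then show "\<exists>\<eta>. natural_alg_iso (cmfd_cat :: ('a cmfd, 'a \<Rightarrow> 'a) cat)
       (op_func red_alg_func \<circ>\<^sub>F CC_inf_func) (C_inf_func \<circ>\<^sub>F red_mfd_func) \<eta>" by blast
qed

end
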